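(* Let $\mathbf{k}$ be an algebraically closed field of characteristic zero, $A=\mathbf{k}[x,y,z]/\langle x^2+y^2+z^2-1\rangle$ and $\mathcal{V}=\mathrm{Der}_{\mathbf{k}}(A)$. The category of finite-dimensional rational $\mathrm{GL}_2$-modules is equivalent to a full subcategory of the category $\mathfrak{T}$ of tensor modules on the sphere $\mathbb{S}^2$. Moreover, this subcategory is generated by $A^{-2}$ and $\Omega$ as a monoidal abelian category.
   Context: An $A\mathcal{V}$-module is a $\mathbf{k}$-vector space $M$ that is both a module over the commutative unital algebra $A$ and a module over the Lie algebra $\mathcal{V}$, such that $\eta\cdot(a\cdot m)=\eta(a)\cdot m+a\cdot(\eta\cdot m)$ for all $a\in A$, $\eta\in\mathcal{V}$, $m\in M$. Morphisms and submodules respect both structures. The category of $A\mathcal{V}$-modules is abelian and is monoidal under $M\otimes_AN$ with its usual $A$-action and $\eta\cdot(m\otimes n)=(\eta\cdot m)\otimes n+m\otimes(\eta\cdot n)$; the unit object is $A$. Charts. For $h\in\{x,y,z\}$ let $A_{(h)}=A[h^{-1}]$ be the localization. The chart parameters $(t_1,t_2)$ of the chart $N(h)=\{P\in\mathbb{S}^2: h(P)\neq0\}$ are the two coordinates other than $h$: $(y,z)$ for $h=x$, $(x,z)$ for $h=y$, $(x,y)$ for $h=z$. The derivations $\frac{\partial}{\partial t_1},\frac{\partial}{\partial t_2}$ of $\mathbf{k}[t_1,t_2]\subset A$ extend uniquely to derivations of $A_{(h)}$ (for instance for $h=z$: $\frac{\partial z}{\partial x}=-\frac{x}{z}$, $\frac{\partial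 z}{\partial y}=-\frac{y}{z}$), and $\mathrm{Der}(A_{(h)})=A_{(h)}\frac{\partial}{\partial t_1}\oplus A_{(h)}\frac{\partial}{\partial t_2}$. Every $\eta\in\mathcal{V}$ extends uniquely to $A_{(h)}$, so $\mathcal{V}\subset\mathrm{Der}(A_{(h)})$. For a finite-dimensional $\mathfrak{gl}_2$-module $U$, the space $A_{(h)}\otimes_{\mathbf{k}}U$ is an $A\mathcal{V}$-module: $A$ acts by multiplication on the left factor, and $$\Big(\sum_{i=1}^{2}f_i\frac{\partial}{\partial t_i}\Big)\cdot(g\otimes u)=\sum_{i=1}^{2}f_i\frac{\partial g}{\partial t_i}\otimes u+\sum_{p=1}^{2}\sum_{i=1}^{2}g\frac{\partial f_i}{\partial t_p}\otimes(E_{p,i}\cdot u),$$ where $E_{p,i}$ are the matrix units of $\mathfrak{gl}_2$. A rational $\mathrm{GL}_2$-module is regarded as a $\mathfrak{gl}_2$-module by differentiation. Change of charts. Let $V$ be the natural module of $\mathrm{GL}_2$ with basis $e_1,e_2$ ($E_{p,i}e_j=\delta_{ij}e_p$), and regard $\mathrm{GL}_2=\mathrm{GL}(V)$. For charts $N(h)$, $N(\tilde h)$ with chart parameters $(t_1,t_2)$, $(\tilde t_1,\tilde t_2)$, write $A_{(h,\tilde h)}$ for the localization of $A$ at both $h$ and $\tilde h$, and let $C$ be the invertible $A_{(h,\tilde h)}$-linear map of $A_{(h,\tilde h)}\otimes V$ given by $Ce_i=\sum_{j=1}^{2}\frac{\partial t_i}{\partial\tilde t_j}e_j$. For a finite-dimensional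 rational representation $\rho:\mathrm{GL}_2\to\mathrm{GL}(U)$, $\rho(C)$ denotes the induced invertible $A_{(h,\tilde h)}$-linear map of $A_{(h,\tilde h)}\otimes U$ (substitute the matrix of $C$, with entries in $A_{(h,\tilde h)}$, into the rational representation $\rho$). Tensor modules. A tensor module on $\mathbb{S}^2$ is an $A\mathcal{V}$-module $M$ which is finitely generated over $A$ and for which there exist a finite-dimensional rational $\mathrm{GL}_2$-module $(U,\rho)$ and injective $A\mathcal{V}$-module homomorphisms $\varphi_h:M\to A_{(h)}\otimes U$ for each $h\in\{x,y,z\}$, such that for every pair $h,\tilde h$ one has $\rho(C)\circ\varphi_h=\varphi_{\tilde h}$ as maps $M\to A_{(h,\tilde h)}\otimes U$ (using $A_{(h)}\otimes U,\ A_{(\tilde h)}\otimes U\subset A_{(h,\tilde h)}\otimes U$). $\mathfrak{T}$ is the full subcategory of $A\mathcal{V}$-modules whose objects are the tensor modules. The modules $A^{\alpha}$ and $\Omega$. For $\alpha\in2\mathbb{Z}$ let $U_0^{\alpha}$ be the one-dimensional $\mathfrak{gl}_2$-module on which $\mathfrak{sl}_2$ acts by zero and the identity matrix acts by $\alpha$; $A^{\alpha}$ denotes the $A\mathcal{V}$-submodule $z^{-\alpha/2}A\otimes U_0^{\alpha}$ of $A_{(z)}\otimes U_0^{\alpha}$. $\Omega$ is the $A\mathcal{V}$-module of polynomial $1$-forms on $\mathbb{S}^2$ (the module of Kähler differentials of $A$ over $\mathbf{k}$), with $\mathcal{V}$ acting by the Lie derivative: $\eta\cdot(g\,df)=\eta(g)\,df+g\,d(\eta(f))$.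 A full subcategory is generated by given objects as a monoidal abelian category if it is, up to isomorphism of objects, the smallest full subcategory of $A\mathcal{V}$-modules that contains these objects and the unit object $A$ and is closed under tensor products over $A$, finite direct sums, kernels and cokernels. *)

theory Defs
  imports
    "HOL-Computational_Algebra.Computational_Algebra"
    "HOL-Analysis.Determinants"
    "HOL-Algebra.Free_Abelian_Groups"
    "HOL-Algebra.AbelCoset"
    "HOL-Algebra.Module"
begin

section \<open>The coordinate ring of the sphere\<close>

text \<open>
  The polynomial ring in \<open>x\<close>, \<open>y\<close>, \<open>z\<close> is built as an iterated univariate polynomial ring:
  the outermost variable is \<open>z\<close>, the innermost one is \<open>x\<close>. It is shown that the quotient by
  \<open>x\<^sup>2 + y\<^sup>2 + z\<^sup>2 - 1\<close> is a domain, so that all localizations are subrings of its fraction field.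
\<close>

definition sphere_poly :: "'k::field_char_0 poly poly poly"
  where "sphere_poly = [:[:[:- 1, 0, 1:], 0, 1:], 0, 1:]"

lemma square_eq_sphere:
  fixes u v :: "'k::field_char_0 poly poly"
  assumes "u\<^sup>2 = [:[:1, 0, - 1:], 0, - 1:] * v\<^sup>2"
  shows "v = 0"
  using assms
proof (induction "degree (lead_coeff v)" arbitrary: u v rule: less_induct)
  case less
  define ev where "ev = map_poly (\<lambda>c :: 'k poly. poly c 0)"
  have ev_mult: "ev (p * q) = ev p * ev q" for p q
    unfolding ev_def by (simp add: poly_eq_iff coeff_map_poly coeff_mult poly_sum)
  have ev_0: "ev p = 0 \<longleftrightarrow> [:[:0, 1:]:] dvd p" for p
    using poly_eq_0_iff_dvd[of _ "0 :: 'k"]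
    by (auto simp: ev_def poly_eq_iff coeff_map_poly const_poly_dvd_iff)
  have ev_d: "ev [:[:1, 0, - 1:], 0, - 1:] = - ([:- 1, 1:] * [:1, 1:])"
    by (simp add: ev_def map_poly_pCons)
  have eq: "(ev u)\<^sup>2 = - ([:- 1, 1:] * [:1, 1:]) * (ev v)\<^sup>2"
    using arg_cong[OF less.prems, of ev] by (simp only: power2_eq_square ev_mult ev_d)
  have "ev v = 0"
  proof (rule ccontr)
    assume nz: "ev v \<noteq> 0"
    have nz': "- ([:- 1, 1:] * [:1, 1:]) * (ev v)\<^sup>2 \<noteq> 0"
      using nz by (simp only: mult_eq_0_iff neg_equal_0_iff_equal power_eq_0_iff) simp
    hence nzu: "(ev u)\<^sup>2 \<noteq> 0" using eq by simp
    have o1: "Polynomial.order 1 ([:- 1, 1:] :: 'k poly) = 1"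
      using Polynomial.order_power_n_n[of "1::'k" 1] by simp
    have o2: "Polynomial.order 1 ([:1, 1:] :: 'k poly) = 0"
      by (rule order_0I) simp
    have a: "Polynomial.order 1 ((ev u)\<^sup>2) = 2 * Polynomial.order 1 (ev u)"
      using nzu by (simp add: power2_eq_square order_mult)
    have b: "Polynomial.order 1 (- ([:- 1, 1:] * [:1, 1:]) * (ev v)\<^sup>2)
        = Polynomial.order 1 ([:- 1, 1:] * [:1, 1:] :: 'k poly) + Polynomial.order 1 ((ev v)\<^sup>2)"
      using order_mult[OF nz'] by (simp only: order_uminus)
    have c: "Polynomial.order 1 ([:- 1, 1:] * [:1, 1:] :: 'k poly) = 1"
    proof -
      have "[:- 1, 1:] * [:1, 1:] \<noteq> (0 :: 'k poly)" by simp
      from order_mult[OF this] show ?thesis by (simp only: o1 o2)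
    qed
    have d: "Polynomial.order 1 ((ev v)\<^sup>2) = 2 * Polynomial.order 1 (ev v)"
      using nz by (simp add: power2_eq_square order_mult)
    have "2 * Polynomial.order 1 (ev u) = 1 + 2 * Polynomial.order 1 (ev v)"
      using a b unfolding eq c d by (rule trans[OF sym])
    thus False by presburger
  qed
  with eq have "ev u = 0" by simp
  from \<open>ev v = 0\<close> obtain v' where v': "v = [:[:0, 1:]:] * v'"
    by (auto simp: ev_0)
  from \<open>ev u = 0\<close> obtain u' where u': "u = [:[:0, 1:]:] * u'"
    by (auto simp: ev_0)
  have "[:[:0, 1:]:]\<^sup>2 * u'\<^sup>2 = [:[:0, 1:]:]\<^sup>2 * ([:[:1, 0, - 1:], 0, - 1:] * v'\<^sup>2)"
    using less.prems unfolding u' v' by (simp only: power_mult_distrib mult_ac)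
  moreover have "[:[:0, 1:]:]\<^sup>2 \<noteq> (0 :: 'k poly poly)" by simp
  ultimately have eq': "u'\<^sup>2 = [:[:1, 0, - 1:], 0, - 1:] * v'\<^sup>2"
    by (metis mult_left_cancel)
  show ?case
  proof (rule ccontr)
    assume "v \<noteq> 0"
    hence "v' \<noteq> 0" using v' by auto
    have "lead_coeff v = [:0, 1:] * lead_coeff v'"
      unfolding v' lead_coeff_mult by simp
    hence "degree (lead_coeff v') < degree (lead_coeff v)"
      using \<open>v' \<noteq> 0\<close> by (simp add: degree_mult_eq)
    from less.hyps[OF this eq'] \<open>v' \<noteq> 0\<close> show False by simp
  qed
qed

lemma sphere_poly_dvd_linear:
  assumes "sphere_poly dvd [:s, t:]"
  shows "s = 0 \<and> t = 0"
proof -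
  have "[:s, t:] = 0"
  proof (rule ccontr)
    assume "[:s, t:] \<noteq> 0"
    from dvd_imp_degree_le[OF assms this] show False
      by (simp add: sphere_poly_def split: if_splits)
  qed
  thus ?thesis by simp
qed

lemma sphere_poly_reduce: "\<exists>u v. sphere_poly dvd p - [:u, v:]"
proof (induction p)
  case 0
  have "sphere_poly dvd 0 - [:0, 0:]" by simp
  thus ?case by blast
next
  case (pCons c p)
  then obtain u v q where q: "p - [:u, v:] = sphere_poly * q" by (auto elim: dvdE)
  hence p: "p = sphere_poly * q + [:u, v:]" by (simp add: algebra_simps)
  have "pCons c p = [:c:] + [:0, 1:] * p" by simp
  also have "\<dots> - [:c - [:[:- 1, 0, 1:], 0, 1:] * v, u:] = sphere_poly * ([:0, 1:] * q + [:v:])"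
    unfolding p by (simp add: sphere_poly_def algebra_simps)
  finally show ?case by (metis dvd_triv_left)
qed

lemma sphere_poly_prime:
  assumes "sphere_poly dvd p * q"
  shows "sphere_poly dvd p \<or> sphere_poly dvd q"
proof -
  let ?d = "[:[:1, 0, - 1:], 0, - 1:]"
  obtain u v where p: "sphere_poly dvd p - [:u, v:]" using sphere_poly_reduce by blast
  obtain u' v' where q: "sphere_poly dvd q - [:u', v':]" using sphere_poly_reduce by blast
  have pq: "p * q - [:u, v:] * [:u', v':] = (p - [:u, v:]) * q + [:u, v:] * (q - [:u', v':])"
    by (simp only: algebra_simps)
  have "sphere_poly dvd p * q - [:u, v:] * [:u', v':]"
    unfolding pq by (intro dvd_add dvd_mult dvd_mult2 p q)
  with assms have uv: "sphere_poly dvd [:u, v:] * [:u', v':]"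
    by (metis dvd_diffD1 dvd_diff_right_iff)
  have sphere: "sphere_poly = [:- ?d, 0, 1:]" by (simp add: sphere_poly_def)
  have "[:u, v:] * [:u', v':] - [:- d, 0, 1:] * [:v * v':] = [:u * u' + v * v' * d, u * v' + v * u':]" for d
    by (simp add: algebra_simps)
  hence red: "[:u, v:] * [:u', v':] - sphere_poly * [:v * v':] = [:u * u' + v * v' * ?d, u * v' + v * u':]"
    by (simp only: sphere)
  have "sphere_poly dvd [:u, v:] * [:u', v':] - sphere_poly * [:v * v':]"
    by (intro dvd_diff uv dvd_triv_left)
  hence "sphere_poly dvd [:u * u' + v * v' * ?d, u * v' + v * u':]"
    by (simp only: red)
  from sphere_poly_dvd_linear[OF this]
  have e1: "u * u' + v * v' * ?d = 0" and e2: "u * v' + v * u' = 0" by simp_all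
  have "u * (u'\<^sup>2 - ?d * v'\<^sup>2) = u' * (u * u' + v * v' * ?d) - v' * ?d * (u * v' + v * u')"
       "v * (u'\<^sup>2 - ?d * v'\<^sup>2) = u' * (u * v' + v * u') - v' * (u * u' + v * v' * ?d)"
    by (simp_all only: algebra_simps power2_eq_square)
  hence e3: "u * (u'\<^sup>2 - ?d * v'\<^sup>2) = 0" "v * (u'\<^sup>2 - ?d * v'\<^sup>2) = 0"
    by (simp_all only: e1 e2 mult_zero_right diff_zero)
  show ?thesis
  proof (cases "u = 0 \<and> v = 0")
    case True
    with p show ?thesis by simp
  next
    case False
    with e3 have "u'\<^sup>2 = ?d * v'\<^sup>2" by (metis mult_eq_0_iff right_minus_eq)
    moreover from this have "v' = 0" by (rule square_eq_sphere)
    ultimately have "u' = 0" by simp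
    with q \<open>v' = 0\<close> show ?thesis by simp
  qed
qed

quotient_type (overloaded) 'k sphere = "'k::field_char_0 poly poly poly" / "\<lambda>p q. sphere_poly dvd p - q"
  morphisms rep_sphere sphere_class
proof (rule equivpI)
  show "reflp (\<lambda>p q :: 'k poly poly poly. sphere_poly dvd p - q)"
    by (simp add: reflp_def)
  show "symp (\<lambda>p q :: 'k poly poly poly. sphere_poly dvd p - q)"
    unfolding symp_def by (metis dvd_minus_iff minus_diff_eq)
  show "transp (\<lambda>p q :: 'k poly poly poly. sphere_poly dvd p - q)"
    proof (rule transpI)
    fix p q r :: "'k poly poly poly" assume "sphere_poly dvd p - q" "sphere_poly dvd q - r"
    hence "sphere_poly dvd (p - q) + (q - r)" by (rule dvd_add)
    thus "sphere_poly dvd p - r" by simp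
  qed
qed

instantiation sphere :: (field_char_0) idom
begin

lift_definition zero_sphere :: "'a sphere" is 0 .
lift_definition one_sphere :: "'a sphere" is 1 .
lift_definition uminus_sphere :: "'a sphere \<Rightarrow> 'a sphere" is uminus
proof -
  fix p q :: "'a poly poly poly" assume "sphere_poly dvd p - q"
  hence "sphere_poly dvd - (p - q)" by (simp only: dvd_minus_iff)
  thus "sphere_poly dvd - p - - q" by simp
qed

lift_definition plus_sphere :: "'a sphere \<Rightarrow> 'a sphere \<Rightarrow> 'a sphere" is "(+)"
proof -
  fix p q p' q' :: "'a poly poly poly" assume "sphere_poly dvd p - q" "sphere_poly dvd p' - q'"
  hence "sphere_poly dvd (p - q) + (p' - q')" by (rule dvd_add)
  thus "sphere_poly dvd (p + p') - (q + q')" by (simp only: add_diff_add)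
qed

lift_definition minus_sphere :: "'a sphere \<Rightarrow> 'a sphere \<Rightarrow> 'a sphere" is "(-)"
proof -
  fix p q p' q' :: "'a poly poly poly" assume "sphere_poly dvd p - q" "sphere_poly dvd p' - q'"
  hence "sphere_poly dvd (p - q) - (p' - q')" by (rule dvd_diff)
  moreover have "(p - q) - (p' - q') = (p - p') - (q - q')" by simp
  ultimately show "sphere_poly dvd (p - p') - (q - q')" by (simp only:)
qed

lift_definition times_sphere :: "'a sphere \<Rightarrow> 'a sphere \<Rightarrow> 'a sphere" is "(*)"
proof -
  fix p q p' q' :: "'a poly poly poly" assume "sphere_poly dvd p - q" "sphere_poly dvd p' - q'"
  hence "sphere_poly dvd (p - q) * p' + q * (p' - q')" by (intro dvd_add dvd_mult dvd_mult2)
  moreover have "(p - q) * p' + q * (p' - q') = p * p' - q * q'" by (simp only: left_diff_distrib right_diff_distrib) simp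
  ultimately show "sphere_poly dvd p * p' - q * q'" by (simp only:)
qed

instance
proof
  fix a b c :: "'a sphere"
  show "a + b + c = a + (b + c)" by transfer (simp add: add.assoc)
  show "a + b = b + a" by transfer (simp add: add.commute)
  show "0 + a = a" by transfer simp
  show "- a + a = 0" by transfer simp
  show "a - b = a + - b" by transfer simp
  show "a * b * c = a * (b * c)" by transfer (simp add: mult.assoc)
  show "a * b = b * a" by transfer (simp add: mult.commute)
  show "1 * a = a" by transfer simp
  show "(a + b) * c = a * c + b * c" by transfer (simp add: distrib_right)
  show "a * (b + c) = a * b + a * c" by transfer (simp add: distrib_left)
  show "0 * a = 0" by transfer simp
  show "a * 0 = 0" by transfer simp
  show "0 \<noteq> (1 :: 'a sphere)"
  proof transfer
    have eq: "0 - 1 = [:- 1, 0 :: 'a poly poly:]" by (simp add: one_pCons)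
    show "\<not> sphere_poly dvd 0 - (1 :: 'a poly poly poly)"
      unfolding eq by (rule notI, drule sphere_poly_dvd_linear) simp
  qed
  show "a \<noteq> 0 \<Longrightarrow> b \<noteq> 0 \<Longrightarrow> a * b \<noteq> 0"
    by transfer (use sphere_poly_prime in auto)
qed

end


text \<open>The three coordinates also index the charts \<open>N(x)\<close>, \<open>N(y)\<close>, \<open>N(z)\<close>.\<close>

datatype coord = coord_x | coord_y | coord_z

fun coord_fun :: "coord \<Rightarrow> 'k::field_char_0 sphere" where
  "coord_fun coord_x = sphere_class [:[:[:0, 1:]:]:]"
| "coord_fun coord_y = sphere_class [:[:0, 1:]:]"
| "coord_fun coord_z = sphere_class [:0, 1:]"

definition scalar :: "'k::field_char_0 \<Rightarrow> 'k sphere"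
  where "scalar c = sphere_class [:[:[:c:]:]:]"

definition derivations :: "('k::field_char_0 sphere \<Rightarrow> 'k sphere) set"
  where "derivations = {\<eta>. (\<forall>f g. \<eta> (f + g) = \<eta> f + \<eta> g) \<and>
    (\<forall>c f. \<eta> (scalar c * f) = scalar c * \<eta> f) \<and>
    (\<forall>f g. \<eta> (f * g) = \<eta> f * g + f * \<eta> g)}"


section \<open>AV-modules\<close>

definition univ_ring :: "'a::comm_ring_1 ring"
  where "univ_ring = \<lparr>carrier = UNIV, mult = (*), one = 1, zero = 0, add = (+)\<rparr>"

record ('a, 'm) av_struct = "('a, 'm) module" +
  lie :: "('a \<Rightarrow> 'a) \<Rightarrow> 'm \<Rightarrow> 'm"

text \<open>
  The vector space structure over the ground field is the restriction of the module structure
  over the coordinate ring along \<^const>\<open>scalar\<close>. As in \<^theory>\<open>HOL-Algebra.Module\<close>, the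
  multiplication and unit that the record inherits from rings carry no meaning.
\<close>

definition av_module :: "('k::field_char_0 sphere, 'm) av_struct \<Rightarrow> bool"
  where "av_module M \<longleftrightarrow> Module.module univ_ring M \<and>
    (\<forall>\<eta>\<in>derivations. \<forall>m\<in>carrier M. lie M \<eta> m \<in> carrier M) \<and>
    (\<forall>\<eta>\<in>derivations. \<forall>m\<in>carrier M. \<forall>n\<in>carrier M.
      lie M \<eta> (m \<oplus>\<^bsub>M\<^esub> n) = lie M \<eta> m \<oplus>\<^bsub>M\<^esub> lie M \<eta> n) \<and>
    (\<forall>\<eta>\<in>derivations. \<forall>c. \<forall>m\<in>carrier M.
      lie M \<eta> (scalar c \<odot>\<^bsub>M\<^esub> m) = scalar c \<odot>\<^bsub>M\<^esub> lie M \<eta> m) \<and>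
    (\<forall>\<eta>\<in>derivations. \<forall>\<theta>\<in>derivations. \<forall>m\<in>carrier M.
      lie M (\<lambda>f. \<eta> f + \<theta> f) m = lie M \<eta> m \<oplus>\<^bsub>M\<^esub> lie M \<theta> m) \<and>
    (\<forall>\<eta>\<in>derivations. \<forall>c. \<forall>m\<in>carrier M.
      lie M (\<lambda>f. scalar c * \<eta> f) m = scalar c \<odot>\<^bsub>M\<^esub> lie M \<eta> m) \<and>
    (\<forall>\<eta>\<in>derivations. \<forall>\<theta>\<in>derivations. \<forall>m\<in>carrier M.
      lie M (\<lambda>f. \<eta> (\<theta> f) - \<theta> (\<eta> f)) m =
        lie M \<eta> (lie M \<theta> m) \<ominus>\<^bsub>M\<^esub> lie M \<theta> (lie M \<eta> m)) \<and>
    (\<forall>\<eta>\<in>derivations. \<forall>a. \<forall>m\<in>carrier M.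
      lie M \<eta> (a \<odot>\<^bsub>M\<^esub> m) = \<eta> a \<odot>\<^bsub>M\<^esub> m \<oplus>\<^bsub>M\<^esub> a \<odot>\<^bsub>M\<^esub> lie M \<eta> m)"

definition av_hom ::
  "('k::field_char_0 sphere, 'm) av_struct \<Rightarrow> ('k sphere, 'n) av_struct \<Rightarrow> ('m \<Rightarrow> 'n) set"
  where "av_hom M N = {f \<in> carrier M \<rightarrow> carrier N.
    (\<forall>m\<in>carrier M. \<forall>n\<in>carrier M. f (m \<oplus>\<^bsub>M\<^esub> n) = f m \<oplus>\<^bsub>N\<^esub> f n) \<and>
    (\<forall>a. \<forall>m\<in>carrier M. f (a \<odot>\<^bsub>M\<^esub> m) = a \<odot>\<^bsub>N\<^esub> f m) \<and>
    (\<forall>\<eta>\<in>derivations. \<forall>m\<in>carrier M. f (lie M \<eta> m) = lie N \<eta> (f m))}"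

definition av_iso ::
  "('k::field_char_0 sphere, 'm) av_struct \<Rightarrow> ('k sphere, 'n) av_struct \<Rightarrow> bool"
  where "av_iso M N \<longleftrightarrow> (\<exists>f\<in>av_hom M N. bij_betw f (carrier M) (carrier N))"

text \<open>Finite-dimensionality is the special case of a field \<open>R\<close>.\<close>

definition fin_gen :: "('r, 'x) ring_scheme \<Rightarrow> ('r, 'm, 'y) module_scheme \<Rightarrow> bool"
  where "fin_gen R M \<longleftrightarrow> (\<exists>B. finite B \<and> B \<subseteq> carrier M \<and>
    (\<forall>m\<in>carrier M. \<exists>c\<in>B \<rightarrow> carrier R. m = (\<Oplus>\<^bsub>M\<^esub>b\<in>B. c b \<odot>\<^bsub>M\<^esub> b)))"

definition av_struct_on ::
  "'m ring \<Rightarrow> ('a \<Rightarrow> 'm \<Rightarrow> 'm) \<Rightarrow> (('a \<Rightarrow> 'a) \<Rightarrow> 'm \<Rightarrow> 'm) \<Rightarrow> ('a, 'm) av_struct"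
  where "av_struct_on G s l = \<lparr>carrier = carrier G, mult = mult G, one = one G,
    zero = zero G, add = add G, smult = s, lie = l\<rparr>"

definition av_unit :: "('k::field_char_0 sphere, 'k sphere) av_struct"
  where "av_unit = av_struct_on univ_ring (*) (\<lambda>\<eta>. \<eta>)"

definition av_sum ::
  "('k::field_char_0 sphere, 'm) av_struct \<Rightarrow> ('k sphere, 'n) av_struct \<Rightarrow>
    ('k sphere, 'm \<times> 'n) av_struct"
  where "av_sum M N = av_struct_on
    \<lparr>carrier = carrier M \<times> carrier N, mult = undefined, one = undefined,
      zero = (\<zero>\<^bsub>M\<^esub>, \<zero>\<^bsub>N\<^esub>), add = (\<lambda>(m, n) (m', n'). (m \<oplus>\<^bsub>M\<^esub> m', n \<oplus>\<^bsub>N\<^esub> n'))\<rparr>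
    (\<lambda>a (m, n). (a \<odot>\<^bsub>M\<^esub> m, a \<odot>\<^bsub>N\<^esub> n))
    (\<lambda>\<eta> (m, n). (lie M \<eta> m, lie N \<eta> n))"

text \<open>The quotient by a submodule with carrier \<open>W\<close>.\<close>

definition av_quotient ::
  "('k::field_char_0 sphere, 'm) av_struct \<Rightarrow> 'm set \<Rightarrow> ('k sphere, 'm set) av_struct"
  where "av_quotient N W = av_struct_on
    \<lparr>carrier = a_rcosets\<^bsub>N\<^esub> W, mult = undefined, one = undefined,
      zero = W, add = set_add N\<rparr>
    (\<lambda>a C. W +>\<^bsub>N\<^esub> (a \<odot>\<^bsub>N\<^esub> (SOME n. n \<in> C)))
    (\<lambda>\<eta> C. W +>\<^bsub>N\<^esub> lie N \<eta> (SOME n. n \<in> C))"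


section \<open>Abelian groups by generators and relations, tensor products\<close>

definition gen_rel :: "'s set \<Rightarrow> ('s \<Rightarrow>\<^sub>0 int) set \<Rightarrow> ('s \<Rightarrow>\<^sub>0 int) set ring"
  where "gen_rel S R =
    (let F = free_Abelian_group S; G = F Mod generate F R
     in \<lparr>carrier = carrier G, mult = undefined, one = undefined,
          zero = \<one>\<^bsub>G\<^esub>, add = (\<lambda>C D. C \<otimes>\<^bsub>G\<^esub> D)\<rparr>)"

definition gen_class :: "'s set \<Rightarrow> ('s \<Rightarrow>\<^sub>0 int) set \<Rightarrow> 's \<Rightarrow> ('s \<Rightarrow>\<^sub>0 int) set"
  where "gen_class S R s =
    generate (free_Abelian_group S) R #>\<^bsub>free_Abelian_group S\<^esub> frag_of s"

text \<open>
  The additive map from a group given by generators and relations to \<open>P\<close> that sends the class of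
  each generator \<open>s\<close> to \<open>f s\<close>. It is independent of the chosen representative whenever \<open>f\<close>
  respects the relations.
\<close>

definition gen_lift ::
  "('p, 'x) ring_scheme \<Rightarrow> ('s \<Rightarrow> 'p) \<Rightarrow> ('s \<Rightarrow>\<^sub>0 int) set \<Rightarrow> 'p"
  where "gen_lift P f C =
    (let c = SOME c. c \<in> C
     in \<Oplus>\<^bsub>P\<^esub>s\<in>Poly_Mapping.keys c. [Poly_Mapping.lookup c s] \<cdot>\<^bsub>P\<^esub> f s)"

definition tensor_relations ::
  "('r, 'x) ring_scheme \<Rightarrow> ('r, 'm, 'y) module_scheme \<Rightarrow> ('r, 'n, 'z) module_scheme \<Rightarrow>
    (('m \<times> 'n) \<Rightarrow>\<^sub>0 int) set"
  where "tensor_relations R M N =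
    {frag_of (m \<oplus>\<^bsub>M\<^esub> m', n) - frag_of (m, n) - frag_of (m', n) |m m' n.
      m \<in> carrier M \<and> m' \<in> carrier M \<and> n \<in> carrier N} \<union>
    {frag_of (m, n \<oplus>\<^bsub>N\<^esub> n') - frag_of (m, n) - frag_of (m, n') |m n n'.
      m \<in> carrier M \<and> n \<in> carrier N \<and> n' \<in> carrier N} \<union>
    {frag_of (r \<odot>\<^bsub>M\<^esub> m, n) - frag_of (m, r \<odot>\<^bsub>N\<^esub> n) |r m n.
      r \<in> carrier R \<and> m \<in> carrier M \<and> n \<in> carrier N}"

definition tensor ::
  "('r, 'x) ring_scheme \<Rightarrow> ('r, 'm, 'y) module_scheme \<Rightarrow> ('r, 'n, 'z) module_scheme \<Rightarrow>
    (('m \<times> 'n) \<Rightarrow>\<^sub>0 int) set ring"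
  where "tensor R M N = gen_rel (carrier M \<times> carrier N) (tensor_relations R M N)"

definition pure_tensor ::
  "('r, 'x) ring_scheme \<Rightarrow> ('r, 'm, 'y) module_scheme \<Rightarrow> ('r, 'n, 'z) module_scheme \<Rightarrow>
    'm \<Rightarrow> 'n \<Rightarrow> (('m \<times> 'n) \<Rightarrow>\<^sub>0 int) set"
  where "pure_tensor R M N m n =
    gen_class (carrier M \<times> carrier N) (tensor_relations R M N) (m, n)"

definition av_tensor ::
  "('k::field_char_0 sphere, 'm) av_struct \<Rightarrow> ('k sphere, 'n) av_struct \<Rightarrow>
    ('k sphere, (('m \<times> 'n) \<Rightarrow>\<^sub>0 int) set) av_struct"
  where "av_tensor M N =
    (let T = tensor univ_ring M N; p = pure_tensor univ_ring M N
     in av_struct_on T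
          (\<lambda>a. gen_lift T (\<lambda>(m, n). p (a \<odot>\<^bsub>M\<^esub> m) n))
          (\<lambda>\<eta>. gen_lift T (\<lambda>(m, n). p (lie M \<eta> m) n \<oplus>\<^bsub>T\<^esub> p m (lie N \<eta> n))))"


section \<open>Representations of the general linear group of rank two\<close>

text \<open>The action field is used both for group and for Lie algebra representations.\<close>

record ('k, 'u) mat_struct = "('k, 'u) module" +
  mact :: "'k^2^2 \<Rightarrow> 'u \<Rightarrow> 'u"

text \<open>
  A regular function on \<open>GL\<^sub>2\<close> is \<open>q / det\<^sup>n\<close> with \<open>q\<close> a polynomial in the matrix entries. It can
  be evaluated, along \<open>\<iota>\<close>, at any matrix with unit determinant over an algebra over the
  ground field.
\<close>

type_synonym 'k gl2_fun = "((2 \<times> 2 \<Rightarrow>\<^sub>0 nat) \<Rightarrow>\<^sub>0 'k) \<times> nat"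

definition gl2_eval ::
  "('k::field \<Rightarrow> 'r::{comm_ring_1,inverse}) \<Rightarrow> 'k gl2_fun \<Rightarrow> 'r^2^2 \<Rightarrow> 'r"
  where "gl2_eval \<iota> \<phi> g = (case \<phi> of (q, n) \<Rightarrow>
    (\<Sum>\<mu>\<in>Poly_Mapping.keys q. \<iota> (Poly_Mapping.lookup q \<mu>) *
      (\<Prod>e\<in>Poly_Mapping.keys \<mu>. (g $ fst e $ snd e) ^ Poly_Mapping.lookup \<mu> e)) *
    inverse (det g) ^ n)"

definition gl2_coeffs_of ::
  "('k::field, 'u) mat_struct \<Rightarrow> 'u \<Rightarrow> 'u set \<Rightarrow> ('u \<Rightarrow> 'k gl2_fun) \<Rightarrow> bool"
  where "gl2_coeffs_of U u B \<phi> \<longleftrightarrow> finite B \<and> B \<subseteq> carrier U \<and>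
    (\<forall>g. invertible g \<longrightarrow> mact U g u = (\<Oplus>\<^bsub>U\<^esub>b\<in>B. gl2_eval (\<lambda>c. c) (\<phi> b) g \<odot>\<^bsub>U\<^esub> b))"

definition rational_gl2_module :: "('k::field, 'u) mat_struct \<Rightarrow> bool"
  where "rational_gl2_module U \<longleftrightarrow> Module.module univ_ring U \<and> fin_gen univ_ring U \<and>
    (\<forall>g. invertible g \<longrightarrow>
      (\<forall>u\<in>carrier U. mact U g u \<in> carrier U) \<and>
      (\<forall>u\<in>carrier U. \<forall>v\<in>carrier U. mact U g (u \<oplus>\<^bsub>U\<^esub> v) = mact U g u \<oplus>\<^bsub>U\<^esub> mact U g v) \<and>
      (\<forall>c. \<forall>u\<in>carrier U. mact U g (c \<odot>\<^bsub>U\<^esub> u) = c \<odot>\<^bsub>U\<^esub> mact U g u)) \<and>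
    (\<forall>u\<in>carrier U. mact U (mat 1) u = u) \<and>
    (\<forall>g h. invertible g \<longrightarrow> invertible h \<longrightarrow>
      (\<forall>u\<in>carrier U. mact U (g ** h) u = mact U g (mact U h u))) \<and>
    (\<forall>u\<in>carrier U. \<exists>B \<phi>. gl2_coeffs_of U u B \<phi>)"

text \<open>
  The coaction \<open>u \<mapsto> \<Sum>b\<in>B. \<phi> b \<otimes> b\<close>. Over an infinite field it does not depend on the choice
  as an element of the tensor product of the ring of regular functions and \<open>U\<close>.
\<close>

definition gl2_coaction :: "('k::field, 'u) mat_struct \<Rightarrow> 'u \<Rightarrow> 'u set \<times> ('u \<Rightarrow> 'k gl2_fun)"
  where "gl2_coaction U u = (SOME (B, \<phi>). gl2_coeffs_of U u B \<phi>)"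

text \<open>A matrix \<open>X\<close> acts by the coefficient of \<open>t\<close> in the action of \<open>1 + t X\<close>.\<close>

definition differentiate :: "('k::field, 'u) mat_struct \<Rightarrow> ('k, 'u) mat_struct"
  where "differentiate U = U\<lparr>mact := (\<lambda>X u. case gl2_coaction U u of (B, \<phi>) \<Rightarrow>
    (\<Oplus>\<^bsub>U\<^esub>b\<in>B. fps_nth
      (gl2_eval fps_const (\<phi> b)
        (\<chi> i j. fps_const (mat 1 $ i $ j) + fps_X * fps_const (X $ i $ j))) 1 \<odot>\<^bsub>U\<^esub> b))\<rparr>"

definition mat_unit :: "2 \<Rightarrow> 2 \<Rightarrow> 'k::field^2^2"
  where "mat_unit p i = (\<chi> r c. if r = p \<and> c = i then 1 else 0)"


section \<open>Charts\<close>

definition incl :: "'k::field_char_0 sphere \<Rightarrow> 'k sphere fract"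
  where "incl a = Fract a 1"

definition fract_scalar :: "'k::field_char_0 \<Rightarrow> 'k sphere fract"
  where "fract_scalar c = incl (scalar c)"

definition loc :: "coord \<Rightarrow> 'k::field_char_0 sphere fract set"
  where "loc h = {incl a / incl (coord_fun h) ^ n |a n. True}"

definition loc2 :: "coord \<Rightarrow> coord \<Rightarrow> 'k::field_char_0 sphere fract set"
  where "loc2 h h' = {incl a / (incl (coord_fun h) ^ m * incl (coord_fun h') ^ n) |a m n. True}"

fun chart_param :: "coord \<Rightarrow> 2 \<Rightarrow> 'k::field_char_0 sphere" where
  "chart_param coord_x i = (if i = 1 then coord_fun coord_y else coord_fun coord_z)"
| "chart_param coord_y i = (if i = 1 then coord_fun coord_x else coord_fun coord_z)"
| "chart_param coord_z i = (if i = 1 then coord_fun coord_x else coord_fun coord_y)"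

definition loc_derivations :: "coord \<Rightarrow> ('k::field_char_0 sphere fract \<Rightarrow> 'k sphere fract) set"
  where "loc_derivations h = {D \<in> loc h \<rightarrow>\<^sub>E loc h.
    (\<forall>f\<in>loc h. \<forall>g\<in>loc h. D (f + g) = D f + D g) \<and>
    (\<forall>c. \<forall>f\<in>loc h. D (fract_scalar c * f) = fract_scalar c * D f) \<and>
    (\<forall>f\<in>loc h. \<forall>g\<in>loc h. D (f * g) = D f * g + f * D g)}"

definition chart_partial ::
  "coord \<Rightarrow> 2 \<Rightarrow> 'k::field_char_0 sphere fract \<Rightarrow> 'k sphere fract"
  where "chart_partial h i = (THE D. D \<in> loc_derivations h \<and>
    (\<forall>j. D (incl (chart_param h j)) = (if i = j then 1 else 0)))"

definition fract_space :: "'k::field_char_0 sphere fract set \<Rightarrow> ('k, 'k sphere fract) module"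
  where "fract_space B = \<lparr>carrier = B, mult = (*), one = 1, zero = 0, add = (+),
    smult = (\<lambda>c g. fract_scalar c * g)\<rparr>"

abbreviation fract_tensor ::
  "'k::field_char_0 sphere fract set \<Rightarrow> ('k, 'u) mat_struct \<Rightarrow>
    (('k sphere fract \<times> 'u) \<Rightarrow>\<^sub>0 int) set ring"
  where "fract_tensor B U \<equiv> tensor univ_ring (fract_space B) U"

abbreviation fract_pure ::
  "'k::field_char_0 sphere fract set \<Rightarrow> ('k, 'u) mat_struct \<Rightarrow>
    'k sphere fract \<Rightarrow> 'u \<Rightarrow> (('k sphere fract \<times> 'u) \<Rightarrow>\<^sub>0 int) set"
  where "fract_pure B U \<equiv> pure_tensor univ_ring (fract_space B) U"

text \<open>
  The module \<open>A\<^bsub>(h)\<^esub> \<otimes> U\<close> for a representation \<open>U\<close> of the Lie algebra. The coefficients of a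
  derivation \<open>\<eta>\<close> with respect to the coordinate vector fields are the functions \<open>\<eta> t\<^sub>i\<close>.
\<close>

definition chart_module ::
  "coord \<Rightarrow> ('k::field_char_0, 'u) mat_struct \<Rightarrow>
    ('k sphere, (('k sphere fract \<times> 'u) \<Rightarrow>\<^sub>0 int) set) av_struct"
  where "chart_module h U =
    (let T = fract_tensor (loc h) U; p = fract_pure (loc h) U; pd = chart_partial h;
         coef = (\<lambda>\<eta> i. incl (\<eta> (chart_param h i)))
     in av_struct_on T
          (\<lambda>a. gen_lift T (\<lambda>(g, u). p (incl a * g) u))
          (\<lambda>\<eta>. gen_lift T (\<lambda>(g, u).
            (\<Oplus>\<^bsub>T\<^esub>i\<in>UNIV. p (coef \<eta> i * pd i g) u) \<oplus>\<^bsub>T\<^esub>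
            (\<Oplus>\<^bsub>T\<^esub>q\<in>UNIV. \<Oplus>\<^bsub>T\<^esub>i\<in>UNIV. p (g * pd q (coef \<eta> i)) (mact U (mat_unit q i) u)))))"

text \<open>The map \<open>B \<otimes> U \<rightarrow> B' \<otimes> U\<close> induced by an inclusion of subspaces of the fraction field.\<close>

definition fract_incl ::
  "'k::field_char_0 sphere fract set \<Rightarrow> ('k, 'u) mat_struct \<Rightarrow>
    (('k sphere fract \<times> 'u) \<Rightarrow>\<^sub>0 int) set \<Rightarrow> (('k sphere fract \<times> 'u) \<Rightarrow>\<^sub>0 int) set"
  where "fract_incl B' U = gen_lift (fract_tensor B' U) (\<lambda>(g, u). fract_pure B' U g u)"

text \<open>The matrix of \<open>C\<close>; its \<open>i\<close>-th column is the image of the \<open>i\<close>-th basis vector.\<close>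

definition chart_change :: "coord \<Rightarrow> coord \<Rightarrow> ('k::field_char_0 sphere fract)^2^2"
  where "chart_change h h' = (\<chi> j i. chart_partial h' j (incl (chart_param h i)))"

text \<open>The map \<open>\<rho>(C)\<close> on \<open>B \<otimes> U\<close> for an invertible matrix \<open>C\<close> over a subring \<open>B\<close> of the fraction field.\<close>

definition gl2_extend ::
  "'k::field_char_0 sphere fract set \<Rightarrow> ('k, 'u) mat_struct \<Rightarrow> ('k sphere fract)^2^2 \<Rightarrow>
    (('k sphere fract \<times> 'u) \<Rightarrow>\<^sub>0 int) set \<Rightarrow> (('k sphere fract \<times> 'u) \<Rightarrow>\<^sub>0 int) set"
  where "gl2_extend B U C =
    (let T = fract_tensor B U
     in gen_lift T (\<lambda>(g, u). case gl2_coaction U u of (S, \<phi>) \<Rightarrow>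
          (\<Oplus>\<^bsub>T\<^esub>b\<in>S. fract_pure B U (g * gl2_eval fract_scalar (\<phi> b) C) b)))"


section \<open>Tensor modules\<close>

text \<open>
  The representation \<open>U\<close> has its carrier in the same universe type as \<open>M\<close>. This is no restriction
  once that type is at least as large as the ground field.
\<close>

definition tensor_module :: "('k::field_char_0 sphere, 'u) av_struct \<Rightarrow> bool"
  where "tensor_module M \<longleftrightarrow> av_module M \<and> fin_gen univ_ring M \<and>
    (\<exists>(U :: ('k, 'u) mat_struct) \<phi>. rational_gl2_module U \<and>
      (\<forall>h. \<phi> h \<in> av_hom M (chart_module h (differentiate U)) \<and> inj_on (\<phi> h) (carrier M)) \<and>
      (\<forall>h h'. \<forall>m\<in>carrier M.
        gl2_extend (loc2 h h') U (chart_change h h') (fract_incl (loc2 h h') U (\<phi> h m)) =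
          fract_incl (loc2 h h') U (\<phi> h' m)))"

text \<open>Trace zero matrices act by zero, the identity matrix acts by \<open>\<alpha>\<close>.\<close>

definition weight_module :: "int \<Rightarrow> ('k::field_char_0, 'k) mat_struct"
  where "weight_module \<alpha> = \<lparr>carrier = UNIV, mult = (*), one = 1, zero = 0, add = (+),
    smult = (*), mact = (\<lambda>X c. of_int \<alpha> / 2 * trace X * c)\<rparr>"

text \<open>Meaningful for even \<open>\<alpha>\<close> only: the module is \<open>z\<close> to the power \<open>- \<alpha> / 2\<close> times \<open>A \<otimes> U\<close>.\<close>

definition A_power ::
  "int \<Rightarrow> ('k::field_char_0 sphere, (('k sphere fract \<times> 'k) \<Rightarrow>\<^sub>0 int) set) av_struct"
  where "A_power \<alpha> =
    (let U = weight_module \<alpha>; B = {incl (coord_fun coord_z) powi (- (\<alpha> div 2)) * incl a |a. True}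
     in (chart_module coord_z U)\<lparr>carrier := fract_incl (loc coord_z) U ` carrier (fract_tensor B U)\<rparr>)"

text \<open>
  Kaehler differentials: the generator \<open>(g, f)\<close> stands for \<open>g df\<close>. The first three families of
  relations yield the free module on the symbols \<open>df\<close> modulo linearity in \<open>f\<close>, the last one is
  the Leibniz rule.
\<close>

definition kahler_relations :: "(('k::field_char_0 sphere \<times> 'k sphere) \<Rightarrow>\<^sub>0 int) set"
  where "kahler_relations =
    {frag_of (g + g', f) - frag_of (g, f) - frag_of (g', f) |g g' f. True} \<union>
    {frag_of (g, f + f') - frag_of (g, f) - frag_of (g, f') |g f f'. True} \<union>
    {frag_of (scalar c * g, f) - frag_of (g, scalar c * f) |c g f. True} \<union>
    {frag_of (g, f * f') - frag_of (g * f', f) - frag_of (g * f, f') |g f f'. True}"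

definition Omega ::
  "('k::field_char_0 sphere, (('k sphere \<times> 'k sphere) \<Rightarrow>\<^sub>0 int) set) av_struct"
  where "Omega =
    (let T = gen_rel UNIV kahler_relations; d = (\<lambda>g f. gen_class UNIV kahler_relations (g, f))
     in av_struct_on T
          (\<lambda>a. gen_lift T (\<lambda>(g, f). d (a * g) f))
          (\<lambda>\<eta>. gen_lift T (\<lambda>(g, f). d (\<eta> g) f \<oplus>\<^bsub>T\<^esub> d g (\<eta> f))))"


section \<open>Categories\<close>

text \<open>Composition takes the three objects involved; \<open>cat_comp x y z g f\<close> is \<open>g\<close> after \<open>f\<close>.\<close>

record ('o, 'a) category =
  cat_obj :: "'o set"
  cat_hom :: "'o \<Rightarrow> 'o \<Rightarrow> 'a set"
  cat_id :: "'o \<Rightarrow> 'a"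
  cat_comp :: "'o \<Rightarrow> 'o \<Rightarrow> 'o \<Rightarrow> 'a \<Rightarrow> 'a \<Rightarrow> 'a"

definition is_functor ::
  "('o, 'a) category \<Rightarrow> ('p, 'b) category \<Rightarrow> ('o \<Rightarrow> 'p) \<Rightarrow> ('o \<Rightarrow> 'o \<Rightarrow> 'a \<Rightarrow> 'b) \<Rightarrow> bool"
  where "is_functor \<C> \<D> F F' \<longleftrightarrow>
    (\<forall>x\<in>cat_obj \<C>. F x \<in> cat_obj \<D>) \<and>
    (\<forall>x\<in>cat_obj \<C>. \<forall>y\<in>cat_obj \<C>. \<forall>f\<in>cat_hom \<C> x y. F' x y f \<in> cat_hom \<D> (F x) (F y)) \<and>
    (\<forall>x\<in>cat_obj \<C>. F' x x (cat_id \<C> x) = cat_id \<D> (F x)) \<and>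
    (\<forall>x\<in>cat_obj \<C>. \<forall>y\<in>cat_obj \<C>. \<forall>z\<in>cat_obj \<C>. \<forall>f\<in>cat_hom \<C> x y. \<forall>g\<in>cat_hom \<C> y z.
      F' x z (cat_comp \<C> x y z g f) = cat_comp \<D> (F x) (F y) (F z) (F' y z g) (F' x y f))"

definition inverse_arrows :: "('o, 'a) category \<Rightarrow> 'o \<Rightarrow> 'o \<Rightarrow> 'a \<Rightarrow> 'a \<Rightarrow> bool"
  where "inverse_arrows \<C> x y f g \<longleftrightarrow> f \<in> cat_hom \<C> x y \<and> g \<in> cat_hom \<C> y x \<and>
    cat_comp \<C> x y x g f = cat_id \<C> x \<and> cat_comp \<C> y x y f g = cat_id \<C> y"

text \<open>\<open>\<tau>\<close> is a natural isomorphism between the functors \<open>(F, F')\<close> and \<open>(G, G')\<close>.\<close>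

definition natural_iso ::
  "('o, 'a) category \<Rightarrow> ('p, 'b) category \<Rightarrow> ('o \<Rightarrow> 'p) \<Rightarrow> ('o \<Rightarrow> 'o \<Rightarrow> 'a \<Rightarrow> 'b) \<Rightarrow>
    ('o \<Rightarrow> 'p) \<Rightarrow> ('o \<Rightarrow> 'o \<Rightarrow> 'a \<Rightarrow> 'b) \<Rightarrow> ('o \<Rightarrow> 'b) \<Rightarrow> bool"
  where "natural_iso \<C> \<D> F F' G G' \<tau> \<longleftrightarrow>
    (\<forall>x\<in>cat_obj \<C>. \<exists>\<sigma>. inverse_arrows \<D> (F x) (G x) (\<tau> x) \<sigma>) \<and>
    (\<forall>x\<in>cat_obj \<C>. \<forall>y\<in>cat_obj \<C>. \<forall>f\<in>cat_hom \<C> x y.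
      cat_comp \<D> (F x) (F y) (G y) (\<tau> y) (F' x y f) = cat_comp \<D> (F x) (G x) (G y) (G' x y f) (\<tau> x))"

definition equivalent_categories :: "('o, 'a) category \<Rightarrow> ('p, 'b) category \<Rightarrow> bool"
  where "equivalent_categories \<C> \<D> \<longleftrightarrow> (\<exists>F F' G G' \<sigma> \<tau>.
    is_functor \<C> \<D> F F' \<and> is_functor \<D> \<C> G G' \<and>
    natural_iso \<C> \<C> (\<lambda>x. x) (\<lambda>x y f. f)
      (\<lambda>x. G (F x)) (\<lambda>x y f. G' (F x) (F y) (F' x y f)) \<sigma> \<and>
    natural_iso \<D> \<D> (\<lambda>x. F (G x)) (\<lambda>x y f. F' (G x) (G y) (G' x y f))
      (\<lambda>x. x) (\<lambda>x y f. f) \<tau>)"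

definition full_subcategory :: "('o, 'a) category \<Rightarrow> 'o set \<Rightarrow> ('o, 'a) category"
  where "full_subcategory \<C> S = \<C>\<lparr>cat_obj := cat_obj \<C> \<inter> S\<rparr>"

text \<open>Morphisms are extensional functions, so that a morphism is determined by its values on the carrier.\<close>

definition av_category :: "(('k::field_char_0 sphere, 'u) av_struct, 'u \<Rightarrow> 'u) category"
  where "av_category = \<lparr>cat_obj = {M. av_module M},
    cat_hom = (\<lambda>M N. av_hom M N \<inter> extensional (carrier M)),
    cat_id = (\<lambda>M. \<lambda>m\<in>carrier M. m),
    cat_comp = (\<lambda>L M N g f. compose (carrier L) g f)\<rparr>"

definition tensor_category :: "(('k::field_char_0 sphere, 'u) av_struct, 'u \<Rightarrow> 'u) category"
  where "tensor_category = full_subcategory av_category {M. tensor_module M}"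

definition gl2_hom :: "('k::field, 'u) mat_struct \<Rightarrow> ('k, 'w) mat_struct \<Rightarrow> ('u \<Rightarrow> 'w) set"
  where "gl2_hom U W = {f \<in> carrier U \<rightarrow> carrier W.
    (\<forall>u\<in>carrier U. \<forall>v\<in>carrier U. f (u \<oplus>\<^bsub>U\<^esub> v) = f u \<oplus>\<^bsub>W\<^esub> f v) \<and>
    (\<forall>c. \<forall>u\<in>carrier U. f (c \<odot>\<^bsub>U\<^esub> u) = c \<odot>\<^bsub>W\<^esub> f u) \<and>
    (\<forall>g. invertible g \<longrightarrow> (\<forall>u\<in>carrier U. f (mact U g u) = mact W g (f u)))}"

definition gl2_category :: "(('k::field, 'u) mat_struct, 'u \<Rightarrow> 'u) category"
  where "gl2_category = \<lparr>cat_obj = {U. rational_gl2_module U},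
    cat_hom = (\<lambda>U W. gl2_hom U W \<inter> extensional (carrier U)),
    cat_id = (\<lambda>U. \<lambda>u\<in>carrier U. u),
    cat_comp = (\<lambda>U V W g f. compose (carrier U) g f)\<rparr>"


section \<open>Generation of monoidal abelian subcategories\<close>

text \<open>
  Tensor products, sums and cokernels are constructed on other types than those of their
  constituents, so membership is required of all isomorphic modules in the universe type.
\<close>

definition has_copies ::
  "('k::field_char_0 sphere, 'u) av_struct set \<Rightarrow> ('k sphere, 'm) av_struct \<Rightarrow> bool"
  where "has_copies S M \<longleftrightarrow> (\<forall>T. av_module T \<longrightarrow> av_iso T M \<longrightarrow> T \<in> S)"

definition monoidal_abelian_closed :: "('k::field_char_0 sphere, 'u) av_struct set \<Rightarrow> bool"
  where "monoidal_abelian_closed S \<longleftrightarrow>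
    (\<forall>M\<in>S. av_module M) \<and>
    (\<forall>M\<in>S. has_copies S M) \<and>
    has_copies S av_unit \<and>
    (\<forall>T. av_module T \<longrightarrow> carrier T = {\<zero>\<^bsub>T\<^esub>} \<longrightarrow> T \<in> S) \<and>
    (\<forall>M\<in>S. \<forall>N\<in>S. has_copies S (av_sum M N)) \<and>
    (\<forall>M\<in>S. \<forall>N\<in>S. has_copies S (av_tensor M N)) \<and>
    (\<forall>M\<in>S. \<forall>N\<in>S. \<forall>f\<in>av_hom M N.
      has_copies S (M\<lparr>carrier := {m \<in> carrier M. f m = \<zero>\<^bsub>N\<^esub>}\<rparr>) \<and>
      has_copies S (av_quotient N (f ` carrier M)))"

definition generated_by_two ::
  "('k::field_char_0 sphere, 'm) av_struct \<Rightarrow> ('k sphere, 'n) av_struct \<Rightarrow>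
    ('k sphere, 'u) av_struct set"
  where "generated_by_two G H =
    \<Inter> {S. monoidal_abelian_closed S \<and> has_copies S G \<and> has_copies S H}"

definition iso_closure ::
  "('k::field_char_0 sphere, 'u) av_struct set \<Rightarrow> ('k sphere, 'u) av_struct set"
  where "iso_closure S = {T. av_module T \<and> (\<exists>M\<in>S. av_iso T M)}"

end

theory Submission imports Defs
begin

text \<open>
 A rational representation \<open>\<rho>\<close> is written in coordinates as \<open>q / det\<^sup>n\<close> with a matrix \<open>q\<close> of polynomials. Its
 module consists of the vectors over the fraction field, written in the chart \<open>N(z)\<close>, that become
 regular on each chart \<open>N(h)\<close> after applying \<open>\<rho>\<close> to the Jacobian matrix of the change of charts. Being
 locally free, these modules have tensor products, kernels and cokernels that are computed on
 representations. A homomorphism between two of them is a matrix over the fraction field; compatibility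
 with vector fields forces its entries to be constant and the matrix to commute with \<open>gl\<^sub>2\<close>, hence with
 \<open>GL\<^sub>2\<close>, by uniqueness for linear differential equations over \<open>k[[s]]\<close>. Finally \<open>\<Omega>\<close> belongs to the natural
 representation and \<open>A\<^sup>-\<^sup>2\<close> to the inverse determinant, and the derivatives at the origin of the matrix
 coefficients embed every representation into a sum of twisted tensor powers of the natural one.
\<close>

text \<open>The identities of a representation are given only on invertible matrices over k, but
  they are needed over the fraction field of A, where the Jacobian matrices live, and over power
  series, where derivatives are read off. Zariski density (\<open>polyfun_eq_0\<close>) transfers
  them to every integral domain over k; this is why k[[t]] takes the place of the dual numbers. The
  second obstacle is that the modules need not be free over A: whatever is clear over one chart is
  stated for local frames multiplied by a power of the coordinate h, and is glued by the partition
  of unity that comes from the equation of the sphere. Complete reducibility of representations is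
  nowhere used; kernels and cokernels of an equivariant matrix T are cut out with the help of a
  matrix T' such that T T' T = T, which need not be equivariant itself. Finally, objects of the
  categories live on an arbitrary type 'u. The modules constructed here live on types of functions
  and are copied to 'u along injections, and this is where the cardinality assumption
  enters.\<close>

no_notation fps_nth (infixl "$" 75)

abbreviation (input) "keys == Poly_Mapping.keys"
abbreviation (input) "lookup == Poly_Mapping.lookup"
abbreviation (input) "single == Poly_Mapping.single"

abbreviation (input) zero_in ("0[_]") where "0[M] == \<zero>\<^bsub>M\<^esub>"
abbreviation (input) add_in ("(_ +[_]/ _)" [65, 0, 66] 65) where "x +[M] y == x \<oplus>\<^bsub>M\<^esub> y"
abbreviation (input) minus_in ("(_ -[_]/ _)" [65, 0, 66] 65) where "x -[M] y == x \<ominus>\<^bsub>M\<^esub> y"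
abbreviation (input) mem_carrier (infix "\<in>." 50) where "x \<in>. M == x \<in> carrier M"
abbreviation (input) smult_in ("(_ .[_]/ _)" [71, 0, 70] 70) where "a .[M] x == a \<odot>\<^bsub>M\<^esub> x"

subsection \<open>Derivations of the coordinate ring\<close>

lemma sphere_class_eq_iff: "sphere_class p = sphere_class q \<longleftrightarrow> sphere_poly dvd p - q"
 by (rule sphere.abs_eq_iff)

lemmas sphere_class_arith = plus_sphere.abs_eq minus_sphere.abs_eq times_sphere.abs_eq
 uminus_sphere.abs_eq zero_sphere.abs_eq one_sphere.abs_eq

lemma sphere_class_surj: "\<exists>p. a = sphere_class p"
 by (metis Quotient3_abs_rep Quotient3_sphere)

lemma sphere_class_eq_0_iff: "sphere_class p = 0 \<longleftrightarrow> sphere_poly dvd p"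
 by (simp add: zero_sphere.abs_eq sphere_class_eq_iff)

lemma scalar_0 [simp]: "scalar 0 = 0"
 and scalar_1 [simp]: "scalar 1 = 1"
 and scalar_add: "scalar (c + d) = scalar c + scalar d"
 and scalar_mult: "scalar (c * d) = scalar c * scalar d"
 by (simp_all add: scalar_def sphere_class_arith one_pCons mult.commute)

declare coord_fun.simps [simp del]

lemma scalar_eq_0_iff [simp]: "scalar c = 0 \<longleftrightarrow> c = 0"
proof
 assume "scalar c = 0"
 hence "sphere_poly dvd [:[:[:c:]:], 0:]" by (simp add: scalar_def sphere_class_eq_0_iff)
 from sphere_poly_dvd_linear[OF this] show "c = 0" by simp
qed simp

fun coord_poly :: "coord => 'k::field_char_0 poly poly poly" where
 "coord_poly coord_x = [:[:[:0, 1:]:]:]"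
| "coord_poly coord_y = [:[:0, 1:]:]"
| "coord_poly coord_z = [:0, 1:]"

lemma coord_fun_eq: "coord_fun a = sphere_class (coord_poly a)"
 by (cases a) (auto simp: coord_fun.simps)

lemma sphere_eq:
 "coord_fun coord_x * coord_fun coord_x + coord_fun coord_y * coord_fun coord_y
  + coord_fun coord_z * coord_fun coord_z = (1 :: 'k::field_char_0 sphere)"
proof -
 have "[:[:[:0, 1:]:]:] * [:[:[:0, 1:]:]:] + [:[:0, 1:]:] * [:[:0, 1:]:] + [:0, 1:] * [:0, 1:] - 1
   = (sphere_poly :: 'k poly poly poly)"
  by (simp add: sphere_poly_def one_pCons)
 hence "sphere_poly dvd [:[:[:0, 1:]:]:] * [:[:[:0, 1:]:]:] + [:[:0, 1:]:] * [:[:0, 1:]:]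
   + [:0, 1:] * [:0, 1:] - (1 :: 'k poly poly poly)" by (simp only: dvd_refl)
 thus ?thesis by (simp only: coord_fun.simps sphere_class_arith sphere_class_eq_iff)
qed

lemma coord_fun_nz [simp]: "coord_fun a \<noteq> (0 :: 'k::field_char_0 sphere)"
proof
 assume *: "coord_fun a = (0 :: 'k sphere)"
 have "\<exists>s t. (coord_poly a :: 'k poly poly poly) = [:s, t:] \<and> (s \<noteq> 0 \<or> t \<noteq> 0)"
  by (cases a) (auto intro: exI[of _ 0])
 then obtain s t where st: "(coord_poly a :: 'k poly poly poly) = [:s, t:]" "s \<noteq> 0 \<or> t \<noteq> 0" by blast
 have "sphere_poly dvd [:s, t:]" using * st(1) by (simp add: coord_fun_eq sphere_class_eq_0_iff)
 from sphere_poly_dvd_linear[OF this] st(2) show False by simp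
qed

text \<open>Horner expansion in each of the three nested variables. It reduces statements about
  derivations to scalars and the three coordinates.\<close>

lemma sphere_induct [case_names scalar coord add mult]:
 assumes "!!c. P (scalar c)" "!!a. P (coord_fun a)"
  "!!a b. P a ==> P b ==> P (a + b)" "!!a b. P a ==> P b ==> P (a * b)"
 shows "P a"
proof -
 have x: "P (sphere_class [:[:p:]:])" for p
 proof (induction p)
  case 0
  show ?case using assms(1)[of 0] by (simp add: scalar_def)
 next
  case (pCons c p)
  have "sphere_class [:[:pCons c p:]:] = scalar c + coord_fun coord_x * sphere_class [:[:p:]:]"
   by (simp add: scalar_def sphere_class_arith coord_fun.simps)
  thus ?case using pCons assms by simp
 qed
 have y: "P (sphere_class [:p:])" for p
 proof (induction p)
  case 0
  show ?case using x[of 0] by simp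
 next
  case (pCons c p)
  have "sphere_class [:pCons c p:] = sphere_class [:[:c:]:] + coord_fun coord_y * sphere_class [:p:]"
   by (simp add: sphere_class_arith coord_fun.simps)
  thus ?case using pCons assms x by simp
 qed
 have z: "P (sphere_class p)" for p
 proof (induction p)
  case 0
  show ?case using y[of 0] by simp
 next
  case (pCons c p)
  have "sphere_class (pCons c p) = sphere_class [:c:] + coord_fun coord_z * sphere_class p"
   by (simp add: sphere_class_arith coord_fun.simps)
  thus ?case using pCons assms y by simp
 qed
 obtain p where "a = sphere_class p" using sphere_class_surj by blast
 thus ?thesis using z by simp
qed

text \<open>As the variables are nested, the partial derivative in an inner variable acts on
  coefficients; this makes it a derivation of the outer polynomial ring.\<close>

lemma map_poly_derivation:
 fixes d :: "'a::comm_ring_1 => 'a"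
 assumes add: "!!a b. d (a + b) = d a + d b" and mult: "!!a b. d (a * b) = d a * b + a * d b"
 shows "map_poly d (p + q) = map_poly d p + map_poly d q"
  and "map_poly d (p * q) = map_poly d p * q + p * map_poly d q"
proof -
 have 0: "d 0 = 0" using add[of 0 0] by simp
 have sum: "d (sum f A) = (\<Sum>a\<in>A. d (f a))" for f and A :: "nat set"
  by (induction A rule: infinite_finite_induct) (auto simp: 0 add)
 show "map_poly d (p + q) = map_poly d p + map_poly d q"
  by (simp add: poly_eq_iff coeff_map_poly 0 add)
 show "map_poly d (p * q) = map_poly d p * q + p * map_poly d q"
  by (simp add: poly_eq_iff coeff_map_poly 0 mult coeff_mult sum sum.distrib)
qed

fun pder :: "coord => 'k::field_char_0 poly poly poly => 'k poly poly poly" where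
 "pder coord_x = map_poly (map_poly pderiv)"
| "pder coord_y = map_poly pderiv"
| "pder coord_z = pderiv"

lemma pder_add: "pder a (p + q) = pder a p + pder a q"
 by (cases a) (simp_all add: pderiv_add pderiv_mult algebra_simps map_poly_derivation)

lemma pder_mult:
 fixes p q :: "'k::field_char_0 poly poly poly"
 shows "pder a (p * q) = pder a p * q + p * pder a q"
proof -
 have y: "map_poly pderiv (p * q) = map_poly pderiv p * q + p * map_poly pderiv q"
  for p q :: "'k poly poly"
  by (rule map_poly_derivation) (simp_all add: pderiv_add pderiv_mult algebra_simps)
 have y': "map_poly pderiv (p + q) = map_poly pderiv p + map_poly pderiv q"
  for p q :: "'k poly poly"
  by (rule map_poly_derivation) (simp_all add: pderiv_add pderiv_mult algebra_simps)
 show ?thesis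
 proof (cases a)
  case coord_x
  show ?thesis unfolding coord_x pder.simps by (rule map_poly_derivation(2)[OF y' y])
 next
  case coord_y
  show ?thesis unfolding coord_y pder.simps
   by (rule map_poly_derivation) (simp_all add: pderiv_add pderiv_mult algebra_simps)
 qed (simp add: pderiv_mult algebra_simps)
qed

lemma pder_const: "pder a [:[:[:c:]:]:] = 0"
 by (cases a) (simp_all add: map_poly_pCons pderiv_pCons)

lemma pder_coord: "pder a (coord_poly b) = (if a = b then 1 else 0)"
 by (cases a; cases b) (simp_all add: map_poly_pCons pderiv_pCons one_pCons)

lemma sphere_poly_eq: "sphere_poly = coord_poly coord_x * coord_poly coord_x
  + coord_poly coord_y * coord_poly coord_y + coord_poly coord_z * coord_poly coord_z - 1"
 by (simp add: sphere_poly_def one_pCons)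

lemma pder_sphere: "pder a sphere_poly = 2 * coord_poly a"
proof -
 \<comment> \<open>Adding the constant 1, whose derivative is 0, leaves a sum of three squares, to
   which the product rule applies.\<close>
 have eq: "sphere_poly + [:[:[:1:]:]:] = coord_poly coord_x * coord_poly coord_x
  + coord_poly coord_y * coord_poly coord_y + coord_poly coord_z * coord_poly coord_z"
  unfolding sphere_poly_eq by (simp add: one_pCons del: coord_poly.simps)
 have "pder a sphere_poly = pder a (sphere_poly + [:[:[:1:]:]:])"
  by (simp only: pder_add pder_const add_0_right)
 thus ?thesis unfolding eq by (cases a) (simp_all add: pder_add pder_mult pder_coord del: coord_poly.simps pder.simps)
qed

text \<open>Infinitesimal rotation in the plane of the coordinates a and b. Unlike the partial
  derivatives it kills \<open>sphere_poly\<close> and thus descends to A. The coordinate vector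
  fields of the charts are built from these rotations.\<close>

definition rot_poly :: "coord => coord => 'k::field_char_0 poly poly poly => 'k poly poly poly"
 where "rot_poly a b p = coord_poly b * pder a p - coord_poly a * pder b p"

lemma rot_poly_add: "rot_poly a b (p + q) = rot_poly a b p + rot_poly a b q"
 by (simp only: rot_poly_def pder_add distrib_left) simp

lemma rot_poly_mult: "rot_poly a b (p * q) = rot_poly a b p * q + p * rot_poly a b q"
 by (simp only: rot_poly_def pder_mult algebra_simps)

lift_definition rot :: "coord => coord => 'k::field_char_0 sphere => 'k sphere" is rot_poly
proof -
 fix a b and p q :: "'k poly poly poly"
 assume "sphere_poly dvd p - q"
 then obtain r where r: "p = q + sphere_poly * r" by (metis add.commute diff_add_cancel dvdE)
 have s: "rot_poly a b sphere_poly = 0"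
  by (simp only: rot_poly_def pder_sphere) simp
 have "rot_poly a b p = rot_poly a b q + sphere_poly * rot_poly a b r"
  unfolding r rot_poly_add rot_poly_mult s by simp
 thus "sphere_poly dvd rot_poly a b p - rot_poly a b q" by simp
qed

lemma rot_class: "rot a b (sphere_class p) = sphere_class (rot_poly a b p)"
 by (rule rot.abs_eq)

lemma rot_coord:
 "rot a b (coord_fun c) = (if c = a then coord_fun b else 0) - (if c = b then coord_fun a else 0)"
 by (simp add: coord_fun_eq rot_class rot_poly_def pder_coord sphere_class_arith del: coord_poly.simps pder.simps)

lemma derivationsD:
 assumes "\<eta> \<in> derivations"
 shows der_add: "\<eta> (f + g) = \<eta> f + \<eta> g" and der_mult: "\<eta> (f * g) = \<eta> f * g + f * \<eta> g"
  and der_scalar_mult: "\<eta> (scalar c * f) = scalar c * \<eta> f"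
  and der_1: "\<eta> 1 = 0" and der_scalar: "\<eta> (scalar c) = 0" and der_0: "\<eta> 0 = 0"
proof -
 show 1: "\<eta> (f + g) = \<eta> f + \<eta> g" "\<eta> (f * g) = \<eta> f * g + f * \<eta> g" "\<eta> (scalar c * f) = scalar c * \<eta> f" for f g c
  using assms by (auto simp: derivations_def)
 show 2: "\<eta> 1 = 0" using 1(2)[of 1 1] by (simp only: mult_1_left mult_1_right) (metis add_cancel_right_left)
 show "\<eta> (scalar c) = 0" using 1(3)[of c 1] 2 by simp
 show "\<eta> 0 = 0" using 1(1)[of 0 0] by (simp only: add_0_left) (metis add_cancel_right_left)
qed

lemma derivationsI:
 assumes "!!f g. \<eta> (f + g) = \<eta> f + \<eta> g" "!!f g. \<eta> (f * g) = \<eta> f * g + f * \<eta> g" "!!c. \<eta> (scalar c) = 0"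
 shows "\<eta> \<in> derivations"
 using assms by (auto simp: derivations_def)

lemma rot_derivation: "(rot a b :: 'k::field_char_0 sphere => _) \<in> derivations"
proof (rule derivationsI)
 show "rot a b (f + g) = rot a b f + rot a b g" for f g :: "'k sphere"
  using sphere_class_surj[of f] sphere_class_surj[of g]
  by (auto simp: rot_class sphere_class_arith rot_poly_add)
 show "rot a b (f * g) = rot a b f * g + f * rot a b g" for f g :: "'k sphere"
  using sphere_class_surj[of f] sphere_class_surj[of g]
  by (auto simp: rot_class sphere_class_arith rot_poly_mult)
 show "rot a b (scalar c) = (0 :: 'k sphere)" for c
  by (simp only: scalar_def rot_class rot_poly_def pder_const) (simp add: sphere_class_arith)
qed

lemma der_closed:
 assumes "\<eta> \<in> derivations" "\<theta> \<in> derivations"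
 shows der_add_closed: "(%f. \<eta> f + \<theta> f) \<in> derivations"
  and der_lie_closed: "(%f. \<eta> (\<theta> f) - \<theta> (\<eta> f)) \<in> derivations"
 by (rule derivationsI; simp add: derivationsD[OF assms(1)] derivationsD[OF assms(2)] algebra_simps)+

lemma der_smult_closed: "\<eta> \<in> derivations ==> (%f. a * \<eta> f) \<in> derivations"
 by (rule derivationsI) (simp_all add: derivationsD algebra_simps)

text \<open>Write the function as u + v z with u, v polynomials in x and y. The rotation in y and z
  gives u_y = 0 and S v_y = y v with S = 1 - x^2 - y^2, which forces v = 0; the rotation in x and z
  then kills the derivative of u in x.\<close>

lemma rot_constant:
 fixes f :: "'k::field_char_0 sphere"
 assumes x: "rot coord_x coord_z f = 0" and y: "rot coord_y coord_z f = 0"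
 shows "\<exists>c. f = scalar c"
proof -
 let ?S = "[:[:1, 0, - 1:], 0, - 1:] :: 'k poly poly"
 obtain p where p: "f = sphere_class p" using sphere_class_surj by blast
 obtain u v where "sphere_poly dvd p - [:u, v:]" using sphere_poly_reduce by blast
 hence f: "f = sphere_class [:u, v:]" by (simp add: p sphere_class_eq_iff)
 have S: "sphere_poly = [:- ?S, 0, 1:]" by (simp add: sphere_poly_def)
 have dy1: "rot_poly coord_y coord_z [:u, v:] = [:- ([:0, 1:] * v), pderiv u, pderiv v:]"
  by (simp add: rot_poly_def map_poly_pCons pderiv_pCons)
 have dy2: "[:- w, pderiv u, pderiv v:] = [:t * pderiv v - w, pderiv u:] + [:- t, 0, 1:] * [:pderiv v:]" for t w
  by simp
 have dy: "rot_poly coord_y coord_z [:u, v:] = [:?S * pderiv v - [:0, 1:] * v, pderiv u:] + sphere_poly * [:pderiv v:]"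
  unfolding dy1 S by (rule dy2)
 have "sphere_poly dvd [:?S * pderiv v - [:0, 1:] * v, pderiv u:]"
  using y unfolding f rot_class sphere_class_eq_0_iff dy by (simp only: dvd_add_times_triv_right_iff dvd_add_left_iff dvd_triv_left)
 from sphere_poly_dvd_linear[OF this] have v: "?S * pderiv v = [:0, 1:] * v" and u: "pderiv u = 0" by simp_all
 have v0: "v = 0"
 proof (rule ccontr)
  assume nz: "v \<noteq> 0"
  \<comment> \<open>Coefficient of y^(deg v + 1) on both sides: minus the degree of v times its
    leading coefficient against that leading coefficient alone, which is impossible in
    characteristic zero.\<close>
  have "coeff (?S * pderiv v) (Suc (degree v)) = - of_nat (degree v) * lead_coeff v"
  proof (cases "degree v")
   case 0
   hence "pderiv v = 0" by (simp add: pderiv_eq_0_iff)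
   thus ?thesis using 0 by simp
  next
   case (Suc m)
   have 1: "coeff (pderiv v) (Suc (Suc m)) = 0" using Suc by (simp add: coeff_pderiv coeff_eq_0)
   show ?thesis using Suc 1 by (simp add: coeff_pderiv numeral_2_eq_2 coeff_eq_0 algebra_simps)
  qed
  moreover have "coeff ([:0, 1:] * v) (Suc (degree v)) = lead_coeff v" by simp
  ultimately have "- of_nat (degree v) * lead_coeff v = lead_coeff v" unfolding v by (rule trans[OF sym])
  hence "of_nat (Suc (degree v)) * lead_coeff v = 0" by (simp add: distrib_right eq_neg_iff_add_eq_0 add.commute) (metis add.commute add.left_inverse)
  thus False using nz by (simp only: mult_eq_0_iff of_nat_eq_0_iff leading_coeff_0_iff) simp
 qed
 from u obtain w where w: "u = [:w:]" by (metis degree_eq_zeroE pderiv_eq_0_iff)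
 have dx: "rot_poly coord_x coord_z [:u, v:] = [:0, [:pderiv w:]:]"
  by (simp add: rot_poly_def map_poly_pCons pderiv_pCons v0 w)
 have "sphere_poly dvd [:0, [:pderiv w:]:]"
  using x unfolding f rot_class sphere_class_eq_0_iff dx .
 from sphere_poly_dvd_linear[OF this] have "pderiv w = 0" by simp
 then obtain c where "w = [:c:]" by (metis degree_eq_zeroE pderiv_eq_0_iff)
 thus ?thesis using f v0 w by (auto simp: scalar_def)
qed

subsection \<open>Charts\<close>

lemma incl_0 [simp]: "incl 0 = 0"
 and incl_1 [simp]: "incl 1 = 1"
 and incl_add: "incl (a + b) = incl a + incl b"
 and incl_diff: "incl (a - b) = incl a - incl b"
 and incl_minus: "incl (- a) = - incl a"
 and incl_mult: "incl (a * b) = incl a * incl b"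
 by (simp_all add: incl_def Zero_fract_def One_fract_def)

lemma incl_eq_iff [simp]: "incl a = incl b \<longleftrightarrow> a = b"
 by (simp add: incl_def eq_fract)

lemma incl_eq_0_iff [simp]: "incl a = 0 \<longleftrightarrow> a = 0"
 using incl_eq_iff[of a 0] by simp

lemma incl_power: "incl (a ^ n) = incl a ^ n"
 by (induction n) (simp_all add: incl_mult)

lemma incl_sum: "incl (sum f A) = (\<Sum>a\<in>A. incl (f a))"
 by (induction A rule: infinite_finite_induct) (simp_all add: incl_add)

lemma fract_exhaust: "\<exists>a b. b \<noteq> 0 \<and> f = incl a / incl b"
proof (cases f rule: Fract_cases)
 case (Fract a b)
 thus ?thesis by (intro exI[of _ a] exI[of _ b]) (simp add: incl_def)
qed

lemma fract_scalar_0 [simp]: "fract_scalar 0 = 0"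
 and fract_scalar_1 [simp]: "fract_scalar 1 = 1"
 and fract_scalar_add: "fract_scalar (c + d) = fract_scalar c + fract_scalar d"
 and fract_scalar_mult: "fract_scalar (c * d) = fract_scalar c * fract_scalar d"
 by (simp_all add: fract_scalar_def scalar_add scalar_mult incl_add incl_mult)

lemma fract_scalar_inj: "inj (fract_scalar :: 'k::field_char_0 => _)"
proof (rule injI)
 fix c d :: 'k assume "fract_scalar c = fract_scalar d"
 hence "scalar c = scalar ((c - d) + d) \<and> scalar c = scalar d" by (simp add: fract_scalar_def)
 hence "scalar (c - d) = 0" unfolding scalar_add by (metis add_cancel_left_left)
 thus "c = d" by simp
qed

lemma scalar_of_nat: "scalar (of_nat n) = of_nat n"
 by (induction n) (simp_all add: scalar_add)

section \<open>Derivations of the fraction field over k\<close>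

definition fder :: "('k::field_char_0 sphere fract => 'k sphere fract) => bool"
 where "fder D \<longleftrightarrow> (\<forall>f g. D (f + g) = D f + D g) \<and> (\<forall>f g. D (f * g) = D f * g + f * D g) \<and>
  (\<forall>c. D (fract_scalar c) = 0)"

lemma fderD:
 assumes "fder D"
 shows fder_add: "D (f + g) = D f + D g" and fder_mult: "D (f * g) = D f * g + f * D g"
  and fder_scalar: "D (fract_scalar c) = 0" and fder_0: "D 0 = 0" and fder_1: "D 1 = 0"
  and fder_minus: "D (- f) = - D f" and fder_diff: "D (f - g) = D f - D g"
proof -
 show 1: "D (f + g) = D f + D g" "D (f * g) = D f * g + f * D g" "D (fract_scalar c) = 0" for f g c
  using assms by (auto simp: fder_def)
 show 2: "D 0 = 0" "D 1 = 0" using 1(3)[of 0] 1(3)[of 1] by simp_all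
 show 3: "D (- f) = - D f" for f using 1(1)[of f "- f"] 2 by (simp add: eq_neg_iff_add_eq_0 add.commute)
 show "D (f - g) = D f - D g" using 1(1)[of f "- g"] 3 by simp
qed

lemma fder_sum: "fder D ==> D (sum f A) = (\<Sum>a\<in>A. D (f a))"
 by (induction A rule: infinite_finite_induct) (simp_all add: fderD)

lemma fder_divide:
 assumes "fder D" "g \<noteq> 0"
 shows "D (f / g) = (D f * g - f * D g) / g\<^sup>2"
proof -
 have "D f = D (f / g * g)" using assms by simp
 also have "... = D (f / g) * g + f / g * D g" using assms(1) by (simp only: fder_mult)
 finally show ?thesis using assms(2) by (simp add: field_simps power2_eq_square)
qed

lemma fder_power: "fder D ==> D (f ^ Suc n) = of_nat (Suc n) * f ^ n * D f"
 by (induction n) (simp_all add: fderD algebra_simps)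

lemma fder_eqI:
 assumes D: "fder D" and E: "fder E" and eq: "!!a. D (incl (coord_fun a)) = E (incl (coord_fun a))"
 shows "D f = E f"
proof -
 have incl: "D (incl a) = E (incl a)" for a
 proof (induction a rule: sphere_induct)
  case (scalar c)
  show ?case using fder_scalar[OF D, of c] fder_scalar[OF E, of c] by (simp add: fract_scalar_def)
 qed (simp_all add: eq incl_add incl_mult fderD[OF D] fderD[OF E])
 obtain a b where "b \<noteq> 0" "f = incl a / incl b" using fract_exhaust by blast
 thus ?thesis using incl by (simp add: fder_divide[OF D] fder_divide[OF E])
qed

lemma fder_closed:
 assumes "fder D" "fder E"
 shows fder_add_closed: "fder (%f. D f + E f)"
  and fder_lie_closed: "fder (%f. D (E f) - E (D f))"
 by (simp_all add: fder_def fderD[OF assms(1)] fderD[OF assms(2)] algebra_simps)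

lemma fder_smult_closed: "fder D ==> fder (%f. g * D f)"
 unfolding fder_def by (simp add: algebra_simps)

definition dext :: "('k::field_char_0 sphere => 'k sphere) => 'k sphere fract => 'k sphere fract"
 where "dext \<eta> f = (case SOME (a, b). b \<noteq> 0 \<and> f = incl a / incl b of (a, b) =>
  (incl (\<eta> a) * incl b - incl a * incl (\<eta> b)) / (incl b)\<^sup>2)"

text \<open>The extension applies the quotient rule to a fraction picked by \<open>SOME\<close>.
  Differentiating the cross-multiplied equation a d = c b and clearing denominators shows that the
  choice does not matter.\<close>

lemma dext_divide:
 assumes \<eta>: "\<eta> \<in> derivations" and b: "b \<noteq> 0"
 shows "dext \<eta> (incl a / incl b) = (incl (\<eta> a) * incl b - incl a * incl (\<eta> b)) / (incl b)\<^sup>2"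
proof -
 obtain c d where cd: "(SOME (c, d). d \<noteq> 0 \<and> incl a / incl b = incl c / incl d) = (c, d)"
  by (cases "SOME (c, d). d \<noteq> 0 \<and> incl a / incl b = incl c / incl d")
 have "\<exists>p. case p of (c, d) => d \<noteq> 0 \<and> incl a / incl b = incl c / incl d" using b by auto
 from someI_ex[OF this] have d: "d \<noteq> 0" and eq: "incl a / incl b = incl c / incl d"
  unfolding cd by auto
 from eq b d have e: "a * d = c * b"
  by (simp add: frac_eq_eq flip: incl_mult)
 hence \<eta>e: "\<eta> a * d + a * \<eta> d = \<eta> c * b + c * \<eta> b"
  using der_mult[OF \<eta>, of a d] der_mult[OF \<eta>, of c b] by simp
 have "(\<eta> a * b - a * \<eta> b) * (d * d) = (\<eta> a * d + a * \<eta> d) * (b * d) - (a * d) * (b * \<eta> d + d * \<eta> b)"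
  by (simp add: algebra_simps)
 also have "... = (\<eta> c * d - c * \<eta> d) * (b * b)"
  unfolding \<eta>e e by (simp add: algebra_simps)
 finally have "(\<eta> a * b - a * \<eta> b) * (d * d) = (\<eta> c * d - c * \<eta> d) * (b * b)" .
 hence "incl ((\<eta> a * b - a * \<eta> b) * (d * d)) = incl ((\<eta> c * d - c * \<eta> d) * (b * b))" by simp
 hence "(incl (\<eta> a) * incl b - incl a * incl (\<eta> b)) / (incl b)\<^sup>2 =
   (incl (\<eta> c) * incl d - incl c * incl (\<eta> d)) / (incl d)\<^sup>2"
  using b d by (simp add: frac_eq_eq power2_eq_square incl_mult incl_diff)
 thus ?thesis by (simp add: dext_def cd)
qed

lemma dext_incl: "\<eta> \<in> derivations ==> dext \<eta> (incl a) = incl (\<eta> a)"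
 using dext_divide[of \<eta> 1 a] by (simp add: der_1)

lemma fder_dext:
 assumes \<eta>: "\<eta> \<in> derivations"
 shows "fder (dext \<eta>)"
 unfolding fder_def
proof (intro conjI allI)
 fix f g :: "'a sphere fract" and c
 obtain a b where f: "b \<noteq> 0" "f = incl a / incl b" using fract_exhaust by blast
 obtain a' b' where g: "b' \<noteq> 0" "g = incl a' / incl b'" using fract_exhaust by blast
 have fg: "f + g = incl (a * b' + a' * b) / incl (b * b')" "f * g = incl (a * a') / incl (b * b')"
  using f g by (simp_all add: incl_add incl_mult add_frac_eq)
 have b: "b * b' \<noteq> 0" using f g by simp
 show "dext \<eta> (f + g) = dext \<eta> f + dext \<eta> g"
  unfolding fg dext_divide[OF \<eta> b] unfolding f(2) g(2) dext_divide[OF \<eta> f(1)] dext_divide[OF \<eta> g(1)] using f g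
  by (simp add: der_add[OF \<eta>] der_mult[OF \<eta>] incl_add incl_mult power2_eq_square)
    (simp add: divide_simps, simp add: algebra_simps)
 show "dext \<eta> (f * g) = dext \<eta> f * g + f * dext \<eta> g"
  unfolding fg dext_divide[OF \<eta> b] unfolding f(2) g(2) dext_divide[OF \<eta> f(1)] dext_divide[OF \<eta> g(1)] using f g
  by (simp add: der_add[OF \<eta>] der_mult[OF \<eta>] incl_add incl_mult power2_eq_square)
    (simp add: divide_simps, simp add: algebra_simps)
 show "dext \<eta> (fract_scalar c) = 0"
  unfolding fract_scalar_def by (simp add: dext_incl[OF \<eta>] der_scalar[OF \<eta>])
qed

lemma dext_add: "[|\<eta> \<in> derivations; \<theta> \<in> derivations|] ==> dext (%f. \<eta> f + \<theta> f) g = dext \<eta> g + dext \<theta> g"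
 by (rule fder_eqI) (simp_all add: fder_dext fder_add_closed der_add_closed dext_incl incl_add)

lemma dext_smult: "\<eta> \<in> derivations ==> dext (%f. a * \<eta> f) g = incl a * dext \<eta> g"
 by (rule fder_eqI[where E = "%g. incl a * dext \<eta> g"])
   (simp_all add: fder_dext fder_smult_closed[OF fder_dext] der_smult_closed dext_incl incl_mult)

lemma dext_lie: "[|\<eta> \<in> derivations; \<theta> \<in> derivations|] ==>
  dext (%f. \<eta> (\<theta> f) - \<theta> (\<eta> f)) g = dext \<eta> (dext \<theta> g) - dext \<theta> (dext \<eta> g)"
 by (rule fder_eqI) (simp_all add: fder_dext fder_lie_closed der_lie_closed dext_incl incl_diff)

section \<open>Coordinate vector fields on the charts\<close>

fun param_coord :: "coord => 2 => coord" where
 "param_coord coord_x i = (if i = 1 then coord_y else coord_z)"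
| "param_coord coord_y i = (if i = 1 then coord_x else coord_z)"
| "param_coord coord_z i = (if i = 1 then coord_x else coord_y)"

lemma chart_param_eq: "chart_param h i = coord_fun (param_coord h i)"
 by (cases h) simp_all

text \<open>The rotation in the plane of t_i and h sends t_i to h and kills the other parameter, so
  dividing it by h gives the coordinate vector field. In contrast to \<open>chart_partial\<close> it
  is explicit and acts on the whole fraction field.\<close>

definition pd :: "coord => 2 => 'k::field_char_0 sphere fract => 'k sphere fract"
 where "pd h i f = dext (rot (param_coord h i) h) f / incl (coord_fun h)"

abbreviation "fcoord a == incl (coord_fun a)"
abbreviation "fparam h i == incl (chart_param h i)"

lemma two_cases: "(i::2) = 1 \<or> i = 2"
 using exhaust_2 by blast

lemma fder_pd: "fder (pd h i)"
 using fder_smult_closed[OF fder_dext[OF rot_derivation[of "param_coord h i" h]], of "1 / fcoord h"]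
 by (simp add: pd_def[abs_def])

lemma pd_param: "pd h i (fparam h j) = (if i = j then 1 else 0)"
 using two_cases[of i] two_cases[of j]
 by (cases h) (auto simp: pd_def chart_param_eq dext_incl rot_derivation rot_coord)

lemma pd_self: "pd h i (fcoord h) = - fparam h i / fcoord h"
 using two_cases[of i]
 by (cases h) (auto simp: pd_def chart_param_eq dext_incl rot_derivation rot_coord incl_minus)

lemma fcoord_sq: "fcoord h * fcoord h = 1 - fparam h 1 * fparam h 1 - fparam h 2 * fparam h 2"
proof -
 have "fcoord coord_x * fcoord coord_x + fcoord coord_y * fcoord coord_y + fcoord coord_z * fcoord coord_z
   = incl (1 :: 'k::field_char_0 sphere)"
  by (simp only: sphere_eq flip: incl_add incl_mult)
 thus ?thesis by (cases h) (simp_all add: chart_param_eq algebra_simps)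
qed

text \<open>Characteristic zero is inherited from k through the embedding of scalars. It allows
  cancelling the factor 2 that arises when the equation of the sphere is differentiated.\<close>

lemma fract_two_nz: "(1::'k::field_char_0 sphere fract) + 1 \<noteq> 0"
proof
 assume "(1::'k sphere fract) + 1 = 0"
 hence "fract_scalar (1 + 1 :: 'k) = fract_scalar 0" by (simp only: fract_scalar_add) simp
 hence "(1 + 1 :: 'k) = 0" using fract_scalar_inj by (blast dest: injD)
 thus False by simp
qed

lemma coord_cases: "a = h \<or> a = param_coord h 1 \<or> a = param_coord h 2"
 by (cases a; cases h) simp_all

text \<open>Differentiate h^2 = 1 - t_1^2 - t_2^2 and cancel 2 h.\<close>

lemma fder_fcoord:
 assumes "fder D"
 shows "D (fcoord h) = - (fparam h 1 * D (fparam h 1) + fparam h 2 * D (fparam h 2)) / fcoord h"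
proof -
 have "D (fcoord h * fcoord h) = D (1 - fparam h 1 * fparam h 1 - fparam h 2 * fparam h 2)"
  by (simp only: fcoord_sq)
 hence "(1 + 1) * (fcoord h * D (fcoord h)) = (1 + 1) * (- (fparam h 1 * D (fparam h 1) + fparam h 2 * D (fparam h 2)))"
  by (simp only: fderD[OF assms]) (simp add: algebra_simps)
 hence "fcoord h * D (fcoord h) = - (fparam h 1 * D (fparam h 1) + fparam h 2 * D (fparam h 2))"
  using fract_two_nz by (metis mult_left_cancel)
 thus ?thesis by (simp add: field_simps)
qed

text \<open>Both sides are derivations that agree on t_1, t_2 and, by the equation of the sphere, on
  h. Every chain rule for changes of charts below is an instance of this expansion.\<close>

lemma fder_expand:
 assumes "fder D"
 shows "D f = (\<Sum>i\<in>UNIV. D (fparam h i) * pd h i f)"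
proof (rule fder_eqI[OF assms])
 have "fder (%f. D (fparam h 1) * pd h 1 f + D (fparam h 2) * pd h 2 f)"
  by (intro fder_add_closed fder_smult_closed[OF fder_pd])
 thus "fder (%f. \<Sum>i\<in>UNIV. D (fparam h i) * pd h i f)" by (simp add: sum_2)
next
 fix a
 show "D (fcoord a) = (\<Sum>i\<in>UNIV. D (fparam h i) * pd h i (fcoord a))"
  using coord_cases[of a h]
  by (auto simp: sum_2 pd_param pd_self fder_fcoord[OF assms, of h] add_divide_distrib diff_divide_distrib chart_param_eq[symmetric] mult.commute)
qed

section \<open>Regular functions on a chart\<close>

lemma locI: "f = incl a / fcoord h ^ n ==> f \<in> loc h"
 by (auto simp: loc_def)

lemma loc_incl [simp]: "incl a \<in> loc h"
 by (rule locI[of _ a _ 0]) simp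

lemma loc_scalar [simp]: "fract_scalar c \<in> loc h"
 by (simp add: fract_scalar_def)

lemma loc_0 [simp]: "0 \<in> loc h" and loc_1 [simp]: "1 \<in> loc h"
 using loc_incl[of 0 h] loc_incl[of 1 h] by simp_all

lemma loc_inverse: "1 / fcoord h ^ n \<in> loc h"
 by (rule locI[of _ 1]) simp

lemma loc_mult: "f \<in> loc h ==> g \<in> loc h ==> f * g \<in> loc h"
 unfolding loc_def by clarsimp (metis incl_mult power_add times_divide_times_eq)

lemma loc_add: "f \<in> loc h ==> g \<in> loc h ==> f + g \<in> loc h"
proof -
 assume "f \<in> loc h" "g \<in> loc h"
 then obtain a b n m where "f = incl a / fcoord h ^ n" "g = incl b / fcoord h ^ m" by (auto simp: loc_def)
 hence "f + g = incl (a * coord_fun h ^ m + b * coord_fun h ^ n) / fcoord h ^ (n + m)"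
  by (simp add: add_frac_eq incl_add incl_mult incl_power power_add)
 thus ?thesis by (rule locI)
qed

lemma loc_minus: "f \<in> loc h ==> - f \<in> loc h"
proof -
 assume "f \<in> loc h"
 hence "incl (- 1) * f \<in> loc h" by (intro loc_mult loc_incl)
 thus ?thesis by (simp add: incl_minus)
qed

lemma loc_diff: "f \<in> loc h ==> g \<in> loc h ==> f - g \<in> loc h"
 unfolding diff_conv_add_uminus by (intro loc_add loc_minus)

lemma loc_sum: "(!!a. a \<in> A ==> f a \<in> loc h) ==> sum f A \<in> loc h"
 by (induction A rule: infinite_finite_induct) (auto intro: loc_add)

lemma loc_divide: "f \<in> loc h ==> f / fcoord h \<in> loc h"
 using loc_mult[OF _ loc_inverse[of h 1]] by fastforce

text \<open>Stated for all large exponents, so that finitely many denominators can be cleared by one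
  power of h.\<close>

lemma loc_clear:
 assumes "f \<in> loc h"
 shows "\<exists>N. \<forall>M\<ge>N. \<exists>a. fcoord h ^ M * f = incl a"
proof -
 from assms obtain a n where f: "f = incl a / fcoord h ^ n" by (auto simp: loc_def)
 have "fcoord h ^ M * f = incl (coord_fun h ^ (M - n) * a)" if "M \<ge> n" for M
  using that by (simp add: f incl_mult incl_power power_diff)
 thus ?thesis by blast
qed

lemma loc_dext:
 assumes \<eta>: "\<eta> \<in> derivations" and f: "f \<in> loc h"
 shows "dext \<eta> f \<in> loc h"
proof -
 from f obtain a n where f: "f = incl a / incl (coord_fun h ^ n)" by (auto simp: loc_def incl_power)
 have "coord_fun h ^ n \<noteq> (0 :: 'a sphere)" by simp
 from dext_divide[OF \<eta> this, of a] show ?thesis unfolding f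
  by (intro locI[of _ "\<eta> a * coord_fun h ^ n - a * \<eta> (coord_fun h ^ n)" h "n * 2"])
    (simp add: incl_diff incl_mult incl_power power_mult)
qed

lemma loc_pd: "f \<in> loc h ==> pd h i f \<in> loc h"
 unfolding pd_def by (intro loc_divide loc_dext rot_derivation)

text \<open>Uniqueness behind \<open>THE\<close>: the difference E of two candidates kills t_1 and
  t_2, hence h because 2 h E(h) = 0, hence all of A, and finally every fraction after clearing its
  denominator.\<close>

lemma chart_partial_eq:
 assumes f: "f \<in> loc h"
 shows "chart_partial h i f = pd h i (f :: 'k::field_char_0 sphere fract)"
proof -
 have "chart_partial h i = restrict (pd h i) (loc h :: 'k sphere fract set)"
  unfolding chart_partial_def
 proof (rule the_equality, goal_cases)
  case 1
  show ?case
   using fderD(1,2)[OF fder_pd[of h i]] fder_scalar[OF fder_pd[of h i]]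
   by (auto simp: loc_derivations_def loc_add loc_mult loc_pd pd_param)
 next
  case (2 D)
  hence D: "D \<in> loc h \<rightarrow>\<^sub>E loc h" "!!f g. f \<in> loc h ==> g \<in> loc h ==> D (f + g) = D f + D g"
   "!!c f. f \<in> loc h ==> D (fract_scalar c * f) = fract_scalar c * D f"
   "!!f g. f \<in> loc h ==> g \<in> loc h ==> D (f * g) = D f * g + f * D g"
   and t: "!!j. D (fparam h j) = (if i = j then 1 else 0)"
   by (auto simp: loc_derivations_def)
  \<comment> \<open>D is only given on the localization, so \<open>fder_eqI\<close> does not apply
    and its argument is repeated for the difference.\<close>
  define E where "E f = D f - pd h i f" for f
  have Eadd: "E (f + g) = E f + E g" and Emult: "E (f * g) = E f * g + f * E g"
   if "f \<in> loc h" "g \<in> loc h" for f g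
   using that by (simp_all add: E_def D fderD[OF fder_pd] algebra_simps)
  have D1: "D 1 = 0" using D(4)[of 1 1] by (simp only: loc_1 mult_1_left mult_1_right) (metis add_cancel_right_left)
  have Es: "E (fract_scalar c) = 0" for c
   using D(3)[of 1 c] D1 by (simp add: E_def fder_scalar[OF fder_pd])
  have Et: "E (fparam h j) = 0" for j by (simp add: E_def t pd_param)
  have "E (fcoord h) = 0"
  proof -
   have "fcoord h * fcoord h + (fparam h 1 * fparam h 1 + fparam h 2 * fparam h 2) = fract_scalar (1 :: 'k)"
    by (simp add: fcoord_sq)
   hence "E (fcoord h * fcoord h + (fparam h 1 * fparam h 1 + fparam h 2 * fparam h 2)) = 0"
    by (simp only: Es)
   hence "(1 + 1) * (fcoord h * E (fcoord h)) = 0"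
    by (simp add: Eadd Emult Et loc_mult loc_add)
   thus ?thesis using fract_two_nz coord_fun_nz by (metis incl_eq_0_iff mult_eq_0_iff)
  qed
  hence Ec: "E (fcoord a) = 0" for a
   using coord_cases[of a h] Et by (auto simp: chart_param_eq)
  have Ei: "E (incl a) = 0" for a
  proof (induction a rule: sphere_induct)
   case (scalar c)
   show ?case using Es[of c] by (simp add: fract_scalar_def)
  qed (simp_all add: Ec incl_add incl_mult Eadd Emult)
  have "E f = 0" if f: "f \<in> loc h" for f
  proof -
   obtain N a where "fcoord h ^ N * f = incl a" using loc_clear[OF f] by blast
   hence "E (incl (coord_fun h ^ N) * f) = 0" by (simp add: Ei incl_power)
   thus ?thesis using f by (simp add: Emult Ei del: incl_power)
  qed
  thus ?case using D(1) by (auto simp: E_def fun_eq_iff PiE_def extensional_def)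
 qed
 thus ?thesis using f by simp
qed

text \<open>The equation of the sphere says that x, y, z generate the unit ideal. Exponents are
  raised for one coordinate at a time, multiplying the term a u^K by the original relation.\<close>

lemma partition_unity:
 "\<exists>a b c. a * coord_fun coord_x ^ K + b * coord_fun coord_y ^ L + c * coord_fun coord_z ^ M
  = (1 :: 'k::field_char_0 sphere)"
proof -
 let ?x = "coord_fun coord_x :: 'k sphere" and ?y = "coord_fun coord_y :: 'k sphere" and ?z = "coord_fun coord_z :: 'k sphere"
 have step: "\<exists>a b c. a * u ^ K + b * v + c * w = 1" if "\<exists>a b c. a * u + b * v + c * w = 1"
  for u v w :: "'k sphere" and K
 proof (induction K)
  case 0
  have "1 * u ^ 0 + 0 * v + 0 * w = 1" by simp
  thus ?case by blast
 next
  case (Suc K)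
  then obtain a b c where 1: "a * u ^ K + b * v + c * w = 1" by blast
  from \<open>\<exists>a b c. a * u + b * v + c * w = 1\<close>
  obtain a' b' c' where 2: "a' * u + b' * v + c' * w = 1" by blast
  have "(a * a') * u ^ Suc K + (a * u ^ K * b' + b) * v + (a * u ^ K * c' + c) * w
    = a * u ^ K * (a' * u + b' * v + c' * w) + b * v + c * w" by (simp add: algebra_simps)
  also have "... = 1" using 1 by (simp only: 2 mult_1_right)
  finally show ?case by blast
 qed
 have "\<exists>a b c. a * ?x + b * ?y + c * ?z = 1" using sphere_eq by blast
 from step[OF this, of K] obtain a b c where "b * ?y + c * ?z + a * ?x ^ K = 1" by (metis add.commute add.left_commute)
 hence "\<exists>b c a. b * ?y + c * ?z + a * ?x ^ K = 1" by blast
 from step[OF this, of L] obtain a b c where "c * ?z + a * ?x ^ K + b * ?y ^ L = 1" by (metis add.commute add.left_commute)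
 hence "\<exists>c a b. c * ?z + a * ?x ^ K + b * ?y ^ L = 1" by blast
 from step[OF this, of M] obtain a b c where "a * ?x ^ K + b * ?y ^ L + c * ?z ^ M = 1" by (metis add.commute add.left_commute)
 thus ?thesis by blast
qed

text \<open>The powers of x, y, z that clear the denominators of f generate the unit ideal, so f
  itself is a combination of elements of A.\<close>

lemma loc_Inter:
 assumes "!!h. f \<in> loc h"
 shows "\<exists>a. f = incl a"
proof -
 obtain K L M u v w where uvw: "fcoord coord_x ^ K * f = incl u" "fcoord coord_y ^ L * f = incl v"
   "fcoord coord_z ^ M * f = incl w"
  by (meson loc_clear assms order_refl)
 obtain a b c where "a * coord_fun coord_x ^ K + b * coord_fun coord_y ^ L + c * coord_fun coord_z ^ M = (1 :: 'a sphere)"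
  using partition_unity by blast
 hence "f = incl (a * coord_fun coord_x ^ K + b * coord_fun coord_y ^ L + c * coord_fun coord_z ^ M) * f" by simp
 also have "... = incl a * (fcoord coord_x ^ K * f) + incl b * (fcoord coord_y ^ L * f) + incl c * (fcoord coord_z ^ M * f)"
  by (simp add: incl_add incl_mult incl_power algebra_simps)
 also have "... = incl (a * u + b * v + c * w)" unfolding uvw by (simp add: incl_add incl_mult)
 finally show ?thesis by blast
qed

lemma fder_incl_divide_eq_0:
 assumes \<eta>: "\<eta> \<in> derivations" and 0: "dext \<eta> (incl a / incl c ^ Suc K) = 0" and c: "c \<noteq> 0"
 shows "c * \<eta> a = of_nat (Suc K) * (a * \<eta> c)"
proof -
 let ?f = "incl a / incl c ^ Suc K"
 have "incl (\<eta> a) = dext \<eta> (?f * incl c ^ Suc K)" using c by (simp add: dext_incl[OF \<eta>])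
 also have "... = ?f * (of_nat (Suc K) * incl c ^ K * incl (\<eta> c))"
  by (simp only: fder_mult[OF fder_dext[OF \<eta>]] 0 fder_power[OF fder_dext[OF \<eta>]] dext_incl[OF \<eta>]) simp
 finally have "incl c * incl (\<eta> a) = of_nat (Suc K) * (incl a * incl (\<eta> c))"
  using c by (simp del: of_nat_Suc add: divide_simps mult_ac)
 hence "incl (c * \<eta> a) = incl (of_nat (Suc K) * (a * \<eta> c))"
  by (simp add: incl_mult incl_add, metis Fract_of_nat_eq incl_def)
 thus ?thesis by simp
qed

text \<open>
 Denominators cancel by \<open>a = x (x a) + y (y a) + z (z a)\<close>, since \<open>z\<close> divides \<open>x a\<close> and \<open>y a\<close>
 whenever \<open>a / z\<^sup>K\<close> with \<open>K > 0\<close> is invariant under the rotations.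
\<close>

lemma loc_constant:
 fixes f :: "'k::field_char_0 sphere fract"
 assumes "f \<in> loc coord_z" and x: "dext (rot coord_x coord_z) f = 0" and y: "dext (rot coord_y coord_z) f = 0"
 shows "\<exists>c. f = fract_scalar c"
proof -
 have "\<exists>c. f = fract_scalar c" if "f = incl a / fcoord coord_z ^ K" for a K
  using that
 proof (induction K arbitrary: a)
  case 0
  hence "incl (rot coord_x coord_z a) = 0" "incl (rot coord_y coord_z a) = 0"
   using x y by (simp_all add: dext_incl rot_derivation)
  thus ?case using rot_constant[of a] 0 by (auto simp: fract_scalar_def)
 next
  case (Suc K)
  let ?x = "coord_fun coord_x :: 'k sphere" and ?y = "coord_fun coord_y :: 'k sphere" and ?z = "coord_fun coord_z :: 'k sphere"
  let ?n = "scalar (inverse (of_nat (Suc K))) :: 'k sphere"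
  have "?n * of_nat (Suc K) = scalar (inverse (of_nat (Suc K)) * of_nat (Suc K))"
   by (simp only: scalar_mult scalar_of_nat)
  also have "... = 1" by (simp del: of_nat_Suc)
  finally have n: "?n * (of_nat (Suc K) * b) = b" for b by (simp only: mult.assoc[symmetric] mult_1_left)
  \<comment> \<open>The rotations send z to -x and to -y, so invariance of a / z^(K+1) reads z
    rot(a) = -(K+1) a x, and likewise with y.\<close>
  have 1: "?z * rot coord_x coord_z a = of_nat (Suc K) * (a * - ?x)" "?z * rot coord_y coord_z a = of_nat (Suc K) * (a * - ?y)"
   using fder_incl_divide_eq_0[OF rot_derivation, of coord_x coord_z a ?z K]
    fder_incl_divide_eq_0[OF rot_derivation, of coord_y coord_z a ?z K] x y Suc.prems
   by (simp_all add: rot_coord)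
  have 2: "a * ?x = ?z * (- ?n * rot coord_x coord_z a)" "a * ?y = ?z * (- ?n * rot coord_y coord_z a)"
   using arg_cong[OF 1(1), of "%u. - ?n * u"] arg_cong[OF 1(2), of "%u. - ?n * u"]
   by (simp_all only: mult_minus_left n mult_minus_right minus_minus) (simp_all add: ac_simps)
  have "a = a * (?x * ?x + ?y * ?y + ?z * ?z)" by (simp add: sphere_eq)
  also have "... = ?x * (a * ?x) + ?y * (a * ?y) + ?z * (?z * a)" by (simp only: algebra_simps)
  also have "... = ?z * (?x * (- ?n * rot coord_x coord_z a) + ?y * (- ?n * rot coord_y coord_z a) + ?z * a)"
   unfolding 2 by (simp only: algebra_simps)
  finally obtain b where "a = ?z * b" by blast
  hence "f = incl b / fcoord coord_z ^ K" using Suc.prems by (simp add: incl_mult)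
  thus ?case by (rule Suc.IH)
 qed
 thus ?thesis using assms(1) by (auto simp: loc_def)
qed

section \<open>Regular functions on the overlap of two charts\<close>

lemma loc_subset_loc2: "loc h \<subseteq> loc2 h h'" "loc h' \<subseteq> loc2 h h'"
proof -
 have "incl a / fcoord h ^ n = incl a / (fcoord h ^ n * fcoord h' ^ 0)"
  "incl a / fcoord h' ^ n = incl a / (fcoord h ^ 0 * fcoord h' ^ n)" for a n by simp_all
 thus "loc h \<subseteq> loc2 h h'" "loc h' \<subseteq> loc2 h h'" by (auto simp only: loc_def loc2_def) blast+
qed

lemma loc2_eq: "loc2 h h' = {f * g |f g. f \<in> loc h \<and> g \<in> loc h'}"
proof safe
 fix f :: "'a sphere fract" assume "f \<in> loc2 h h'"
 then obtain a m n where "f = incl a / (fcoord h ^ m * fcoord h' ^ n)" by (auto simp: loc2_def)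
 hence "f = incl a / fcoord h ^ m * (1 / fcoord h' ^ n)" by simp
 thus "\<exists>f' g. f = f' * g \<and> f' \<in> loc h \<and> g \<in> loc h'" using loc_inverse locI by blast
next
 fix f g :: "'a sphere fract" assume "f \<in> loc h" "g \<in> loc h'"
 then obtain a b m n where "f = incl a / fcoord h ^ m" "g = incl b / fcoord h' ^ n" by (auto simp: loc_def)
 hence "f * g = incl (a * b) / (fcoord h ^ m * fcoord h' ^ n)" by (simp add: incl_mult)
 thus "f * g \<in> loc2 h h'" by (auto simp: loc2_def)
qed

lemma loc2_mult: "f \<in> loc2 h h' ==> g \<in> loc2 h h' ==> f * g \<in> loc2 h h'"
proof -
 assume "f \<in> loc2 h h'" "g \<in> loc2 h h'"
 then obtain f1 f2 g1 g2 where "f = f1 * f2" "g = g1 * g2" and 1: "f1 \<in> loc h" "f2 \<in> loc h'" "g1 \<in> loc h" "g2 \<in> loc h'"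
  by (auto simp: loc2_eq)
 hence "f * g = (f1 * g1) * (f2 * g2)" by (simp add: ac_simps)
 thus ?thesis unfolding loc2_eq using 1 loc_mult by blast
qed

lemma loc2_clear:
 assumes "f \<in> loc2 h h'"
 shows "\<exists>N. \<forall>M\<ge>N. fcoord h ^ M * f \<in> loc h'"
proof -
 obtain g g' where f: "f = g * g'" "g \<in> loc h" "g' \<in> loc h'" using assms by (auto simp: loc2_eq)
 obtain N where N: "\<forall>M\<ge>N. \<exists>a. fcoord h ^ M * g = incl a" using loc_clear f by blast
 have "fcoord h ^ M * f \<in> loc h'" if "M \<ge> N" for M
  using N[rule_format, OF that] f by (metis loc_incl loc_mult mult.assoc)
 thus ?thesis by blast
qed

lemma loc2_add: "f \<in> loc2 h h' ==> g \<in> loc2 h h' ==> f + g \<in> loc2 h h'"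
proof -
 assume "f \<in> loc2 h h'" "g \<in> loc2 h h'"
 then obtain N M where N: "fcoord h ^ (N + M) * f \<in> loc h'" "fcoord h ^ (N + M) * g \<in> loc h'"
  by (meson loc2_clear le_add1 le_add2)
 hence "1 / fcoord h ^ (N + M) * (fcoord h ^ (N + M) * f + fcoord h ^ (N + M) * g) \<in> loc2 h h'"
  unfolding loc2_eq by (blast intro: loc_add loc_inverse)
 thus ?thesis by (simp add: distrib_left mult.assoc[symmetric])
qed

lemma loc2_sum: "(!!a. a \<in> A ==> f a \<in> loc2 h h') ==> sum f A \<in> loc2 h h'"
 by (induction A rule: infinite_finite_induct) (auto intro: loc2_add subsetD[OF loc_subset_loc2(1)])

subsection \<open>Changes of charts and Jacobians\<close>

abbreviation "cc == chart_change"

lemma cc_eq: "cc h h' $ j $ i = pd h' j (fparam h i)"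
 by (simp add: chart_change_def chart_partial_eq)

lemma cc_loc [simp]: "cc h h' $ j $ i \<in> loc h'"
 by (simp add: cc_eq loc_pd)

text \<open>Chain rule through a third chart. In particular \<open>cc h' h\<close> is the inverse of
  \<open>cc h h'\<close>.\<close>

lemma cc_comp: "cc h' h'' ** cc h h' = (cc h h'' :: 'k::field_char_0 sphere fract^2^2)"
 unfolding vec_eq_iff
proof (intro allI)
 fix j i
 show "(cc h' h'' ** cc h h') $ j $ i = (cc h h'' :: 'k sphere fract^2^2) $ j $ i"
  using fder_expand[OF fder_pd, of h'' j "fparam h i :: 'k sphere fract" h']
  by (simp add: matrix_matrix_mult_def cc_eq)
qed

lemma cc_refl [simp]: "cc h h = mat 1"
 by (simp add: vec_eq_iff cc_eq mat_def pd_param)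

lemma det_cc: "det (cc h h') * det (cc h' h) = 1"
 using det_mul[of "cc h h'" "cc h' h"] by (simp add: cc_comp)

lemma det_cc_nz [simp]: "det (cc h h') \<noteq> 0"
 by (metis det_cc mult_zero_left zero_neq_one)

lemma inverse_det_cc: "inverse (det (cc h h')) = det (cc h' h)"
 by (rule inverse_unique[OF det_cc])

text \<open>Its entry (p, i) is the derivative of the i-th coefficient of \<eta> in direction p,
  which is the factor of the matrix unit E_{p,i} in the action on a chart. The whole second sum of
  that action is therefore this matrix acting through the representation.\<close>

definition jac :: "coord => ('k::field_char_0 sphere => 'k sphere) => 'k sphere fract^2^2"
 where "jac h \<eta> = (\<chi> p i. pd h p (incl (\<eta> (chart_param h i))))"

lemma jac_loc: "jac h \<eta> $ p $ i \<in> loc h"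
 by (simp add: jac_def loc_pd)

lemma jac_add: "jac h (%f. \<eta> f + \<theta> f) = jac h \<eta> + jac h \<theta>"
 by (simp add: jac_def vec_eq_iff incl_add fder_add[OF fder_pd])

lemma jac_smult: "jac h (%f. a * \<eta> f) $ p $ i
  = incl a * jac h \<eta> $ p $ i + pd h p (incl a) * incl (\<eta> (chart_param h i))"
 by (simp add: jac_def incl_mult fder_mult[OF fder_pd])

text \<open>The commutator of \<open>pd h j\<close> with \<eta> is again a derivation, and it is
  expanded by its values on the parameters.\<close>

lemma pd_commutator:
 assumes \<eta>: "\<eta> \<in> derivations"
 shows "pd h j (dext \<eta> f) = dext \<eta> (pd h j f) + (\<Sum>q\<in>UNIV. jac h \<eta> $ j $ q * pd h q f)"
proof -
 have "fder (%f. pd h j (dext \<eta> f) - dext \<eta> (pd h j f))"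
  by (rule fder_lie_closed[OF fder_pd fder_dext[OF \<eta>]])
 from fder_expand[OF this, of f h] show ?thesis
  by (simp add: jac_def dext_incl[OF \<eta>] pd_param fder_0[OF fder_dext[OF \<eta>]] fder_1[OF fder_dext[OF \<eta>]]
    if_distrib[of "dext \<eta>"] sum_2 algebra_simps cong: if_cong)
qed

text \<open>Apply the new coordinate vector fields to \<eta>(t_i) and compute in two ways, by the
  chain rule and by \<open>pd_commutator\<close>. The inhomogeneous term \<eta>(C) is what the
  derivative of \<rho>(C) compensates in \<open>Lie_chart_cc\<close>.\<close>

lemma jac_cocycle:
 assumes \<eta>: "\<eta> \<in> derivations"
 shows "(cc h h' ** jac h \<eta>) $ j $ i = dext \<eta> (cc h h' $ j $ i) + (jac h' \<eta> ** cc h h') $ j $ i"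
proof -
 have "(cc h h' ** jac h \<eta>) $ j $ i = pd h' j (dext \<eta> (fparam h i))"
  unfolding dext_incl[OF \<eta>] fder_expand[OF fder_pd, of h' j "incl (\<eta> (chart_param h i))" h]
  by (simp add: matrix_matrix_mult_def cc_eq jac_def)
 thus ?thesis by (simp add: pd_commutator[OF \<eta>] matrix_matrix_mult_def cc_eq)
qed

text \<open>The cocycle property of the Jacobian of a vector field; it makes the chart formula an
  action of the Lie algebra.\<close>

lemma jac_lie:
 assumes \<eta>: "\<eta> \<in> derivations" and \<theta>: "\<theta> \<in> derivations"
 shows "jac h (%f. \<eta> (\<theta> f) - \<theta> (\<eta> f)) $ p $ i = dext \<eta> (jac h \<theta> $ p $ i) - dext \<theta> (jac h \<eta> $ p $ i)
  + (jac h \<eta> ** jac h \<theta> - jac h \<theta> ** jac h \<eta>) $ p $ i"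
proof -
 let ?t = "fparam h i"
 have "pd h p (dext \<eta> (dext \<theta> ?t)) = dext \<eta> (pd h p (dext \<theta> ?t)) + (\<Sum>q\<in>UNIV. jac h \<eta> $ p $ q * pd h q (dext \<theta> ?t))"
  "pd h p (dext \<theta> (dext \<eta> ?t)) = dext \<theta> (pd h p (dext \<eta> ?t)) + (\<Sum>q\<in>UNIV. jac h \<theta> $ p $ q * pd h q (dext \<eta> ?t))"
  by (rule pd_commutator[OF \<eta>], rule pd_commutator[OF \<theta>])
 moreover have "pd h q (dext \<theta> ?t) = jac h \<theta> $ q $ i" "pd h q (dext \<eta> ?t) = jac h \<eta> $ q $ i" for q
  by (simp_all add: jac_def dext_incl[OF \<eta>] dext_incl[OF \<theta>])
 moreover have "jac h (%f. \<eta> (\<theta> f) - \<theta> (\<eta> f)) $ p $ i = pd h p (dext \<eta> (dext \<theta> ?t)) - pd h p (dext \<theta> (dext \<eta> ?t))"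
  by (simp add: jac_def dext_incl[OF \<eta>] dext_incl[OF \<theta>] incl_diff fder_diff[OF fder_pd])
 ultimately show ?thesis by (simp add: matrix_matrix_mult_def)
qed

subsection \<open>Polynomial matrix functions and base change\<close>

definition rhom :: "('a::comm_ring_1 => 'b::comm_ring_1) => bool"
 where "rhom f \<longleftrightarrow> f 1 = 1 \<and> (\<forall>x y. f (x + y) = f x + f y) \<and> (\<forall>x y. f (x * y) = f x * f y)"

lemma rhomD:
 assumes "rhom f"
 shows rhom_1: "f 1 = 1" and rhom_add: "f (x + y) = f x + f y" and rhom_mult: "f (x * y) = f x * f y"
  and rhom_0: "f 0 = 0" and rhom_minus: "f (- x) = - f x" and rhom_diff: "f (x - y) = f x - f y"
  and rhom_power: "f (x ^ n) = f x ^ n" and rhom_of_nat: "f (of_nat n) = of_nat n"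
proof -
 show 1: "f 1 = 1" "f (x + y) = f x + f y" "f (x * y) = f x * f y" for x y
  using assms by (auto simp: rhom_def)
 show 2: "f 0 = 0" using 1(2)[of 0 0] by (simp only: add_0_left) (metis add_cancel_right_left)
 show 3: "f (- x) = - f x" for x using 1(2)[of x "- x"] by (simp add: 2 eq_neg_iff_add_eq_0 add.commute)
 show "f (x - y) = f x - f y" using 1(2)[of x "- y"] 3 by simp
 show "f (x ^ n) = f x ^ n" by (induction n) (simp_all add: 1)
 show "f (of_nat n) = of_nat n" by (induction n) (simp_all add: 1 2)
qed

lemma rhom_sum: "rhom f ==> f (sum g A) = (\<Sum>a\<in>A. f (g a))"
 by (induction A rule: infinite_finite_induct) (simp_all add: rhomD)

lemma rhom_inj:
 fixes f :: "'a::field => 'b::comm_ring_1"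
 assumes "rhom f"
 shows "inj f"
proof (rule injI)
 fix x y assume "f x = f y"
 hence 0: "f (x - y) = 0" by (simp add: rhomD[OF assms])
 show "x = y"
 proof (rule ccontr)
  assume "x \<noteq> y"
  hence "f ((x - y) * inverse (x - y)) = 1" by (simp add: rhomD[OF assms])
  thus False using 0 by (simp only: rhom_mult[OF assms]) simp
 qed
qed

lemma rhom_comp: "rhom f ==> rhom g ==> rhom (%x. f (g x))"
 by (simp add: rhom_def)

lemma rhom_inverse:
 fixes f :: "'a::field => 'b::field"
 assumes "rhom f"
 shows "f (inverse x) = inverse (f x)"
proof (cases "x = 0")
 case False
 hence "f x * f (inverse x) = 1" by (simp add: rhomD[OF assms] flip: rhom_mult[OF assms])
 thus ?thesis by (simp add: inverse_unique)
qed (simp add: rhomD[OF assms])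

lemma rhom_divide:
 fixes f :: "'a::field => 'b::field"
 shows "rhom f ==> f (x / y) = f x / f y"
 by (simp add: divide_inverse rhom_mult rhom_inverse)

lemma rhom_id [simp]: "rhom (%x. x)"
 by (simp add: rhom_def)

lemma rhom_fs [simp]: "rhom fract_scalar"
 by (simp add: rhom_def fract_scalar_add fract_scalar_mult)

lemma rhom_fps_const [simp]: "rhom fps_const"
 by (simp add: rhom_def)

lemma rhom_fps_nth_0 [simp]: "rhom (%f. fps_nth f 0)"
 by (simp add: rhom_def)

definition mmap :: "('a => 'b) => 'a^2^2 => 'b^2^2"
 where "mmap f g = (\<chi> i j. f (g $ i $ j))"

lemma mmap_nth [simp]: "mmap f g $ i $ j = f (g $ i $ j)"
 by (simp add: mmap_def)

lemma mmap_mult: "rhom f ==> mmap f (g ** h) = mmap f g ** mmap f h"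
 by (simp add: vec_eq_iff matrix_matrix_mult_def rhom_sum rhom_mult)

lemma mmap_1: "rhom f ==> mmap f (mat 1) = mat 1"
 by (simp add: vec_eq_iff mat_def rhomD)

lemma mmap_det: "rhom f ==> det (mmap f g) = f (det g)"
 by (simp add: det_2 rhomD)

text \<open>Polynomials in the matrix entries are kept as expressions: one and the same polynomial
  can then be evaluated over every ring reached from k and differentiated by recursion. Different
  expressions may have the same values, so the statements speak of values only.\<close>

datatype 'k pexp = PC 'k | PV 2 2 | PA "'k pexp" "'k pexp" | PM "'k pexp" "'k pexp"

primrec pev :: "('k => 'r) => 'k pexp => 'r^2^2 => 'r::comm_ring_1" where
 "pev \<iota> (PC c) g = \<iota> c"
| "pev \<iota> (PV i j) g = g $ i $ j"
| "pev \<iota> (PA a b) g = pev \<iota> a g + pev \<iota> b g"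
| "pev \<iota> (PM a b) g = pev \<iota> a g * pev \<iota> b g"

primrec pdv :: "('k => 'r) => 'k pexp => 'r^2^2 => 'r^2^2 => 'r::comm_ring_1" where
 "pdv \<iota> (PC c) g X = 0"
| "pdv \<iota> (PV i j) g X = X $ i $ j"
| "pdv \<iota> (PA a b) g X = pdv \<iota> a g X + pdv \<iota> b g X"
| "pdv \<iota> (PM a b) g X = pdv \<iota> a g X * pev \<iota> b g + pev \<iota> a g * pdv \<iota> b g X"

abbreviation "pev0 == pev (%c. c)"

type_synonym ('i, 'k) qmat = "'i => 'i => 'k pexp"

lemma pev_map: "rhom \<sigma> ==> \<sigma> (pev \<iota> e g) = pev (%c. \<sigma> (\<iota> c)) e (mmap \<sigma> g)"
 by (induction e) (simp_all add: rhomD)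

lemma pdv_map: "rhom \<sigma> ==> \<sigma> (pdv \<iota> e g X) = pdv (%c. \<sigma> (\<iota> c)) e (mmap \<sigma> g) (mmap \<sigma> X)"
 by (induction e) (simp_all add: rhomD pev_map)

lemma pev_fps_nth_0:
 "fps_nth (pev (%c. fps_const (\<iota> c)) e G) 0 = pev \<iota> e (mmap (%f. fps_nth f 0) G)"
 by (induction e) simp_all

text \<open>First-order Taylor expansion: the coefficient of t at G_0 + t G_1 + ... is the
  directional derivative at G_0 along G_1.\<close>

lemma pev_fps_nth_1:
 "fps_nth (pev (%c. fps_const (\<iota> c)) e G) (Suc 0)
  = pdv \<iota> e (mmap (%f. fps_nth f 0) G) (mmap (%f. fps_nth f 1) G)"
 by (induction e) (simp_all add: fps_mult_nth_1[simplified] pev_fps_nth_0)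

lemma pdv_add: "pdv \<iota> e g (X + Y) = pdv \<iota> e g X + pdv \<iota> e g Y"
 by (induction e) (simp_all add: algebra_simps)

lemma pdv_diff: "pdv \<iota> e g (X - Y) = pdv \<iota> e g X - pdv \<iota> e g Y"
 using pdv_add[of \<iota> e g "X - Y" Y] by simp

lemma pdv_smult: "pdv \<iota> e g (\<chi> i j. a * X $ i $ j) = a * pdv \<iota> e g X"
 by (induction e) (simp_all add: algebra_simps)

lemma pdv_chain:
 assumes "!!f g. D (f + g) = D f + D g" "!!f g. D (f * g) = D f * g + f * D g" "!!c. D (\<iota> c) = 0"
 shows "D (pev \<iota> e g) = pdv \<iota> e g (mmap D g)"
 by (induction e) (simp_all add: assms)

text \<open>Coefficients are taken in the ring itself, not in k, so that fixing one of several
  matrices in an identity still leaves a polynomial function of the others.\<close>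

inductive polyfun :: "('r::comm_ring_1^2^2 => 'r) => bool" where
 pf_const: "polyfun (%g. c)"
| pf_entry: "polyfun (%g. g $ i $ j)"
| pf_add: "polyfun f ==> polyfun f' ==> polyfun (%g. f g + f' g)"
| pf_mult: "polyfun f ==> polyfun f' ==> polyfun (%g. f g * f' g)"

lemma pf_minus: "polyfun f ==> polyfun (%g. - f g)"
 using pf_mult[OF pf_const[of "- 1"]] by fastforce

lemma pf_diff: "polyfun f ==> polyfun f' ==> polyfun (%g. f g - f' g)"
 using pf_add[OF _ pf_minus] by fastforce

lemma pf_sum: "(!!a. a \<in> A ==> polyfun (f a)) ==> polyfun (%g. \<Sum>a\<in>A. f a g)"
 by (induction A rule: infinite_finite_induct) (auto intro: pf_const pf_add)

lemma pf_power: "polyfun f ==> polyfun (%g. f g ^ n)"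
 by (induction n) (auto intro: pf_const pf_mult)

lemma pf_pev: "(!!i j. polyfun (%g. F g $ i $ j)) ==> polyfun (%g. pev \<iota> e (F g))"
 by (induction e) (auto intro: pf_const pf_add pf_mult)

lemma pf_det: "polyfun det"
 unfolding det_2[abs_def] by (intro pf_diff pf_mult pf_entry)

lemma pf_times_left: "polyfun (%g. (h ** g) $ i $ j)" and pf_times_right: "polyfun (%g. (g ** h) $ i $ j)"
 unfolding matrix_matrix_mult_def by (simp_all add: pf_sum pf_mult pf_const pf_entry)

lemma polyfun_curve:
 "polyfun f ==> \<exists>p. \<forall>x. f (mmap (%p. poly p x) G) = poly p x"
proof (induction rule: polyfun.induct)
 case (pf_const c)
 show ?case by (rule exI[of _ "[:c:]"]) simp
next
 case (pf_entry i j)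
 show ?case by (rule exI[of _ "G $ i $ j"]) simp
next
 case (pf_add f f')
 thus ?case by (metis poly_add)
next
 case (pf_mult f f')
 thus ?case by (metis poly_mult)
qed

lemma poly_eq_0_infinite:
 fixes p :: "'r::idom poly"
 assumes "infinite X" "!!x. x \<in> X ==> poly p x = 0"
 shows "p = 0"
 using assms poly_roots_finite[of p] by (metis (mono_tags, lifting) finite_subset mem_Collect_eq subsetI)

definition mk22 :: "'a => 'a => 'a => 'a => 'a^2^2"
 where "mk22 a b c d = (\<chi> i j. if i = 1 then (if j = 1 then a else b) else (if j = 1 then c else d))"

lemma mk22_eq: "\<exists>a b c d. g = mk22 a b c d"
 by (rule exI[of _ "g$1$1"], rule exI[of _ "g$1$2"], rule exI[of _ "g$2$1"], rule exI[of _ "g$2$2"])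
   (use two_cases in \<open>auto simp: mk22_def vec_eq_iff\<close>)

lemma mmap_mk22: "mmap f (mk22 a b c d) = mk22 (f a) (f b) (f c) (f d)"
 by (simp add: vec_eq_iff mk22_def)

text \<open>Zariski density of the invertible matrices over k, proved by restricting to lines: a
  univariate polynomial over a domain with infinitely many zeros vanishes.\<close>

lemma polyfun_eq_0:
 fixes f :: "'r::idom^2^2 => 'r" and \<iota> :: "'k::field_char_0 => 'r"
 assumes f: "polyfun f" and \<iota>: "rhom \<iota>" and 0: "!!g. invertible g ==> f (mmap \<iota> g) = 0"
 shows "f g = 0"
proof -
 have inf: "infinite (UNIV :: 'k set)" by (rule infinite_UNIV_char_0)
 have curve: "f (mmap (%p. poly p x) G) = 0"
  if "infinite X" "!!c. c \<in> X ==> f (mmap (%p. poly p (\<iota> c)) G) = 0" for G x and X :: "'k set"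
 proof -
  obtain p where p: "!!x. f (mmap (%p. poly p x) G) = poly p x" using polyfun_curve[OF f] by blast
  have "infinite (\<iota> ` X)" using that(1) rhom_inj[OF \<iota>] by (metis finite_imageD inj_on_subset subset_UNIV)
  hence "p = 0" by (rule poly_eq_0_infinite) (use that(2) p in auto)
  thus ?thesis by (simp add: p)
 qed
 have 1: "f (mmap \<iota> g) = 0" for g
 proof -
  \<comment> \<open>The line g + c 1. Its determinant is monic of degree two in c, so only finitely
    many points are not invertible, and c = 0 gives back g.\<close>
  let ?G = "mk22 [:\<iota> (g$1$1), 1:] [:\<iota> (g$1$2):] [:\<iota> (g$2$1):] [:\<iota> (g$2$2), 1:]"
  let ?g = "%c. mk22 (g$1$1 + c) (g$1$2) (g$2$1) (g$2$2 + c)"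
  have "det (?g c) = poly [:det g, g$1$1 + g$2$2, 1:] c" for c
   by (simp add: det_2 mk22_def algebra_simps)
  hence "{c. det (?g c) = 0} = {c. poly [:det g, g$1$1 + g$2$2, 1:] c = 0}" by (simp only:)
  moreover have "finite {c. poly [:det g, g$1$1 + g$2$2, 1:] c = 0}"
   by (rule poly_roots_finite) simp
  ultimately have "infinite (UNIV - {c. det (?g c) = 0})"
   using inf by (intro Diff_infinite_finite) simp_all
  hence "infinite {c. det (?g c) \<noteq> 0}" by (simp add: set_diff_eq)
  hence "f (mmap (%p. poly p 0) ?G) = 0"
  proof (rule curve)
   fix c assume "c \<in> {c. det (?g c) \<noteq> 0}"
   hence "f (mmap \<iota> (?g c)) = 0" by (intro 0) (simp add: invertible_det_nz)
   thus "f (mmap (%p. poly p (\<iota> c)) ?G) = 0" by (simp add: mmap_mk22 rhom_add[OF \<iota>])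
  qed
  moreover have "mmap (%p. poly p 0) ?G = mmap \<iota> g"
   using two_cases by (auto simp: vec_eq_iff mk22_def)
  ultimately show ?thesis by simp
 qed
 \<comment> \<open>The four entries are released from the image of k one after the other, each along
   the line on which it is the variable.\<close>
 obtain a b c d where g: "g = mk22 a b c d" using mk22_eq[of g] by blast
 have 2: "f (mk22 (\<iota> a) (\<iota> b) (\<iota> c) (\<iota> d)) = 0" for a b c d
  using 1[of "mk22 a b c d"] by (simp add: mmap_mk22)
 have 3: "f (mk22 a (\<iota> b) (\<iota> c) (\<iota> d)) = 0" for a b c d
  using curve[OF inf, of "mk22 [:0, 1:] [:\<iota> b:] [:\<iota> c:] [:\<iota> d:]" a] 2 by (simp add: mmap_mk22)
 have 4: "f (mk22 a b (\<iota> c) (\<iota> d)) = 0" for a b c d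
  using curve[OF inf, of "mk22 [:a:] [:0, 1:] [:\<iota> c:] [:\<iota> d:]" b] 3 by (simp add: mmap_mk22)
 have 5: "f (mk22 a b c (\<iota> d)) = 0" for a b c d
  using curve[OF inf, of "mk22 [:a:] [:b:] [:0, 1:] [:\<iota> d:]" c] 4 by (simp add: mmap_mk22)
 show ?thesis
  unfolding g using curve[OF inf, of "mk22 [:a:] [:b:] [:c:] [:0, 1:]" d] 5 by (simp add: mmap_mk22)
qed

subsection \<open>Representations in coordinates\<close>

definition mm :: "'l set => ('i => 'l => 'r::comm_ring_1) => ('l => 'j => 'r) => 'i => 'j => 'r"
 where "mm L A B i j = (\<Sum>l\<in>L. A i l * B l j)"

lemma mm_assoc: "mm K (mm L A B) C i j = mm L A (mm K B C) i j"
 unfolding mm_def sum_distrib_left sum_distrib_right by (subst sum.swap) (simp add: mult.assoc)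

lemma mm_cong:
 "[|!!l. l \<in> L ==> A i l = A' i l; !!l. l \<in> L ==> B l j = B' l j|] ==> mm L A B i j = mm L A' B' i j"
 by (simp add: mm_def)

lemma mm_map: "rhom f ==> f (mm L A B i j) = mm L (%i j. f (A i j)) (%i j. f (B i j)) i j"
 by (simp add: mm_def rhom_sum rhom_mult)

text \<open>
 A representation in coordinates is a matrix \<open>q\<close> of polynomials in the matrix entries, multiplicative
 on \<open>GL\<^sub>2\<close>, together with a power \<open>n\<close> of the inverse determinant. It is not required that \<open>q 1 = 1\<close>:
 the underlying space is the image of the idempotent \<open>q 1\<close>, so that subrepresentations and quotients
 do not require a choice of bases.
\<close>

definition polyrep :: "'i set => ('i, 'k::field_char_0) qmat => bool"
 where "polyrep I q \<longleftrightarrow> finite I \<and> (\<forall>g h. invertible g --> invertible h --> (\<forall>i\<in>I. \<forall>j\<in>I.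
  mm I (%i j. pev0 (q i j) g) (%i j. pev0 (q i j) h) i j = pev0 (q i j) (g ** h)))"

text \<open>Density applied to each factor in turn. The conclusion covers matrices that are not
  invertible, which is used at the zero matrix when derivatives at the origin are taken.\<close>

lemma polyrep_mult:
 fixes \<iota> :: "'k::field_char_0 => 'r::idom"
 assumes q: "polyrep I q" and \<iota>: "rhom \<iota>" and ij: "i \<in> I" "j \<in> I"
 shows "mm I (%i j. pev \<iota> (q i j) G) (%i j. pev \<iota> (q i j) H) i j = pev \<iota> (q i j) (G ** H)"
proof -
 let ?f = "%G H. mm I (%i j. pev \<iota> (q i j) G) (%i j. pev \<iota> (q i j) H) i j - pev \<iota> (q i j) (G ** H)"
 have 1: "?f (mmap \<iota> g) (mmap \<iota> h) = 0" if "invertible g" "invertible h" for g h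
 proof -
  have "?f (mmap \<iota> g) (mmap \<iota> h) = \<iota> (mm I (%i j. pev0 (q i j) g) (%i j. pev0 (q i j) h) i j
    - pev0 (q i j) (g ** h))"
   by (simp add: rhom_diff[OF \<iota>] mm_map[OF \<iota>] pev_map[OF \<iota>] mmap_mult[OF \<iota>])
  also have "... = 0" using q that ij by (simp add: polyrep_def rhom_0[OF \<iota>])
  finally show ?thesis .
 qed
 have 2: "?f G (mmap \<iota> h) = 0" if "invertible h" for h
 proof (rule polyfun_eq_0[OF _ \<iota>, where f = "%G. ?f G (mmap \<iota> h)"])
  show "polyfun (%G. ?f G (mmap \<iota> h))"
   unfolding mm_def by (intro pf_diff pf_sum pf_mult pf_pev pf_entry pf_const pf_times_right)
 qed (rule 1[OF _ that])
 have "?f G H = 0"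
 proof (rule polyfun_eq_0[OF _ \<iota>, where f = "%H. ?f G H"])
  show "polyfun (%H. ?f G H)"
   unfolding mm_def by (intro pf_diff pf_sum pf_mult pf_pev pf_entry pf_const pf_times_left)
 qed (rule 2)
 thus ?thesis by simp
qed

text \<open>The point g + t X over power series rather than dual numbers, since
  \<open>polyrep_mult\<close> requires a domain; only the coefficients of 1 and t are ever
  inspected.\<close>

definition jet :: "'r^2^2 => 'r^2^2 => 'r::comm_ring_1 fps^2^2"
 where "jet g X = (\<chi> i j. fps_const (g $ i $ j) + fps_X * fps_const (X $ i $ j))"

lemma jet_nth_0 [simp]: "mmap (%f. fps_nth f 0) (jet g X) = g"
 and jet_nth_1 [simp]: "mmap (%f. fps_nth f (Suc 0)) (jet g X) = X"
 by (simp_all add: jet_def vec_eq_iff)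

lemma const_nth [simp]: "mmap (%f. fps_nth f 0) (mmap fps_const g) = g"
 "mmap (%f. fps_nth f (Suc 0)) (mmap fps_const g) = 0"
 by (simp_all add: vec_eq_iff)

lemma jet_mult_nth_0: "mmap (%f. fps_nth f 0) ((G :: 'r::comm_ring_1 fps^2^2) ** H)
  = mmap (%f. fps_nth f 0) G ** mmap (%f. fps_nth f 0) H"
 by (rule mmap_mult) simp

lemma jet_mult_nth_1: "mmap (%f. fps_nth f (Suc 0)) (G ** H)
  = mmap (%f. fps_nth f (Suc 0)) G ** mmap (%f. fps_nth f 0) H
   + mmap (%f. fps_nth f 0) G ** mmap (%f. fps_nth f (Suc 0)) H"
 by (simp add: vec_eq_iff matrix_matrix_mult_def fps_sum_nth fps_mult_nth_1[simplified] sum.distrib add.commute)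

text \<open>Coefficient of t in q(1 + t X) q(G) = q(G + t X G).\<close>

lemma polyrep_pdv_left:
 fixes \<iota> :: "'k::field_char_0 => 'r::idom"
 assumes q: "polyrep I q" and \<iota>: "rhom \<iota>" and ij: "i \<in> I" "j \<in> I"
 shows "mm I (%i j. pdv \<iota> (q i j) (mat 1) X) (%i j. pev \<iota> (q i j) G) i j = pdv \<iota> (q i j) G (X ** G)"
proof -
 have 0: "pdv \<iota> e g 0 = 0" for e g using pdv_diff[of \<iota> e g 0 0] by simp
 have "rhom (%c. fps_const (\<iota> c))" by (rule rhom_comp[OF rhom_fps_const \<iota>])
 from polyrep_mult[OF q this ij, of "jet (mat 1) X" "mmap fps_const G"]
 have "fps_nth (mm I (%i j. pev (%c. fps_const (\<iota> c)) (q i j) (jet (mat 1) X))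
   (%i j. pev (%c. fps_const (\<iota> c)) (q i j) (mmap fps_const G)) i j) (Suc 0)
  = fps_nth (pev (%c. fps_const (\<iota> c)) (q i j) (jet (mat 1) X ** mmap fps_const G)) (Suc 0)" by simp
 thus ?thesis
  by (simp add: mm_def fps_sum_nth fps_mult_nth_1[simplified] pev_fps_nth_0 pev_fps_nth_1 jet_mult_nth_0 jet_mult_nth_1 0)
qed

lemma polyrep_pdv_right:
 fixes \<iota> :: "'k::field_char_0 => 'r::idom"
 assumes q: "polyrep I q" and \<iota>: "rhom \<iota>" and ij: "i \<in> I" "j \<in> I"
 shows "mm I (%i j. pev \<iota> (q i j) G) (%i j. pdv \<iota> (q i j) (mat 1) X) i j = pdv \<iota> (q i j) G (G ** X)"
proof -
 have 0: "pdv \<iota> e g 0 = 0" for e g using pdv_diff[of \<iota> e g 0 0] by simp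
 have "rhom (%c. fps_const (\<iota> c))" by (rule rhom_comp[OF rhom_fps_const \<iota>])
 from polyrep_mult[OF q this ij, of "mmap fps_const G" "jet (mat 1) X"]
 have "fps_nth (mm I (%i j. pev (%c. fps_const (\<iota> c)) (q i j) (mmap fps_const G))
   (%i j. pev (%c. fps_const (\<iota> c)) (q i j) (jet (mat 1) X)) i j) (Suc 0)
  = fps_nth (pev (%c. fps_const (\<iota> c)) (q i j) (mmap fps_const G ** jet (mat 1) X)) (Suc 0)" by simp
 thus ?thesis
  by (simp add: mm_def fps_sum_nth fps_mult_nth_1[simplified] pev_fps_nth_0 pev_fps_nth_1 jet_mult_nth_0 jet_mult_nth_1 0)
qed

text \<open>The coefficient of \<open>t\<close> in \<open>q(g) dq(X) - dq(X) q(g)\<close> at \<open>g = 1 + t Y\<close>.\<close>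

lemma polyrep_pdv_lie:
 fixes \<iota> :: "'k::field_char_0 => 'r::idom"
 assumes q: "polyrep I q" and \<iota>: "rhom \<iota>" and ij: "i \<in> I" "j \<in> I"
 defines "dq == %X i j. pdv \<iota> (q i j) (mat 1) X"
 shows "mm I (dq Y) (dq X) i j - mm I (dq X) (dq Y) i j = dq (Y ** X - X ** Y) i j"
proof -
 let ?\<iota> = "%c. fps_const (\<iota> c)" and ?X = "mmap fps_const X" and ?G = "jet (mat 1) Y"
 have h: "rhom ?\<iota>" by (rule rhom_comp[OF rhom_fps_const \<iota>])
 have X: "pdv ?\<iota> (q i j) (mat 1) ?X = fps_const (dq X i j)" for i j
  by (simp add: dq_def pdv_map[OF rhom_fps_const] mmap_1)
 \<comment> \<open>(1 + t Y) X - X (1 + t Y) = t (Y X - X Y), so by linearity in the direction its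
   coefficient of t only involves the derivative at 1.\<close>
 have comm: "?G ** ?X - ?X ** ?G = (\<chi> i j. fps_X * mmap fps_const (Y ** X - X ** Y) $ i $ j)"
  by (simp add: vec_eq_iff jet_def matrix_matrix_mult_def mat_def sum_2 fps_eq_iff algebra_simps)
    (use two_cases in \<open>auto simp: algebra_simps\<close>)
 have "fps_nth (pdv ?\<iota> (q i j) ?G (?G ** ?X - ?X ** ?G)) (Suc 0)
   = fps_nth (mm I (%i j. pev ?\<iota> (q i j) ?G) (%i j. pdv ?\<iota> (q i j) (mat 1) ?X) i j
    - mm I (%i j. pdv ?\<iota> (q i j) (mat 1) ?X) (%i j. pev ?\<iota> (q i j) ?G) i j) (Suc 0)"
  unfolding pdv_diff polyrep_pdv_left[OF q h ij] polyrep_pdv_right[OF q h ij] ..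
 also have "... = mm I (dq Y) (dq X) i j - mm I (dq X) (dq Y) i j"
  unfolding X by (simp add: mm_def fps_sum_nth pev_fps_nth_1) (simp add: dq_def)
 also have "fps_nth (pdv ?\<iota> (q i j) ?G (?G ** ?X - ?X ** ?G)) (Suc 0) = dq (Y ** X - X ** Y) i j"
  unfolding comm pdv_smult by (simp add: dq_def pdv_map[OF rhom_fps_nth_0])
 finally show ?thesis by simp
qed

definition rho :: "('k => 'f::field) => ('i, 'k) qmat => nat => 'f^2^2 => 'i => 'i => 'f"
 where "rho \<iota> q n g i j = pev \<iota> (q i j) g / det g ^ n"

text \<open>The derivative of q / det^n at the identity, by the quotient rule and because the
  derivative of det there is the trace. The last factor is q(1), which need not be the identity
  matrix.\<close>

definition drho :: "('k => 'f::comm_ring_1) => ('i, 'k) qmat => nat => 'f^2^2 => 'i => 'i => 'f"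
 where "drho \<iota> q n X i j = pdv \<iota> (q i j) (mat 1) X - of_nat n * trace X * pev \<iota> (q i j) (mat 1)"

abbreviation "rho0 == rho (%c. c)"
abbreviation "drho0 == drho (%c. c)"

lemma rho_1: "rho \<iota> q n (mat 1) i j = pev \<iota> (q i j) (mat 1)"
 by (simp add: rho_def)

lemma rho_map: "rhom \<sigma> ==> \<sigma> (rho \<iota> q n g i j) = rho (%c. \<sigma> (\<iota> c)) q n (mmap \<sigma> g) i j"
 by (simp add: rho_def rhom_divide rhom_power pev_map mmap_det)

lemma trace_2: "trace (X :: 'a::semiring_1^2^2) = X $ 1 $ 1 + X $ 2 $ 2"
 by (simp add: trace_def sum_2)

lemma drho_map: "rhom \<sigma> ==> \<sigma> (drho \<iota> q n X i j) = drho (%c. \<sigma> (\<iota> c)) q n (mmap \<sigma> X) i j"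
 by (simp add: drho_def rhomD pdv_map pev_map mmap_1 trace_2)

lemma drho_add: "drho \<iota> q n (X + Y) i j = drho \<iota> q n X i j + drho \<iota> q n Y i j"
 by (simp add: drho_def pdv_add trace_add algebra_simps)

lemma drho_smult: "drho \<iota> q n (\<chi> i j. a * X $ i $ j) k l = a * drho \<iota> q n X k l"
 by (simp add: drho_def pdv_smult trace_2 algebra_simps)

definition munit :: "2 => 2 => 'r::comm_ring_1^2^2"
 where "munit p i = (\<chi> r c. if r = p \<and> c = i then 1 else 0)"

lemma mat_unit_eq: "mat_unit = munit"
 by (simp add: fun_eq_iff mat_unit_def munit_def)

lemma mmap_munit: "rhom f ==> mmap f (munit p i) = munit p i"
 by (simp add: vec_eq_iff munit_def rhomD)

lemma drho_expand: "drho \<iota> q n X k l = (\<Sum>p\<in>UNIV. \<Sum>i\<in>UNIV. X $ p $ i * drho \<iota> q n (munit p i) k l)"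
proof -
 have "X = (\<chi> r c. X$1$1 * munit 1 1 $ r $ c) + (\<chi> r c. X$1$2 * munit 1 2 $ r $ c)
   + (\<chi> r c. X$2$1 * munit 2 1 $ r $ c) + (\<chi> r c. X$2$2 * munit 2 2 $ r $ c)"
  using two_cases by (auto simp: vec_eq_iff munit_def)
 hence "drho \<iota> q n X k l = drho \<iota> q n ((\<chi> r c. X$1$1 * munit 1 1 $ r $ c) + (\<chi> r c. X$1$2 * munit 1 2 $ r $ c)
   + (\<chi> r c. X$2$1 * munit 2 1 $ r $ c) + (\<chi> r c. X$2$2 * munit 2 2 $ r $ c)) k l" by simp
 thus ?thesis by (simp add: drho_add drho_smult sum_2)
qed

context
 fixes I :: "'i set" and q :: "('i, 'k::field_char_0) qmat" and n :: nat and \<iota> :: "'k => 'f::field"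
 assumes q: "polyrep I q" and \<iota>: "rhom \<iota>"
begin

lemma rho_mult:
 assumes "i \<in> I" "j \<in> I"
 shows "mm I (rho \<iota> q n G) (rho \<iota> q n H) i j = rho \<iota> q n (G ** H) i j"
proof -
 have "mm I (rho \<iota> q n G) (rho \<iota> q n H) i j
   = mm I (%i j. pev \<iota> (q i j) G) (%i j. pev \<iota> (q i j) H) i j / (det G ^ n * det H ^ n)"
  by (simp add: mm_def rho_def sum_divide_distrib)
 thus ?thesis by (simp add: polyrep_mult[OF q \<iota> assms] rho_def det_mul power_mult_distrib)
qed

lemma drho_rho:
 assumes "i \<in> I" "j \<in> I"
 shows "mm I (drho \<iota> q n X) (rho \<iota> q n G) i j
  = (pdv \<iota> (q i j) G (X ** G) - of_nat n * trace X * pev \<iota> (q i j) G) / det G ^ n"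
proof -
 have "mm I (drho \<iota> q n X) (rho \<iota> q n G) i j
   = (mm I (%i j. pdv \<iota> (q i j) (mat 1) X) (%i j. pev \<iota> (q i j) G) i j
    - of_nat n * trace X * mm I (%i j. pev \<iota> (q i j) (mat 1)) (%i j. pev \<iota> (q i j) G) i j) / det G ^ n"
  by (simp add: mm_def drho_def rho_def sum_divide_distrib sum_distrib_left left_diff_distrib sum_subtractf mult.assoc diff_divide_distrib)
 thus ?thesis by (simp add: polyrep_pdv_left[OF q \<iota> assms] polyrep_mult[OF q \<iota> assms])
qed

lemma rho_drho:
 assumes "i \<in> I" "j \<in> I"
 shows "mm I (rho \<iota> q n G) (drho \<iota> q n X) i j
  = (pdv \<iota> (q i j) G (G ** X) - of_nat n * trace X * pev \<iota> (q i j) G) / det G ^ n"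
proof -
 have "mm I (rho \<iota> q n G) (drho \<iota> q n X) i j
   = (mm I (%i j. pev \<iota> (q i j) G) (%i j. pdv \<iota> (q i j) (mat 1) X) i j
    - of_nat n * trace X * mm I (%i j. pev \<iota> (q i j) G) (%i j. pev \<iota> (q i j) (mat 1)) i j) / det G ^ n"
  by (simp add: mm_def drho_def rho_def sum_divide_distrib sum_distrib_left right_diff_distrib sum_subtractf mult.assoc
    mult.left_commute diff_divide_distrib)
 thus ?thesis by (simp add: polyrep_pdv_right[OF q \<iota> assms] polyrep_mult[OF q \<iota> assms])
qed

lemma rho_1_drho: "[|i \<in> I; j \<in> I|] ==> mm I (rho \<iota> q n (mat 1)) (drho \<iota> q n X) i j = drho \<iota> q n X i j"
 and drho_rho_1: "[|i \<in> I; j \<in> I|] ==> mm I (drho \<iota> q n X) (rho \<iota> q n (mat 1)) i j = drho \<iota> q n X i j"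
 by (simp_all add: rho_drho drho_rho) (simp_all add: drho_def)

text \<open>Chain rule for a derivation D that kills k. If D G = X G then D(det G) = trace X det G,
  and the polynomial part has derivative \<open>pdv\<close> along X G, which \<open>drho_rho\<close>
  rewrites as a product.\<close>

lemma rho_der:
 assumes D: "!!f g. D (f + g) = D f + D g" "!!f g. D (f * g) = D f * g + f * D g" "!!c. D (\<iota> c) = 0"
  and G: "det G \<noteq> 0" and DG: "mmap D G = X ** G" and ij: "i \<in> I" "j \<in> I"
 shows "D (rho \<iota> q n G i j) = mm I (drho \<iota> q n X) (rho \<iota> q n G) i j"
proof -
 have DG': "D (G $ i $ j) = (X ** G) $ i $ j" for i j using arg_cong[OF DG, of "%A. A $ i $ j"] by simp
 have Dminus: "D (- f) = - D f" for f
  using D(1)[of f "- f"] D(3)[of 0] by (simp add: rhom_0[OF \<iota>] eq_neg_iff_add_eq_0 add.commute)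
 have Ddet: "D (det G) = trace X * det G"
  by (simp only: det_2 trace_2 diff_conv_add_uminus D Dminus DG' matrix_matrix_mult_def sum_2) (simp add: sum_2 algebra_simps)
 have Dpow: "D (det G ^ n) = of_nat n * trace X * det G ^ n" for n
  using D(3)[of 1] by (induction n) (simp_all add: rhom_1[OF \<iota>] D Ddet algebra_simps)
 have "D (pev \<iota> (q i j) G) = D (rho \<iota> q n G i j * det G ^ n)"
  using G by (simp add: rho_def)
 also have "... = D (rho \<iota> q n G i j) * det G ^ n + of_nat n * trace X * pev \<iota> (q i j) G"
  using G by (simp only: D Dpow) (simp add: rho_def)
 finally have "D (rho \<iota> q n G i j) * det G ^ n = pdv \<iota> (q i j) G (X ** G) - of_nat n * trace X * pev \<iota> (q i j) G"
  using pdv_chain[OF D, where e = "q i j" and g = G] by (simp add: DG)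
 thus ?thesis unfolding drho_rho[OF ij] using G by (simp add: nonzero_eq_divide_eq)
qed

text \<open>Both products are derivatives at G along the same direction G X = Y G. The correction by
  the determinant also needs trace X = trace Y, which holds because G is invertible.\<close>

lemma rho_drho_conj:
 assumes G: "det G \<noteq> 0" and X: "G ** X = Y ** G" and ij: "i \<in> I" "j \<in> I"
 shows "mm I (rho \<iota> q n G) (drho \<iota> q n X) i j = mm I (drho \<iota> q n Y) (rho \<iota> q n G) i j"
proof -
 have eq: "(G ** X) $ i $ j = (Y ** G) $ i $ j" for i j using X by simp
 have eq': "G$i$1 * X$1$j + G$i$2 * X$2$j = Y$i$1 * G$1$j + Y$i$2 * G$2$j" for i j
  using eq[of i j] by (simp add: matrix_matrix_mult_def sum_2)
 \<comment> \<open>Expressed through the entries of G X alone, so that those of Y G can be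
   substituted.\<close>
 have "det G * trace X = G$2$2 * (G$1$1 * X$1$1 + G$1$2 * X$2$1) - G$1$2 * (G$2$1 * X$1$1 + G$2$2 * X$2$1)
   + G$1$1 * (G$2$1 * X$1$2 + G$2$2 * X$2$2) - G$2$1 * (G$1$1 * X$1$2 + G$1$2 * X$2$2)"
  by (simp add: det_2 trace_2 algebra_simps)
 also have "... = det G * trace Y"
  unfolding eq' by (simp add: det_2 trace_2 algebra_simps)
 finally have "trace X = trace Y" using G by simp
 thus ?thesis by (simp add: rho_drho[OF ij] drho_rho[OF ij] X)
qed

text \<open>The trace terms of the twist by det^n are multiples of q(1), hence cancel in the
  commutator, and the trace of a commutator is zero.\<close>

lemma drho_lie:
 assumes ij: "i \<in> I" "j \<in> I"
 shows "mm I (drho \<iota> q n Y) (drho \<iota> q n X) i j - mm I (drho \<iota> q n X) (drho \<iota> q n Y) i j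
  = drho \<iota> q n (Y ** X - X ** Y) i j"
proof -
 let ?d = "%X i j. pdv \<iota> (q i j) (mat 1) X" and ?e = "%i j. pev \<iota> (q i j) (mat 1)"
 have exp: "mm I (drho \<iota> q n Y) (drho \<iota> q n X) i j = mm I (?d Y) (?d X) i j
   - of_nat n * trace X * ?d Y i j - of_nat n * trace Y * ?d X i j + of_nat n * trace X * of_nat n * trace Y * ?e i j" for X Y
 proof -
  have "mm I (drho \<iota> q n Y) (drho \<iota> q n X) i j = mm I (?d Y) (?d X) i j
   - of_nat n * trace X * mm I (?d Y) ?e i j - of_nat n * trace Y * mm I ?e (?d X) i j
   + of_nat n * trace X * of_nat n * trace Y * mm I ?e ?e i j"
   by (simp add: mm_def drho_def sum_distrib_left algebra_simps sum.distrib sum_subtractf)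
  thus ?thesis
   by (simp add: polyrep_pdv_left[OF q \<iota> ij] polyrep_pdv_right[OF q \<iota> ij] polyrep_mult[OF q \<iota> ij])
 qed
 have tr: "trace (Y ** X - X ** Y) = 0" by (simp add: trace_2 matrix_matrix_mult_def sum_2 algebra_simps)
 show ?thesis unfolding exp unfolding drho_def tr polyrep_pdv_lie[OF q \<iota> ij, symmetric] by (simp add: algebra_simps)
qed

end

subsection \<open>Equivariant matrices\<close>

text \<open>T is not normalized: T and T \<rho>(1) induce the same map between the modules.
  Uniqueness of T is therefore only claimed under the condition T \<rho>(1) = T.\<close>

definition equivariant :: "'i set => ('i, 'k::field_char_0) qmat => nat =>
  'j set => ('j, 'k) qmat => nat => ('j => 'i => 'k) => bool"
 where "equivariant I q n J q' n' T \<longleftrightarrow> (\<forall>g. invertible g --> (\<forall>j\<in>J. \<forall>i\<in>I.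
  mm I T (rho0 q n g) j i = mm J (rho0 q' n' g) T j i))"

text \<open>With the determinants cleared the condition is polynomial in G, so density extends it
  from invertible matrices over k to all matrices over a domain.\<close>

lemma equivariant_pev:
 fixes \<iota> :: "'k::field_char_0 => 'r::idom"
 assumes T: "equivariant I q n J q' n' T" and \<iota>: "rhom \<iota>" and ij: "j \<in> J" "i \<in> I"
 shows "det G ^ n' * mm I (%j i. \<iota> (T j i)) (%i j. pev \<iota> (q i j) G) j i
  = det G ^ n * mm J (%i j. pev \<iota> (q' i j) G) (%j i. \<iota> (T j i)) j i"
proof -
 let ?f = "%G. det G ^ n' * mm I (%j i. \<iota> (T j i)) (%i j. pev \<iota> (q i j) G) j i
  - det G ^ n * mm J (%i j. pev \<iota> (q' i j) G) (%j i. \<iota> (T j i)) j i"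
 have "?f G = 0"
 proof (rule polyfun_eq_0[OF _ \<iota>, where f = ?f])
  show "polyfun ?f"
   unfolding mm_def by (intro pf_diff pf_sum pf_mult pf_pev pf_entry pf_const pf_power pf_det)
  fix g :: "'k^2^2" assume g: "invertible g"
  hence d: "det g \<noteq> 0" by (simp add: invertible_det_nz)
  have "mm I T (rho0 q n g) j i = mm J (rho0 q' n' g) T j i"
   using T g ij by (simp add: equivariant_def)
  hence "mm I T (%i j. pev0 (q i j) g) j i / det g ^ n = mm J (%i j. pev0 (q' i j) g) T j i / det g ^ n'"
   by (simp add: mm_def rho_def sum_divide_distrib)
  hence "\<iota> (det g ^ n' * mm I T (%i j. pev0 (q i j) g) j i
    - det g ^ n * mm J (%i j. pev0 (q' i j) g) T j i) = 0"
   using d by (simp add: frac_eq_eq rhomD[OF \<iota>] mult.commute)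
  thus "?f (mmap \<iota> g) = 0"
   by (simp add: rhomD[OF \<iota>] mm_map[OF \<iota>] pev_map[OF \<iota>] mmap_det[OF \<iota>])
 qed
 thus ?thesis by simp
qed

lemma equivariant_rho:
 fixes \<iota> :: "'k::field_char_0 => 'f::field"
 assumes T: "equivariant I q n J q' n' T" and \<iota>: "rhom \<iota>" and ij: "j \<in> J" "i \<in> I" and G: "det G \<noteq> 0"
 shows "mm I (%j i. \<iota> (T j i)) (rho \<iota> q n G) j i = mm J (rho \<iota> q' n' G) (%j i. \<iota> (T j i)) j i"
proof -
 have "mm I (%j i. \<iota> (T j i)) (rho \<iota> q n G) j i = mm I (%j i. \<iota> (T j i)) (%i j. pev \<iota> (q i j) G) j i / det G ^ n"
  "mm J (rho \<iota> q' n' G) (%j i. \<iota> (T j i)) j i = mm J (%i j. pev \<iota> (q' i j) G) (%j i. \<iota> (T j i)) j i / det G ^ n'"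
  by (simp_all add: mm_def rho_def sum_divide_distrib)
 thus ?thesis using equivariant_pev[OF T \<iota> ij, of G] G by (simp add: frac_eq_eq mult.commute)
qed

lemma fps_power_nth: "fps_nth f 0 = 1 ==> fps_nth (f ^ n) 0 = 1"
 "fps_nth f 0 = 1 ==> fps_nth (f ^ n) (Suc 0) = of_nat n * fps_nth f (Suc 0)"
 for f :: "'r::comm_ring_1 fps"
proof -
 assume *: "fps_nth f 0 = 1"
 show 0: "fps_nth (f ^ n) 0 = 1" for n using * by (induction n) simp_all
 show "fps_nth (f ^ n) (Suc 0) = of_nat n * fps_nth f (Suc 0)"
  using * by (induction n) (simp_all add: fps_mult_nth_1[simplified] 0 algebra_simps)
qed

text \<open>Coefficient of t in \<open>equivariant_pev\<close> at 1 + t X. The two powers of the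
  determinant contribute n' trace X and n trace X, which become the trace terms of
  \<open>drho\<close> on the opposite sides.\<close>

lemma equivariant_drho:
 fixes \<iota> :: "'k::field_char_0 => 'f::field"
 assumes T: "equivariant I q n J q' n' T" and \<iota>: "rhom \<iota>" and ij: "j \<in> J" "i \<in> I"
 shows "mm I (%j i. \<iota> (T j i)) (drho \<iota> q n X) j i = mm J (drho \<iota> q' n' X) (%j i. \<iota> (T j i)) j i"
proof -
 let ?\<iota> = "%c. fps_const (\<iota> c)" and ?G = "jet (mat 1) X"
 let ?T = "%j i. \<iota> (T j i)" and ?q = "%i j. pev \<iota> (q i j) (mat 1)" and ?q' = "%i j. pev \<iota> (q' i j) (mat 1)"
 have d: "fps_nth (det ?G) 0 = 1" "fps_nth (det ?G) (Suc 0) = trace X"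
  by (simp_all add: det_2 trace_2 jet_def mat_def fps_mult_nth_1[simplified])
 have e: "mm I ?T ?q j i = mm J ?q' ?T j i"
  using equivariant_pev[OF T \<iota> ij, of "mat 1"] by simp
 have "fps_nth (det ?G ^ n' * mm I (%j i. ?\<iota> (T j i)) (%i j. pev ?\<iota> (q i j) ?G) j i) (Suc 0)
  = fps_nth (det ?G ^ n * mm J (%i j. pev ?\<iota> (q' i j) ?G) (%j i. ?\<iota> (T j i)) j i) (Suc 0)"
  using equivariant_pev[OF T rhom_comp[OF rhom_fps_const \<iota>] ij, of ?G] by simp
 hence "mm I ?T (%i j. pdv \<iota> (q i j) (mat 1) X) j i + of_nat n' * trace X * mm I ?T ?q j i
  = mm J (%i j. pdv \<iota> (q' i j) (mat 1) X) ?T j i + of_nat n * trace X * mm J ?q' ?T j i"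
  by (simp add: mm_def fps_mult_nth_1[simplified] fps_sum_nth fps_power_nth d pev_fps_nth_0 pev_fps_nth_1)
 thus ?thesis using e
  by (simp add: mm_def drho_def left_diff_distrib right_diff_distrib sum_subtractf mult.assoc mult.left_commute
    sum_distrib_left[symmetric]) (simp add: algebra_simps)
qed

subsection \<open>General facts on AV-modules\<close>

lemma univ_ring_simps [simp]:
 "carrier univ_ring = UNIV" "mult univ_ring = (*)" "one univ_ring = 1" "zero univ_ring = 0" "add univ_ring = (+)"
 by (simp_all add: univ_ring_def)

lemma cring_univ_ring: "cring (univ_ring :: 'r::comm_ring_1 ring)"
proof (rule cringI)
 show "abelian_group (univ_ring :: 'r ring)"
 proof (rule abelian_groupI)
  fix x :: 'r
  show "\<exists>y\<in>carrier univ_ring. y +[univ_ring] x = 0[univ_ring]" by (auto intro: exI[of _ "- x"])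
 qed (simp_all add: algebra_simps)
 show "Group.comm_monoid (univ_ring :: 'r ring)"
  by (rule comm_monoidI) (simp_all add: algebra_simps)
qed (simp add: algebra_simps)

lemma av_moduleD:
 assumes "av_module M"
 shows av_module_module: "Module.module univ_ring M"
  and av_lie_closed: "[|\<eta> \<in> derivations; m \<in>. M|] ==> lie M \<eta> m \<in>. M"
  and av_abelian: "abelian_group M"
  and av_add_closed: "[|m \<in>. M; n \<in>. M|] ==> m +[M] n \<in>. M"
  and av_smult_closed: "m \<in>. M ==> a .[M] m \<in>. M"
  and av_zero_closed: "0[M] \<in>. M"
proof -
 show 1: "Module.module univ_ring M" using assms by (simp add: av_module_def)
 then interpret Module.module univ_ring M .
 show "abelian_group M" ..
 show "[|m \<in>. M; n \<in>. M|] ==> m +[M] n \<in>. M" by simp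
 show "m \<in>. M ==> a .[M] m \<in>. M" using smult_closed[of a m] by simp
 show "0[M] \<in>. M" by simp
 show "[|\<eta> \<in> derivations; m \<in>. M|] ==> lie M \<eta> m \<in>. M"
  using assms by (simp add: av_module_def)
qed

lemma av_homD:
 assumes "f \<in> av_hom M N"
 shows av_hom_closed: "m \<in>. M ==> f m \<in>. N"
  and av_hom_add: "[|m \<in>. M; n \<in>. M|] ==> f (m +[M] n) = f m +[N] f n"
  and av_hom_smult: "m \<in>. M ==> f (a .[M] m) = a .[N] f m"
  and av_hom_lie: "[|\<eta> \<in> derivations; m \<in>. M|] ==> f (lie M \<eta> m) = lie N \<eta> (f m)"
 using assms by (auto simp: av_hom_def)

lemma av_homI:
 assumes "!!m. m \<in>. M ==> f m \<in>. N"
  "!!m n. [|m \<in>. M; n \<in>. M|] ==> f (m +[M] n) = f m +[N] f n"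
  "!!a m. m \<in>. M ==> f (a .[M] m) = a .[N] f m"
  "!!\<eta> m. [|\<eta> \<in> derivations; m \<in>. M|] ==> f (lie M \<eta> m) = lie N \<eta> (f m)"
 shows "f \<in> av_hom M N"
 using assms by (auto simp: av_hom_def)

lemma av_hom_comp:
 assumes "f \<in> av_hom L M" "g \<in> av_hom M N"
 shows "(%x. g (f x)) \<in> av_hom L N"
 by (rule av_homI) (simp_all add: av_homD[OF assms(1)] av_homD[OF assms(2)])

text \<open>Closure under the operations is all that is needed to invert a bijective homomorphism.
  It is used for sums, tensor products and the generators, for which the module axioms are never
  proved directly.\<close>

definition av_closed :: "('k::field_char_0 sphere, 'm) av_struct => bool"
 where "av_closed M \<longleftrightarrow> (\<forall>m\<in>carrier M. \<forall>n\<in>carrier M. m +[M] n \<in>. M) \<and>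
  (\<forall>a. \<forall>m\<in>carrier M. a .[M] m \<in>. M) \<and> (\<forall>\<eta>\<in>derivations. \<forall>m\<in>carrier M. lie M \<eta> m \<in>. M)"

lemma av_module_closed: "av_module M ==> av_closed M"
 by (simp add: av_closed_def av_moduleD)

lemma av_hom_inverse:
 assumes f: "f \<in> av_hom M N" and bij: "bij_betw f (carrier M) (carrier N)" and M: "av_closed M"
 shows "the_inv_into (carrier M) f \<in> av_hom N M"
proof -
 let ?g = "the_inv_into (carrier M) f"
 have inj: "inj_on f (carrier M)" and surj: "f ` carrier M = carrier N"
  using bij by (simp_all add: bij_betw_def)
 have g: "?g n \<in>. M" "f (?g n) = n" if "n \<in>. N" for n
  using that surj inj by (auto simp: f_the_inv_into_f the_inv_into_into)
 have eq: "?g n = m" if "m \<in>. M" "f m = n" for m n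
  using that inj by (auto simp: the_inv_into_f_f)
 show ?thesis
  by (rule av_homI; (rule eq)?) (use M in \<open>auto simp: g av_homD[OF f] av_closed_def\<close>)
qed

lemma av_iso_sym: "av_iso M N ==> av_closed M ==> av_iso N M"
 unfolding av_iso_def using av_hom_inverse bij_betw_the_inv_into by blast

lemma av_iso_trans: "av_iso L M ==> av_iso M N ==> av_iso L N"
 unfolding av_iso_def using av_hom_comp[of _ L M _ N] bij_betw_trans[of _ "carrier L" "carrier M" _ "carrier N"]
 by (fastforce simp: comp_def)

lemma av_iso_refl: "av_iso M M"
 unfolding av_iso_def by (rule bexI[of _ "%x. x"]) (simp_all add: av_hom_def bij_betw_def)

lemma has_copiesD: "has_copies S M ==> av_module T ==> av_iso T M ==> T \<in> S"
 by (simp add: has_copies_def)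

lemma has_copies_iso: "has_copies S M ==> av_iso N M ==> has_copies S N"
 unfolding has_copies_def using av_iso_trans by blast

text \<open>The axioms are equations and pull back along an injective map that respects the
  operations. Only additive inverses are an existence statement; they are supplied by the last
  hypothesis.\<close>

lemma av_module_transfer:
 fixes M :: "('k::field_char_0 sphere, 'm) av_struct"
 assumes M: "av_module M" and f: "f \<in> av_hom N M" and inj: "inj_on f (carrier N)" and N: "av_closed N"
  and zero: "0[N] \<in>. N" "f 0[N] = 0[M]"
  and neg: "!!n. n \<in>. N ==> \<exists>n'\<in>carrier N. f n' = \<ominus>\<^bsub>M\<^esub> f n"
 shows "av_module N"
proof -
 interpret M: Module.module univ_ring M by (rule av_module_module[OF M])
 have eqI: "f x = f y ==> x \<in>. N ==> y \<in>. N ==> x = y" for x y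
  using inj by (auto dest: inj_onD)
 have cl: "x \<in>. N ==> y \<in>. N ==> x +[N] y \<in>. N" "x \<in>. N ==> a .[N] x \<in>. N"
  "\<eta> \<in> derivations ==> x \<in>. N ==> lie N \<eta> x \<in>. N" for x y a \<eta>
  using N by (auto simp: av_closed_def)
 note fs = av_homD[OF f] cl zero
 interpret N: abelian_group N
 proof (rule abelian_groupI)
  fix x y z assume *: "x \<in>. N" "y \<in>. N" "z \<in>. N"
  show "x +[N] y +[N] z = x +[N] (y +[N] z)" by (rule eqI) (simp_all add: * fs M.a_assoc)
 next
  fix x y assume *: "x \<in>. N" "y \<in>. N"
  show "x +[N] y = y +[N] x" by (rule eqI) (simp_all add: * fs M.a_comm)
 next
  fix x assume *: "x \<in>. N"
  show "0[N] +[N] x = x" by (rule eqI) (simp_all add: * fs)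
  obtain y where y: "y \<in>. N" "f y = \<ominus>\<^bsub>M\<^esub> f x" using neg[OF *] by blast
  have "y +[N] x = 0[N]" by (rule eqI) (simp_all add: * y fs M.l_neg)
  thus "\<exists>y\<in>carrier N. y +[N] x = 0[N]" using y(1) by blast
 qed (simp_all add: fs)
 have fneg: "f (\<ominus>\<^bsub>N\<^esub> x) = \<ominus>\<^bsub>M\<^esub> f x" if "x \<in>. N" for x
 proof -
  have "f (\<ominus>\<^bsub>N\<^esub> x) +[M] f x = 0[M]"
   using that av_hom_add[OF f, of "\<ominus>\<^bsub>N\<^esub> x" x] by (simp add: N.l_neg zero)
  thus ?thesis using that by (intro M.minus_equality[symmetric]) (simp_all add: fs)
 qed
 have fminus: "f (x -[N] y) = f x -[M] f y" if "x \<in>. N" "y \<in>. N" for x y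
  using that by (simp add: a_minus_def fs fneg)
 have mod: "Module.module univ_ring N"
 proof (rule moduleI)
  show "cring (univ_ring :: 'k sphere ring)" by (rule cring_univ_ring)
  show "abelian_group N" ..
  fix a b :: "'k sphere" and x y assume *: "x \<in>. N" 
  show "(a +[univ_ring] b) .[N] x = a .[N] x +[N] b .[N] x"
   using M.smult_l_distr[of a b "f x"] by (intro eqI) (simp_all add: * fs)
  show "(a \<otimes>\<^bsub>univ_ring\<^esub> b) .[N] x = a .[N] (b .[N] x)"
   using M.smult_assoc1[of a b "f x"] by (intro eqI) (simp_all add: * fs)
  show "\<one>\<^bsub>univ_ring\<^esub> .[N] x = x"
   using M.smult_one[of "f x"] by (intro eqI) (simp_all add: * fs)
  assume y: "y \<in>. N"
  show "a .[N] (x +[N] y) = a .[N] x +[N] a .[N] y"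
   using M.smult_r_distr[of a "f x" "f y"] by (intro eqI) (simp_all add: * y fs)
 qed (simp_all add: fs)
 note Ms = M[unfolded av_module_def, THEN conjunct2]
 show ?thesis unfolding av_module_def
  by (intro conjI ballI allI mod; (rule eqI)?)
    (use Ms in \<open>simp_all add: fs fminus der_scalar M.smult_l_null[simplified] der_add_closed der_lie_closed der_smult_closed N.minus_closed\<close>)
qed

definition av_copy :: "('m => 'u) => ('k::field_char_0 sphere, 'm) av_struct => ('k sphere, 'u) av_struct"
 where "av_copy \<kappa> M = (let \<pi> = the_inv_into (carrier M) \<kappa> in
  \<lparr>carrier = \<kappa> ` carrier M, mult = undefined, one = undefined, zero = \<kappa> 0[M],
   add = (%x y. \<kappa> (\<pi> x +[M] \<pi> y)), smult = (%a x. \<kappa> (a .[M] \<pi> x)), lie = (%\<eta> x. \<kappa> (lie M \<eta> (\<pi> x)))\<rparr>)"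

lemma av_copy:
 assumes M: "av_module M" and \<kappa>: "inj_on \<kappa> (carrier M)"
 shows "av_module (av_copy \<kappa> M)" "the_inv_into (carrier M) \<kappa> \<in> av_hom (av_copy \<kappa> M) M"
  "bij_betw (the_inv_into (carrier M) \<kappa>) (carrier (av_copy \<kappa> M)) (carrier M)"
proof -
 let ?\<pi> = "the_inv_into (carrier M) \<kappa>"
 have \<pi>: "?\<pi> (\<kappa> m) = m" if "m \<in>. M" for m using \<kappa> that by (rule the_inv_into_f_f)
 note cl = av_moduleD(2-)[OF M]
 show h: "?\<pi> \<in> av_hom (av_copy \<kappa> M) M"
  by (rule av_homI) (auto simp: av_copy_def Let_def \<pi> cl)
 show b: "bij_betw ?\<pi> (carrier (av_copy \<kappa> M)) (carrier M)"
  using \<kappa> by (simp add: av_copy_def Let_def bij_betw_the_inv_into inj_on_imp_bij_betw)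
 show "av_module (av_copy \<kappa> M)"
 proof (rule av_module_transfer[OF M h])
  interpret M: abelian_group M by (rule cl)
  show "\<exists>n'\<in>carrier (av_copy \<kappa> M). ?\<pi> n' = \<ominus>\<^bsub>M\<^esub> ?\<pi> n" if "n \<in>. av_copy \<kappa> M" for n
   using that by (auto simp: av_copy_def Let_def \<pi> intro!: bexI[of _ "\<kappa> (\<ominus>\<^bsub>M\<^esub> ?\<pi> n)"])
 qed (use b in \<open>auto simp: bij_betw_def av_closed_def av_copy_def Let_def \<pi> cl\<close>)
qed

text \<open>Local-to-global principle: m is a combination of the three elements h^K m with
  coefficients from \<open>partition_unity\<close>. Surjectivity statements and injectivity for
  tensor products are reduced to single charts in this way.\<close>

lemma partition_principle:
 fixes M :: "('k::field_char_0 sphere, 'm) av_struct"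
 assumes M: "Module.module univ_ring M" and m: "m \<in>. M" and X: "X \<subseteq> carrier M"
  and add: "!!x y. x \<in> X ==> y \<in> X ==> x +[M] y \<in> X" and smult: "!!a x. x \<in> X ==> a .[M] x \<in> X"
  and local: "!!h. \<exists>K. coord_fun h ^ K .[M] m \<in> X"
 shows "m \<in> X"
proof -
 interpret Module.module univ_ring M by (rule M)
 obtain K1 K2 K3 where K: "coord_fun coord_x ^ K1 .[M] m \<in> X" "coord_fun coord_y ^ K2 .[M] m \<in> X"
  "coord_fun coord_z ^ K3 .[M] m \<in> X" using local by metis
 obtain a b c where 1: "a * coord_fun coord_x ^ K1 + b * coord_fun coord_y ^ K2 + c * coord_fun coord_z ^ K3 = (1 :: 'k sphere)"
  using partition_unity by blast
 have s: "(u * v) .[M] m = u .[M] (v .[M] m)" "(u + v) .[M] m = u .[M] m +[M] v .[M] m" for u v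
  using smult_assoc1[of u v m] smult_l_distr[of u v m] m by simp_all
 have "1 .[M] m = m" using smult_one[of m] m by simp
 hence "m = a .[M] (coord_fun coord_x ^ K1 .[M] m) +[M] b .[M] (coord_fun coord_y ^ K2 .[M] m)
   +[M] c .[M] (coord_fun coord_z ^ K3 .[M] m)"
  by (simp only: 1 flip: s)
 thus ?thesis using K add smult by metis
qed

subsection \<open>The AV-module of a representation\<close>

abbreviation "fs == fract_scalar"
abbreviation "fsm == %T j i. fs (T j i)"

text \<open>The value 0 outside J makes vectors over a finite index set total functions that can be
  compared by plain equality.\<close>

definition mv :: "'j set => 'i set => ('j => 'i => 'f::comm_ring_1) => ('i => 'f) => 'j => 'f"
 where "mv J I A v j = (if j \<in> J then \<Sum>i\<in>I. A j i * v i else 0)"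

lemma mv_mv: "mv K J A (mv J I B v) = mv K I (mm J A B) v"
proof
 fix k
 show "mv K J A (mv J I B v) k = mv K I (mm J A B) v k"
  by (simp add: mv_def mm_def sum_distrib_left sum_distrib_right mult.assoc sum.swap[of _ J I])
qed

lemma mv_cong: "[|!!j i. j \<in> J ==> i \<in> I ==> A j i = B j i; !!i. i \<in> I ==> v i = w i|] ==> mv J I A v = mv J I B w"
 by (simp add: mv_def fun_eq_iff)

lemma mv_add: "mv J I A (%i. v i + w i) = (%j. mv J I A v j + mv J I A w j)"
 by (simp add: mv_def fun_eq_iff distrib_left sum.distrib)

lemma mv_smult: "mv J I A (%i. c * v i) = (%j. c * mv J I A v j)"
 by (simp add: mv_def fun_eq_iff sum_distrib_left mult.left_commute)

lemma mv_add_mat: "mv J I (%j i. A j i + B j i) v = (%j. mv J I A v j + mv J I B v j)"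
 by (simp add: mv_def fun_eq_iff distrib_right sum.distrib)

lemma mv_out: "j \<notin> J ==> mv J I A v j = 0"
 by (simp add: mv_def)

lemma mv_0: "mv J I A (%i. 0) = (%j. 0)"
 by (simp add: mv_def fun_eq_iff)

text \<open>The prescribed action on A_(h) \<otimes> U in coordinates; linearity of
  \<open>drho\<close> collects the double sum over matrix units into one application to the
  Jacobian.\<close>

definition Lie_chart :: "'i set => ('i, 'k::field_char_0) qmat => nat => coord =>
  ('k sphere => 'k sphere) => ('i => 'k sphere fract) => 'i => 'k sphere fract"
 where "Lie_chart I q n h \<eta> v i = (if i \<in> I then dext \<eta> (v i) else 0) + mv I I (drho fs q n (jac h \<eta>)) v i"

text \<open>
 The vectors are written in the chart \<open>N(z)\<close>, and \<open>\<rho>(C)\<close> for the change from \<open>N(z)\<close> to \<open>N(h)\<close>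
 is applied to express regularity on \<open>N(h)\<close>.
\<close>

definition SMod :: "'i set => ('i, 'k::field_char_0) qmat => nat => ('k sphere, 'i => 'k sphere fract) av_struct"
 where "SMod I q n = \<lparr>carrier = {v. mv I I (rho fs q n (mat 1)) v = v \<and>
   (\<forall>h i. mv I I (rho fs q n (cc coord_z h)) v i \<in> loc h)},
  mult = undefined, one = undefined, zero = (%i. 0), add = (%v w i. v i + w i),
  smult = (%a v i. incl a * v i), lie = Lie_chart I q n coord_z\<rparr>"

lemma Mod_simps [simp]:
 "zero (SMod I q n) = (%i. 0)" "add (SMod I q n) = (%v w i. v i + w i)"
 "smult (SMod I q n) = (%a v i. incl a * v i)" "lie (SMod I q n) = Lie_chart I q n coord_z"
 by (simp_all add: SMod_def)

lemma Mod_carrier: "v \<in>. SMod I q n \<longleftrightarrow> mv I I (rho fs q n (mat 1)) v = v \<and>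
   (\<forall>h i. mv I I (rho fs q n (cc coord_z h)) v i \<in> loc h)"
 by (simp add: SMod_def)

lemma coord_All: "(\<forall>h. P h) \<longleftrightarrow> P coord_x \<and> P coord_y \<and> P coord_z"
 by (metis coord.exhaust)

lemma UNIV_coord: "(UNIV :: coord set) = {coord_x, coord_y, coord_z}"
 using coord.exhaust by auto

lemma pev_closed:
 assumes "!!c. \<iota> c \<in> B" "!!x y. x \<in> B ==> y \<in> B ==> x + y \<in> B" "!!x y. x \<in> B ==> y \<in> B ==> x * y \<in> B"
  "!!i j. g $ i $ j \<in> B"
 shows "pev \<iota> e g \<in> B"
 by (induction e) (auto intro: assms)

lemma pdv_closed:
 assumes "!!c. \<iota> c \<in> B" "0 \<in> B" "!!x y. x \<in> B ==> y \<in> B ==> x + y \<in> B" "!!x y. x \<in> B ==> y \<in> B ==> x * y \<in> B"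
  "!!i j. g $ i $ j \<in> B" "!!i j. X $ i $ j \<in> B"
 shows "pdv \<iota> e g X \<in> B"
 by (induction e) (auto intro: assms pev_closed)

lemma loc_power: "f \<in> loc h ==> f ^ n \<in> loc h"
 by (induction n) (auto intro: loc_mult)

lemma loc_det: "(!!i j. G $ i $ j \<in> loc h) ==> det (G :: 'k::field_char_0 sphere fract^2^2) \<in> loc h"
 unfolding det_2 by (intro loc_diff loc_mult) auto

text \<open>The polynomial part of \<rho>(C) is regular on N(h'), where the entries of C are; the
  inverse determinant of C is the determinant of the reverse change and is regular on N(h).\<close>

lemma rho_cc_loc2: "rho fs q n (cc h h') i j \<in> loc2 h h'"
proof -
 have "pev fs (q i j) (cc h h') \<in> loc h'" by (rule pev_closed) (auto intro: loc_add loc_mult)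
 moreover have "det (cc h' h) ^ n \<in> loc h" by (intro loc_power loc_det) auto
 ultimately have "pev fs (q i j) (cc h h') * det (cc h' h) ^ n \<in> loc2 h h'"
  using loc_subset_loc2 by (blast intro: loc2_mult)
 thus ?thesis by (simp add: rho_def divide_inverse inverse_det_cc flip: power_inverse)
qed

lemma loc_of_nat: "of_nat n \<in> loc h"
 by (induction n) (auto intro: loc_add)

lemma drho_loc: "(!!i j. X $ i $ j \<in> loc h) ==> drho fs q n X i j \<in> loc h"
 unfolding drho_def trace_2
 by (intro loc_diff loc_mult loc_add loc_of_nat pdv_closed pev_closed) (auto intro: loc_add loc_mult simp: mat_def)

lemma mv_loc: "(!!j i. A j i \<in> loc h) ==> (!!i. v i \<in> loc h) ==> mv J I A v j \<in> loc h"
 by (auto simp: mv_def intro!: loc_sum loc_mult)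

lemma fder_mv: "fder D ==> j \<in> J ==> D (mv J I A v j) = mv J I (%j i. D (A j i)) v j + mv J I A (%i. D (v i)) j"
 by (simp add: mv_def fder_sum fder_mult sum.distrib)

context
 fixes I :: "'i set" and q :: "('i, 'k::field_char_0) qmat" and n :: nat
 assumes q: "polyrep I q"
begin

lemma finite_polyrep: "finite I"
 using q by (simp add: polyrep_def)

lemma mv_rho_mult: "mv I I (rho fs q n G) (mv I I (rho fs q n H) v) = mv I I (rho fs q n (G ** H)) v"
 unfolding mv_mv by (rule mv_cong) (simp_all add: rho_mult[OF q])

lemma mv_rho_fixed: "mv I I (rho fs q n (mat 1)) v = v ==> mv I I (rho fs q n (cc h' h)) (mv I I (rho fs q n (cc h h')) v) = v"
 by (simp add: mv_rho_mult cc_comp)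

lemma rho_1_const: "fder D ==> D (rho fs q n (mat 1) i j) = 0"
proof -
 assume D: "fder D"
 have "rho fs q n (mat 1) i j = fs (rho0 q n (mat 1) i j)"
  by (simp add: rho_map mmap_1)
 thus ?thesis by (simp add: fder_scalar[OF D])
qed

lemma Lie_chart_fixed:
 assumes \<eta>: "\<eta> \<in> derivations" and v: "mv I I (rho fs q n (mat 1)) v = v"
 shows "mv I I (rho fs q n (mat 1)) (Lie_chart I q n h \<eta> v) = Lie_chart I q n h \<eta> v"
proof
 fix i
 show "mv I I (rho fs q n (mat 1)) (Lie_chart I q n h \<eta> v) i = Lie_chart I q n h \<eta> v i"
 proof (cases "i \<in> I")
  case True
  have 1: "mv I I (rho fs q n (mat 1)) (mv I I (drho fs q n (jac h \<eta>)) v) = mv I I (drho fs q n (jac h \<eta>)) v"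
   unfolding mv_mv by (rule mv_cong) (simp_all add: rho_1_drho[OF q])
  have "dext \<eta> (v i) = dext \<eta> (mv I I (rho fs q n (mat 1)) v i)" using v by simp
  also have "... = mv I I (rho fs q n (mat 1)) (%i. dext \<eta> (v i)) i"
   using True by (simp add: fder_mv[OF fder_dext[OF \<eta>]] rho_1_const[OF fder_dext[OF \<eta>]]) (simp add: mv_def)
  also have "... = mv I I (rho fs q n (mat 1)) (%i. if i \<in> I then dext \<eta> (v i) else 0) i"
   by (rule fun_cong[OF mv_cong]) simp_all
  finally show ?thesis using 1 True by (simp add: Lie_chart_def[abs_def] mv_add)
 qed (simp add: Lie_chart_def mv_out)
qed

text \<open>The chart actions are compatible with \<rho>(C): differentiating \<rho>(C) by \<eta>
  produces the derivative of the representation at \<eta>(C) C^(-1), which is exactly the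
  discrepancy of the two Jacobians of \<eta>.\<close>

lemma Lie_chart_cc:
 assumes \<eta>: "\<eta> \<in> derivations"
 shows "mv I I (rho fs q n (cc h h')) (Lie_chart I q n h \<eta> v) = Lie_chart I q n h' \<eta> (mv I I (rho fs q n (cc h h')) v)"
proof
 fix i
 let ?G = "cc h h' :: 'k sphere fract^2^2" and ?D = "dext \<eta>"
 \<comment> \<open>The logarithmic derivative of C along \<eta>, so that \<eta>(C) = X C as
   \<open>rho_der\<close> requires.\<close>
 let ?X = "mmap ?D ?G ** cc h' h"
 let ?R = "mv I I (rho fs q n ?G)"
 note D = fder_dext[OF \<eta>]
 have DG: "mmap ?D ?G = ?X ** ?G" by (simp add: cc_comp flip: matrix_mul_assoc)
 \<comment> \<open>\<open>jac_cocycle\<close> rewritten as a conjugation by C, the form in which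
   \<open>rho_drho_conj\<close> applies.\<close>
 have conj: "?G ** jac h \<eta> = (?X + jac h' \<eta>) ** ?G"
 proof -
  have "(?X + jac h' \<eta>) ** ?G = ?X ** ?G + jac h' \<eta> ** ?G"
   by (simp add: vec_eq_iff matrix_matrix_mult_def distrib_right sum.distrib)
  thus ?thesis unfolding DG[symmetric] by (simp add: vec_eq_iff jac_cocycle[OF \<eta>])
 qed
 show "?R (Lie_chart I q n h \<eta> v) i = Lie_chart I q n h' \<eta> (?R v) i"
 proof (cases "i \<in> I")
  case True
  have 1: "?R (mv I I (drho fs q n (jac h \<eta>)) v)
    = mv I I (drho fs q n (?X + jac h' \<eta>)) (?R v)"
   unfolding mv_mv by (rule mv_cong) (simp_all add: rho_drho_conj[OF q rhom_fs det_cc_nz conj])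
  have "mv I I (%j i. ?D (rho fs q n ?G j i)) v = mv I I (drho fs q n ?X) (?R v)"
   unfolding mv_mv
   by (rule mv_cong) (simp_all add: rho_der[OF q rhom_fs fderD(1,2,3)[OF D] det_cc_nz DG])
  hence 2: "?D (?R v i) = mv I I (drho fs q n ?X) (?R v) i
    + ?R (%i. ?D (v i)) i"
   using True by (simp add: fder_mv[OF D])
  have 3: "?R (%i. ?D (v i)) = ?R (%i. if i \<in> I then ?D (v i) else 0)"
   by (rule mv_cong) simp_all
  have 4: "drho fs q n (?X + jac h' \<eta>) = (%i j. drho fs q n ?X i j + drho fs q n (jac h' \<eta>) i j)"
   by (simp add: fun_eq_iff drho_add)
  show ?thesis using True
   by (simp add: Lie_chart_def[abs_def] mv_add 1 2 3 4 mv_add_mat)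
 qed (simp add: Lie_chart_def mv_out)
qed

lemma Lie_chart_loc:
 assumes "\<eta> \<in> derivations" "!!i. v i \<in> loc h"
 shows "Lie_chart I q n h \<eta> v i \<in> loc h"
 unfolding Lie_chart_def using assms
 by (auto intro!: loc_add loc_dext mv_loc drho_loc jac_loc)

text \<open>By \<open>Lie_chart_cc\<close> the action may be computed in any chart h, where each of
  its terms preserves regularity on N(h).\<close>

lemma Mod_lie_closed: "\<eta> \<in> derivations ==> v \<in>. SMod I q n ==> Lie_chart I q n coord_z \<eta> v \<in>. SMod I q n"
 by (simp add: Mod_carrier Lie_chart_fixed Lie_chart_cc Lie_chart_loc)

lemma Mod_out: "v \<in>. SMod I q n ==> i \<notin> I ==> v i = 0"
 by (metis Mod_carrier mv_out)

lemma Mod_abelian: "abelian_group (SMod I q n)"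
proof (rule abelian_groupI)
 fix x assume "x \<in>. SMod I q n"
 hence "(%i. - 1 * x i) \<in>. SMod I q n"
  unfolding Mod_carrier mv_smult by (auto intro: loc_minus)
 thus "\<exists>y\<in>carrier (SMod I q n). y +[SMod I q n] x = 0[SMod I q n]"
  by (intro bexI[of _ "%i. - 1 * x i"]) simp_all
qed (auto simp: Mod_carrier mv_add mv_0 algebra_simps intro: loc_add)

lemma Mod_minus: "x \<in>. SMod I q n ==> \<ominus>\<^bsub>SMod I q n\<^esub> x = (%i. - x i)"
proof -
 interpret abelian_group "SMod I q n" by (rule Mod_abelian)
 assume x: "x \<in>. SMod I q n"
 hence "\<ominus>\<^bsub>SMod I q n\<^esub> x +[SMod I q n] x = 0[SMod I q n]" by (rule l_neg)
 thus ?thesis by (simp add: fun_eq_iff eq_neg_iff_add_eq_0)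
qed

lemma Lie_chart_add: "\<eta> \<in> derivations ==> Lie_chart I q n h \<eta> (%i. v i + w i) = (%i. Lie_chart I q n h \<eta> v i + Lie_chart I q n h \<eta> w i)"
 by (simp add: Lie_chart_def fun_eq_iff mv_add fder_add[OF fder_dext])

lemma Lie_chart_smult: "[|\<eta> \<in> derivations; !!i. i \<notin> I ==> v i = 0|] ==>
  Lie_chart I q n h \<eta> (%i. incl a * v i) = (%i. incl (\<eta> a) * v i + incl a * Lie_chart I q n h \<eta> v i)"
 by (simp add: Lie_chart_def fun_eq_iff mv_smult fder_mult[OF fder_dext] dext_incl algebra_simps)

text \<open>In the composition of two actions the terms with one derivative on v are symmetric in
  \<eta> and \<theta> and cancel. What remains is the commutator of derivations and the cocycle
  identity \<open>jac_lie\<close> carried through \<open>drho\<close>.\<close>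

lemma Lie_chart_lie:
 assumes \<eta>: "\<eta> \<in> derivations" and \<theta>: "\<theta> \<in> derivations"
 shows "Lie_chart I q n h (%f. \<eta> (\<theta> f) - \<theta> (\<eta> f)) v i
  = Lie_chart I q n h \<eta> (Lie_chart I q n h \<theta> v) i - Lie_chart I q n h \<theta> (Lie_chart I q n h \<eta> v) i"
proof (cases "i \<in> I")
 case True
 let ?d = "%\<eta>. drho fs q n (jac h \<eta>)"
 have exp: "Lie_chart I q n h \<eta> (Lie_chart I q n h \<theta> v) i = dext \<eta> (dext \<theta> (v i))
   + mv I I (%i j. dext \<eta> (?d \<theta> i j)) v i + mv I I (?d \<theta>) (%i. dext \<eta> (v i)) i
   + mv I I (?d \<eta>) (%i. dext \<theta> (v i)) i + mv I I (mm I (?d \<eta>) (?d \<theta>)) v i" if \<eta>: "\<eta> \<in> derivations" for \<eta> \<theta>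
 proof -
  have "mv I I (?d \<eta>) (%i. if i \<in> I then dext \<theta> (v i) else 0) = mv I I (?d \<eta>) (%i. dext \<theta> (v i))"
   by (rule mv_cong) simp_all
  thus ?thesis using True
   by (simp add: Lie_chart_def[abs_def] mv_add fder_add[OF fder_dext[OF \<eta>]] fder_mv[OF fder_dext[OF \<eta>]] mv_mv)
 qed
 have der: "dext \<eta> (drho fs q n X k l) = drho fs q n (mmap (dext \<eta>) X) k l" if \<eta>: "\<eta> \<in> derivations" for \<eta> X k l
 proof -
  have "drho fs q n (munit p i) k l = fs (drho0 q n (munit p i) k l)" for p i
   by (simp add: drho_map mmap_munit)
  thus ?thesis unfolding drho_expand[of fs q n X] drho_expand[of fs q n "mmap (dext \<eta>) X"]
   by (simp add: fderD[OF fder_dext[OF \<eta>]] fder_sum[OF fder_dext[OF \<eta>]])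
 qed
 \<comment> \<open>The subtracted term of \<open>jac_lie\<close> is moved to the left, so that
   additivity of \<open>drho\<close> can be used on both sides.\<close>
 have "jac h (%f. \<eta> (\<theta> f) - \<theta> (\<eta> f)) + mmap (dext \<theta>) (jac h \<eta>)
   = mmap (dext \<eta>) (jac h \<theta>) + (jac h \<eta> ** jac h \<theta> - jac h \<theta> ** jac h \<eta>)"
  by (simp add: vec_eq_iff jac_lie[OF \<eta> \<theta>])
 hence J: "drho fs q n (jac h (%f. \<eta> (\<theta> f) - \<theta> (\<eta> f)) + mmap (dext \<theta>) (jac h \<eta>)) i j
   = drho fs q n (mmap (dext \<eta>) (jac h \<theta>) + (jac h \<eta> ** jac h \<theta> - jac h \<theta> ** jac h \<eta>)) i j" for j
  by simp
 have J': "?d (%f. \<eta> (\<theta> f) - \<theta> (\<eta> f)) i j = dext \<eta> (?d \<theta> i j) - dext \<theta> (?d \<eta> i j)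
   + mm I (?d \<eta>) (?d \<theta>) i j - mm I (?d \<theta>) (?d \<eta>) i j" if "j \<in> I" for j
  using J[of j] unfolding drho_add drho_lie[OF q rhom_fs True that, symmetric] der[OF \<eta>] der[OF \<theta>]
  by (simp add: algebra_simps)
 have "mv I I (?d (%f. \<eta> (\<theta> f) - \<theta> (\<eta> f))) v i = mv I I (%i j. dext \<eta> (?d \<theta> i j)) v i - mv I I (%i j. dext \<theta> (?d \<eta> i j)) v i
   + mv I I (mm I (?d \<eta>) (?d \<theta>)) v i - mv I I (mm I (?d \<theta>) (?d \<eta>)) v i"
  using True by (simp add: mv_def J' algebra_simps sum.distrib sum_subtractf)
 thus ?thesis using True unfolding exp[OF \<eta>] exp[OF \<theta>]
  by (simp add: Lie_chart_def dext_lie[OF \<eta> \<theta>])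
qed (simp add: Lie_chart_def mv_out)

lemma Mod_module: "Module.module univ_ring (SMod I q n)"
proof (rule moduleI)
 show "cring (univ_ring :: 'k sphere ring)" by (rule cring_univ_ring)
 show "abelian_group (SMod I q n)" by (rule Mod_abelian)
qed (auto simp: Mod_carrier mv_smult incl_add incl_mult mult.assoc distrib_left distrib_right intro: loc_mult)

lemma av_module_Mod: "av_module (SMod I q n)"
 unfolding av_module_def
proof (intro conjI ballI allI, goal_cases)
 case 1
 show ?case by (rule Mod_module)
next
 case (2 \<eta> v)
 thus ?case by (simp add: Mod_lie_closed)
next
 case (3 \<eta> v w)
 thus ?case by (simp add: Lie_chart_add)
next
 case (4 \<eta> c v)
 thus ?case by (simp add: Lie_chart_smult Mod_out der_scalar)
next
 case (5 \<eta> \<theta> v)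
 have "drho fs q n (jac coord_z \<eta> + jac coord_z \<theta>) = (%i j. drho fs q n (jac coord_z \<eta>) i j + drho fs q n (jac coord_z \<theta>) i j)"
  by (simp add: fun_eq_iff drho_add)
 thus ?case using 5 by (intro ext) (simp add: Lie_chart_def jac_add dext_add mv_add_mat)
next
 case (6 \<eta> c v)
 have "jac coord_z (%f. scalar c * \<eta> f) = (\<chi> i j. fs c * jac coord_z \<eta> $ i $ j)"
  using fder_scalar[OF fder_pd, of coord_z _ c]
  by (simp add: vec_eq_iff jac_smult fract_scalar_def)
 hence "drho fs q n (jac coord_z (%f. scalar c * \<eta> f)) = (%i j. fs c * drho fs q n (jac coord_z \<eta>) i j)"
  by (simp add: fun_eq_iff drho_smult)
 thus ?case using 6
  by (intro ext) (simp add: Lie_chart_def dext_smult mv_def sum_distrib_left fract_scalar_def distrib_left mult.assoc)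
next
 case (7 \<eta> \<theta> v)
 thus ?case by (simp add: a_minus_def Mod_minus Mod_lie_closed Lie_chart_lie fun_eq_iff)
next
 case (8 \<eta> a v)
 thus ?case by (simp add: Lie_chart_smult Mod_out)
qed

text \<open>In a chart h' the transported vector has coordinates in \<open>loc2 h h'\<close>, so a
  large power of h leaves only denominators allowed on N(h'). Finitely many charts and indices
  permit a common exponent.\<close>

lemma local_lift:
 assumes w: "!!i. w i \<in> loc h"
 shows "\<forall>\<^sub>F M in sequentially. (%i. fcoord h ^ M * mv I I (rho fs q n (cc h coord_z)) w i) \<in>. SMod I q n"
proof -
 have "\<forall>\<^sub>F M in sequentially. fcoord h ^ M * mv I I (rho fs q n (cc h h')) w i \<in> loc h'" for h' i
 proof -
  have "mv I I (rho fs q n (cc h h')) w i \<in> loc2 h h'"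
   unfolding mv_def using w subsetD[OF loc_subset_loc2(1) loc_0]
   by (auto intro!: loc2_sum loc2_mult[OF rho_cc_loc2] intro: subsetD[OF loc_subset_loc2(1)])
  thus ?thesis using loc2_clear by (simp add: eventually_sequentially)
 qed
 hence "\<forall>\<^sub>F M in sequentially. \<forall>i\<in>I. fcoord h ^ M * mv I I (rho fs q n (cc h h')) w i \<in> loc h'" for h'
  by (intro eventually_ball_finite finite_polyrep) auto
 hence "\<forall>\<^sub>F M in sequentially. \<forall>h'. \<forall>i\<in>I. fcoord h ^ M * mv I I (rho fs q n (cc h h')) w i \<in> loc h'"
  unfolding coord_All by (intro eventually_conj) auto
 thus ?thesis
 proof eventually_elim
  case (elim M)
  show ?case unfolding Mod_carrier
  proof (intro conjI allI)
   show "mv I I (rho fs q n (mat 1)) (%i. fcoord h ^ M * mv I I (rho fs q n (cc h coord_z)) w i)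
     = (%i. fcoord h ^ M * mv I I (rho fs q n (cc h coord_z)) w i)"
    unfolding mv_smult mv_rho_mult by simp
   fix h' i
   show "mv I I (rho fs q n (cc coord_z h')) (%i. fcoord h ^ M * mv I I (rho fs q n (cc h coord_z)) w i) i \<in> loc h'"
    unfolding mv_smult mv_rho_mult cc_comp using elim by (cases "i \<in> I") (simp_all add: mv_out)
  qed
 qed
qed

text \<open>The standard vectors of the chart N(h), moved to the chart N(z) by \<rho>(C) and
  multiplied by h^N to remove their poles outside N(h). The first index counts the vectors, the
  second their components.\<close>

definition frame :: "coord => nat => 'i => 'i => 'k sphere fract"
 where "frame h N j i = (if i \<in> I then fcoord h ^ N * rho fs q n (cc h coord_z) i j else 0)"

lemma frame_Mod: "\<exists>N. \<forall>j\<in>I. frame h N j \<in>. SMod I q n"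
proof -
 have "\<forall>\<^sub>F M in sequentially. frame h M j \<in>. SMod I q n" if "j \<in> I" for j
 proof -
  have "(%i. fcoord h ^ M * mv I I (rho fs q n (cc h coord_z)) (%i. if i = j then 1 else 0) i) = frame h M j" for M
   using that finite_polyrep by (auto simp: fun_eq_iff frame_def mv_def if_distrib cong: if_cong)
  thus ?thesis using local_lift[of "%i. if i = j then 1 else 0" h] by simp
 qed
 hence "\<forall>\<^sub>F M in sequentially. \<forall>j\<in>I. frame h M j \<in>. SMod I q n"
  by (intro eventually_ball_finite finite_polyrep) auto
 thus ?thesis by (auto simp: eventually_sequentially)
qed

text \<open>The coefficients are the coordinates of v in the chart h with denominators cleared, as
  the second conjunct records. The exponent N of the frame is arbitrary here.\<close>

lemma frame_expand:
 assumes v: "v \<in>. SMod I q n"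
 shows "\<exists>K a. (\<forall>i. fcoord h ^ K * v i = (\<Sum>j\<in>I. incl (a j) * frame h N j i)) \<and>
  (\<forall>j\<in>I. fcoord h ^ K * mv I I (rho fs q n (cc coord_z h)) v j = incl (a j) * fcoord h ^ N)"
proof -
 let ?w = "mv I I (rho fs q n (cc coord_z h)) v"
 have "\<forall>\<^sub>F M in sequentially. \<exists>a. fcoord h ^ M * ?w j = incl a" for j
  using v loc_clear[of "?w j" h] by (auto simp: Mod_carrier eventually_sequentially)
 hence "\<forall>\<^sub>F M in sequentially. \<forall>j\<in>I. \<exists>a. fcoord h ^ M * ?w j = incl a"
  by (intro eventually_ball_finite finite_polyrep) auto
 then obtain M where "\<forall>j\<in>I. \<exists>a. fcoord h ^ M * ?w j = incl a" by (auto simp: eventually_sequentially)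
 then obtain a where a: "!!j. j \<in> I ==> fcoord h ^ M * ?w j = incl (a j)" by metis
 define w where "w = ?w"
 have v': "v = mv I I (rho fs q n (cc h coord_z)) w"
  using v by (simp add: w_def Mod_carrier mv_rho_fixed)
 have "fcoord h ^ (M + N) * v i = (\<Sum>j\<in>I. (fcoord h ^ M * w j) * frame h N j i)" for i
  by (simp add: v' mv_def frame_def sum_distrib_left power_add mult_ac)
 hence "fcoord h ^ (M + N) * v i = (\<Sum>j\<in>I. incl (a j) * frame h N j i)" for i
  by (simp add: w_def a cong: sum.cong)
 moreover have "fcoord h ^ (M + N) * ?w j = incl (a j) * fcoord h ^ N" if "j \<in> I" for j
  using a[OF that] by (simp add: power_add mult_ac)
 ultimately show ?thesis by blast
qed

end

text \<open>An equivariant matrix is constant and commutes with \<rho>(C) and with the derivative of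
  \<rho>, hence respects regularity on all charts and the action of vector fields.\<close>

lemma Mod_map:
 fixes q :: "('i, 'k::field_char_0) qmat" and q' :: "('j, 'k) qmat"
 assumes q: "polyrep I q" and q': "polyrep J q'" and T: "equivariant I q n J q' n' T"
 shows Mod_map_rho: "det G \<noteq> 0 ==> mv J I (fsm T) (mv I I (rho fs q n G) v)
   = mv J J (rho fs q' n' G) (mv J I (fsm T) v)"
  and Mod_map_hom: "mv J I (fsm T) \<in> av_hom (SMod I q n) (SMod J q' n')"
proof -
 let ?T = "mv J I (fsm T)"
 show 1: "?T (mv I I (rho fs q n G) v) = mv J J (rho fs q' n' G) (?T v)" if "det G \<noteq> 0" for G v
  unfolding mv_mv by (rule mv_cong) (simp_all add: equivariant_rho[OF T rhom_fs] that)
 have 2: "?T (mv I I (drho fs q n X) v) = mv J J (drho fs q' n' X) (?T v)" for X v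
  unfolding mv_mv by (rule mv_cong) (simp_all add: equivariant_drho[OF T rhom_fs])
 show "?T \<in> av_hom (SMod I q n) (SMod J q' n')"
 proof (rule av_homI)
  fix v assume "v \<in>. SMod I q n"
  thus "?T v \<in>. SMod J q' n'"
   by (simp add: Mod_carrier flip: 1) (auto intro: mv_loc)
 next
  fix \<eta> :: "'k sphere => 'k sphere" and v assume \<eta>: "\<eta> \<in> derivations" and v: "v \<in>. SMod I q n"
  have "?T (%i. if i \<in> I then dext \<eta> (v i) else 0) j = (if j \<in> J then dext \<eta> (?T v j) else 0)" for j
  proof (cases "j \<in> J")
   case True
   thus ?thesis by (simp add: fder_mv[OF fder_dext[OF \<eta>]] fder_scalar[OF fder_dext[OF \<eta>]]) (simp add: mv_def)
  qed (simp add: mv_out)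
  thus "?T (lie (SMod I q n) \<eta> v) = lie (SMod J q' n') \<eta> (?T v)"
   by (simp add: Lie_chart_def[abs_def] mv_add 2)
 qed (simp_all add: mv_add mv_smult)
qed

subsection \<open>Homomorphisms are equivariant matrices\<close>

text \<open>Failure of equivariance at c with determinants cleared. Written over an arbitrary ring,
  it can be moved along homomorphisms from k[s] to k[[s]] and, at s = 1, to k.\<close>

definition equi_defect :: "'i set => ('i, 'k) qmat => nat =>
  'j set => ('j, 'k) qmat => nat => ('j => 'i => 'k) => ('k => 'r::comm_ring_1) => 'r^2^2 => 'j => 'i => 'r"
 where "equi_defect I q n J q' n' T \<iota> c j i =
  det c ^ n' * mm I (%j i. \<iota> (T j i)) (%i j. pev \<iota> (q i j) c) j i
   - det c ^ n * mm J (%i j. pev \<iota> (q' i j) c) (%j i. \<iota> (T j i)) j i"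

lemma equi_defect_map: "rhom \<sigma> ==> \<sigma> (equi_defect I q n J q' n' T \<iota> c j i)
  = equi_defect I q n J q' n' T (%x. \<sigma> (\<iota> x)) (mmap \<sigma> c) j i"
 by (simp add: equi_defect_def rhomD mm_map pev_map mmap_det)

text \<open>The equation expresses (m+1) times the coefficient of s^(m+1) through coefficients of
  lower order, and m+1 is invertible in characteristic zero.\<close>

lemma linear_ode_unique:
 fixes Y :: "'j => 'k::field_char_0 fps"
 assumes ode: "!!j. j \<in> J ==> fps_deriv (Y j) = (\<Sum>l\<in>J. B j l * Y l)" and 0: "!!j. j \<in> J ==> fps_nth (Y j) 0 = 0"
  and j: "j \<in> J"
 shows "Y j = 0"
proof -
 have "\<forall>j\<in>J. fps_nth (Y j) m = 0" for m
 proof (induction m rule: less_induct)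
  case (less m)
  show ?case
  proof (cases m)
   case (Suc m')
   show ?thesis
   proof
    fix j assume j: "j \<in> J"
    have "fps_nth (B j l * Y l) m' = 0" if "l \<in> J" for l
     using less that Suc by (auto simp: fps_mult_nth intro!: sum.neutral)
    hence "fps_nth (fps_deriv (Y j)) m' = 0" unfolding ode[OF j] by (simp add: fps_sum_nth)
    thus "fps_nth (Y j) m = 0" unfolding Suc by (simp del: of_nat_Suc)
   qed
  qed (use 0 in simp)
 qed
 thus ?thesis using j by (auto simp: fps_eq_iff)
qed

text \<open>
 Along the curve \<open>c = 1 + s (g - 1)\<close> the matrices \<open>T \<rho>(c)\<close> and \<open>\<rho>'(c) T\<close> satisfy the same linear
 differential equation over \<open>k[[s]]\<close>, hence they agree; being rational in \<open>s\<close>, they agree at \<open>s = 1\<close>.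
\<close>

lemma equivariant_integrate:
 fixes q :: "('i, 'k::field_char_0) qmat" and q' :: "('j, 'k) qmat"
 assumes q: "polyrep I q" and q': "polyrep J q'"
  and d: "!!p m j i. [|j \<in> J; i \<in> I|] ==> mm I T (drho0 q n (munit p m)) j i = mm J (drho0 q' n' (munit p m)) T j i"
  and e: "!!j i. [|j \<in> J; i \<in> I|] ==> mm I T (rho0 q n (mat 1)) j i = mm J (rho0 q' n' (mat 1)) T j i"
 shows "equivariant I q n J q' n' T"
 unfolding equivariant_def
proof (intro allI impI ballI)
 fix g :: "'k^2^2" and j i assume g: "invertible g" and j: "j \<in> J" and i: "i \<in> I"
 let ?\<iota> = "fps_const :: 'k => 'k fps" and ?T = "%j i. fps_const (T j i)"
 define c where "c = jet (mat 1) (g - mat 1)"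
 \<comment> \<open>X = c' c^(-1), the inverse being the adjugate divided by det c, a unit in k[[s]]
   since c starts with the identity matrix.\<close>
 define X where "X = mmap fps_deriv c ** (\<chi> i j. inverse (det c) * mk22 (c$2$2) (- c$1$2) (- c$2$1) (c$1$1) $ i $ j)"
 let ?Y = "%j. equi_defect I q n J q' n' T ?\<iota> c j i"
 \<comment> \<open>Coefficients of the differential equation for the defect: the derivative of q' at
   1 along X, plus n trace X from the factor det^n.\<close>
 let ?B = "%j l. pdv ?\<iota> (q' j l) (mat 1) X + (if j = l then of_nat n * trace X else 0)"
 have c0: "mmap (%f. fps_nth f 0) c = mat 1" by (simp add: c_def)
 have det0: "fps_nth (det c) 0 = 1" using mmap_det[OF rhom_fps_nth_0, of c] by (simp add: c0)
 hence "inverse (det c) * det c = 1" by (intro inverse_mult_eq_1) simp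
 hence "inverse (det c) * (c$1$1 * c$2$2 - c$1$2 * c$2$1) = 1" by (simp add: det_2)
 hence "(\<chi> i j. inverse (det c) * mk22 (c$2$2) (- c$1$2) (- c$2$1) (c$1$1) $ i $ j) ** c = mat 1"
  by (simp add: vec_eq_iff forall_2 matrix_matrix_mult_def sum_2 mk22_def mat_def algebra_simps)
 hence Xc: "X ** c = mmap fps_deriv c" unfolding X_def by (simp flip: matrix_mul_assoc)
 have Xc': "fps_deriv (c $ i $ j) = (X ** c) $ i $ j" for i j by (simp add: Xc)
 have Dpev: "fps_deriv (pev ?\<iota> e c) = pdv ?\<iota> e c (X ** c)" for e
  by (subst pdv_chain) (simp_all add: Xc fps_deriv_mult)
 have Ddet: "fps_deriv (det c) = trace X * det c"
  by (simp add: det_2 trace_2 Xc' fps_deriv_mult matrix_matrix_mult_def sum_2 algebra_simps)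
 have Dpow: "fps_deriv (det c ^ m) = of_nat m * trace X * det c ^ m" for m
  by (induction m) (simp_all add: fps_deriv_mult Ddet algebra_simps)
 have hom: "rhom ?\<iota>" by simp
 have Dq: "fps_deriv (pev ?\<iota> (q k l) c) = mm I (%i j. pdv ?\<iota> (q i j) (mat 1) X) (%i j. pev ?\<iota> (q i j) c) k l"
  if "k \<in> I" "l \<in> I" for k l using that by (simp add: Dpev polyrep_pdv_left[OF q hom])
 have Dq': "fps_deriv (pev ?\<iota> (q' k l) c) = mm J (%i j. pdv ?\<iota> (q' i j) (mat 1) X) (%i j. pev ?\<iota> (q' i j) c) k l"
  if "k \<in> J" "l \<in> J" for k l using that by (simp add: Dpev polyrep_pdv_left[OF q' hom])
 have dm: "drho ?\<iota> q n (munit p m) k l = fps_const (drho0 q n (munit p m) k l)"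
  "drho ?\<iota> q' n' (munit p m) k' l' = fps_const (drho0 q' n' (munit p m) k' l')" for p m k l k' l'
  by (simp_all add: drho_map mmap_munit)
 have TX: "mm I ?T (drho ?\<iota> q n X) j i = mm J (drho ?\<iota> q' n' X) ?T j i" if j: "j \<in> J" and i: "i \<in> I" for j i
 proof -
  have "mm I ?T (drho ?\<iota> q n X) j i = (\<Sum>p\<in>UNIV. \<Sum>m\<in>UNIV. X $ p $ m * fps_const (mm I T (drho0 q n (munit p m)) j i))"
   unfolding mm_map[OF hom] unfolding mm_def drho_expand[of _ _ _ X] dm
   by (simp add: sum_2 sum_distrib_left sum.distrib distrib_left mult_ac del: fps_const_mult)
  also have "... = (\<Sum>p\<in>UNIV. \<Sum>m\<in>UNIV. X $ p $ m * fps_const (mm J (drho0 q' n' (munit p m)) T j i))"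
   using d[OF j i] by simp
  also have "... = mm J (drho ?\<iota> q' n' X) ?T j i"
   unfolding mm_map[OF hom] unfolding mm_def drho_expand[of _ _ _ X] dm
   by (simp add: sum_2 sum_distrib_left sum_distrib_right sum.distrib distrib_left distrib_right mult_ac del: fps_const_mult)
  finally show ?thesis .
 qed
 have e': "mm I ?T (%i j. pev ?\<iota> (q i j) (mat 1)) j i = mm J (%i j. pev ?\<iota> (q' i j) (mat 1)) ?T j i" if "j \<in> J" "i \<in> I" for j i
  using arg_cong[OF e[OF that], of fps_const] unfolding mm_map[OF hom] rho_1 pev_map[OF hom] mmap_1[OF hom] .
 have TX': "mm I ?T (%i j. pdv ?\<iota> (q i j) (mat 1) X) j i = mm J (%i j. pdv ?\<iota> (q' i j) (mat 1) X) ?T j i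
   + (of_nat n - of_nat n') * trace X * mm I ?T (%i j. pev ?\<iota> (q i j) (mat 1)) j i" if "j \<in> J" "i \<in> I" for j i
  using TX[OF that] e'[OF that]
  by (simp add: mm_def drho_def left_diff_distrib right_diff_distrib sum_subtractf mult.assoc mult.left_commute
    sum_distrib_left[symmetric]) (simp add: algebra_simps)
 let ?q = "%i j. pev ?\<iota> (q i j) c" and ?q' = "%i j. pev ?\<iota> (q' i j) c"
 let ?dq = "%i j. pdv ?\<iota> (q i j) (mat 1) X" and ?dq' = "%i j. pdv ?\<iota> (q' i j) (mat 1) X"
 have fin: "finite J" "finite I" using q q' by (simp_all add: polyrep_def)
 have ode: "fps_deriv (?Y j) = (\<Sum>l\<in>J. ?B j l * ?Y l)" if j: "j \<in> J" for j
 proof -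
  have 1: "fps_deriv (mm I ?T ?q j i) = mm J ?dq' (mm I ?T ?q) j i + (of_nat n - of_nat n') * trace X * mm I ?T ?q j i"
  proof -
   have "fps_deriv (mm I ?T ?q j i) = mm I ?T (mm I ?dq ?q) j i"
    by (simp add: mm_def[of I ?T] fps_deriv_sum fps_deriv_mult Dq i)
   also have "... = mm I (mm I ?T ?dq) ?q j i" by (simp add: mm_assoc)
   also have "... = mm I (mm J ?dq' ?T) ?q j i
     + (of_nat n - of_nat n') * trace X * mm I (mm I ?T (%i j. pev ?\<iota> (q i j) (mat 1))) ?q j i"
    by (simp add: mm_def[of I "mm I ?T ?dq"] mm_def[of I "mm J ?dq' ?T"] mm_def[of I "mm I ?T (%i j. pev ?\<iota> (q i j) (mat 1))"]
      TX' j distrib_right sum.distrib sum_distrib_left mult.assoc)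
   also have "mm I (mm I ?T (%i j. pev ?\<iota> (q i j) (mat 1))) ?q j i = mm I ?T ?q j i"
    unfolding mm_assoc by (rule mm_cong) (simp_all add: polyrep_mult[OF q hom] i)
   finally show ?thesis by (simp add: mm_assoc)
  qed
  have 2: "fps_deriv (mm J ?q' ?T j i) = mm J ?dq' (mm J ?q' ?T) j i"
  proof -
   have "fps_deriv (mm J ?q' ?T j i) = mm J (mm J ?dq' ?q') ?T j i"
    by (simp add: mm_def[of J _ ?T] fps_deriv_sum fps_deriv_mult Dq' j)
   thus ?thesis by (simp add: mm_assoc)
  qed
  have "fps_deriv (?Y j) = det c ^ n' * mm J ?dq' (mm I ?T ?q) j i - det c ^ n * mm J ?dq' (mm J ?q' ?T) j i
    + of_nat n * trace X * ?Y j"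
   unfolding equi_defect_def fps_deriv_sub fps_deriv_mult Dpow 1 2 by (simp add: algebra_simps)
  also have "det c ^ n' * mm J ?dq' (mm I ?T ?q) j i - det c ^ n * mm J ?dq' (mm J ?q' ?T) j i = (\<Sum>l\<in>J. ?dq' j l * ?Y l)"
   unfolding equi_defect_def mm_def[of J ?dq']
   by (simp add: sum_distrib_left right_diff_distrib sum_subtractf mult.left_commute)
  also have "of_nat n * trace X * ?Y j = (\<Sum>l\<in>J. (if j = l then of_nat n * trace X else 0) * ?Y l)"
   using fin j by (simp add: if_distrib[of "%x. x * _"] cong: if_cong)
  finally show ?thesis by (simp add: distrib_right sum.distrib)
 qed
 have init: "fps_nth (?Y j) 0 = 0" if "j \<in> J" for j
 proof -
  have "fps_nth (?Y j) 0 = equi_defect I q n J q' n' T (%x. x) (mat 1) j i"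
   by (subst equi_defect_map[OF rhom_fps_nth_0]) (simp add: c0)
  thus ?thesis using e[OF that i] by (simp add: equi_defect_def rho_1[abs_def])
 qed
 have Y0: "?Y j = 0" by (rule linear_ode_unique[OF ode init j])
 \<comment> \<open>The same curve over k[s], which embeds into k[[s]]: the polynomial defect
   vanishes as well and may be evaluated at s = 1, where the curve passes through g.\<close>
 let ?c = "(\<chi> i j. [:mat 1 $ i $ j, (g - mat 1) $ i $ j:]) :: 'k poly^2^2"
 have hp: "rhom (fps_of_poly :: 'k poly => 'k fps)" by (simp add: rhom_def fps_of_poly_add fps_of_poly_mult)
 have "mmap fps_of_poly ?c = c"
  by (simp add: vec_eq_iff c_def jet_def fps_of_poly_pCons mult.commute)
 hence "fps_of_poly (equi_defect I q n J q' n' T (%c. [:c:]) ?c j i) = 0"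
  using Y0 by (simp add: equi_defect_map[OF hp] fps_of_poly_const)
 hence P0: "equi_defect I q n J q' n' T (%c. [:c:]) ?c j i = 0" by (simp add: fps_of_poly_eq_iff[of _ 0, simplified])
 have h1: "rhom (%p :: 'k poly. poly p 1)" by (simp add: rhom_def)
 have "mmap (%p. poly p 1) ?c = g" by (simp add: vec_eq_iff)
 hence "equi_defect I q n J q' n' T (%c. c) g j i = 0"
  using arg_cong[OF P0, of "%p. poly p 1"] by (simp add: equi_defect_map[OF h1])
 moreover have "det g \<noteq> 0" using g by (simp add: invertible_det_nz)
 ultimately have "mm I T (%i j. pev0 (q i j) g) j i / det g ^ n = mm J (%i j. pev0 (q' i j) g) T j i / det g ^ n'"
  by (simp add: equi_defect_def frac_eq_eq mult.commute)
 thus "mm I T (rho0 q n g) j i = mm J (rho0 q' n' g) T j i"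
  by (simp add: mm_def rho_def sum_divide_distrib)
qed

lemma av_hom_lincomb:
 assumes f: "f \<in> av_hom (SMod I q n) (SMod J q' n')" and I: "polyrep I q"
  and S: "finite S" and w: "!!s. s \<in> S ==> w s \<in>. SMod I q n"
 shows "f (%i. \<Sum>s\<in>S. incl (a s) * w s i) = (%j. \<Sum>s\<in>S. incl (a s) * f (w s) j)
  \<and> (%i. \<Sum>s\<in>S. incl (a s) * w s i) \<in>. SMod I q n"
 using S w
proof (induction S rule: finite_induct)
 case empty
 have 0: "(%i. 0) \<in>. SMod I q n" using av_zero_closed[OF av_module_Mod[OF I]] by simp
 have "f (%i. incl 0 * 0) = (%j. incl 0 * f (%i. 0) j)" using av_hom_smult[OF f 0, of 0] by simp
 thus ?case using 0 by simp
next
 case (insert s S)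
 have 1: "(%i. incl (a s) * w s i) \<in>. SMod I q n"
  using av_smult_closed[OF av_module_Mod[OF I, of n], of "w s" "a s"] insert.prems by simp
 have 2: "f (%i. incl (a s) * w s i) = (%j. incl (a s) * f (w s) j)"
  using av_hom_smult[OF f, of "w s" "a s"] insert.prems by simp
 have 3: "(%i. \<Sum>s\<in>S. incl (a s) * w s i) \<in>. SMod I q n" using insert by simp
 show ?case
  using av_hom_add[OF f 1 3] av_add_closed[OF av_module_Mod[OF I, of n] 1 3] insert 2 by simp
qed

text \<open>Fullness. By A-linearity f is determined by its values on the frame over N(z), so it is
  a matrix T0 with entries in \<open>loc coord_z\<close>. Compatibility with \<eta> and with a
  \<eta> for a parameter a shows that T0 commutes with every matrix unit; hence all vector fields
  kill T0, its entries are constant by \<open>loc_constant\<close>, and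
  \<open>equivariant_integrate\<close> passes to the group.\<close>

lemma Mod_hom_matrix:
 fixes q :: "('i, 'k::field_char_0) qmat" and q' :: "('j, 'k) qmat"
 assumes q: "polyrep I q" and q': "polyrep J q'" and f: "f \<in> av_hom (SMod I q n) (SMod J q' n')"
 shows "\<exists>T. equivariant I q n J q' n' T \<and> (\<forall>j\<in>J. \<forall>i\<in>I. mm I T (rho0 q n (mat 1)) j i = T j i) \<and>
  (\<forall>v\<in>carrier (SMod I q n). f v = mv J I (fsm T) v)"
proof -
 let ?M = "SMod I q n" and ?N = "SMod J q' n'" and ?z = "coord_z"
 note fin = finite_polyrep[OF q]
 obtain N where N: "!!i. i \<in> I ==> frame I q n ?z N i \<in>. ?M" using frame_Mod[OF q] by blast
 define w where "w = frame I q n ?z N"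
 have w: "w i \<in>. ?M" if "i \<in> I" for i using N that by (simp add: w_def)
 let ?e = "rho fs q n (mat 1)" and ?e' = "rho fs q' n' (mat 1)" and ?zN = "fcoord ?z ^ N :: 'k sphere fract"
 have w_eq: "w i k = (if k \<in> I then ?zN * ?e k i else 0)" for i k
  by (simp add: w_def frame_def[OF q])
 \<comment> \<open>Up to the factor z^N the frame over N(z) consists of the columns of \<rho>(1), so
   dividing by z^N gives the columns of the matrix of f.\<close>
 define T0 where "T0 j i = f (w i) j / ?zN" for j i
 have fw: "f (w i) j = ?zN * T0 j i" for i j by (simp add: T0_def)
 have fwM: "f (w i) \<in>. ?N" if "i \<in> I" for i using f w[OF that] by (rule av_hom_closed)
 have fv: "f v = mv J I T0 v" if v: "v \<in>. ?M" for v
 proof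
  fix j
  obtain K a where K: "!!i. fcoord ?z ^ K * v i = (\<Sum>j\<in>I. incl (a j) * w j i)"
   and a: "!!j. j \<in> I ==> fcoord ?z ^ K * mv I I (rho fs q n (cc ?z ?z)) v j = incl (a j) * ?zN"
   using frame_expand[OF q v, of ?z N] unfolding w_def by blast
  have a': "incl (a j) * ?zN = fcoord ?z ^ K * v j" if "j \<in> I" for j
   using a[OF that] v by (simp add: Mod_carrier)
  have "(%j. fcoord ?z ^ K * f v j) = f (%i. fcoord ?z ^ K * v i)"
   using av_hom_smult[OF f v, of "coord_fun ?z ^ K"] by (simp add: incl_power)
  also have "... = (%j. \<Sum>s\<in>I. incl (a s) * f (w s) j)"
   unfolding K using av_hom_lincomb[OF f q fin, of w a] w by simp
  also have "... = (%j. \<Sum>s\<in>I. (incl (a s) * ?zN) * T0 j s)" by (simp add: fw mult.assoc)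
  also have "... = (%j. fcoord ?z ^ K * (\<Sum>s\<in>I. T0 j s * v s))"
   by (simp add: a' sum_distrib_left mult_ac cong: sum.cong)
  finally have 1: "fcoord ?z ^ K * f v j = fcoord ?z ^ K * (\<Sum>s\<in>I. T0 j s * v s)" by (rule fun_cong)
  have "f v \<in>. ?N" using f v by (rule av_hom_closed)
  thus "f v j = mv J I T0 v j" using 1 by (cases "j \<in> J") (simp_all add: mv_def Mod_out[OF q'])
 qed
 have T0e: "mm I T0 ?e j i = T0 j i" if "j \<in> J" "i \<in> I" for j i
 proof -
  have "?zN * T0 j i = mv J I T0 (w i) j" unfolding fw[symmetric] fv[OF w[OF that(2)]] ..
  also have "... = ?zN * mm I T0 ?e j i"
   using that by (simp add: mv_def mm_def w_eq sum_distrib_left mult_ac cong: sum.cong)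
  finally show ?thesis by simp
 qed
 have T0_loc: "T0 j i \<in> loc ?z" if "i \<in> I" for j i
 proof -
  have "mv J J (rho fs q' n' (cc ?z ?z)) (f (w i)) j \<in> loc ?z" using fwM[OF that] unfolding Mod_carrier by blast
  hence "f (w i) j \<in> loc ?z" using fwM[OF that] by (simp add: Mod_carrier)
  from loc_mult[OF this loc_inverse[of ?z N]] show ?thesis by (simp add: T0_def)
 qed
 have e'T0: "mm J ?e' T0 j i = T0 j i" if "j \<in> J" "i \<in> I" for j i
 proof -
  have "f (w i) j = mv J J ?e' (f (w i)) j" using fwM[OF that(2)] by (simp add: Mod_carrier)
  also have "... = ?zN * mm J ?e' T0 j i"
   using that by (simp add: mv_def mm_def fw sum_distrib_left mult_ac cong: sum.cong)
  finally show ?thesis by (simp add: fw)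
 qed
 \<comment> \<open>Both sides of f(\<eta> w) = \<eta> f(w) on a frame vector w; the terms in which
   \<eta> differentiates z^N agree and drop out.\<close>
 have comm: "dext \<eta> (T0 j i) = mm I T0 (drho fs q n (jac ?z \<eta>)) j i - mm J (drho fs q' n' (jac ?z \<eta>)) T0 j i"
  if \<eta>: "\<eta> \<in> derivations" and j: "j \<in> J" and i: "i \<in> I" for \<eta> j i
 proof -
  note D = fder_dext[OF \<eta>]
  let ?J = "jac ?z \<eta>"
  have "Lie_chart I q n ?z \<eta> (w i) k = (if k \<in> I then dext \<eta> ?zN * ?e k i + ?zN * drho fs q n ?J k i else 0)" for k
  proof (cases "k \<in> I")
   case True
   have "mv I I (drho fs q n ?J) (w i) k = ?zN * mm I (drho fs q n ?J) ?e k i"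
    using True by (simp add: mv_def mm_def w_eq sum_distrib_left mult_ac cong: sum.cong)
   thus ?thesis using True i
    by (simp add: Lie_chart_def w_eq fder_mult[OF D] rho_1_const[OF q D] drho_rho_1[OF q rhom_fs])
  qed (simp add: Lie_chart_def mv_out)
  hence "f (Lie_chart I q n ?z \<eta> (w i)) j = (\<Sum>k\<in>I. T0 j k * (dext \<eta> ?zN * ?e k i + ?zN * drho fs q n ?J k i))"
   using fv[OF Mod_lie_closed[OF q \<eta> w[OF i]]] j by (simp add: mv_def cong: sum.cong)
  also have "... = dext \<eta> ?zN * mm I T0 ?e j i + ?zN * mm I T0 (drho fs q n ?J) j i"
   by (simp add: mm_def sum_distrib_left distrib_left sum.distrib mult_ac)
  finally have 1: "f (Lie_chart I q n ?z \<eta> (w i)) j = dext \<eta> ?zN * T0 j i + ?zN * mm I T0 (drho fs q n ?J) j i"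
   by (simp add: T0e[OF j i])
  have "f (Lie_chart I q n ?z \<eta> (w i)) j = Lie_chart J q' n' ?z \<eta> (f (w i)) j"
   using av_hom_lie[OF f \<eta> w[OF i]] by simp
  also have "... = dext \<eta> ?zN * T0 j i + ?zN * dext \<eta> (T0 j i) + ?zN * mm J (drho fs q' n' ?J) T0 j i"
   using j by (simp add: Lie_chart_def fw fder_mult[OF D] mv_def mm_def sum_distrib_left mult_ac)
  finally have "?zN * (mm I T0 (drho fs q n ?J) j i) = ?zN * (dext \<eta> (T0 j i) + mm J (drho fs q' n' ?J) T0 j i)"
   using 1 by (simp add: distrib_left)
  thus ?thesis by simp
 qed
 have unit: "mm I T0 (drho fs q n (munit p m)) j i = mm J (drho fs q' n' (munit p m)) T0 j i"
  if j: "j \<in> J" and i: "i \<in> I" for p m j i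
 proof -
  \<comment> \<open>The Jacobian of a \<eta> is a times that of \<eta> plus the products of
    derivatives of a with components of \<eta>. For a = t_p and this rotation, which sends t_m to z
    and kills the other parameter, that extra matrix is z E_{p,m}; subtracting a times the identity
    for \<eta> isolates it.\<close>
  let ?\<eta> = "rot (param_coord ?z m) ?z" and ?a = "chart_param ?z p :: 'k sphere"
  have \<eta>: "?\<eta> \<in> derivations" by (rule rot_derivation)
  have \<eta>t: "?\<eta> (chart_param ?z l) = (if m = l then coord_fun ?z else 0)" for l
   using two_cases[of m] two_cases[of l] by (auto simp: rot_coord)
  have J: "jac ?z (%f. ?a * ?\<eta> f) = (\<chi> r c. incl ?a * jac ?z ?\<eta> $ r $ c) + (\<chi> r c. fcoord ?z * munit p m $ r $ c)"
   by (simp only: vec_eq_iff jac_smult pd_param \<eta>t vector_add_component vec_lambda_beta munit_def) auto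
  have 1: "incl ?a * dext ?\<eta> (T0 j i) = mm I T0 (drho fs q n (jac ?z (%f. ?a * ?\<eta> f))) j i
    - mm J (drho fs q' n' (jac ?z (%f. ?a * ?\<eta> f))) T0 j i"
   using comm[OF der_smult_closed[OF \<eta>] j i, of ?a] by (simp only: dext_smult[OF \<eta>])
  have "mm I T0 (drho fs q n (jac ?z (%f. ?a * ?\<eta> f))) j i
    = incl ?a * mm I T0 (drho fs q n (jac ?z ?\<eta>)) j i + fcoord ?z * mm I T0 (drho fs q n (munit p m)) j i"
   unfolding J by (simp only: mm_def drho_add drho_smult) (simp add: sum_distrib_left distrib_left sum.distrib mult_ac)
  moreover have "mm J (drho fs q' n' (jac ?z (%f. ?a * ?\<eta> f))) T0 j i
    = incl ?a * mm J (drho fs q' n' (jac ?z ?\<eta>)) T0 j i + fcoord ?z * mm J (drho fs q' n' (munit p m)) T0 j i"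
   unfolding J by (simp only: mm_def drho_add drho_smult) (simp add: sum_distrib_left distrib_left distrib_right sum.distrib mult_ac)
  ultimately have "fcoord ?z * mm I T0 (drho fs q n (munit p m)) j i = fcoord ?z * mm J (drho fs q' n' (munit p m)) T0 j i"
   using 1 unfolding comm[OF \<eta> j i] by (simp add: right_diff_distrib)
  thus ?thesis by simp
 qed
 have "mm I T0 (drho fs q n X) j i = mm J (drho fs q' n' X) T0 j i" if "j \<in> J" "i \<in> I" for X j i
 proof -
  have "mm I T0 (drho fs q n X) j i = (\<Sum>p\<in>UNIV. \<Sum>m\<in>UNIV. X $ p $ m * mm I T0 (drho fs q n (munit p m)) j i)"
   unfolding mm_def drho_expand[of _ _ _ X] by (simp add: sum_2 sum_distrib_left sum.distrib distrib_left mult_ac)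
  also have "... = (\<Sum>p\<in>UNIV. \<Sum>m\<in>UNIV. X $ p $ m * mm J (drho fs q' n' (munit p m)) T0 j i)"
   using unit[OF that] by simp
  also have "... = mm J (drho fs q' n' X) T0 j i"
   unfolding mm_def drho_expand[of _ _ _ X] by (simp add: sum_2 sum_distrib_left sum_distrib_right sum.distrib distrib_left distrib_right mult_ac)
  finally show ?thesis .
 qed
 hence "dext \<eta> (T0 j i) = 0" if "\<eta> \<in> derivations" "j \<in> J" "i \<in> I" for \<eta> j i
  using comm[OF that] that by simp
 hence "\<exists>c. T0 j i = fs c" if "j \<in> J" "i \<in> I" for j i
  using loc_constant[OF T0_loc[OF that(2)]] rot_derivation that by blast
 then obtain T where T: "!!j i. j \<in> J ==> i \<in> I ==> T0 j i = fs (T j i)" by metis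
 have cong: "mm I T0 A j i = mm I (fsm T) A j i" "mm J B T0 j i = mm J B (fsm T) j i"
  if "j \<in> J" "i \<in> I" for A B j i using that by (simp_all add: mm_def T)
 note inj = fract_scalar_inj[THEN injD]
 have rho1: "rho fs q n (mat 1) = (%i j. fs (rho0 q n (mat 1) i j))"
  "rho fs q' n' (mat 1) = (%i j. fs (rho0 q' n' (mat 1) i j))"
  by (simp_all add: rho_map mmap_1)
 have Te: "mm I T (rho0 q n (mat 1)) j i = T j i" if "j \<in> J" "i \<in> I" for j i
  using T0e[OF that] that by (intro inj) (simp add: mm_map[OF rhom_fs] rho1 T cong[OF that])
 have "equivariant I q n J q' n' T"
 proof (rule equivariant_integrate[OF q q'])
  fix p m j i assume ji: "j \<in> J" "i \<in> I"
  show "mm I T (drho0 q n (munit p m)) j i = mm J (drho0 q' n' (munit p m)) T j i"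
   using unit[OF ji, of p m] by (intro inj) (simp add: mm_map cong[OF ji] drho_map mmap_munit)
  have "mm J (rho0 q' n' (mat 1)) T j i = T j i"
   using e'T0[OF ji] ji by (intro inj) (simp add: mm_map[OF rhom_fs] rho1 T cong[OF ji])
  thus "mm I T (rho0 q n (mat 1)) j i = mm J (rho0 q' n' (mat 1)) T j i"
   using Te[OF ji] by simp
 qed
 moreover have "f v = mv J I (fsm T) v" if "v \<in>. ?M" for v
  unfolding fv[OF that] by (rule mv_cong) (simp_all add: T)
 ultimately show ?thesis using Te by blast
qed

text \<open>Faithfulness: on the i-th frame vector over N(z) the map has the value z^N times the
  i-th column of T \<rho>(1) = T.\<close>

lemma Mod_hom_matrix_unique:
 fixes q :: "('i, 'k::field_char_0) qmat" and T T' :: "'j => 'i => 'k"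
 assumes q: "polyrep I q"
  and Te: "!!j i. [|j \<in> J; i \<in> I|] ==> mm I T (rho0 q n (mat 1)) j i = T j i"
  and Te': "!!j i. [|j \<in> J; i \<in> I|] ==> mm I T' (rho0 q n (mat 1)) j i = T' j i"
  and eq: "!!v. v \<in>. SMod I q n ==> mv J I (fsm T) v = mv J I (fsm T') v"
  and ji: "j \<in> J" "i \<in> I"
 shows "T j i = T' j i"
proof -
 obtain N where N: "frame I q n coord_z N i \<in>. SMod I q n" using frame_Mod[OF q] ji by blast
 let ?zN = "fcoord coord_z ^ N :: 'k sphere fract"
 have 1: "mv J I (fsm T) (frame I q n coord_z N i) j = ?zN * fs (mm I T (rho0 q n (mat 1)) j i)" for T
 proof -
  have "fs (mm I T (rho0 q n (mat 1)) j i) = mm I (fsm T) (rho fs q n (mat 1)) j i"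
   by (simp add: mm_map rho_map mmap_1)
  thus ?thesis using ji by (simp add: mv_def mm_def frame_def[OF q] sum_distrib_left mult_ac cong: sum.cong)
 qed
 have "?zN * fs (T j i) = ?zN * fs (T' j i)"
  using fun_cong[OF eq[OF N], of j] unfolding 1 Te[OF ji] Te'[OF ji] .
 hence "fs (T j i) = fs (T' j i)" by simp
 thus ?thesis by (rule injD[OF fract_scalar_inj])
qed

subsection \<open>Generators and relations\<close>

definition free_lift :: "('p, 'x) ring_scheme => ('s => 'p) => ('s \<Rightarrow>\<^sub>0 int) => 'p"
 where "free_lift P f c = (\<Oplus>\<^bsub>P\<^esub>s\<in>keys c. [lookup c s] \<cdot>\<^bsub>P\<^esub> f s)"

lemma free_lift:
 assumes P: "abelian_group P" and f: "f \<in> S \<rightarrow> carrier P"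
 shows free_lift_closed: "keys c \<subseteq> S ==> free_lift P f c \<in>. P"
  and free_lift_add: "[|keys c \<subseteq> S; keys d \<subseteq> S|] ==> free_lift P f (c + d) = free_lift P f c +[P] free_lift P f d"
  and free_lift_of: "s \<in> S ==> free_lift P f (frag_of s) = f s"
  and free_lift_0: "free_lift P f 0 = 0[P]"
  and free_lift_diff: "[|keys c \<subseteq> S; keys d \<subseteq> S|] ==> free_lift P f (c - d) = free_lift P f c -[P] free_lift P f d"
proof -
 interpret P: abelian_group P by (rule P)
 have "f ` S \<subseteq> carrier P" using f by auto
 from P.add.free_Abelian_group_universal[OF this]
 obtain h where h: "h \<in> hom (free_Abelian_group S) (add_monoid P)" and hf: "!!x. x \<in> S ==> h (frag_of x) = f x"
  by metis
 interpret h: group_hom "free_Abelian_group S" "add_monoid P" h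
  by (intro group_hom.intro group_hom_axioms.intro group_free_Abelian_group P.a_group h)
 let ?S = "%c K. \<Sum>s\<in>K. frag_cmul (lookup c s) (frag_of s)"
 have eq: "free_lift P f c = h c" if c: "keys c \<subseteq> S" for c
 proof -
  have sum: "h (?S c K)
    = (\<Oplus>\<^bsub>P\<^esub>s\<in>K. [lookup c s] \<cdot>\<^bsub>P\<^esub> f s) \<and>
   keys (?S c K) \<subseteq> S" if "finite K" "K \<subseteq> S" for K
   using that
  proof (induction K rule: finite_induct)
   case empty
   thus ?case using h.hom_one by simp
  next
   case (insert s K)
   let ?a = "frag_cmul (lookup c s) (frag_of s)"
   have a: "keys ?a \<subseteq> S" using insert.prems keys_cmul[of "lookup c s" "frag_of s"] by auto
   have s: "h ?a = [lookup c s] \<cdot>\<^bsub>P\<^esub> f s"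
    using h.hom_int_pow[of "frag_of s" "lookup c s"] insert.prems
    by (simp add: hf add_pow_def)
   have "h (?a + (?S c K))
     = h ?a +[P] h (?S c K)"
    using h.hom_mult[of ?a "?S c K"] a insert by simp
   moreover have "(%s. [lookup c s] \<cdot>\<^bsub>P\<^esub> f s) \<in> insert s K \<rightarrow> carrier P"
    using f insert.prems by auto
   moreover have "keys (?a + (?S c K)) \<subseteq> S"
    using keys_add a insert by (metis (no_types, lifting) Un_subset_iff insert_subset order_trans)
   ultimately show ?case using insert s by (simp add: P.finsum_insert)
  qed
  have "c = ?S c (keys c)"
   using frag_expansion[of c] by (simp add: frag_extend_def)
  thus ?thesis using sum[OF finite_keys c] by (simp add: free_lift_def)
 qed
 show 1: "free_lift P f c \<in>. P" if "keys c \<subseteq> S" for c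
  using h.hom_closed[of c] that by (simp add: eq)
 show 2: "free_lift P f (c + d) = free_lift P f c +[P] free_lift P f d" if "keys c \<subseteq> S" "keys d \<subseteq> S" for c d
  using h.hom_mult[of c d] that keys_add[of c d] by (subst (1 2 3) eq) auto
 show "free_lift P f (frag_of s) = f s" if "s \<in> S" using that by (simp add: eq hf)
 show "free_lift P f 0 = 0[P]" by (simp add: free_lift_def)
 show "free_lift P f (c - d) = free_lift P f c -[P] free_lift P f d" if "keys c \<subseteq> S" "keys d \<subseteq> S" for c d
 proof -
  have k: "keys (c - d) \<subseteq> S" using keys_diff[of c d] that by auto
  have "free_lift P f (c - d) +[P] free_lift P f d = free_lift P f c" using 2[OF k that(2)] by simp
  thus ?thesis using 1[OF that(2)] 1[OF k] by (metis P.add.inv_solve_right a_minus_def 1 that(1))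
 qed
qed

definition gen_coset :: "'s set => ('s \<Rightarrow>\<^sub>0 int) set => ('s \<Rightarrow>\<^sub>0 int) => ('s \<Rightarrow>\<^sub>0 int) set"
 where "gen_coset S R c = generate (free_Abelian_group S) R #>\<^bsub>free_Abelian_group S\<^esub> c"

lemma gen_class_coset: "gen_class S R s = gen_coset S R (frag_of s)"
 by (simp add: gen_class_def gen_coset_def)

context
 fixes S :: "'s set" and R :: "('s \<Rightarrow>\<^sub>0 int) set"
 assumes R': "\<forall>r\<in>R. keys r \<subseteq> S"
begin

abbreviation (input) "GR == gen_rel S R"
abbreviation (input) "cls == gen_coset S R"
abbreviation (input) "FS == free_Abelian_group S"
abbreviation (input) "RS == generate FS R"

lemmas R = R'[rule_format]

lemma gen_normal: "RS \<lhd> FS"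
proof -
 interpret F: comm_group "FS" by (rule abelian_free_Abelian_group)
 have "subgroup RS FS"
  by (rule F.generate_is_subgroup) (use R in auto)
 thus ?thesis by (rule F.subgroup_imp_normal)
qed

lemma gen_rel_simps:
 "carrier GR = {cls c |c. keys c \<subseteq> S}" 
 "0[GR] = cls 0"
 "[|keys c \<subseteq> S; keys d \<subseteq> S|] ==> cls c +[GR] cls d = cls (c + d)"
proof -
 interpret N: normal "RS" "FS" by (rule gen_normal)
 show "carrier GR = {cls c |c. keys c \<subseteq> S}"
  by (auto simp: gen_rel_def Let_def FactGroup_def RCOSETS_def gen_coset_def)
 show "0[GR] = cls 0"
  using N.coset_join2[OF _ N.subgroup_axioms, of 0] generate.one[of "FS" R]
  by (simp add: gen_rel_def Let_def FactGroup_def gen_coset_def N.subset)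
 show "[|keys c \<subseteq> S; keys d \<subseteq> S|] ==> cls c +[GR] cls d = cls (c + d)"
  using N.rcos_sum[of c d] by (simp add: gen_rel_def Let_def FactGroup_def gen_coset_def)
qed

lemma gen_rel_abelian: "abelian_group GR"
proof (rule abelian_groupI)
 fix x assume "x \<in>. GR"
 then obtain c where c: "keys c \<subseteq> S" "x = cls c" by (auto simp: gen_rel_simps)
 hence "cls (- c) +[GR] x = 0[GR]" by (simp add: gen_rel_simps keys_minus)
 moreover have "cls (- c) \<in>. GR" using c by (auto simp: gen_rel_simps keys_minus intro!: exI[of _ "- c"])
 ultimately show "\<exists>y\<in>carrier GR. y +[GR] x = 0[GR]" by blast
next
 fix x y assume "x \<in>. GR" "y \<in>. GR"
 then obtain c d where cd: "keys c \<subseteq> S" "x = cls c" "keys d \<subseteq> S" "y = cls d"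
  by (auto simp: gen_rel_simps)
 have k: "keys (c + d) \<subseteq> S" using keys_add[of c d] cd by auto
 show "x +[GR] y \<in>. GR" using cd k by (auto simp: gen_rel_simps)
 show "x +[GR] y = y +[GR] x" using cd by (simp add: gen_rel_simps add.commute)
 fix z assume "z \<in>. GR"
 then obtain e where e: "keys e \<subseteq> S" "z = cls e" by (auto simp: gen_rel_simps)
 have "keys (d + e) \<subseteq> S" using keys_add[of d e] cd e by auto
 thus "x +[GR] y +[GR] z = x +[GR] (y +[GR] z)"
  using cd e k by (simp add: gen_rel_simps add.assoc)
next
 show "0[GR] \<in>. GR" by (auto simp: gen_rel_simps intro!: exI[of _ 0])
 fix x assume "x \<in>. GR"
 thus "0[GR] +[GR] x = x" by (auto simp: gen_rel_simps)
qed

lemma gen_coset_diff: "[|keys c \<subseteq> S; keys d \<subseteq> S|] ==>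
  cls (c - d) = cls c -[GR] cls d"
proof -
 assume cd: "keys c \<subseteq> S" "keys d \<subseteq> S"
 interpret abelian_group "GR" by (rule gen_rel_abelian)
 have k: "keys (c - d) \<subseteq> S" using keys_diff[of c d] cd by auto
 have cl: "cls e \<in>. GR" if "keys e \<subseteq> S" for e
  using that by (auto simp: gen_rel_simps)
 have "cls (c - d) +[GR] cls d = cls c"
  using cd k by (simp add: gen_rel_simps)
 thus ?thesis using cl[OF k] cl[OF cd(1)] cl[OF cd(2)] by (metis add.inv_solve_right a_minus_def)
qed

lemma gen_class_closed: "s \<in> S ==> gen_class S R s \<in>. GR"
 by (auto simp: gen_class_coset gen_rel_simps)

lemma gen_coset_rel: "r \<in> R ==> cls r = 0[GR]"
proof -
 interpret N: normal "RS" "FS" by (rule gen_normal)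
 assume r: "r \<in> R"
 hence "r \<in> RS" by (rule generate.incl)
 thus ?thesis using N.coset_join2[OF _ N.subgroup_axioms, of r] N.coset_join2[OF _ N.subgroup_axioms, of 0] R[OF r] generate.one[of "FS" R]
  by (simp add: gen_rel_simps gen_coset_def)
qed

lemma gen_rel_induct [consumes 1, case_names zero diff of]:
 assumes x: "x \<in>. GR" and 0: "Q 0[GR]"
  and diff: "!!x y. [|x \<in>. GR; y \<in>. GR; Q x; Q y|] ==> Q (x -[GR] y)"
  and of: "!!s. s \<in> S ==> Q (gen_class S R s)"
 shows "Q x"
proof -
 obtain c where c: "keys c \<subseteq> S" "x = cls c" using x by (auto simp: gen_rel_simps)
 have "Q (cls c)"
 proof (rule free_Abelian_group_induct[OF c(1), where P = "%c. Q (cls c)"])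
  fix c d assume 1: "keys c \<subseteq> S" "keys d \<subseteq> S" "Q (cls c)" "Q (cls d)"
  show "Q (cls (c - d))"
   unfolding gen_coset_diff[OF 1(1,2)] by (rule diff) (use 1 in \<open>auto simp: gen_rel_simps\<close>)
 qed (use 0 of in \<open>simp_all add: gen_rel_simps gen_class_coset\<close>)
 thus ?thesis using c by simp
qed

text \<open>The representative picked by \<open>SOME\<close> differs from c by an element of the
  subgroup generated by the relations, and the free lift vanishes on that subgroup.\<close>

lemma gen_lift_coset:
 assumes P: "abelian_group P" and f: "f \<in> S \<rightarrow> carrier P" and rel: "!!r. r \<in> R ==> free_lift P f r = 0[P]"
  and c: "keys c \<subseteq> S"
 shows "gen_lift P f (cls c) = free_lift P f c"
proof -
 interpret P: abelian_group P by (rule P)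
 interpret N: normal "RS" "FS" by (rule gen_normal)
 have 0: "keys d \<subseteq> S \<and> free_lift P f d = 0[P]" if "d \<in> RS" for d
  using that
 proof induction
  case (inv h)
  thus ?case using free_lift_diff[OF P f _ R[OF inv], of 0] R[OF inv] rel[OF inv]
   by (simp add: keys_minus free_lift_0[OF P f] a_minus_def)
 next
  case (eng h1 h2)
  thus ?case using keys_add[of h1 h2] by (auto simp: free_lift_add[OF P f])
 qed (use R rel in \<open>simp_all add: free_lift_0[OF P f]\<close>)
 have "cls c \<noteq> {}" using N.rcos_self[OF _ N.subgroup_axioms, of c] c by (auto simp: gen_coset_def)
 hence "(SOME d. d \<in> cls c) \<in> cls c" by (simp add: some_in_eq)
 then obtain d where d: "d \<in> RS" "(SOME d. d \<in> cls c) = d + c"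
  unfolding gen_coset_def r_coset_def by auto
 show ?thesis using 0[OF d(1)] c free_lift_closed[OF P f c]
  by (simp add: gen_lift_def d(2) flip: free_lift_def) (simp add: free_lift_add[OF P f])
qed

lemma gen_lift:
 assumes P: "abelian_group P" and f: "f \<in> S \<rightarrow> carrier P" and rel: "!!r. r \<in> R ==> free_lift P f r = 0[P]"
 shows gen_lift_closed: "x \<in>. GR ==> gen_lift P f x \<in>. P"
  and gen_lift_add: "[|x \<in>. GR; y \<in>. GR|] ==>
   gen_lift P f (x +[GR] y) = gen_lift P f x +[P] gen_lift P f y"
  and gen_lift_class: "s \<in> S ==> gen_lift P f (gen_class S R s) = f s"
proof -
 note eq = gen_lift_coset[OF P f rel]
 show "gen_lift P f x \<in>. P" if "x \<in>. GR"
  using that by (auto simp: gen_rel_simps eq free_lift_closed[OF P f])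
 show "gen_lift P f (x +[GR] y) = gen_lift P f x +[P] gen_lift P f y"
  if "x \<in>. GR" "y \<in>. GR"
 proof -
  obtain c d where cd: "keys c \<subseteq> S" "x = cls c" "keys d \<subseteq> S" "y = cls d"
   using \<open>x \<in> carrier GR\<close> \<open>y \<in> carrier GR\<close> by (auto simp: gen_rel_simps)
  thus ?thesis using keys_add[of c d] by (simp add: gen_rel_simps eq) (subst eq, auto simp: free_lift_add[OF P f])
 qed
 show "gen_lift P f (gen_class S R s) = f s" if "s \<in> S"
  using that by (simp add: gen_class_coset eq free_lift_of[OF P f])
qed

text \<open>
 If additive maps \<open>\<Theta>\<close> and \<open>\<theta>\<close> to spaces of functions are given, \<open>\<theta>\<close> injective, and on generators \<open>f\<close>
 corresponds to an additive map \<open>\<Lambda>\<close>, then \<open>f\<close> respects all relations.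
\<close>

lemma gen_lift_transfer:
 fixes \<theta> :: "'p => 'i => 'f::ab_group_add" and \<Theta> :: "('s \<Rightarrow>\<^sub>0 int) set => 'j => 'g::ab_group_add"
 assumes P: "abelian_group P" and f: "f \<in> S \<rightarrow> carrier P"
  and \<theta>: "!!x y. [|x \<in>. P; y \<in>. P|] ==> \<theta> (x +[P] y) = (%i. \<theta> x i + \<theta> y i)"
  and inj: "inj_on \<theta> (carrier P)"
  and \<Theta>: "!!x y. [|x \<in>. GR; y \<in>. GR|] ==> \<Theta> (x +[GR] y) = (%i. \<Theta> x i + \<Theta> y i)"
  and \<Lambda>: "!!v w. \<Lambda> (%i. v i + w i) = (%i. \<Lambda> v i + \<Lambda> w i)"
  and gen: "!!s. s \<in> S ==> \<theta> (f s) = \<Lambda> (\<Theta> (gen_class S R s))"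
 shows gen_transfer_closed: "x \<in>. GR ==> gen_lift P f x \<in>. P"
  and gen_transfer_add: "[|x \<in>. GR; y \<in>. GR|] ==>
   gen_lift P f (x +[GR] y) = gen_lift P f x +[P] gen_lift P f y"
  and gen_transfer_class: "s \<in> S ==> gen_lift P f (gen_class S R s) = f s"
  and gen_transfer: "x \<in>. GR ==> \<theta> (gen_lift P f x) = \<Lambda> (\<Theta> x)"
proof -
 interpret P: abelian_group P by (rule P)
 interpret T: abelian_group "GR" by (rule gen_rel_abelian)
 have diff: "\<theta> (x -[P] y) = (%i. \<theta> x i - \<theta> y i)" if "x \<in>. P" "y \<in>. P" for x y
 proof -
  have "x -[P] y +[P] y = x" using that by (simp add: a_minus_def P.a_assoc P.l_neg)
  thus ?thesis using \<theta>[of "x -[P] y" y] that by (simp add: fun_eq_iff)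
 qed
 have Diff: "\<Theta> (x -[GR] y) = (%i. \<Theta> x i - \<Theta> y i)" if "x \<in>. GR" "y \<in>. GR" for x y
 proof -
  have "x -[GR] y +[GR] y = x" using that by (simp add: a_minus_def T.a_assoc T.l_neg)
  thus ?thesis using \<Theta>[of "x -[GR] y" y] that by (simp add: fun_eq_iff)
 qed
 have \<Lambda>d: "\<Lambda> (%i. v i - w i) = (%i. \<Lambda> v i - \<Lambda> w i)" for v w
  using \<Lambda>[of "%i. v i - w i" w] by (simp add: fun_eq_iff)
 have 0: "\<theta> 0[P] = (%i. 0)" "\<Theta> 0[GR] = (%i. 0)" "\<Lambda> (%i. 0) = (%i. 0)"
  using \<theta>[of "0[P]" "0[P]"] \<Theta>[of "0[GR]" "0[GR]"] \<Lambda>d[of "%i. 0" "%i. 0"]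
  by (simp_all add: fun_eq_iff)
 have key: "\<theta> (free_lift P f c) = \<Lambda> (\<Theta> (cls c))" if "keys c \<subseteq> S" for c
 proof (rule free_Abelian_group_induct[OF that, where P = "%c. \<theta> (free_lift P f c) = \<Lambda> (\<Theta> (cls c))"])
  show "\<theta> (free_lift P f 0) = \<Lambda> (\<Theta> (cls 0))"
   using 0 by (simp add: free_lift_0[OF P f] flip: gen_rel_simps(2))
 next
  fix x y assume 2: "keys x \<subseteq> S" "keys y \<subseteq> S"
   "\<theta> (free_lift P f x) = \<Lambda> (\<Theta> (cls x))" "\<theta> (free_lift P f y) = \<Lambda> (\<Theta> (cls y))"
  have "cls x \<in>. GR" "cls y \<in>. GR" using 2 by (auto simp: gen_rel_simps)
  thus "\<theta> (free_lift P f (x - y)) = \<Lambda> (\<Theta> (cls (x - y)))"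
   using 2 by (simp add: free_lift_diff[OF P f] gen_coset_diff diff Diff \<Lambda>d free_lift_closed[OF P f])
 next
  fix a assume "a \<in> S"
  thus "\<theta> (free_lift P f (frag_of a)) = \<Lambda> (\<Theta> (cls (frag_of a)))"
   by (simp add: free_lift_of[OF P f] gen flip: gen_class_coset)
 qed
 have rel: "free_lift P f r = 0[P]" if "r \<in> R" for r
  using key[OF R[OF that]] gen_coset_rel[OF that] 0 free_lift_closed[OF P f R[OF that]] inj by (metis P.zero_closed inj_onD)
 note gl = gen_lift[OF P f rel]
 show "x \<in>. GR ==> gen_lift P f x \<in>. P"
  "[|x \<in>. GR; y \<in>. GR|] ==>
   gen_lift P f (x +[GR] y) = gen_lift P f x +[P] gen_lift P f y"
  "s \<in> S ==> gen_lift P f (gen_class S R s) = f s" by (simp_all add: gl)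
 show "\<theta> (gen_lift P f x) = \<Lambda> (\<Theta> x)" if "x \<in>. GR"
  using that key by (auto simp: gen_rel_simps gen_lift_coset[OF P f rel])
qed

end

subsection \<open>Tensor products\<close>

context
 fixes R :: "('r, 'x) ring_scheme" and M :: "('r, 'm, 'y) module_scheme" and N :: "('r, 'n, 'z) module_scheme"
 assumes M: "Module.module R M" and N: "Module.module R N"
begin

abbreviation (input) "MN == carrier M \<times> carrier N"
abbreviation (input) "RT == tensor R M N"
abbreviation (input) "RR == tensor_relations R M N"
abbreviation (input) "tp == pure_tensor R M N"

interpretation M: Module.module R M by (rule M)
interpretation N: Module.module R N by (rule N)

lemma tensor_relations_keys: "\<forall>r\<in>RR. keys r \<subseteq> MN"
proof -
 have 1: "keys (frag_of a - frag_of b) \<subseteq> {a, b}" for a b :: "'m \<times> 'n"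
  using keys_diff[of "frag_of a" "frag_of b"] by (auto simp: keys_frag_of)
 have 2: "keys (frag_of a - frag_of b - frag_of c) \<subseteq> {a, b, c}" for a b c :: "'m \<times> 'n"
  using keys_diff[of "frag_of a - frag_of b" "frag_of c"] 1[of a b] by (auto simp: keys_frag_of)
 show ?thesis
  unfolding tensor_relations_def
  by (intro ballI, elim UnE CollectE exE conjE; hypsubst; rule order_trans[OF 1] order_trans[OF 2]) auto
qed

lemmas tensor_abelian = gen_rel_abelian[OF tensor_relations_keys, folded tensor_def]
 and tensor_induct = gen_rel_induct[OF tensor_relations_keys, folded tensor_def, case_names zero diff of]
 and tensor_transfer = gen_lift_transfer[OF tensor_relations_keys, folded tensor_def]

lemma pure_tensor_closed: "[|m \<in>. M; n \<in>. N|] ==> tp m n \<in>. RT"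
 unfolding pure_tensor_def tensor_def by (rule gen_class_closed[OF tensor_relations_keys]) auto

lemma tensor_rel_eq:
 assumes "r \<in> RR"
 shows "r = frag_of a - frag_of b - frag_of c ==> a \<in> MN ==> b \<in> MN ==> c \<in> MN ==>
   gen_class MN RR a = gen_class MN RR b
    +[RT] gen_class MN RR c"
  and "r = frag_of a - frag_of b ==> a \<in> MN ==> b \<in> MN ==>
   gen_class MN RR a = gen_class MN RR b"
proof -
 interpret T: abelian_group "RT" by (rule tensor_abelian)
 note K = tensor_relations_keys
 let ?c = "gen_class MN RR"
 have cl: "?c s \<in>. RT" if "s \<in> MN" for s
  unfolding tensor_def by (rule gen_class_closed[OF K that])
 note diff = gen_coset_diff[OF K, folded tensor_def]
 have 0: "gen_coset MN RR r = 0[RT]"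
  unfolding tensor_def by (rule gen_coset_rel[OF K assms])
 have min: "x = y" if "x -[RT] y = 0[RT]" "x \<in>. RT" "y \<in>. RT" for x y
 proof -
  have "x = (x -[RT] y) +[RT] y" using that(2,3) by (simp add: a_minus_def T.a_assoc T.l_neg)
  thus ?thesis using that by simp
 qed
 show "?c a = ?c b +[RT] ?c c"
  if r: "r = frag_of a - frag_of b - frag_of c" and abc: "a \<in> MN" "b \<in> MN" "c \<in> MN"
 proof (rule min)
  have k: "keys (frag_of a - frag_of b) \<subseteq> MN"
   using keys_diff[of "frag_of a" "frag_of b"] abc by (auto simp: keys_frag_of)
  show "?c a -[RT] (?c b +[RT] ?c c) = 0[RT]"
   using 0 abc k cl unfolding r
   by (simp add: diff flip: gen_class_coset) (simp add: a_minus_def T.minus_add T.a_ac)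
 qed (use abc cl in auto)
 show "?c a = ?c b" if r: "r = frag_of a - frag_of b" and ab: "a \<in> MN" "b \<in> MN"
 proof (rule min)
  show "?c a -[RT] ?c b = 0[RT]"
   using 0 ab unfolding r by (simp add: diff flip: gen_class_coset)
 qed (use ab cl in auto)
qed

lemma pure_tensor_add_left: "[|m \<in>. M; m' \<in>. M; n \<in>. N|] ==>
  tp (m +[M] m') n = tp m n +[RT] tp m' n"
 unfolding pure_tensor_def by (rule tensor_rel_eq(1)[OF _ refl]) (auto simp: tensor_relations_def)

lemma pure_tensor_add_right: "[|m \<in>. M; n \<in>. N; n' \<in>. N|] ==>
  tp m (n +[N] n') = tp m n +[RT] tp m n'"
 unfolding pure_tensor_def by (rule tensor_rel_eq(1)[OF _ refl]) (auto simp: tensor_relations_def)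

lemma pure_tensor_smult: "[|a \<in>. R; m \<in>. M; n \<in>. N|] ==>
  tp (a .[M] m) n = tp m (a .[N] n)"
 unfolding pure_tensor_def by (rule tensor_rel_eq(2)[OF _ refl]) (auto simp: tensor_relations_def)

lemma tensor_lift:
 assumes P: "abelian_group P" and f: "!!m n. [|m \<in>. M; n \<in>. N|] ==> f (m, n) \<in>. P"
  and left: "!!m m' n. [|m \<in>. M; m' \<in>. M; n \<in>. N|] ==> f (m +[M] m', n) = f (m, n) +[P] f (m', n)"
  and right: "!!m n n'. [|m \<in>. M; n \<in>. N; n' \<in>. N|] ==> f (m, n +[N] n') = f (m, n) +[P] f (m, n')"
  and bal: "!!a m n. [|a \<in>. R; m \<in>. M; n \<in>. N|] ==> f (a .[M] m, n) = f (m, a .[N] n)"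
 shows tensor_lift_closed: "x \<in>. RT ==> gen_lift P f x \<in>. P"
  and tensor_lift_add: "[|x \<in>. RT; y \<in>. RT|] ==>
   gen_lift P f (x +[RT] y) = gen_lift P f x +[P] gen_lift P f y"
  and tensor_lift_pure: "[|m \<in>. M; n \<in>. N|] ==> gen_lift P f (tp m n) = f (m, n)"
proof -
 interpret P: abelian_group P by (rule P)
 have f': "f \<in> MN \<rightarrow> carrier P" using f by auto
 note l = free_lift_of[OF P f'] free_lift_diff[OF P f'] free_lift_closed[OF P f']
 have 3: "free_lift P f (frag_of a - frag_of b - frag_of c) = 0[P]"
  if "f a = f b +[P] f c" and abc: "a \<in> MN" "b \<in> MN" "c \<in> MN" for a b c
 proof -
  have "keys (frag_of a - frag_of b) \<subseteq> MN"
   using keys_diff[of "frag_of a" "frag_of b"] abc by (auto simp: keys_frag_of)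
  moreover have "f b \<in>. P" "f c \<in>. P" using f' abc by auto
  moreover from this have "f b +[P] f c -[P] f b -[P] f c = (f b +[P] f c) +[P] \<ominus>\<^bsub>P\<^esub> (f b +[P] f c)"
   by (simp add: a_minus_def P.minus_add P.a_assoc)
  ultimately show ?thesis using abc that(1) by (simp add: l P.r_neg)
 qed
 have 2: "free_lift P f (frag_of a - frag_of b) = 0[P]"
  if "f a = f b" "a \<in> MN" "b \<in> MN" for a b
 proof -
  have "f b \<in>. P" using f' that by auto
  thus ?thesis using that by (simp add: l a_minus_def P.r_neg)
 qed
 have "free_lift P f r = 0[P]" if "r \<in> RR" for r
  using that unfolding tensor_relations_def
  by (elim UnE CollectE exE conjE; hypsubst) (auto intro!: 2 3 simp: left right bal)
 note g = gen_lift[OF tensor_relations_keys P f' this, folded tensor_def]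
 show "x \<in>. RT ==> gen_lift P f x \<in>. P"
  "[|x \<in>. RT; y \<in>. RT|] ==>
   gen_lift P f (x +[RT] y) = gen_lift P f x +[P] gen_lift P f y"
  "[|m \<in>. M; n \<in>. N|] ==> gen_lift P f (tp m n) = f (m, n)"
  by (simp_all add: g pure_tensor_def)
qed

end

lemma av_struct_on_simps [simp]:
 "carrier (av_struct_on G s l) = carrier G" "zero (av_struct_on G s l) = zero G" "add (av_struct_on G s l) = add G"
 "smult (av_struct_on G s l) = s" "lie (av_struct_on G s l) = l"
 by (simp_all add: av_struct_on_def)

lemma additive:
 assumes T: "abelian_group T" and P: "abelian_group P" and f: "!!x. x \<in>. T ==> f x \<in>. P"
  and add: "!!x y. [|x \<in>. T; y \<in>. T|] ==> f (x +[T] y) = f x +[P] f y"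
 shows additive_zero: "f 0[T] = 0[P]"
  and additive_diff: "[|x \<in>. T; y \<in>. T|] ==> f (x -[T] y) = f x -[P] f y"
  and additive_finsum: "g \<in> A \<rightarrow> carrier T ==> finite A ==> f (finsum T g A) = finsum P (%a. f (g a)) A"
proof -
 interpret T: abelian_group T by (rule T)
 interpret P: abelian_group P by (rule P)
 show 0: "f 0[T] = 0[P]"
  using add[of "0[T]" "0[T]"] f[of "0[T]"] by (simp add: P.add.l_cancel_one')
 show "f (x -[T] y) = f x -[P] f y" if xy: "x \<in>. T" "y \<in>. T"
 proof -
  have "f (\<ominus>\<^bsub>T\<^esub> y) +[P] f y = 0[P]" using add[of "\<ominus>\<^bsub>T\<^esub> y" y] xy by (simp add: T.l_neg 0)
  hence "f (\<ominus>\<^bsub>T\<^esub> y) = \<ominus>\<^bsub>P\<^esub> f y" using f xy by (metis P.minus_equality T.a_inv_closed)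
  thus ?thesis using xy by (simp add: a_minus_def add)
 qed
 show "f (finsum T g A) = finsum P (%a. f (g a)) A" if "g \<in> A \<rightarrow> carrier T" "finite A"
  using that(2,1) by (induction A rule: finite_induct) (simp_all add: 0 add f Pi_iff)
qed

lemma finsum_Mod:
 assumes q: "polyrep I q" and g: "g \<in> A \<rightarrow> carrier (SMod I q n)" and A: "finite A"
 shows "finsum (SMod I q n) g A = (%i. \<Sum>a\<in>A. g a i)"
proof -
 interpret abelian_group "SMod I q n" by (rule Mod_abelian[OF q])
 show ?thesis using A g by (induction A rule: finite_induct) (simp_all add: Pi_iff)
qed

lemma Mod_lincomb_closed:
 assumes q: "polyrep I q" and A: "finite A" and w: "!!a. a \<in> A ==> w a \<in> X" and X: "(%i. 0) \<in> X"
  "!!v w. v \<in> X ==> w \<in> X ==> (%i. v i + w i) \<in> X" "!!a v. v \<in> X ==> (%i. incl a * v i) \<in> X"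
 shows "(%i. \<Sum>a\<in>A. incl (c a) * w a i) \<in> X"
 using A w by (induction A rule: finite_induct) (simp_all add: X)

lemma av_struct_on_abelian:
 assumes "abelian_group G"
 shows "abelian_group (av_struct_on G s l)"
proof -
 interpret abelian_group G by (rule assms)
 show ?thesis
 proof (rule abelian_groupI)
  fix x assume "x \<in>. av_struct_on G s l"
  thus "\<exists>y\<in>carrier (av_struct_on G s l). y +[av_struct_on G s l] x = 0[av_struct_on G s l]"
   by (auto intro: bexI[of _ "\<ominus>\<^bsub>G\<^esub> x"] simp: l_neg)
 qed (simp_all add: a_ac)
qed

text \<open>The frames of the three charts together generate: h^K v is a combination of the frame of
  h, and \<open>partition_principle\<close> combines the charts.\<close>

lemma fin_gen_Mod:
 fixes q :: "('i, 'k::field_char_0) qmat"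
 assumes q: "polyrep I q"
 shows "\<exists>w :: coord \<times> 'i => _. (\<forall>s\<in>UNIV \<times> I. w s \<in>. SMod I q n) \<and>
  (\<forall>v\<in>carrier (SMod I q n). \<exists>a. v = (%i. \<Sum>s\<in>UNIV \<times> I. incl (a s) * w s i))"
proof -
 let ?M = "SMod I q n"
 have fin: "finite (UNIV \<times> I :: (coord \<times> 'i) set)" using finite_polyrep[OF q] by (simp add: UNIV_coord)
 have "\<forall>h. \<exists>N. \<forall>j\<in>I. frame I q n h N j \<in>. ?M" using frame_Mod[OF q] by blast
 then obtain N where N: "!!h j. j \<in> I ==> frame I q n h (N h) j \<in>. ?M" by metis
 define w where "w s = frame I q n (fst s) (N (fst s)) (snd s)" for s
 have w: "w s \<in>. ?M" if "s \<in> UNIV \<times> I" for s using that N by (auto simp: w_def)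
 let ?L = "%a i. \<Sum>s\<in>UNIV \<times> I. incl (a s) * w s i"
 let ?X = "{?L a |a. True}"
 have "v \<in> ?X" if v: "v \<in>. ?M" for v
 proof (rule partition_principle[OF Mod_module[OF q] v])
  note cl = av_moduleD(4-)[OF av_module_Mod[OF q, of n], simplified]
  show "?X \<subseteq> carrier ?M"
   using Mod_lincomb_closed[OF q fin, of w "carrier ?M"] w cl by auto
  show "x +[?M] y \<in> ?X" if x: "x \<in> ?X" and y: "y \<in> ?X" for x y
  proof -
   obtain a c where "x = ?L a" "y = ?L c" using x y by blast
   hence eq: "x +[?M] y = ?L (%s. a s + c s)"
    by (simp add: incl_add distrib_right sum.distrib)
   show ?thesis unfolding eq by (rule CollectI, rule exI[of _ "%s. a s + c s"], simp)
  qed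
  show "d .[?M] x \<in> ?X" if x: "x \<in> ?X" for x d
  proof -
   obtain a where "x = ?L a" using x by blast
   hence eq: "d .[?M] x = ?L (%s. d * a s)"
    by (simp add: incl_mult sum_distrib_left mult.assoc)
   show ?thesis unfolding eq by (rule CollectI, rule exI[of _ "%s. d * a s"], simp)
  qed
  fix h
  obtain K a where K: "!!i. fcoord h ^ K * v i = (\<Sum>j\<in>I. incl (a j) * frame I q n h (N h) j i)"
   using frame_expand[OF q v, of h "N h"] by blast
  define c where "c s = (if fst s = h then a (snd s) else 0)" for s
  have "?L c i = fcoord h ^ K * v i" for i
  proof -
   have "?L c i = (\<Sum>h'\<in>UNIV. \<Sum>j\<in>I. incl (c (h', j)) * w (h', j) i)"
    by (simp add: sum.cartesian_product)
   also have "... = (\<Sum>j\<in>I. incl (a j) * frame I q n h (N h) j i)"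
    by (cases h) (simp_all add: UNIV_coord c_def w_def)
   finally show ?thesis by (simp add: K)
  qed
  hence eq: "coord_fun h ^ K .[?M] v = ?L c" by (simp add: incl_power)
  show "\<exists>K. coord_fun h ^ K .[?M] v \<in> ?X"
   by (rule exI[of _ K], unfold eq, rule CollectI, rule exI[of _ c], simp)
 qed
 thus ?thesis using w by (intro exI[of _ w]) blast
qed

text \<open>One exponent K serves all v because the module is finitely generated. Thus h^K times the
  coordinates in the chart h are A-linear forms with values in A, the dual objects to a
  frame.\<close>

lemma frame_dual:
 assumes q: "polyrep I q"
 shows "\<exists>K. \<forall>v\<in>carrier (SMod I q n). \<forall>i\<in>I. \<exists>a. fcoord h ^ K * mv I I (rho fs q n (cc coord_z h)) v i = incl a"
proof -
 let ?R = "mv I I (rho fs q n (cc coord_z h))" and ?S = "(UNIV :: coord set) \<times> I"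
 obtain w where w: "!!s. s \<in> ?S ==> w s \<in>. SMod I q n"
  and ex: "!!v. v \<in>. SMod I q n ==> \<exists>a. v = (%i. \<Sum>s\<in>?S. incl (a s) * w s i)"
  using fin_gen_Mod[OF q, of n] by (elim exE conjE) (rule that, erule (1) bspec, erule (1) bspec)
 have fin: "finite ?S" using finite_polyrep[OF q] by (simp add: UNIV_coord)
 have "\<forall>\<^sub>F K in sequentially. \<exists>a. fcoord h ^ K * ?R (w s) i = incl a" if "s \<in> ?S" for s i
  using w[OF that] loc_clear[of "?R (w s) i" h] by (auto simp: Mod_carrier eventually_sequentially)
 hence "\<forall>\<^sub>F K in sequentially. \<forall>s\<in>?S. \<forall>i\<in>I. \<exists>a. fcoord h ^ K * ?R (w s) i = incl a"
  using fin finite_polyrep[OF q] by (intro eventually_ball_finite ballI)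
 then obtain K where "\<forall>s\<in>?S. \<forall>i\<in>I. \<exists>a. fcoord h ^ K * ?R (w s) i = incl a" unfolding eventually_sequentially by blast
 then obtain b where b: "!!s i. s \<in> ?S ==> i \<in> I ==> fcoord h ^ K * ?R (w s) i = incl (b s i)" by metis
 show ?thesis
 proof (intro exI[of _ K] ballI)
  fix v i assume v: "v \<in>. SMod I q n" and i: "i \<in> I"
  obtain c where c: "v = (%i. \<Sum>s\<in>?S. incl (c s) * w s i)" using ex[OF v] by (elim exE)
  have "?R v i = (\<Sum>s\<in>?S. incl (c s) * ?R (w s) i)"
   using i unfolding c mv_def by (simp add: sum_distrib_left mult.left_commute sum.swap[of _ I])
  hence "fcoord h ^ K * ?R v i = (\<Sum>s\<in>?S. incl (c s) * (fcoord h ^ K * ?R (w s) i))"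
   by (simp add: sum_distrib_left mult.left_commute)
  also have "... = incl (\<Sum>s\<in>?S. c s * b s i)" using b[OF _ i] unfolding incl_sum by (intro sum.cong refl) (simp add: incl_mult)
  finally show "\<exists>a. fcoord h ^ K * ?R v i = incl a" by blast
 qed
qed

definition qtensor :: "('i, 'k) qmat => ('j, 'k) qmat => 'i \<times> 'j => 'i \<times> 'j => 'k pexp"
 where "qtensor q q' = (%(i, j) (i', j'). PM (q i i') (q' j j'))"

lemma rho_qtensor: "rho \<iota> (qtensor q q') (n + n') G (i, j) (i', j') = rho \<iota> q n G i i' * rho \<iota> q' n' G j j'"
 by (simp add: rho_def qtensor_def power_add)

lemma drho_qtensor: "drho \<iota> (qtensor q q') (n + n') X (i, j) (i', j')
  = drho \<iota> q n X i i' * rho \<iota> q' n' (mat 1) j j' + rho \<iota> q n (mat 1) i i' * drho \<iota> q' n' X j j'"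
 by (simp add: drho_def rho_1 qtensor_def algebra_simps)

lemma mm_times: "mm (I \<times> J) (%(i, j) (i', j'). A i i' * B j j') (%(i, j) (i', j'). A' i i' * B' j j') (i, j) (i', j')
  = mm I A A' i i' * mm J B B' j j'"
 by (simp add: mm_def sum_product sum.cartesian_product split_def mult_ac)

lemma polyrep_qtensor:
 assumes "polyrep I q" "polyrep J q'"
 shows "polyrep (I \<times> J) (qtensor q q')"
proof -
 have "(%a b. pev0 (qtensor q q' a b) g) = (%(i, j) (i', j'). pev0 (q i i') g * pev0 (q' j j') g)" for g
  by (simp add: qtensor_def fun_eq_iff)
 thus ?thesis using assms by (auto simp: polyrep_def mm_times qtensor_def)
qed

lemma mv_times: "mv (I \<times> J) (I' \<times> J') (%(i, j) (i', j'). A i i' * B j j') (%(i, j). v i * w j) = (%(i, j). mv I I' A v i * mv J J' B w j)"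
 by (auto simp: fun_eq_iff mv_def sum_product sum.cartesian_product split_def mult_ac)

context
 fixes I :: "'i set" and q :: "('i, 'k::field_char_0) qmat" and n :: nat
  and J :: "'j set" and q' :: "('j, 'k) qmat" and n' :: nat
  and M :: "('k sphere, 'm) av_struct" and N :: "('k sphere, 'n) av_struct" and \<alpha> \<beta>
 assumes q: "polyrep I q" and q': "polyrep J q'" and M: "av_module M" and N: "av_module N"
  and \<alpha>: "\<alpha> \<in> av_hom M (SMod I q n)" "bij_betw \<alpha> (carrier M) (carrier (SMod I q n))"
  and \<beta>: "\<beta> \<in> av_hom N (SMod J q' n')" "bij_betw \<beta> (carrier N) (carrier (SMod J q' n'))"
begin

abbreviation (input) "TT == tensor univ_ring M N"
abbreviation (input) "QQ == SMod (I \<times> J) (qtensor q q') (n + n')"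
abbreviation (input) "pt == pure_tensor univ_ring M N"

lemmas tmod = av_module_module[OF M] av_module_module[OF N]
lemmas qq = polyrep_qtensor[OF q q']
lemmas tind = tensor_induct[OF tmod, consumes 1, case_names zero diff of]

lemma rho_qtensor_fun: "rho fs (qtensor q q') (n + n') G = (%(i, j) (i', j'). rho fs q n G i i' * rho fs q' n' G j j')"
 by (simp add: fun_eq_iff rho_qtensor)

lemma tensor_vec_closed:
 assumes "v \<in>. SMod I q n" "w \<in>. SMod J q' n'"
 shows "(%(i, j). v i * w j) \<in>. QQ"
 using assms by (auto simp: Mod_carrier rho_qtensor_fun mv_times intro: loc_mult)

lemma Lie_chart_tensor:
 assumes \<eta>: "\<eta> \<in> derivations" and v: "v \<in>. SMod I q n" and w: "w \<in>. SMod J q' n'"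
 shows "Lie_chart (I \<times> J) (qtensor q q') (n + n') coord_z \<eta> (%(i, j). v i * w j)
  = (%(i, j). Lie_chart I q n coord_z \<eta> v i * w j + v i * Lie_chart J q' n' coord_z \<eta> w j)"
proof -
 let ?J = "jac coord_z \<eta>"
 have "drho fs (qtensor q q') (n + n') ?J = (%a b. (%(i, j) (i', j'). drho fs q n ?J i i' * rho fs q' n' (mat 1) j j') a b
   + (%(i, j) (i', j'). rho fs q n (mat 1) i i' * drho fs q' n' ?J j j') a b)"
  by (simp add: fun_eq_iff drho_qtensor)
 note e = this
 have 1: "mv (I \<times> J) (I \<times> J) (drho fs (qtensor q q') (n + n') ?J) (%(i, j). v i * w j)
   = (%(i, j). mv I I (drho fs q n ?J) v i * w j + v i * mv J J (drho fs q' n' ?J) w j)"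
  unfolding e mv_add_mat mv_times using v w by (simp add: Mod_carrier split_def)
 show ?thesis
  using Mod_out[OF q v] Mod_out[OF q' w]
  by (auto simp: fun_eq_iff Lie_chart_def 1 fder_mult[OF fder_dext[OF \<eta>]] algebra_simps)
qed

definition tvec :: "(('m \<times> 'n) \<Rightarrow>\<^sub>0 int) set => 'i \<times> 'j => 'k sphere fract"
 where "tvec = gen_lift QQ (%(m, n). (%(i, j). \<alpha> m i * \<beta> n j))"

lemma tvec:
 shows tvec_closed: "x \<in>. TT ==> tvec x \<in>. QQ"
  and tvec_add: "[|x \<in>. TT; y \<in>. TT|] ==> tvec (x +[TT] y) = (%i. tvec x i + tvec y i)"
  and tvec_pure: "[|m \<in>. M; k \<in>. N|] ==> tvec (pt m k) = (%(i, j). \<alpha> m i * \<beta> k j)"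
proof -
 note l = tensor_lift[OF tmod Mod_abelian[OF qq, of "n + n'"], where f = "%(m, n). (%(i, j). \<alpha> m i * \<beta> n j)", folded tvec_def]
 note h = av_homD[OF \<alpha>(1)] av_homD[OF \<beta>(1)]
 show "x \<in>. TT ==> tvec x \<in>. QQ"
  by (rule l(1)) (auto simp: h tensor_vec_closed[unfolded split_def] algebra_simps split_def)
 show "[|x \<in>. TT; y \<in>. TT|] ==> tvec (x +[TT] y) = (%i. tvec x i + tvec y i)"
  by (rule l(2)[simplified]) (auto simp: h tensor_vec_closed[unfolded split_def] algebra_simps split_def)
 show "[|m \<in>. M; k \<in>. N|] ==> tvec (pt m k) = (%(i, j). \<alpha> m i * \<beta> k j)"
  by (rule l(3)[simplified]) (auto simp: h tensor_vec_closed[unfolded split_def] algebra_simps split_def)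
qed

definition tsm :: "'k sphere => (('m \<times> 'n) \<Rightarrow>\<^sub>0 int) set => (('m \<times> 'n) \<Rightarrow>\<^sub>0 int) set"
 where "tsm a = gen_lift TT (%(m, n). pt (a .[M] m) n)"

lemma tsm:
 shows tsm_closed: "x \<in>. TT ==> tsm a x \<in>. TT"
  and tsm_add: "[|x \<in>. TT; y \<in>. TT|] ==> tsm a (x +[TT] y) = tsm a x +[TT] tsm a y"
  and tsm_pure: "[|m \<in>. M; k \<in>. N|] ==> tsm a (pt m k) = pt (a .[M] m) k"
proof -
 interpret M: Module.module univ_ring M by (rule tmod)
 interpret N: Module.module univ_ring N by (rule tmod)
 note l = tensor_lift[OF tmod tensor_abelian[OF tmod], where f = "%(m, n). pt (a .[M] m) n", folded tsm_def]
 have c: "a .[M] (b .[M] m) = b .[M] (a .[M] m)" if "m \<in>. M" for b m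
  using M.smult_assoc1[of a b m] M.smult_assoc1[of b a m] that by (simp add: mult.commute)
 note h = pure_tensor_closed[OF tmod] pure_tensor_add_left[OF tmod] pure_tensor_add_right[OF tmod]
  pure_tensor_smult[OF tmod] av_moduleD(4-)[OF M] av_moduleD(4-)[OF N] M.smult_r_distr c
 show "x \<in>. TT ==> tsm a x \<in>. TT"
  by (rule l(1)) (simp_all add: h)
 show "[|x \<in>. TT; y \<in>. TT|] ==> tsm a (x +[TT] y) = tsm a x +[TT] tsm a y"
  by (rule l(2)) (simp_all add: h)
 show "[|m \<in>. M; k \<in>. N|] ==> tsm a (pt m k) = pt (a .[M] m) k"
  by (rule l(3)[simplified]) (simp_all add: h)
qed

interpretation M: Module.module univ_ring M by (rule tmod)
interpretation N: Module.module univ_ring N by (rule tmod)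
interpretation TT: abelian_group TT by (rule tensor_abelian[OF tmod])

lemma av_tensor_simps:
 "carrier (av_tensor M N) = carrier TT" "add (av_tensor M N) = add TT" "zero (av_tensor M N) = zero TT"
 "smult (av_tensor M N) = tsm"
 "lie (av_tensor M N) = (%\<eta>. gen_lift TT (%(m, n). pt (lie M \<eta> m) n +[TT] pt m (lie N \<eta> n)))"
 by (simp_all add: av_tensor_def Let_def tsm_def[abs_def])

lemmas tsm_additive = additive[OF tensor_abelian[OF tmod] tensor_abelian[OF tmod] tsm_closed tsm_add]

lemma tensor_minus_add:
 "[|a \<in>. TT; b \<in>. TT; c \<in>. TT; d \<in>. TT|] ==>
  (a +[TT] b) -[TT] (c +[TT] d) = (a -[TT] c) +[TT] (b -[TT] d)"
 by (simp add: a_minus_def TT.minus_add TT.a_ac)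

text \<open>Needed before any comparison with coordinates, because
  \<open>partition_principle\<close> is applied inside M \<otimes> N to prove that
  \<open>tvec\<close> is injective.\<close>

lemma tensor_module: "Module.module univ_ring (av_tensor M N)"
proof (rule moduleI)
 show "cring (univ_ring :: 'k sphere ring)" by (rule cring_univ_ring)
 let ?V = "av_tensor M N"
 show "abelian_group ?V"
  unfolding av_tensor_def Let_def by (rule av_struct_on_abelian[OF tensor_abelian[OF tmod]])
 fix a b :: "'k sphere" and x assume "x \<in>. ?V"
 hence x: "x \<in>. TT" by (simp add: av_tensor_simps)
 show "a .[?V] x \<in>. ?V" using x by (simp add: av_tensor_simps tsm_closed)
 have "tsm (a + b) x = tsm a x +[TT] tsm b x" using x
 proof (induction rule: tind)
  case (of s)
  then obtain m k where s: "s = (m, k)" and mk: "m \<in>. M" "k \<in>. N" by auto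
  have "tsm (a + b) (pt m k) = tsm a (pt m k) +[TT] tsm b (pt m k)"
   using mk M.smult_l_distr[of a b m] by (simp add: tsm_pure pure_tensor_add_left[OF tmod] av_moduleD(4-)[OF M])
  thus ?case by (simp add: s pure_tensor_def)
 qed (simp_all add: tsm_additive tensor_minus_add tsm_closed)
 thus "(a +[univ_ring] b) .[?V] x = a .[?V] x +[?V] b .[?V] x"
  by (simp add: av_tensor_simps)
 have "tsm (a * b) x = tsm a (tsm b x)" using x
 proof (induction rule: tind)
  case (of s)
  then obtain m k where s: "s = (m, k)" and mk: "m \<in>. M" "k \<in>. N" by auto
  have "tsm (a * b) (pt m k) = tsm a (tsm b (pt m k))"
   using mk M.smult_assoc1[of a b m] by (simp add: tsm_pure av_moduleD(4-)[OF M])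
  thus ?case by (simp add: s pure_tensor_def)
 qed (simp_all add: tsm_additive tsm_closed)
 thus "(a \<otimes>\<^bsub>univ_ring\<^esub> b) .[?V] x = a .[?V] (b .[?V] x)"
  by (simp add: av_tensor_simps)
 have "tsm 1 x = x" using x
 proof (induction rule: tind)
  case (of s)
  then obtain m k where s: "s = (m, k)" and mk: "m \<in>. M" "k \<in>. N" by auto
  have "tsm 1 (pt m k) = pt m k"
   using mk M.smult_one[of m] by (simp add: tsm_pure)
  thus ?case by (simp add: s pure_tensor_def)
 qed (simp_all add: tsm_additive)
 thus "\<one>\<^bsub>univ_ring\<^esub> .[?V] x = x" by (simp add: av_tensor_simps)
 fix y assume "y \<in>. ?V"
 thus "a .[?V] (x +[?V] y) = a .[?V] x +[?V] a .[?V] y"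
  using x by (simp add: av_tensor_simps tsm_add)
qed

lemma tvec_diff: "[|x \<in>. TT; y \<in>. TT|] ==> tvec (x -[TT] y) = (%i. tvec x i - tvec y i)"
 and tvec_zero: "tvec 0[TT] = (%i. 0)"
proof -
 note l = additive[OF tensor_abelian[OF tmod] Mod_abelian[OF qq, of "n + n'"], of tvec]
 show "tvec 0[TT] = (%i. 0)" using l(1) by (simp add: tvec_closed tvec_add)
 assume xy: "x \<in>. TT" "y \<in>. TT"
 have "tvec (x -[TT] y +[TT] y) = tvec x" using xy by (simp add: a_minus_def TT.a_assoc TT.l_neg)
 thus "tvec (x -[TT] y) = (%i. tvec x i - tvec y i)" using xy by (simp add: tvec_add fun_eq_iff eq_diff_eq)
qed

lemma tvec_smult:
 assumes x: "x \<in>. TT"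
 shows "tvec (tsm a x) = (%i. incl a * tvec x i)"
 using x
proof (induction rule: tind)
 case (of s)
 then obtain m k where s: "s = (m, k)" and mk: "m \<in>. M" "k \<in>. N" by auto
 have "tvec (tsm a (pt m k)) = (%i. incl a * tvec (pt m k) i)"
  using mk by (auto simp: tsm_pure tvec_pure av_moduleD(4-)[OF M] av_hom_smult[OF \<alpha>(1)])
 thus ?case by (simp add: s pure_tensor_def)
qed (simp_all add: tsm_additive tvec_diff tvec_zero tsm_closed right_diff_distrib)

lemma pullback_frame_exists:
 assumes p: "polyrep K r" and \<gamma>: "bij_betw \<gamma> (carrier P) (carrier (SMod K r l))"
 shows "\<exists>N0 \<mu>. \<forall>i\<in>K. \<mu> i \<in>. P \<and> \<gamma> (\<mu> i) = frame K r l h N0 i"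
proof -
 obtain N0 where "\<forall>i\<in>K. frame K r l h N0 i \<in>. SMod K r l" using frame_Mod[OF p] by blast
 hence "\<forall>i\<in>K. \<exists>m. m \<in>. P \<and> \<gamma> m = frame K r l h N0 i" using \<gamma> unfolding bij_betw_def by (metis imageE)
 thus ?thesis by metis
qed

text \<open>
 On the chart \<open>N(h)\<close> one has \<open>h ^ e m = \<Sum>i. l\<^sub>i(m) \<mu>\<^sub>i\<close> with linear forms \<open>l\<^sub>i\<close> on \<open>M\<close>. Hence
 \<open>h ^ e x = \<Sum>i. \<mu>\<^sub>i \<otimes> \<Lambda>\<^sub>i(x)\<close>, where \<open>\<Lambda>\<^sub>i(x)\<close> in \<open>N\<close> is determined by the coordinates of \<open>x\<close>.
\<close>

lemma tvec_inj: "inj_on tvec (carrier TT)"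
proof -
 note fin = finite_polyrep[OF q] and cl = av_moduleD(4-)[OF M] av_moduleD(4-)[OF N] and ptc = pure_tensor_closed[OF tmod]
 have t0: "x = 0[TT]" if x: "x \<in>. TT" and 0: "tvec x = (%i. 0)" for x
 proof -
  have "\<exists>L. tsm (coord_fun h ^ L) x \<in> {0[TT]}" for h
  proof -
   let ?R = "rho fs q n (cc coord_z h)"
   obtain L \<mu> where \<mu>: "!!i. i \<in> I ==> \<mu> i \<in>. M" "!!i. i \<in> I ==> \<alpha> (\<mu> i) = frame I q n h L i"
    using pullback_frame_exists[OF q \<alpha>(2)] by metis
   obtain K where "\<forall>v\<in>carrier (SMod I q n). \<forall>i\<in>I. \<exists>a. fcoord h ^ K * mv I I ?R v i = incl a"
    using frame_dual[OF q] by blast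
   hence "\<forall>m i. \<exists>a. m \<in>. M --> i \<in> I --> fcoord h ^ K * mv I I ?R (\<alpha> m) i = incl a" using av_hom_closed[OF \<alpha>(1)] by blast
   then obtain l where l: "!!m i. [|m \<in>. M; i \<in> I|] ==> incl (l m i) = fcoord h ^ K * mv I I ?R (\<alpha> m) i" by metis
   define \<Lambda> where "\<Lambda> i = gen_lift N (%(m, k). l m i .[N] k)" for i
   define \<Theta> where "\<Theta> i w = (%j. fcoord h ^ K * (\<Sum>i'\<in>I. ?R i i' * w (i', j)))" for i and w :: "'i \<times> 'j => 'k sphere fract"
   have \<Lambda>: "x \<in>. TT ==> \<Lambda> i x \<in>. N" "[|x \<in>. TT; y \<in>. TT|] ==> \<Lambda> i (x +[TT] y) = \<Lambda> i x +[N] \<Lambda> i y"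
    "[|m \<in>. M; k \<in>. N|] ==> \<Lambda> i (pt m k) = l m i .[N] k" "x \<in>. TT ==> \<beta> (\<Lambda> i x) = \<Theta> i (tvec x)"
    if i: "i \<in> I" for i x y m k
   proof -
    have g: "\<beta> (l m i .[N] k) = \<Theta> i (tvec (pt m k))" if mk: "m \<in>. M" "k \<in>. N" for m k
     using i by (simp add: av_hom_smult[OF \<beta>(1) mk(2)] \<Theta>_def tvec_pure mk mv_def sum_distrib_left sum_distrib_right mult_ac l)
    have f: "(%(m, k). l m i .[N] k) \<in> carrier M \<times> carrier N \<rightarrow> carrier N" using cl by auto
    note t = tensor_transfer[OF tmod N.abelian_group_axioms f _ bij_betw_imp_inj_on[OF \<beta>(2)], where \<Theta> = tvec and \<Lambda> = "\<Theta> i", folded \<Lambda>_def]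
    have \<Theta>: "\<Theta> i (%s. v s + w s) = (%s. \<Theta> i v s + \<Theta> i w s)" for v w
     by (simp add: \<Theta>_def distrib_left sum.distrib)
    have g': "\<beta> ((%(m, k). l m i .[N] k) s) = \<Theta> i (tvec (gen_class (carrier M \<times> carrier N) (tensor_relations univ_ring M N) s))"
     if "s \<in> carrier M \<times> carrier N" for s using that g by (auto simp: pure_tensor_def)
    show "x \<in>. TT ==> \<Lambda> i x \<in>. N" "[|x \<in>. TT; y \<in>. TT|] ==> \<Lambda> i (x +[TT] y) = \<Lambda> i x +[N] \<Lambda> i y"
     "x \<in>. TT ==> \<beta> (\<Lambda> i x) = \<Theta> i (tvec x)"
     by (rule t(1,2,4); simp add: av_hom_add[OF \<beta>(1)] tvec_add \<Theta> g')+
    show "[|m \<in>. M; k \<in>. N|] ==> \<Lambda> i (pt m k) = l m i .[N] k"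
     unfolding pure_tensor_def by (subst t(3)) (simp_all add: av_hom_add[OF \<beta>(1)] tvec_add \<Theta> g')
   qed
   define G where "G x = (\<Oplus>\<^bsub>TT\<^esub>i\<in>I. pt (\<mu> i) (\<Lambda> i x))" for x
   have Gt: "(%i. pt (\<mu> i) (\<Lambda> i x)) \<in> I \<rightarrow> carrier TT" if "x \<in>. TT" for x
    using that \<mu> \<Lambda>(1) ptc by auto
   have Gc: "G x \<in>. TT" if "x \<in>. TT" for x using TT.finsum_closed[OF Gt[OF that]] by (simp add: G_def)
   have Ga: "G (x +[TT] y) = G x +[TT] G y" if xy: "x \<in>. TT" "y \<in>. TT" for x y
    unfolding G_def TT.finsum_addf[OF Gt[OF xy(1)] Gt[OF xy(2)], symmetric]
    by (rule TT.finsum_cong') (use xy \<mu> \<Lambda>(1) in \<open>auto simp: \<Lambda>(2) pure_tensor_add_right[OF tmod] ptc\<close>)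
   note G = additive[OF TT.abelian_group_axioms TT.abelian_group_axioms Gc Ga]
   \<comment> \<open>Both sides are additive, so pure tensors suffice. There the claim is h^(K+L) m
     = \<Sum> l_i(m) \<mu>_i, which is checked after applying the injective \<alpha>: going to the
     chart h and back is the identity.\<close>
   have "tsm (coord_fun h ^ (K + L)) x = G x" using x
   proof (induction rule: tind)
    case (of s)
    then obtain m k where s: "s = (m, k)" and mk: "m \<in>. M" "k \<in>. N" by auto
    have t: "(%i. l m i .[M] \<mu> i) \<in> I \<rightarrow> carrier M" using \<mu> cl by auto
    have "\<alpha> (\<Oplus>\<^bsub>M\<^esub>i\<in>I. l m i .[M] \<mu> i) = (%j. \<Sum>i\<in>I. \<alpha> (l m i .[M] \<mu> i) j)"
     using additive_finsum[OF M.abelian_group_axioms Mod_abelian[OF q, of n], of \<alpha> _ I] av_homD[OF \<alpha>(1)] t fin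
      finsum_Mod[OF q _ fin, of "%i. \<alpha> (l m i .[M] \<mu> i)" n] by (auto simp: Pi_iff)
    also have "... = (%j. fcoord h ^ (K + L) * mv I I (rho fs q n (cc h coord_z)) (mv I I ?R (\<alpha> m)) j)"
    proof -
     have "(\<Sum>i\<in>I. \<alpha> (l m i .[M] \<mu> i) j) = (\<Sum>i\<in>I. fcoord h ^ K * mv I I ?R (\<alpha> m) i * frame I q n h L i j)" for j
      using \<mu> mk by (intro sum.cong refl) (simp add: av_hom_smult[OF \<alpha>(1)] l)
     thus ?thesis by (auto simp: fun_eq_iff frame_def[OF q] mv_def[of I I "rho fs q n (cc h coord_z)"] sum_distrib_left power_add mult_ac)
    qed
    also have "... = \<alpha> (coord_fun h ^ (K + L) .[M] m)"
     using av_hom_closed[OF \<alpha>(1) mk(1)] by (simp add: mv_rho_fixed[OF q] Mod_carrier av_hom_smult[OF \<alpha>(1) mk(1)] incl_power)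
    finally have "(\<Oplus>\<^bsub>M\<^esub>i\<in>I. l m i .[M] \<mu> i) = coord_fun h ^ (K + L) .[M] m"
     by (rule inj_onD[OF bij_betw_imp_inj_on[OF \<alpha>(2)]]) (use t mk cl in auto)
    hence "tsm (coord_fun h ^ (K + L)) (pt m k) = pt (\<Oplus>\<^bsub>M\<^esub>i\<in>I. l m i .[M] \<mu> i) k" by (simp add: tsm_pure mk)
    also have "... = (\<Oplus>\<^bsub>TT\<^esub>i\<in>I. pt (l m i .[M] \<mu> i) k)"
     using mk t fin by (intro additive_finsum[OF M.abelian_group_axioms TT.abelian_group_axioms, where f = "%m. pt m k"])
      (simp_all add: ptc pure_tensor_add_left[OF tmod])
    also have "... = G (pt m k)"
     unfolding G_def by (rule TT.finsum_cong') (use mk \<mu> cl in \<open>auto simp: \<Lambda>(3) pure_tensor_smult[OF tmod] ptc\<close>)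
    finally show ?case by (simp add: s pure_tensor_def)
   qed (simp_all add: tsm_additive G tsm_closed Gc)
   moreover have "G x = 0[TT]"
   proof -
    have z: "\<beta> 0[N] = (%j. 0)"
     using additive_zero[OF N.abelian_group_axioms Mod_abelian[OF q', of n'], of \<beta>] av_homD[OF \<beta>(1)] by simp
    have "\<Lambda> i x = 0[N]" if "i \<in> I" for i
     by (rule inj_onD[OF bij_betw_imp_inj_on[OF \<beta>(2)]]) (use that x in \<open>simp_all add: \<Lambda> z 0 \<Theta>_def\<close>)
    moreover have "pt m 0[N] = 0[TT]" if "m \<in>. M" for m
     using that by (intro additive_zero[OF N.abelian_group_axioms TT.abelian_group_axioms]) (simp_all add: ptc pure_tensor_add_right[OF tmod])
    ultimately have "G x = (\<Oplus>\<^bsub>TT\<^esub>i\<in>I. 0[TT])" unfolding G_def by (intro TT.finsum_cong') (auto simp: \<mu>)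
    thus ?thesis by simp
   qed
   ultimately show ?thesis by blast
  qed
  hence loc: "\<exists>L. coord_fun h ^ L .[av_tensor M N] x \<in> {0[TT]}" for h by (simp add: av_tensor_simps)
  have "x \<in> {0[TT]}"
   by (rule partition_principle[OF tensor_module _ _ _ _ loc]) (simp_all add: av_tensor_simps tsm_additive(1) x)
  thus ?thesis by simp
 qed
 show ?thesis
 proof (rule inj_onI)
  fix x y assume xy: "x \<in>. TT" "y \<in>. TT" "tvec x = tvec y"
  hence "x -[TT] y = 0[TT]" by (intro t0) (simp_all add: tvec_diff)
  moreover have "x = (x -[TT] y) +[TT] y" using xy by (simp add: a_minus_def TT.a_assoc TT.l_neg)
  ultimately show "x = y" using xy by simp
 qed
qed

text \<open>A frame of the tensor product representation consists of the products of frame vectors,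
  which are images of pure tensors; the rest is linearity and gluing.\<close>

lemma tvec_surj: "tvec ` carrier TT = carrier QQ"
proof
 interpret V: Module.module univ_ring "av_tensor M N" by (rule tensor_module)
 show "tvec ` carrier TT \<subseteq> carrier QQ" using tvec_closed by auto
 show "carrier QQ \<subseteq> tvec ` carrier TT"
 proof
  fix v assume v: "v \<in>. QQ"
  let ?X = "tvec ` carrier TT"
 let ?F = "frame (I \<times> J) (qtensor q q') (n + n')"
  have X: "(%i. 0) \<in> ?X" "v \<in> ?X ==> w \<in> ?X ==> (%i. v i + w i) \<in> ?X" "v \<in> ?X ==> (%i. incl a * v i) \<in> ?X" for v w a
  proof -
   show "(%i. 0) \<in> ?X" by (rule image_eqI[where x = "0[TT]"]) (simp_all add: tvec_zero)
   show "(%i. v i + w i) \<in> ?X" if vw: "v \<in> ?X" "w \<in> ?X"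
   proof -
    obtain x y where "v = tvec x" "w = tvec y" and xy: "x \<in>. TT" "y \<in>. TT" using vw by blast
    thus ?thesis by (intro image_eqI[of _ _ "x +[TT] y"]) (simp_all add: tvec_add)
   qed
   show "(%i. incl a * v i) \<in> ?X" if v: "v \<in> ?X"
   proof -
    obtain x where "v = tvec x" and x: "x \<in>. TT" using v by blast
    thus ?thesis by (intro image_eqI[of _ _ "tsm a x"]) (simp_all add: tvec_smult tsm_closed)
   qed
  qed
  have "\<exists>K. (%i. fcoord h ^ K * v i) \<in> ?X" for h
  proof -
   obtain N1 \<mu> where \<mu>: "!!i. i \<in> I ==> \<mu> i \<in>. M" "!!i. i \<in> I ==> \<alpha> (\<mu> i) = frame I q n h N1 i"
    using pullback_frame_exists[OF q \<alpha>(2)] by metis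
   obtain N2 \<nu> where \<nu>: "!!i. i \<in> J ==> \<nu> i \<in>. N" "!!i. i \<in> J ==> \<beta> (\<nu> i) = frame J q' n' h N2 i"
    using pullback_frame_exists[OF q' \<beta>(2)] by metis
   have W: "?F h (N1 + N2) s \<in> ?X" if s: "s \<in> I \<times> J" for s
   proof -
    obtain i j where ij: "s = (i, j)" "i \<in> I" "j \<in> J" using s by auto
    have "?F h (N1 + N2) s = tvec (pt (\<mu> i) (\<nu> j))"
     using ij \<mu> \<nu> by (auto simp: tvec_pure fun_eq_iff frame_def[OF q] frame_def[OF q'] frame_def[OF qq] rho_qtensor power_add)
    thus ?thesis using \<mu> \<nu> ij pure_tensor_closed[OF tmod] by auto
   qed
   obtain K a where "!!i. fcoord h ^ K * v i = (\<Sum>j\<in>I \<times> J. incl (a j) * ?F h (N1 + N2) j i)"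
    using frame_expand[OF qq v, of h "N1 + N2"] by blast
   hence "(%i. fcoord h ^ K * v i) = (%i. \<Sum>j\<in>I \<times> J. incl (a j) * ?F h (N1 + N2) j i)" by auto
   also have "... \<in> ?X" by (rule Mod_lincomb_closed[OF qq finite_polyrep[OF qq] W X])
   finally show ?thesis by blast
  qed
  thus "v \<in> ?X"
   by (intro partition_principle[OF Mod_module[OF qq] v]) (use tvec_closed X in \<open>auto simp: incl_power\<close>)
 qed
qed

text \<open>That the action of \<eta> is well defined on M \<otimes> N is deduced from
  \<open>tvec_inj\<close>: in coordinates it is \<open>Lie_chart\<close>, so it must respect the
  tensor relations.\<close>

lemma av_tensor_iso: "av_iso (av_tensor M N) QQ" "av_closed (av_tensor M N)"
proof -
 note cl = av_moduleD(2-)[OF M] av_moduleD(2-)[OF N]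
 let ?f = "%\<eta> (m, n). pt (lie M \<eta> m) n +[TT] pt m (lie N \<eta> n)"
 have lie: "gen_lift TT (?f \<eta>) x \<in>. TT \<and>
  tvec (gen_lift TT (?f \<eta>) x)
   = Lie_chart (I \<times> J) (qtensor q q') (n + n') coord_z \<eta> (tvec x)" if \<eta>: "\<eta> \<in> derivations" and x: "x \<in>. TT" for \<eta> x
 proof -
  note l = tensor_transfer[OF tmod TT.abelian_group_axioms, where \<theta> = tvec and \<Theta> = tvec and \<Lambda> = "Lie_chart (I \<times> J) (qtensor q q') (n + n') coord_z \<eta>" and f = "?f \<eta>"]
  have f: "(?f \<eta>) \<in> carrier M \<times> carrier N \<rightarrow> carrier TT"
   using \<eta> by (auto simp: cl pure_tensor_closed[OF tmod])
  have g: "tvec ((?f \<eta>) s)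
    = Lie_chart (I \<times> J) (qtensor q q') (n + n') coord_z \<eta> (tvec (gen_class (carrier M \<times> carrier N) (tensor_relations univ_ring M N) s))"
   if s: "s \<in> carrier M \<times> carrier N" for s
  proof -
   obtain m k where mk: "s = (m, k)" "m \<in>. M" "k \<in>. N" using s by auto
   have "tvec (pt (lie M \<eta> m) k +[TT] pt m (lie N \<eta> k)) = Lie_chart (I \<times> J) (qtensor q q') (n + n') coord_z \<eta> (tvec (pt m k))"
    using mk \<eta> by (simp add: cl pure_tensor_closed[OF tmod] tvec_add tvec_pure av_homD[OF \<alpha>(1)] av_homD[OF \<beta>(1)] Lie_chart_tensor)
      (simp add: fun_eq_iff)
   thus ?thesis by (simp add: mk pure_tensor_def)
  qed
  show ?thesis
   by (intro conjI l(1)[OF f _ tvec_inj _ Lie_chart_add[OF qq \<eta>] g x] l(4)[OF f _ tvec_inj _ Lie_chart_add[OF qq \<eta>] g x])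
     (simp_all add: tvec_add)
 qed
 show "av_closed (av_tensor M N)"
  using lie by (auto simp: av_closed_def av_tensor_simps tsm_closed)
 have "tvec \<in> av_hom (av_tensor M N) QQ"
  by (rule av_homI) (simp_all add: av_tensor_simps tvec_closed tvec_add tvec_smult lie)
 thus "av_iso (av_tensor M N) QQ"
  unfolding av_iso_def using tvec_inj tvec_surj by (auto simp: bij_betw_def av_tensor_simps)
qed

end

subsection \<open>Sums, kernels and cokernels\<close>

definition psum :: "('i => 'k::zero pexp) => 'i set => 'k pexp"
 where "psum f A = foldr (%i. PA (f i)) (SOME xs. set xs = A \<and> distinct xs) (PC 0)"

lemma psum:
 assumes "finite A" "rhom \<iota>"
 shows "pev \<iota> (psum f A) g = (\<Sum>i\<in>A. pev \<iota> (f i) g)" "pdv \<iota> (psum f A) g X = (\<Sum>i\<in>A. pdv \<iota> (f i) g X)"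
proof -
 let ?xs = "SOME xs. set xs = A \<and> distinct xs"
 have xs: "set ?xs = A" "distinct ?xs"
  using someI_ex[OF finite_distinct_list[OF assms(1)]] by auto
 have "pev \<iota> (foldr (%i. PA (f i)) xs (PC 0)) g = (\<Sum>i\<in>set xs. pev \<iota> (f i) g)" 
  "pdv \<iota> (foldr (%i. PA (f i)) xs (PC 0)) g X = (\<Sum>i\<in>set xs. pdv \<iota> (f i) g X)" if "distinct xs" for xs
  using that by (induction xs) (simp_all add: rhom_0[OF assms(2)])
 from this[OF xs(2)] show "pev \<iota> (psum f A) g = (\<Sum>i\<in>A. pev \<iota> (f i) g)"
  "pdv \<iota> (psum f A) g X = (\<Sum>i\<in>A. pdv \<iota> (f i) g X)" unfolding psum_def xs(1) .
qed

definition pdet :: "'k::comm_ring_1 pexp"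
 where "pdet = PA (PM (PV 1 1) (PV 2 2)) (PM (PC (- 1)) (PM (PV 1 2) (PV 2 1)))"

lemma pdet: "rhom \<iota> ==> pev \<iota> pdet g = det g" "rhom \<iota> ==> pdv \<iota> pdet (mat 1) X = trace X"
 by (simp_all add: pdet_def det_2 trace_2 mat_def rhomD)

primrec ppow :: "'k::one pexp => nat => 'k pexp" where
 "ppow e 0 = PC 1"
| "ppow e (Suc n) = PM e (ppow e n)"

lemma pev_ppow: "rhom \<iota> ==> pev \<iota> (ppow e n) g = pev \<iota> e g ^ n"
 by (induction n) (simp_all add: rhom_1)

lemma pdv_ppow: "rhom \<iota> ==> pev \<iota> e g = 1 ==> pdv \<iota> (ppow e n) g X = of_nat n * pdv \<iota> e g X"
 by (induction n) (simp_all add: pev_ppow algebra_simps)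

text \<open>Multiplying q by det^m and adding m to n leaves q / det^n unchanged. Two representations
  can thus be given the same exponent, as \<open>av_sum_iso\<close> requires.\<close>

definition ptwist :: "nat => ('i, 'k::comm_ring_1) qmat => ('i, 'k) qmat"
 where "ptwist m q i j = PM (q i j) (ppow pdet m)"

lemma rho_ptwist: "rhom \<iota> ==> det g \<noteq> 0 ==> rho \<iota> (ptwist m q) (n + m) g i j = rho \<iota> q n g i j"
 by (simp add: rho_def ptwist_def pev_ppow pdet power_add)

lemma drho_ptwist: "rhom \<iota> ==> drho \<iota> (ptwist m q) (n + m) X i j = drho \<iota> q n X i j"
 by (simp add: drho_def ptwist_def pev_ppow pdv_ppow pdet algebra_simps)

lemma SMod_cong:
 assumes "!!G i j. det G \<noteq> 0 ==> i \<in> I ==> j \<in> I ==> rho fs q n G i j = rho fs q' n' G i j"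
  "!!X i j. i \<in> I ==> j \<in> I ==> drho fs q n X i j = drho fs q' n' X i j"
 shows "SMod I q n = SMod I q' n'"
proof -
 have 1: "mv I I (rho fs q n G) = mv I I (rho fs q' n' G)" if "det G \<noteq> 0" for G
  by (rule ext, rule mv_cong) (simp_all add: assms(1)[OF that])
 have "mv I I (drho fs q n X) = mv I I (drho fs q' n' X)" for X
  by (rule ext, rule mv_cong) (simp_all add: assms(2))
 thus ?thesis by (simp add: SMod_def 1 Lie_chart_def[abs_def])
qed

lemma SMod_ptwist: "SMod I (ptwist m q) (n + m) = SMod I q n"
 by (rule SMod_cong) (simp_all add: rho_ptwist drho_ptwist)

lemma polyrep_ptwist:
 assumes "polyrep I q"
 shows "polyrep I (ptwist m q)"
 unfolding polyrep_def
proof (intro conjI allI impI ballI)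
 show "finite I" by (rule finite_polyrep[OF assms])
 fix g h :: "'b^2^2" and i j assume *: "i \<in> I" "j \<in> I"
 have "mm I (%i j. pev0 (ptwist m q i j) g) (%i j. pev0 (ptwist m q i j) h) i j
   = det g ^ m * det h ^ m * mm I (%i j. pev0 (q i j) g) (%i j. pev0 (q i j) h) i j"
  by (simp add: mm_def ptwist_def pev_ppow pdet sum_distrib_left mult_ac)
 thus "mm I (%i j. pev0 (ptwist m q i j) g) (%i j. pev0 (ptwist m q i j) h) i j = pev0 (ptwist m q i j) (g ** h)"
  using polyrep_mult[OF assms rhom_id *, of g h] by (simp add: ptwist_def pev_ppow pdet det_mul power_mult_distrib mult_ac)
qed

definition rep_module :: "('k::field_char_0 sphere, 'm) av_struct => 'i set => ('i, 'k) qmat => nat => bool"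
 where "rep_module M I q n \<longleftrightarrow> polyrep I q \<and> av_iso M (SMod I q n)"

lemma rep_module_ptwist: "rep_module M I q n ==> rep_module M I (ptwist m q) (n + m)"
 by (simp add: rep_module_def polyrep_ptwist SMod_ptwist)

text \<open>T and S need only be inverse to each other modulo the idempotents \<rho>(1) and
  \<rho>'(1), which act as identities on the modules.\<close>

lemma Mod_iso:
 assumes q: "polyrep I q" and q': "polyrep J q'"
  and T: "equivariant I q n J q' n' T" and S: "equivariant J q' n' I q n S"
  and TS: "!!i j. i \<in> J ==> j \<in> J ==> mm I T S i j = rho0 q' n' (mat 1) i j"
  and ST: "!!i j. i \<in> I ==> j \<in> I ==> mm J S T i j = rho0 q n (mat 1) i j"
 shows "bij_betw (mv J I (fsm T)) (carrier (SMod I q n)) (carrier (SMod J q' n'))"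
  "av_iso (SMod I q n) (SMod J q' n')"
proof -
 let ?T = "mv J I (fsm T)" and ?S = "mv I J (fsm S)"
 note h = Mod_map_hom[OF q q' T] Mod_map_hom[OF q' q S]
 have 1: "?S (?T v) = v" if "v \<in>. SMod I q n" for v
 proof -
  have "?S (?T v) = mv I I (rho fs q n (mat 1)) v"
   unfolding mv_mv by (rule mv_cong) (simp_all add: rho_map mmap_1 ST flip: mm_map[OF rhom_fs])
  thus ?thesis using that by (simp add: Mod_carrier)
 qed
 have 2: "?T (?S v) = v" if "v \<in>. SMod J q' n'" for v
 proof -
  have "?T (?S v) = mv J J (rho fs q' n' (mat 1)) v"
   unfolding mv_mv by (rule mv_cong) (simp_all add: rho_map mmap_1 TS flip: mm_map[OF rhom_fs])
  thus ?thesis using that by (simp add: Mod_carrier)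
 qed
 show "bij_betw ?T (carrier (SMod I q n)) (carrier (SMod J q' n'))"
  by (rule bij_betw_byWitness[where f' = ?S]) (auto simp: 1 2 av_hom_closed[OF h(1)] av_hom_closed[OF h(2)])
 thus "av_iso (SMod I q n) (SMod J q' n')" using h(1) by (auto simp: av_iso_def)
qed

lemma SMod_reindex:
 assumes q: "polyrep I q" and e: "bij_betw e J I"
 shows "polyrep J (%i j. q (e i) (e j))" "av_iso (SMod J (%i j. q (e i) (e j)) n) (SMod I q n)"
proof -
 note sum = sum.reindex_bij_betw[OF e]
 have eI: "j \<in> J ==> e j \<in> I" for j using e by (auto simp: bij_betw_def)
 show q': "polyrep J (%i j. q (e i) (e j))"
  using q bij_betw_finite[OF e] sum[of "%l. pev0 (q _ l) _ * pev0 (q l _) _"] by (simp add: polyrep_def mm_def eI)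
 let ?r = "rho0 q n"
 let ?T = "%i j. ?r (mat 1) i (e j)" and ?S = "%j i. ?r (mat 1) (e j) i"
 have r: "rho0 (%i j. q (e i) (e j)) n g i j = ?r g (e i) (e j)" for g i j by (simp add: rho_def)
 have J: "(\<Sum>l\<in>J. ?r g x (e l) * ?r h (e l) y) = ?r (g ** h) x y" if "x \<in> I" "y \<in> I" for g h x y
  using rho_mult[OF q rhom_id that, of n g h] sum[of "%l. ?r g x l * ?r h l y"] by (simp add: mm_def)
 have I: "(\<Sum>l\<in>I. ?r g x l * ?r h l y) = ?r (g ** h) x y" if "x \<in> I" "y \<in> I" for g h x y
  using rho_mult[OF q rhom_id that, of n g h] by (simp add: mm_def)
 show "av_iso (SMod J (%i j. q (e i) (e j)) n) (SMod I q n)"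
  by (rule Mod_iso[OF q' q, of n n ?T ?S]) (simp_all add: equivariant_def mm_def r I J eI)
qed

definition qsum :: "('i, 'k::zero) qmat => ('j, 'k) qmat => 'i + 'j => 'i + 'j => 'k pexp"
 where "qsum q q' a b = (case (a, b) of (Inl i, Inl i') => q i i' | (Inr j, Inr j') => q' j j' | _ => PC 0)"

lemma qsum_simps [simp]:
 "qsum q q' (Inl i) (Inl i') = q i i'" "qsum q q' (Inr j) (Inr j') = q' j j'"
 "qsum q q' (Inl i) (Inr j') = PC 0" "qsum q q' (Inr j) (Inl i') = PC 0"
 by (simp_all add: qsum_def)

lemma polyrep_qsum:
 assumes "polyrep I q" "polyrep J q'"
 shows "polyrep (I <+> J) (qsum q q')"
 using assms unfolding polyrep_def by (auto simp: mm_def sum.Plus)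

lemma av_sum_iso:
 fixes q :: "('i, 'k::field_char_0) qmat" and q' :: "('j, 'k) qmat"
  and M :: "('k sphere, 'm) av_struct" and N :: "('k sphere, 'n) av_struct"
 assumes M: "rep_module M I q n" and N: "rep_module N J q' n"
 shows "rep_module (av_sum M N) (I <+> J) (qsum q q') n"
proof -
 obtain \<alpha> \<beta> where \<alpha>: "\<alpha> \<in> av_hom M (SMod I q n)" "bij_betw \<alpha> (carrier M) (carrier (SMod I q n))"
  and \<beta>: "\<beta> \<in> av_hom N (SMod J q' n)" "bij_betw \<beta> (carrier N) (carrier (SMod J q' n))"
  using M N by (auto simp: rep_module_def av_iso_def)
 have q: "polyrep I q" and q': "polyrep J q'" using M N by (auto simp: rep_module_def)
 note fin = finite_polyrep[OF q] finite_polyrep[OF q']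
 let ?S = "SMod (I <+> J) (qsum q q') n"
 have split: "mv (I <+> J) (I <+> J) A (case_sum v w) = case_sum (mv I I (%i j. A (Inl i) (Inl j)) v) (mv J J (%i j. A (Inr i) (Inr j)) w)"
  if "!!i j. A (Inl i) (Inr j) = 0" "!!i j. A (Inr i) (Inl j) = 0" for A and v :: "'i => 'k sphere fract" and w
  by (auto simp: fun_eq_iff mv_def sum.Plus fin that split: sum.splits)
 have r: "mv (I <+> J) (I <+> J) (rho fs (qsum q q') n G) (case_sum v w) = case_sum (mv I I (rho fs q n G) v) (mv J J (rho fs q' n G) w)" for G v w
  by (subst split) (simp_all add: rho_def[abs_def])
 have d: "mv (I <+> J) (I <+> J) (drho fs (qsum q q') n X) (case_sum v w) = case_sum (mv I I (drho fs q n X) v) (mv J J (drho fs q' n X) w)" for X v w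
  by (subst split) (simp_all add: drho_def[abs_def])
 have [simp]: "Inl i \<in> I <+> J \<longleftrightarrow> i \<in> I" "Inr j \<in> I <+> J \<longleftrightarrow> j \<in> J" for i j by auto
 have all: "(\<forall>s. P s) \<longleftrightarrow> (\<forall>i. P (Inl i)) \<and> (\<forall>j. P (Inr j))" for P :: "'i + 'j => bool"
  by (metis sum.exhaust)
 have car: "case_sum v w \<in>. ?S \<longleftrightarrow> v \<in>. SMod I q n \<and> w \<in>. SMod J q' n" for v w
  by (auto simp: Mod_carrier r fun_eq_iff all)
 have cs: "case_sum (%i. x (Inl i)) (%j. x (Inr j)) = x" for x :: "'i + 'j => 'k sphere fract"
  by (auto simp: fun_eq_iff all)
 let ?f = "%(m, n). case_sum (\<alpha> m) (\<beta> n)"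
 have "?f \<in> av_hom (av_sum M N) ?S"
  by (rule av_homI) (auto simp: av_sum_def car av_homD[OF \<alpha>(1)] av_homD[OF \<beta>(1)] fun_eq_iff all Lie_chart_def d)
 moreover have "bij_betw ?f (carrier (av_sum M N)) (carrier ?S)"
  unfolding bij_betw_def
 proof
  show "inj_on ?f (carrier (av_sum M N))"
   using \<alpha>(2) \<beta>(2) unfolding bij_betw_def
   by (auto simp: inj_on_def av_sum_def fun_eq_iff all)
  show "?f ` carrier (av_sum M N) = carrier ?S"
  proof
   show "?f ` carrier (av_sum M N) \<subseteq> carrier ?S"
    by (auto simp: av_sum_def car av_homD[OF \<alpha>(1)] av_homD[OF \<beta>(1)])
   show "carrier ?S \<subseteq> ?f ` carrier (av_sum M N)"
   proof
    fix x assume x: "x \<in>. ?S"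
    have "case_sum (%i. x (Inl i)) (%j. x (Inr j)) \<in>. ?S" by (subst cs) (rule x)
    hence 1: "(%i. x (Inl i)) \<in>. SMod I q n" "(%j. x (Inr j)) \<in>. SMod J q' n" by (simp_all only: car)
    obtain m where m: "m \<in>. M" "\<alpha> m = (%i. x (Inl i))"
     using 1(1) bij_betw_imp_surj_on[OF \<alpha>(2)] by (metis imageE)
    obtain k where k: "k \<in>. N" "\<beta> k = (%j. x (Inr j))"
     using 1(2) bij_betw_imp_surj_on[OF \<beta>(2)] by (metis imageE)
    show "x \<in> ?f ` carrier (av_sum M N)"
     by (rule image_eqI[of _ _ "(m, k)"]) (use m k in \<open>simp_all add: cs av_sum_def\<close>)
   qed
  qed
 qed
 ultimately show ?thesis using polyrep_qsum[OF q q'] by (auto simp: rep_module_def av_iso_def)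
qed

text \<open>Induction on the columns. Its use is that 1 - T'T projects onto the kernel of T and 1 -
  TT' is a projection whose kernel is the image of T, so kernels and cokernels can be described by
  matrices without choosing bases.\<close>

lemma generalized_inverse:
 fixes T :: "'j => 'i => 'k::field"
 assumes "finite I" "finite J"
 shows "\<exists>T'. \<forall>j\<in>J. \<forall>i\<in>I. mm J (mm I T T') T j i = T j i"
 using assms(1)
proof (induction I rule: finite_induct)
 case empty
 show ?case by simp
next
 case (insert a I)
 then obtain T' where T': "!!j i. j \<in> J ==> i \<in> I ==> mm J (mm I T T') T j i = T j i" by blast
 let ?P = "mm I T T'"
 \<comment> \<open>The part of the new column a not already reproduced by the projection P = T
   T'.\<close>
 define d where "d j = T j a - mm J ?P T j a" for j
 show ?case
 proof (cases "\<forall>j\<in>J. d j = 0")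
  case True
  let ?T = "%i j. if i = a then 0 else T' i j"
  have "mm (insert a I) T ?T j l = ?P j l" for j l
   using insert.hyps by (auto simp: mm_def intro!: sum.cong)
  hence "mm J (mm (insert a I) T ?T) T j i = mm J ?P T j i" for j i by (simp add: mm_def[of J])
  thus ?thesis using T' True by (intro exI[of _ ?T]) (auto simp: d_def)
 next
  case False
  then obtain j0 where j0: "j0 \<in> J" "d j0 \<noteq> 0" by blast
  \<comment> \<open>The linear form y |-> (y - P y)_{j0} / d_{j0}. It vanishes on the old columns
    and equals 1 on the new one.\<close>
  define \<phi> where "\<phi> l = ((if l = j0 then 1 else 0) - ?P j0 l) / d j0" for l
  have \<phi>: "(\<Sum>l\<in>J. \<phi> l * T l i) = (T j0 i - mm J ?P T j0 i) / d j0" for i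
  proof -
   have "\<phi> l * T l i = ((if l = j0 then T l i else 0) - ?P j0 l * T l i) / d j0" for l
    by (simp add: \<phi>_def algebra_simps)
   thus ?thesis using assms(2) j0(1) by (simp add: mm_def[of J] sum_subtractf flip: sum_divide_distrib)
  qed
  have \<phi>0: "(\<Sum>l\<in>J. \<phi> l * T l i) = 0" if "i \<in> I" for i using T' j0(1) that by (simp add: \<phi>)
  have \<phi>1: "(\<Sum>l\<in>J. \<phi> l * T l a) = 1" using j0 by (simp add: \<phi> d_def)
  \<comment> \<open>Row a of the new inverse is \<phi>, and the coefficients T' T_a are subtracted
    along \<phi> in the other rows, so that the product with T becomes P + d \<phi>.\<close>
  let ?u = "%i. \<Sum>m\<in>J. T' i m * T m a"
  let ?T = "%i j. if i = a then \<phi> j else T' i j - ?u i * \<phi> j"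
  have "mm (insert a I) T ?T j l = ?P j l + d j * \<phi> l" for j l
  proof -
   have "mm (insert a I) T ?T j l = T j a * \<phi> l + (\<Sum>i\<in>I. T j i * (T' i l - ?u i * \<phi> l))"
    using insert.hyps by (auto simp: mm_def intro!: sum.cong)
   also have "(\<Sum>i\<in>I. T j i * (T' i l - ?u i * \<phi> l)) = ?P j l - mm J ?P T j a * \<phi> l"
   proof -
    have "(\<Sum>i\<in>I. T j i * ?u i) = mm J ?P T j a" using mm_assoc[of J I T T' T j a] by (simp add: mm_def)
    thus ?thesis by (simp add: right_diff_distrib sum_subtractf mm_def[of I] sum_distrib_right mult.assoc[symmetric] flip: sum_distrib_right)
   qed
   finally show ?thesis by (simp add: d_def algebra_simps)
  qed
  hence "mm J (mm (insert a I) T ?T) T j i = mm J ?P T j i + d j * (\<Sum>l\<in>J. \<phi> l * T l i)" for j i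
   by (simp add: mm_def[of J] distrib_right sum.distrib sum_distrib_left mult.assoc)
  thus ?thesis using T' \<phi>0 \<phi>1 by (intro exI[of _ ?T]) (auto simp: d_def)
 qed
qed

definition idm :: "'i => 'i => 'k::comm_ring_1"
 where "idm i j = (if i = j then 1 else 0)"

lemma mm_idm_left: "finite I ==> i \<in> I ==> mm I idm A i j = A i j"
 by (simp add: mm_def idm_def if_distrib[of "%x. x * _"] cong: if_cong)

lemma mm_idm_right: "finite I ==> j \<in> I ==> mm I A idm i j = A i j"
 by (simp add: mm_def idm_def if_distrib[of "%x. _ * x"] cong: if_cong)

lemma mm_diff_right: "mm I A (%i j. B i j - C i j) i j = mm I A B i j - mm I A C i j"
 by (simp add: mm_def algebra_simps sum_subtractf)

lemma mm_diff_left: "mm I (%i j. B i j - C i j) A i j = mm I B A i j - mm I C A i j"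
 by (simp add: mm_def algebra_simps sum_subtractf)

section \<open>Kernels and cokernels of equivariant matrices\<close>

definition pmm_right :: "'i set => ('i, 'k::zero) qmat => ('i => 'i => 'k) => ('i, 'k) qmat"
 where "pmm_right I q P i j = psum (%l. PM (q i l) (PC (P l j))) I"

definition pmm_left :: "'i set => ('i => 'i => 'k) => ('i, 'k::zero) qmat => ('i, 'k) qmat"
 where "pmm_left I P q i j = psum (%l. PM (PC (P i l)) (q l j)) I"

lemma pmm:
 assumes "finite I" "rhom \<iota>"
 shows "pev \<iota> (pmm_right I q P i j) g = mm I (%i j. pev \<iota> (q i j) g) (%i j. \<iota> (P i j)) i j"
  "pdv \<iota> (pmm_right I q P i j) g X = mm I (%i j. pdv \<iota> (q i j) g X) (%i j. \<iota> (P i j)) i j"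
  "pev \<iota> (pmm_left I P q i j) g = mm I (%i j. \<iota> (P i j)) (%i j. pev \<iota> (q i j) g) i j"
  "pdv \<iota> (pmm_left I P q i j) g X = mm I (%i j. \<iota> (P i j)) (%i j. pdv \<iota> (q i j) g X) i j"
 by (simp_all add: pmm_right_def pmm_left_def psum[OF assms] mm_def)

lemma rho_pmm:
 assumes "finite I" "rhom \<iota>"
 shows "rho \<iota> (pmm_right I q P) n g i j = mm I (rho \<iota> q n g) (%i j. \<iota> (P i j)) i j"
  "drho \<iota> (pmm_right I q P) n X i j = mm I (drho \<iota> q n X) (%i j. \<iota> (P i j)) i j"
  "rho \<iota> (pmm_left I P q) n g i j = mm I (%i j. \<iota> (P i j)) (rho \<iota> q n g) i j"
  "drho \<iota> (pmm_left I P q) n X i j = mm I (%i j. \<iota> (P i j)) (drho \<iota> q n X) i j"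
 by (simp_all add: rho_def drho_def pmm[OF assms] mm_def sum_divide_distrib left_diff_distrib right_diff_distrib
   sum_subtractf sum_distrib_left mult_ac)

lemma image_submodule:
 assumes f: "f \<in> av_hom M N" and M: "av_module M"
 shows "x \<in> f ` carrier M ==> y \<in> f ` carrier M ==> x +[N] y \<in> f ` carrier M"
  "x \<in> f ` carrier M ==> a .[N] x \<in> f ` carrier M" "f ` carrier M \<subseteq> carrier N"
 using av_homD[OF f] av_moduleD(4-)[OF M] by (auto simp: image_iff) metis+

lemma local_lift_ex:
 assumes "polyrep I q" "\<forall>i. w i \<in> loc h"
 shows "\<exists>K. (%i. fcoord h ^ K * mv I I (rho fs q n (cc h coord_z)) w i) \<in>. SMod I q n"
 using local_lift[OF assms(1), of w h n] assms(2) by (auto simp: eventually_sequentially)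

context
 fixes I :: "'i set" and q :: "('i, 'k::field_char_0) qmat" and n :: nat
  and J :: "'j set" and q' :: "('j, 'k) qmat" and n' :: nat and T T'
 assumes q: "polyrep I q" and q': "polyrep J q'" and T: "equivariant I q n J q' n' T"
  and T': "\<forall>j\<in>J. \<forall>i\<in>I. mm J (mm I T T') T j i = T j i"
begin

text \<open>The kernel of T is stable under q, so q(h) maps the image of 1 - T'T into itself. This
  makes the product multiplicative although 1 - T'T does not commute with q.\<close>

definition qker :: "('i, 'k) qmat"
 where "qker = pmm_right I q (%i j. idm i j - mm J T' T i j)"

text \<open>The quotient by the image of T, realized on the complement cut out by 1 - TT'. It is
  multiplicative because the image of T is stable under q' and killed by 1 - TT'.\<close>

definition qcoker :: "('j, 'k) qmat"
 where "qcoker = pmm_left J (%i j. idm i j - mm I T T' i j) q'"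

abbreviation (input) "KT == %i j. idm i j - mm J T' T i j"
abbreviation (input) "PT == %i j. idm i j - mm I T T' i j"

lemma T_ker_0: "j \<in> J ==> i \<in> I ==> mm I T KT j i = 0"
 using T' by (simp add: mm_diff_right mm_idm_right finite_polyrep[OF q] flip: mm_assoc)

lemma coker_T_0: "j \<in> J ==> i \<in> I ==> mm J PT T j i = 0"
 using T' by (simp add: mm_diff_left mm_idm_left finite_polyrep[OF q'])

lemma equi_pev: "j \<in> J ==> i \<in> I ==> invertible g ==> mm I T (%i j. pev0 (q i j) g) j i
  = det g ^ n / det g ^ n' * mm J (%i j. pev0 (q' i j) g) T j i"
 using equivariant_pev[OF T rhom_id, of j i g] by (simp add: invertible_det_nz field_simps)

lemma polyrep_qker: "polyrep I qker"
 unfolding polyrep_def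
proof (intro conjI allI impI ballI)
 show fin: "finite I" by (rule finite_polyrep[OF q])
 fix g h :: "'k^2^2" and i j assume g: "invertible g" and h: "invertible h" and ij: "i \<in> I" "j \<in> I"
 let ?P = "%i j. idm i j - mm J T' T i j" and ?g = "%i j. pev0 (q i j) g" and ?h = "%i j. pev0 (q i j) h"
 have e: "(%i j. pev0 (qker i j) g) = mm I (%i j. pev0 (q i j) g) ?P" for g
  by (simp add: fun_eq_iff qker_def pmm[OF fin rhom_id])
 have Th: "mm I T (mm I ?h ?P) l j = 0" if l: "l \<in> J" for l
 proof -
  have "mm I T (mm I ?h ?P) l j = mm I (mm I T ?h) ?P l j" by (simp add: mm_assoc)
  also have "... = mm I (%l i. det h ^ n / det h ^ n' * mm J (%i j. pev0 (q' i j) h) T l i) ?P l j"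
   using l by (intro mm_cong) (simp_all add: equi_pev[OF _ _ h])
  also have "... = det h ^ n / det h ^ n' * mm I (mm J (%i j. pev0 (q' i j) h) T) ?P l j"
   by (simp add: mm_def[of I] sum_distrib_left mult.assoc)
  also have "mm I (mm J (%i j. pev0 (q' i j) h) T) ?P l j = 0"
  proof -
   have "mm J (%i j. pev0 (q' i j) h) (mm I T ?P) l j = mm J (%i j. pev0 (q' i j) h) (%l j. 0) l j"
    by (rule mm_cong) (simp_all add: T_ker_0 ij)
   thus ?thesis unfolding mm_assoc by (simp add: mm_def[of _ _ "%l j. 0"])
  qed
  finally show ?thesis by simp
 qed
 have Ph: "mm I ?P (mm I ?h ?P) l j = mm I ?h ?P l j" if "l \<in> I" for l
 proof -
  have "mm I (mm J T' T) (mm I ?h ?P) l j = mm J T' (%l j. 0) l j"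
   unfolding mm_assoc[of I J T' T] by (rule mm_cong) (simp_all add: Th)
  thus ?thesis using that by (simp add: mm_diff_left mm_idm_left[OF fin]) (simp add: mm_def)
 qed
 have "mm I (mm I ?g ?P) (mm I ?h ?P) i j = mm I ?g (mm I ?h ?P) i j"
  unfolding mm_assoc by (rule mm_cong) (simp_all add: Ph)
 also have "... = mm I (mm I ?g ?h) ?P i j" by (simp add: mm_assoc)
 also have "... = mm I (%i j. pev0 (q i j) (g ** h)) ?P i j"
  using ij by (intro mm_cong) (simp_all add: polyrep_mult[OF q rhom_id])
 finally show "mm I (%i j. pev0 (qker i j) g) (%i j. pev0 (qker i j) h) i j = pev0 (qker i j) (g ** h)"
  unfolding e by (simp add: e[THEN fun_cong, THEN fun_cong])
qed

lemma SMod_qker: "carrier (SMod I qker n) = {v \<in> carrier (SMod I q n). mv J I (fsm T) v = (%j. 0)}"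
 "v \<in>. SMod I qker n ==> Lie_chart I qker n coord_z \<eta> v = Lie_chart I q n coord_z \<eta> v"
proof -
 note fin = finite_polyrep[OF q] finite_polyrep[OF q']
 let ?T = "mv J I (fsm T)" and ?P = "%i j. fs (idm i j - mm J T' T i j)"
 have TP: "?T (mv I I ?P v) = (%j. 0)" for v
 proof -
  have "mm I (fsm T) ?P j i = 0" if "j \<in> J" "i \<in> I" for j i
   using arg_cong[OF T_ker_0[OF that], of fs] by (simp add: mm_map)
  thus ?thesis unfolding mv_mv by (simp add: mv_def fun_eq_iff)
 qed
 have Pv: "mv I I ?P v = v" if "?T v = (%j. 0)" "!!i. i \<notin> I ==> v i = 0" for v
 proof -
  have "?P i j = idm i j - mm J (fsm T') (fsm T) i j" for i j
   by (simp add: rhom_diff[OF rhom_fs] mm_map idm_def)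
  hence "mv I I ?P v i = mv I I idm v i - mv I J (fsm T') (?T v) i" for i
   unfolding mv_mv by (simp add: mv_def left_diff_distrib sum_subtractf)
  moreover have "mv I I idm v i = v i" for i
   using fin that(2) by (simp add: mv_def idm_def if_distrib[of "%x. x * _"] cong: if_cong)
  ultimately show ?thesis by (simp add: that(1) mv_0 fun_eq_iff)
 qed
 have r: "mv I I (rho fs qker n G) v = mv I I (rho fs q n G) (mv I I ?P v)" for G v
  unfolding mv_mv qker_def by (rule mv_cong) (simp_all add: rho_pmm[OF fin(1) rhom_fs])
 have d: "mv I I (drho fs qker n G) v = mv I I (drho fs q n G) (mv I I ?P v)" for G v
  unfolding mv_mv qker_def by (rule mv_cong) (simp_all add: rho_pmm[OF fin(1) rhom_fs])
 have fixd: "?T v = (%j. 0)" if "mv I I (rho fs qker n (mat 1)) v = v" for v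
 proof -
  have "?T v = ?T (mv I I (rho fs q n (mat 1)) (mv I I ?P v))" using that by (simp add: r)
  thus ?thesis by (simp add: Mod_map_rho[OF q q' T] TP mv_0)
 qed
 have out: "v i = 0" if "mv I I (rho fs qker n (mat 1)) v = v" "i \<notin> I" for v i
  using that by (metis mv_out)
 show car: "carrier (SMod I qker n) = {v \<in> carrier (SMod I q n). ?T v = (%j. 0)}"
 proof (intro Set.set_eqI iffI)
  fix v assume v: "v \<in>. SMod I qker n"
  hence "mv I I (rho fs qker n (mat 1)) v = v" by (simp add: Mod_carrier)
  from fixd[OF this] Pv[OF fixd[OF this] out[OF this]] v
  show "v \<in> {v \<in> carrier (SMod I q n). ?T v = (%j. 0)}" by (simp add: Mod_carrier r)
 next
  fix v assume v: "v \<in> {v \<in> carrier (SMod I q n). ?T v = (%j. 0)}"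
  hence "mv I I ?P v = v" using Mod_out[OF q] by (intro Pv) auto
  thus "v \<in>. SMod I qker n" using v by (simp add: Mod_carrier r)
 qed
 assume "v \<in>. SMod I qker n"
 hence "?T v = (%j. 0)" "v \<in>. SMod I q n" unfolding car by auto
 hence "mv I I ?P v = v" using Mod_out[OF q] by (intro Pv) auto
 thus "Lie_chart I qker n coord_z \<eta> v = Lie_chart I q n coord_z \<eta> v"
  by (intro ext) (simp add: Lie_chart_def d)
qed

lemma coker_image_0:
 assumes g: "invertible g" and ij: "i \<in> J" "j \<in> J"
 shows "mm J (mm J PT (rho0 q' n' g)) (mm I T T') i j = 0"
proof -
 let ?P = "%i j. idm i j - mm I T T' i j" and ?r = "rho0 q n g" and ?r' = "rho0 q' n' g"
 have "mm J (mm J ?P ?r') T i l = 0" if "l \<in> I" for l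
 proof -
  have "mm J (mm J ?P ?r') T i l = mm J ?P (mm I T ?r) i l"
   unfolding mm_assoc using T g that by (intro mm_cong) (simp_all add: equivariant_def)
  also have "... = mm I (mm J ?P T) ?r i l" by (simp add: mm_assoc)
  also have "... = mm I (%i l. 0) ?r i l" by (rule mm_cong) (simp_all add: coker_T_0 ij)
  finally show ?thesis by (simp add: mm_def[of _ "%i l. 0"])
 qed
 hence "mm I (mm J (mm J ?P ?r') T) T' i j = mm I (%i l. 0) T' i j" by (intro mm_cong) simp_all
 thus ?thesis by (simp add: mm_def[of _ "%i l. 0"] mm_assoc)
qed

lemma coker_equi: 
 assumes g: "invertible g" and ij: "i \<in> J" "j \<in> J"
 shows "mm J (mm J PT (rho0 q' n' g)) PT i j
  = mm J PT (rho0 q' n' g) i j"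
 using coker_image_0[OF assms] ij by (simp add: mm_diff_right mm_idm_right finite_polyrep[OF q'])

lemma rho_qcoker: "rhom \<iota> ==> rho \<iota> qcoker n' g i j = mm J (%i j. \<iota> (idm i j - mm I T T' i j)) (rho \<iota> q' n' g) i j"
 by (simp add: qcoker_def rho_pmm finite_polyrep[OF q'])

lemma polyrep_qcoker: "polyrep J qcoker"
 unfolding polyrep_def
proof (intro conjI allI impI ballI)
 show fin: "finite J" by (rule finite_polyrep[OF q'])
 fix g h :: "'k^2^2" and i j assume g: "invertible g" and h: "invertible h" and ij: "i \<in> J" "j \<in> J"
 let ?P = "%i j. idm i j - mm I T T' i j" and ?r = "rho0 q' n'"
 have gh: "invertible (g ** h)" using g h by (rule invertible_mult)
 have "mm J (rho0 qcoker n' g) (rho0 qcoker n' h) i j = mm J (mm J ?P (?r g)) (mm J ?P (?r h)) i j"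
  by (rule mm_cong) (simp_all add: rho_qcoker)
 also have "... = mm J (mm J (mm J ?P (?r g)) ?P) (?r h) i j" by (simp add: mm_assoc)
 also have "... = mm J (mm J ?P (?r g)) (?r h) i j"
  by (rule mm_cong) (simp_all add: coker_equi[OF g] ij)
 also have "... = mm J ?P (?r (g ** h)) i j"
  unfolding mm_assoc by (rule mm_cong) (simp_all add: rho_mult[OF q' rhom_id] ij)
 finally have "mm J (rho0 qcoker n' g) (rho0 qcoker n' h) i j = rho0 qcoker n' (g ** h) i j"
  by (simp add: rho_qcoker)
 thus "mm J (%i j. pev0 (qcoker i j) g) (%i j. pev0 (qcoker i j) h) i j = pev0 (qcoker i j) (g ** h)"
  using g h by (simp add: mm_def rho_def det_mul power_mult_distrib invertible_det_nz flip: sum_divide_distrib)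
qed

lemma equivariant_qcoker: "equivariant J q' n' J qcoker n' PT"
 unfolding equivariant_def
proof (intro allI impI ballI)
 fix g :: "'k^2^2" and i j assume g: "invertible g" and ij: "i \<in> J" "j \<in> J"
 let ?P = "%i j. idm i j - mm I T T' i j"
 have "mm J (rho0 qcoker n' g) ?P i j = mm J (mm J ?P (rho0 q' n' g)) ?P i j"
  by (rule mm_cong) (simp_all add: rho_qcoker)
 thus "mm J ?P (rho0 q' n' g) i j = mm J (rho0 qcoker n' g) ?P i j"
  using coker_equi[OF g ij] by simp
qed

abbreviation (input) "vT == mv J I (fsm T)"
abbreviation (input) "vP == mv J J (fsm PT)"

lemma vP_eq: "(!!j. j \<notin> J ==> v j = 0) ==> vP v j = v j - vT (mv I J (fsm T') v) j"
proof -
 assume v: "!!j. j \<notin> J ==> v j = 0"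
 have "fs (idm i j - mm I T T' i j) = idm i j - mm I (fsm T) (fsm T') i j" for i j
  by (simp add: rhom_diff[OF rhom_fs] mm_map idm_def)
 hence "vP v j = mv J J idm v j - vT (mv I J (fsm T') v) j"
  unfolding mv_mv by (simp add: mv_def left_diff_distrib sum_subtractf)
 moreover have "mv J J idm v j = v j"
  using finite_polyrep[OF q'] v by (simp add: mv_def idm_def if_distrib[of "%x. x * _"] cong: if_cong)
 ultimately show ?thesis by simp
qed

text \<open>Over each chart T' v is a preimage of v. As T' is not equivariant these preimages do not
  agree on overlaps, so a multiple by a power of h is lifted for each chart and the results are
  glued by \<open>partition_principle\<close>.\<close>

lemma ker_vP: 
 assumes v: "v \<in>. SMod J q' n'" and 0: "vP v = (%j. 0)"
 shows "v \<in> vT ` carrier (SMod I q n)"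
proof (rule partition_principle[OF Mod_module[OF q'] v])
 note hom = Mod_map_hom[OF q q' T]
 note im = image_submodule[OF hom av_module_Mod[OF q]]
 show "vT ` carrier (SMod I q n) \<subseteq> carrier (SMod J q' n')" by (rule im(3))
 show "\<exists>K. coord_fun h ^ K .[SMod J q' n'] v \<in> vT ` carrier (SMod I q n)" for h
 proof -
  let ?v = "mv J J (rho fs q' n' (cc coord_z h)) v" and ?T' = "mv I J (fsm T')"
  have "\<forall>i. ?T' ?v i \<in> loc h" using v by (auto simp: Mod_carrier intro: mv_loc)
  from local_lift_ex[OF q this, of n] obtain K where
   K: "(%i. fcoord h ^ K * mv I I (rho fs q n (cc h coord_z)) (?T' ?v) i) \<in>. SMod I q n" by blast
  have "vP ?v = mv J J (rho fs qcoker n' (cc coord_z h)) (vP v)"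
   by (simp add: Mod_map_rho[OF q' polyrep_qcoker equivariant_qcoker])
  hence "vP ?v j = 0" for j by (simp add: 0 mv_0)
  hence "vT (?T' ?v) = ?v" using vP_eq[of ?v] by (simp add: mv_out fun_eq_iff)
  hence "vT (%i. fcoord h ^ K * mv I I (rho fs q n (cc h coord_z)) (?T' ?v) i) = (%j. fcoord h ^ K * v j)"
   using v by (simp add: mv_smult Mod_map_rho[OF q q' T] mv_rho_fixed[OF q'] Mod_carrier)
  thus ?thesis using K by (intro exI[of _ K] image_eqI[OF _ K]) (simp add: incl_power)
 qed
qed (use image_submodule[OF Mod_map_hom[OF q q' T] av_module_Mod[OF q]] in auto)

text \<open>In the chart h the vector y is its own preimage, since the projection fixes everything
  in the range of \<open>qcoker\<close>; multiplied by a power of h it lifts to the module of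
  q'.\<close>

lemma vP_surj: "vP ` carrier (SMod J q' n') = carrier (SMod J qcoker n')"
proof
 note hom = Mod_map_hom[OF q' polyrep_qcoker equivariant_qcoker]
 note im = image_submodule[OF hom av_module_Mod[OF q']]
 show "vP ` carrier (SMod J q' n') \<subseteq> carrier (SMod J qcoker n')" by (rule im(3))
 show "carrier (SMod J qcoker n') \<subseteq> vP ` carrier (SMod J q' n')"
 proof
  fix y assume y: "y \<in>. SMod J qcoker n'"
  show "y \<in> vP ` carrier (SMod J q' n')"
  proof (rule partition_principle[OF Mod_module[OF polyrep_qcoker] y im(3)])
   show "\<exists>K. coord_fun h ^ K .[SMod J qcoker n'] y \<in> vP ` carrier (SMod J q' n')" for h
   proof -
    let ?y = "mv J J (rho fs qcoker n' (cc coord_z h)) y"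
    have "\<forall>i. ?y i \<in> loc h" using y by (simp add: Mod_carrier)
    from local_lift_ex[OF q' this, of n'] obtain K where
     K: "(%i. fcoord h ^ K * mv J J (rho fs q' n' (cc h coord_z)) ?y i) \<in>. SMod J q' n'" by blast
    have PP: "mm J (fsm PT) (fsm PT) i j
      = fs (idm i j - mm I T T' i j)" if "i \<in> J" "j \<in> J" for i j
    proof -
     let ?P = "%i j. idm i j - mm I T T' i j"
     have "mm J ?P (mm I T T') i j = mm I (%i l. 0) T' i j"
      unfolding mm_assoc[symmetric] by (rule mm_cong) (simp_all add: coker_T_0 that)
     hence "mm J ?P ?P i j = ?P i j"
      using that by (subst mm_diff_right) (simp add: mm_idm_right finite_polyrep[OF q'] mm_def[of _ "%i l. 0"])
     from arg_cong[OF this, of fs] show ?thesis by (simp add: mm_map[OF rhom_fs])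
    qed
    have vPR: "vP (mv J J (rho fs qcoker n' G) u) = mv J J (rho fs qcoker n' G) u" for G u
     unfolding mv_mv
    proof (rule mv_cong)
     fix i j assume ij: "i \<in> J" "j \<in> J"
     let ?P = "%i j. fs (idm i j - mm I T T' i j)"
     have "mm J ?P (rho fs qcoker n' G) i j = mm J (mm J ?P ?P) (rho fs q' n' G) i j"
      unfolding mm_assoc by (rule mm_cong) (simp_all add: rho_qcoker)
     also have "... = mm J ?P (rho fs q' n' G) i j" by (rule mm_cong) (simp_all add: PP ij)
     finally show "mm J ?P (rho fs qcoker n' G) i j = rho fs qcoker n' G i j" by (simp add: rho_qcoker)
    qed simp
    have "vP (%i. fcoord h ^ K * mv J J (rho fs q' n' (cc h coord_z)) ?y i) = (%j. fcoord h ^ K * y j)"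
     using y by (simp add: mv_smult Mod_map_rho[OF q' polyrep_qcoker equivariant_qcoker] vPR mv_rho_fixed[OF polyrep_qcoker] Mod_carrier)
    thus ?thesis using K by (intro exI[of _ K] image_eqI[OF _ K]) (simp add: incl_power)
   qed
  qed (use im in auto)
 qed
qed

lemma vP_vT: "vP (vT v) = (%j. 0)"
proof -
 have "mm J (fsm PT) (fsm T) j i = 0" if "j \<in> J" "i \<in> I" for i j
  using arg_cong[OF coker_T_0[OF that], of fs] by (simp add: mm_map[OF rhom_fs])
 thus ?thesis unfolding mv_mv by (simp add: mv_def fun_eq_iff)
qed

end

lemma rep_hom_matrix:
 assumes M: "av_module M" and q: "polyrep I q" and q': "polyrep J q'"
  and \<alpha>: "\<alpha> \<in> av_hom M (SMod I q n)" "bij_betw \<alpha> (carrier M) (carrier (SMod I q n))"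
  and \<beta>: "\<beta> \<in> av_hom N (SMod J q' n')" and f: "f \<in> av_hom M N"
 shows "\<exists>T. equivariant I q n J q' n' T \<and> (\<forall>m\<in>carrier M. \<beta> (f m) = mv J I (fsm T) (\<alpha> m))"
proof -
 have "(%v. \<beta> (f (the_inv_into (carrier M) \<alpha> v))) \<in> av_hom (SMod I q n) (SMod J q' n')"
  by (rule av_hom_comp[OF av_hom_comp[OF av_hom_inverse[OF \<alpha> av_module_closed[OF M]] f] \<beta>])
 from Mod_hom_matrix[OF q q' this] obtain T where T: "equivariant I q n J q' n' T"
  "!!v. v \<in>. SMod I q n ==> \<beta> (f (the_inv_into (carrier M) \<alpha> v)) = mv J I (fsm T) v" by blast
 have "\<beta> (f m) = mv J I (fsm T) (\<alpha> m)" if "m \<in>. M" for m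
  using T(2)[of "\<alpha> m"] av_hom_closed[OF \<alpha>(1) that] the_inv_into_f_f[OF bij_betw_imp_inj_on[OF \<alpha>(2)] that] by simp
 thus ?thesis using T(1) by blast
qed

lemma Mod_zero_iff:
 assumes N: "av_module N" and q': "polyrep J q'"
  and \<beta>: "\<beta> \<in> av_hom N (SMod J q' n')" "bij_betw \<beta> (carrier N) (carrier (SMod J q' n'))" and x: "x \<in>. N"
 shows "\<beta> x = (%j. 0) \<longleftrightarrow> x = 0[N]"
proof -
 have "\<beta> 0[N] = (%j. 0)"
  using additive_zero[OF av_abelian[OF N] Mod_abelian[OF q', of n'], of \<beta>] av_homD[OF \<beta>(1)] by simp
 thus ?thesis using bij_betw_imp_inj_on[OF \<beta>(2)] x av_zero_closed[OF N] by (metis inj_onD)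
qed

lemma av_kernel_iso:
 assumes M: "av_module M" "rep_module M I q n" and N: "av_module N" "rep_module N J q' n'" and f: "f \<in> av_hom M N"
 shows "\<exists>r. rep_module (M\<lparr>carrier := {m \<in> carrier M. f m = 0[N]}\<rparr>) I r n"
proof -
 obtain \<alpha> \<beta> where \<alpha>: "\<alpha> \<in> av_hom M (SMod I q n)" "bij_betw \<alpha> (carrier M) (carrier (SMod I q n))"
  and \<beta>: "\<beta> \<in> av_hom N (SMod J q' n')" "bij_betw \<beta> (carrier N) (carrier (SMod J q' n'))"
  and q: "polyrep I q" and q': "polyrep J q'" using M N by (auto simp: rep_module_def av_iso_def)
 obtain T where T: "equivariant I q n J q' n' T" "!!m. m \<in>. M ==> \<beta> (f m) = mv J I (fsm T) (\<alpha> m)"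
  using rep_hom_matrix[OF M(1) q q' \<alpha> \<beta>(1) f] by blast
 obtain T' where T': "\<forall>j\<in>J. \<forall>i\<in>I. mm J (mm I T T') T j i = T j i"
  using generalized_inverse[OF finite_polyrep[OF q] finite_polyrep[OF q'], of T] by blast
 let ?K = "M\<lparr>carrier := {m \<in> carrier M. f m = 0[N]}\<rparr>"
 note r = polyrep_qker[OF q q' T(1) T'] and c = SMod_qker[OF q q' T(1) T']
 let ?Q = "SMod I (qker I q J T T') n"
 have iff: "f m = 0[N] \<longleftrightarrow> \<alpha> m \<in>. ?Q" if "m \<in>. M" for m
  using Mod_zero_iff[OF N(1) q' \<beta>, of "f m"] av_hom_closed[OF f that] av_hom_closed[OF \<alpha>(1) that] T(2)[OF that] by (simp add: c(1))
 have "\<alpha> \<in> av_hom ?K ?Q"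
  by (rule av_homI) (auto simp: iff av_homD[OF \<alpha>(1)] c(2))
 moreover have "bij_betw \<alpha> (carrier ?K) (carrier ?Q)"
 proof -
  have "inj_on \<alpha> (carrier ?K)" by (rule inj_on_subset[OF bij_betw_imp_inj_on[OF \<alpha>(2)]]) auto
  moreover have "\<alpha> ` carrier ?K = carrier ?Q"
  proof
   show "\<alpha> ` carrier ?K \<subseteq> carrier ?Q" by (auto simp: iff)
   show "carrier ?Q \<subseteq> \<alpha> ` carrier ?K"
   proof
    fix v assume v: "v \<in>. ?Q"
    hence "v \<in> \<alpha> ` carrier M" using bij_betw_imp_surj_on[OF \<alpha>(2)] by (simp add: c(1))
    thus "v \<in> \<alpha> ` carrier ?K" using v iff by auto
   qed
  qed
  ultimately show ?thesis by (simp add: bij_betw_def)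
 qed
 ultimately show ?thesis using r by (auto simp: rep_module_def av_iso_def)
qed

text \<open>First isomorphism theorem: \<beta> followed by the projection has kernel the image of f
  by \<open>ker_vP\<close> and is onto by \<open>vP_surj\<close>.\<close>

lemma av_cokernel_iso:
 assumes M: "av_module M" "rep_module M I q n" and N: "av_module N" "rep_module N J q' n'" and f: "f \<in> av_hom M N"
 shows "\<exists>r. rep_module (av_quotient N (f ` carrier M)) J r n'"
proof -
 obtain \<alpha> \<beta> where \<alpha>: "\<alpha> \<in> av_hom M (SMod I q n)" "bij_betw \<alpha> (carrier M) (carrier (SMod I q n))"
  and \<beta>: "\<beta> \<in> av_hom N (SMod J q' n')" "bij_betw \<beta> (carrier N) (carrier (SMod J q' n'))"
  and q: "polyrep I q" and q': "polyrep J q'" using M N by (auto simp: rep_module_def av_iso_def)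
 obtain T where T: "equivariant I q n J q' n' T" "!!m. m \<in>. M ==> \<beta> (f m) = mv J I (fsm T) (\<alpha> m)"
  using rep_hom_matrix[OF M(1) q q' \<alpha> \<beta>(1) f] by blast
 obtain T' where T': "\<forall>j\<in>J. \<forall>i\<in>I. mm J (mm I T T') T j i = T j i"
  using generalized_inverse[OF finite_polyrep[OF q] finite_polyrep[OF q'], of T] by blast
 note r = polyrep_qcoker[OF q q' T(1) T'] and eq = equivariant_qcoker[OF q q' T(1) T']
 let ?Q = "SMod J (qcoker I J q' T T') n'" and ?P = "mv J J (%i j. fs (idm i j - mm I T T' i j))"
 let ?W = "f ` carrier M"
 define G where "G x = ?P (\<beta> x)" for x
 have G: "G \<in> av_hom N ?Q" unfolding G_def by (rule av_hom_comp[OF \<beta>(1) Mod_map_hom[OF q' r eq]])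
 note W = image_submodule[OF f M(1)]
 interpret N: Module.module univ_ring N by (rule av_module_module[OF N(1)])
 have W0: "0[N] \<in> ?W"
  using additive_zero[OF av_abelian[OF M(1)] N.abelian_group_axioms, of f] av_homD[OF f] av_zero_closed[OF M(1)] by (metis imageI)
 have GW: "G x = (%j. 0) \<longleftrightarrow> x \<in> ?W" if x: "x \<in>. N" for x
 proof
  assume "x \<in> ?W"
  thus "G x = (%j. 0)" by (auto simp: G_def T(2) vP_vT[OF q q' T(1) T'])
 next
  assume "G x = (%j. 0)"
  from ker_vP[OF q q' T(1) T' av_hom_closed[OF \<beta>(1) x] this[unfolded G_def]]
  obtain v where v: "v \<in>. SMod I q n" "\<beta> x = mv J I (fsm T) v" by auto
  obtain m where m: "m \<in>. M" "\<alpha> m = v" using v(1) bij_betw_imp_surj_on[OF \<alpha>(2)] by (metis imageE)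
  hence "\<beta> (f m) = \<beta> x" using T(2) v by simp
  hence "x = f m" using x av_hom_closed[OF f m(1)] bij_betw_imp_inj_on[OF \<beta>(2)] by (metis inj_onD)
  thus "x \<in> ?W" using m by simp
 qed
 have sub: "additive_subgroup ?W N"
 proof (rule additive_subgroupI)
  show "subgroup ?W (add_monoid N)"
  proof (rule N.add.subgroupI)
   fix x assume x: "x \<in> ?W"
   hence xN: "x \<in>. N" using W(3) by auto
   have "(- 1) .[N] x +[N] x = 0[N]"
    using N.smult_l_distr[of "- 1" 1 x] N.smult_one[of x] N.smult_l_null[of x] xN by simp
   hence "\<ominus>\<^bsub>N\<^esub> x = (- 1) .[N] x" using xN N.smult_closed[of "- 1" x] by (intro N.minus_equality) auto
   thus "\<ominus>\<^bsub>N\<^esub> x \<in> ?W" using W(2)[OF x] by simp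
  qed (use W W0 in auto)
 qed
 interpret W: abelian_subgroup ?W N by (rule abelian_subgroupI3[OF sub N.abelian_group_axioms])
 have Gcos: "G x = G y" if "x \<in> ?W +>\<^bsub>N\<^esub> y" "y \<in>. N" for x y
 proof -
  obtain w where w: "w \<in> ?W" "x = w +[N] y" using \<open>x \<in> ?W +>\<^bsub>N\<^esub> y\<close> by (auto simp: a_r_coset_def')
  have wN: "w \<in>. N" using w W(3) by auto
  have "G w = (%j. 0)" using GW[OF wN] w by simp
  thus ?thesis using av_hom_add[OF G wN that(2)] w by simp
 qed
 have some: "(SOME x. x \<in> ?W +>\<^bsub>N\<^esub> y) \<in> ?W +>\<^bsub>N\<^esub> y" if "y \<in>. N" for y
  using W.a_rcos_self[OF that] by (rule someI)
 have someN: "(SOME x. x \<in> ?W +>\<^bsub>N\<^esub> y) \<in>. N" if "y \<in>. N" for y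
  using some[OF that] W.a_rcosets_carrier N.a_r_coset_subset_G[OF W(3) that] by auto
 define \<gamma> where "\<gamma> C = G (SOME x. x \<in> C)" for C
 have \<gamma>: "\<gamma> (?W +>\<^bsub>N\<^esub> y) = G y" if "y \<in>. N" for y
  unfolding \<gamma>_def using Gcos[OF some[OF that] that] .
 have car: "carrier (av_quotient N ?W) = {?W +>\<^bsub>N\<^esub> y |y. y \<in> carrier N}"
  by (auto simp: av_quotient_def A_RCOSETS_def')
 have hom: "\<gamma> \<in> av_hom (av_quotient N ?W) ?Q"
 proof (rule av_homI)
  fix C assume "C \<in>. av_quotient N ?W"
  then obtain x where x: "x \<in>. N" "C = ?W +>\<^bsub>N\<^esub> x" by (auto simp: car)
  show "\<gamma> C \<in>. ?Q" using x by (simp add: \<gamma> av_homD[OF G])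
  show "\<gamma> (a .[av_quotient N ?W] C) = a .[?Q] \<gamma> C" for a
   using x someN[OF x(1)] av_smult_closed[OF N(1)] av_hom_smult[OF G] by (simp add: av_quotient_def \<gamma> Gcos[OF some])
  show "\<gamma> (lie (av_quotient N ?W) \<eta> C) = lie ?Q \<eta> (\<gamma> C)" if "\<eta> \<in> derivations" for \<eta>
   using that x someN[OF x(1)] av_lie_closed[OF N(1)] av_hom_lie[OF G] by (simp add: av_quotient_def \<gamma> Gcos[OF some])
  fix D assume "D \<in>. av_quotient N ?W"
  then obtain y where y: "y \<in>. N" "D = ?W +>\<^bsub>N\<^esub> y" by (auto simp: car)
  show "\<gamma> (C +[av_quotient N ?W] D) = \<gamma> C +[?Q] \<gamma> D"
   using x y W.a_rcos_sum av_hom_add[OF G x(1) y(1)] by (simp add: av_quotient_def \<gamma>)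
 qed
 have "inj_on \<gamma> (carrier (av_quotient N ?W))"
 proof (rule inj_onI)
  fix C D assume "C \<in>. av_quotient N ?W" "D \<in>. av_quotient N ?W" "\<gamma> C = \<gamma> D"
  then obtain x y where xy: "x \<in>. N" "C = ?W +>\<^bsub>N\<^esub> x" "y \<in>. N" "D = ?W +>\<^bsub>N\<^esub> y" "G x = G y"
   by (auto simp: car \<gamma>)
  have "x -[N] y +[N] y = x" using xy by (simp add: a_minus_def N.a_assoc N.l_neg)
  moreover from this have "G (x -[N] y) = (%j. 0)"
   using av_hom_add[OF G, of "x -[N] y" y] xy by (simp add: fun_eq_iff)
  hence "x -[N] y \<in> ?W" using GW[of "x -[N] y"] xy by simp
  ultimately have "x \<in> ?W +>\<^bsub>N\<^esub> y" unfolding a_r_coset_def' by force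
  thus "C = D" using xy W.a_repr_independence' by metis
 qed
 moreover have "\<gamma> ` carrier (av_quotient N ?W) = carrier ?Q"
 proof -
  have "\<gamma> ` carrier (av_quotient N ?W) = G ` carrier N" unfolding car using \<gamma> by (auto simp: image_iff) metis
  also have "... = ?P ` carrier (SMod J q' n')"
   unfolding G_def using bij_betw_imp_surj_on[OF \<beta>(2)] by (metis image_image)
  also have "... = carrier ?Q" by (rule vP_surj[OF q q' T(1) T'])
  finally show ?thesis .
 qed
 ultimately show ?thesis using hom r unfolding rep_module_def av_iso_def bij_betw_def by blast
qed

subsection \<open>Coordinates on base changes of vector spaces\<close>

definition vecs :: "('i => 'f::ab_group_add) ring"
 where "vecs = \<lparr>carrier = UNIV, mult = undefined, one = undefined, zero = (%i. 0), add = (%v w i. v i + w i)\<rparr>"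

lemma vecs_simps [simp]: "carrier vecs = UNIV" "zero vecs = (%i. 0)" "add vecs = (%v w i. v i + w i)"
 by (simp_all add: vecs_def)

lemma vecs_abelian: "abelian_group (vecs :: ('i => 'f::ab_group_add) ring)"
proof (rule abelian_groupI)
 fix x :: "'i => 'f"
 show "\<exists>y\<in>carrier vecs. y +[vecs] x = 0[vecs]" by (rule bexI[of _ "%i. - x i"]) simp_all
qed (simp_all add: algebra_simps)

lemma finsum_vecs: "finite A ==> finsum (vecs :: ('i => 'f::ab_group_add) ring) g A = (%i. \<Sum>a\<in>A. g a i)"
proof -
 interpret abelian_group "vecs :: ('i => 'f) ring" by (rule vecs_abelian)
 show "finite A ==> ?thesis" by (induction A rule: finite_induct) simp_all
qed

definition kspace :: "'k::field_char_0 sphere fract set => bool"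
 where "kspace B \<longleftrightarrow> 0 \<in> B \<and> (\<forall>f\<in>B. \<forall>g\<in>B. f + g \<in> B) \<and> (\<forall>c. \<forall>f\<in>B. fs c * f \<in> B)"

lemma kspace_loc: "kspace (loc h)"
 by (simp add: kspace_def loc_add loc_mult)

lemma kspace_loc2: "kspace (loc2 h h' :: 'k::field_char_0 sphere fract set)"
proof -
 have "0 \<in> loc2 h h'" "fs c \<in> loc2 h h'" for c :: 'k
  by (rule subsetD[OF loc_subset_loc2(1)], simp)+
 thus ?thesis by (auto simp: kspace_def loc2_add intro: loc2_mult)
qed

lemma fract_space_simps [simp]:
 "carrier (fract_space B) = B" "add (fract_space B) = (+)" "zero (fract_space B) = 0" "smult (fract_space B) = (%c g. fs c * g)"
 by (simp_all add: fract_space_def)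

lemma fract_space_module:
 assumes B: "kspace B"
 shows "Module.module univ_ring (fract_space B)"
proof (rule moduleI)
 show "cring (univ_ring :: 'a ring)" by (rule cring_univ_ring)
 show "abelian_group (fract_space B)"
 proof (rule abelian_groupI)
  fix x assume x: "x \<in>. fract_space B"
  hence "fs (- 1) * x \<in> B" using B by (simp add: kspace_def)
  thus "\<exists>y\<in>carrier (fract_space B). y +[fract_space B] x = 0[fract_space B]"
   by (intro bexI[of _ "fs (- 1) * x"]) (simp_all add: rhom_minus)
 qed (use B in \<open>simp_all add: kspace_def algebra_simps\<close>)
qed (use B in \<open>simp_all add: kspace_def fract_scalar_add fract_scalar_mult algebra_simps\<close>)

text \<open>The family b only has to span, with a chosen linear section \<sigma> giving
  coefficients. Besides bases this admits the columns of an idempotent matrix \<rho>(1), as in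
  \<open>rep_space\<close>.\<close>

definition coords :: "('k::field_char_0, 'u) mat_struct => 'i set => ('i => 'u) => ('u => 'i => 'k) => bool"
 where "coords U I b \<sigma> \<longleftrightarrow> Module.module univ_ring U \<and> finite I \<and> b \<in> I \<rightarrow> carrier U \<and>
  (\<forall>u\<in>carrier U. u = (\<Oplus>\<^bsub>U\<^esub>i\<in>I. \<sigma> u i .[U] b i)) \<and>
  (\<forall>u\<in>carrier U. \<forall>v\<in>carrier U. \<sigma> (u +[U] v) = (%i. \<sigma> u i + \<sigma> v i)) \<and>
  (\<forall>c. \<forall>u\<in>carrier U. \<sigma> (c .[U] u) = (%i. c * \<sigma> u i)) \<and>
  (\<forall>u\<in>carrier U. \<forall>i. i \<notin> I --> \<sigma> u i = 0)"

context
 fixes U :: "('k::field_char_0, 'u) mat_struct" and I :: "'i set" and b \<sigma>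
 assumes co: "coords U I b \<sigma>"
begin

lemma coordsD:
 shows U_module: "Module.module univ_ring U" and finite_I: "finite I" and b_closed: "i \<in> I ==> b i \<in>. U"
  and \<sigma>_expand: "u \<in>. U ==> (\<Oplus>\<^bsub>U\<^esub>i\<in>I. \<sigma> u i .[U] b i) = u"
  and \<sigma>_add: "[|u \<in>. U; v \<in>. U|] ==> \<sigma> (u +[U] v) = (%i. \<sigma> u i + \<sigma> v i)"
  and \<sigma>_smult: "u \<in>. U ==> \<sigma> (c .[U] u) = (%i. c * \<sigma> u i)"
  and \<sigma>_out: "[|u \<in>. U; i \<notin> I|] ==> \<sigma> u i = 0"
 using co by (auto simp: coords_def)

interpretation U: Module.module univ_ring U by (rule U_module)

lemma U_smult_closed: "u \<in>. U ==> c .[U] u \<in>. U"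
 using U.smult_closed[of c u] by simp

lemma \<sigma>_inj: "inj_on \<sigma> (carrier U)"
 by (rule inj_onI) (metis \<sigma>_expand)

lemma \<sigma>_finsum: "finite A ==> g \<in> A \<rightarrow> carrier U ==> \<sigma> (finsum U g A) = (%i. \<Sum>a\<in>A. \<sigma> (g a) i)"
 using additive_finsum[OF U.abelian_group_axioms vecs_abelian, of \<sigma> g A] by (simp add: \<sigma>_add finsum_vecs)

context
 fixes B :: "'k sphere fract set"
 assumes B: "kspace B"
begin

lemmas fu = fract_space_module[OF B] U_module

abbreviation (input) "FT == fract_tensor B U"
abbreviation (input) "fp == fract_pure B U"

interpretation FT: abelian_group FT by (rule tensor_abelian[OF fu])

definition tcoord :: "(('k sphere fract \<times> 'u) \<Rightarrow>\<^sub>0 int) set => 'i => 'k sphere fract"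
 where "tcoord = gen_lift vecs (%(g, u) i. g * fs (\<sigma> u i))"

lemma tcoord:
 shows tcoord_add: "[|x \<in>. FT; y \<in>. FT|] ==>
   tcoord (x +[FT] y) = (%i. tcoord x i + tcoord y i)"
  and tcoord_pure: "[|g \<in> B; u \<in>. U|] ==> tcoord (fp g u) = (%i. g * fs (\<sigma> u i))"
proof -
 note l = tensor_lift[OF fu vecs_abelian, where f = "%(g, u) i. g * fs (\<sigma> u i)", folded tcoord_def]
 show "[|x \<in>. FT; y \<in>. FT|] ==>
   tcoord (x +[FT] y) = (%i. tcoord x i + tcoord y i)"
  by (rule l(2)[simplified]) (simp_all add: \<sigma>_add \<sigma>_smult fract_scalar_add fract_scalar_mult algebra_simps)
 show "[|g \<in> B; u \<in>. U|] ==> tcoord (fp g u) = (%i. g * fs (\<sigma> u i))"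
  by (rule l(3)[simplified]) (simp_all add: \<sigma>_add \<sigma>_smult fract_scalar_add fract_scalar_mult algebra_simps)
qed

lemma fpure_closed: "[|g \<in> B; u \<in>. U|] ==> fp g u \<in>. FT"
 using pure_tensor_closed[OF fu] by simp

lemma fpure_add: "[|g \<in> B; g' \<in> B; u \<in>. U|] ==>
  fp (g + g') u = fp g u +[FT] fp g' u"
 using pure_tensor_add_left[OF fu] by simp

lemma fpure_smult: "[|g \<in> B; u \<in>. U|] ==> fp (fs c * g) u = fp g (c .[U] u)"
 using pure_tensor_smult[OF fu, of c g u] by simp

lemmas find = tensor_induct[OF fu, consumes 1, case_names zero diff of]

lemma tcoord_zero: "tcoord 0[FT] = (%i. 0)"
 using additive_zero[OF FT.abelian_group_axioms vecs_abelian, of tcoord] by (simp add: tcoord_add)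

lemma tcoord_diff: "[|x \<in>. FT; y \<in>. FT|] ==>
  tcoord (x -[FT] y) = (%i. tcoord x i - tcoord y i)"
proof -
 assume xy: "x \<in>. FT" "y \<in>. FT"
 have "tcoord (x -[FT] y +[FT] y) = tcoord x"
  using xy by (simp add: a_minus_def FT.a_assoc FT.l_neg)
 thus ?thesis using xy by (simp add: tcoord_add fun_eq_iff eq_diff_eq)
qed

lemma tcoord_finsum: "finite A ==> g \<in> A \<rightarrow> carrier FT ==>
  tcoord (finsum FT g A) = (%i. \<Sum>a\<in>A. tcoord (g a) i)"
 using additive_finsum[OF FT.abelian_group_axioms vecs_abelian, of tcoord g A] by (simp add: tcoord_add finsum_vecs)

lemma tcoord_range:
 assumes "x \<in>. FT"
 shows "tcoord x i \<in> B"
 using assms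
proof (induction rule: find)
 case (diff x y)
 have "tcoord x i + fs (- 1) * tcoord y i \<in> B" using B diff(3,4) by (auto simp: kspace_def)
 thus ?case by (simp add: tcoord_diff[OF diff(1,2)] rhom_minus)
next
 case (of s)
 then obtain g u where s: "s = (g, u)" and gu: "g \<in> B" "u \<in>. U" by auto
 have "g * fs (\<sigma> u i) \<in> B" using B gu by (metis kspace_def mult.commute)
 thus ?case using tcoord_pure[OF gu] by (simp add: s pure_tensor_def)
qed (use B in \<open>simp add: tcoord_zero kspace_def\<close>)

lemma tcoord_expand:
 assumes "x \<in>. FT"
 shows "(\<Oplus>\<^bsub>FT\<^esub>i\<in>I. fp (tcoord x i) (b i)) = x"
proof -
 let ?p = "%x i. fp (tcoord x i) (b i)"
 have p: "?p x \<in> I \<rightarrow> carrier FT" if "x \<in>. FT" for x using that by (auto intro: fpure_closed b_closed tcoord_range)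
 have cl: "finsum FT (?p x) I \<in>. FT" if "x \<in>. FT" for x by (rule FT.finsum_closed[OF p[OF that]])
 have add: "finsum FT (?p (x +[FT] y)) I = finsum FT (?p x) I +[FT] finsum FT (?p y) I" if "x \<in>. FT" "y \<in>. FT" for x y
  unfolding FT.finsum_addf[OF p[OF that(1)] p[OF that(2)], symmetric]
  by (rule FT.finsum_cong') (use that in \<open>auto simp: tcoord_add fpure_add tcoord_range b_closed intro!: fpure_closed\<close>)
 note G = additive[OF FT.abelian_group_axioms FT.abelian_group_axioms cl add]
 show ?thesis using assms
 proof (induction rule: find)
  case (of s)
  then obtain g u where s: "s = (g, u)" and gu: "g \<in> B" "u \<in>. U" by auto
  have "fp g u = fp g (\<Oplus>\<^bsub>U\<^esub>i\<in>I. \<sigma> u i .[U] b i)" using gu by (simp add: \<sigma>_expand)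
  also have "... = (\<Oplus>\<^bsub>FT\<^esub>i\<in>I. fp g (\<sigma> u i .[U] b i))"
   by (rule additive_finsum[OF U.abelian_group_axioms FT.abelian_group_axioms])
     (use gu pure_tensor_add_right[OF fu] b_closed U_smult_closed finite_I in \<open>auto intro: fpure_closed\<close>)
  also have "... = (\<Oplus>\<^bsub>FT\<^esub>i\<in>I. fp (tcoord (fp g u) i) (b i))"
   by (rule FT.finsum_cong')
     (use gu b_closed B in \<open>auto simp: tcoord_pure mult.commute kspace_def fpure_smult[symmetric] intro!: fpure_closed\<close>)
  finally show ?case by (simp add: s pure_tensor_def)
 qed (simp_all add: G)
qed

lemma tcoord_inj: "inj_on tcoord (carrier FT)"
proof (rule inj_onI)
 fix x y assume x: "x \<in>. FT" and y: "y \<in>. FT" and eq: "tcoord x = tcoord y"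
 show "x = y" using tcoord_expand[OF x] tcoord_expand[OF y] unfolding eq by (rule trans[OF sym])
qed

text \<open>As b may be linearly dependent, not every vector is a coordinate vector; the second
  hypothesis says that v is fixed by the matrix with columns \<sigma>(b_j).\<close>

lemma tcoord_surj:
 assumes "!!i. i \<in> I ==> v i \<in> B" "!!i. v i = (\<Sum>j\<in>I. fs (\<sigma> (b j) i) * v j)"
 shows "\<exists>x\<in>carrier FT. tcoord x = v"
proof
 have p: "(%i. fp (v i) (b i)) \<in> I \<rightarrow> carrier FT"
  using assms(1) b_closed fpure_closed by auto
 show "(\<Oplus>\<^bsub>FT\<^esub>i\<in>I. fp (v i) (b i)) \<in>. FT"
  by (rule FT.finsum_closed[OF p])
 show "tcoord (\<Oplus>\<^bsub>FT\<^esub>i\<in>I. fp (v i) (b i)) = v"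
 proof
  fix i
  have "(\<Sum>a\<in>I. tcoord (fp (v a) (b a)) i) = (\<Sum>a\<in>I. fs (\<sigma> (b a) i) * v a)"
   by (rule sum.cong) (simp_all add: tcoord_pure assms(1) b_closed mult.commute)
  thus "tcoord (\<Oplus>\<^bsub>FT\<^esub>i\<in>I. fp (v i) (b i)) i = v i"
   unfolding tcoord_finsum[OF finite_I p] assms(2)[of i, symmetric] .
 qed
qed

end

lemma tcoord_transfer:
 assumes B: "kspace B" and B': "kspace B'"
  and f: "!!g u. [|g \<in> B; u \<in>. U|] ==> f (g, u) \<in>. fract_tensor B' U"
  and \<Lambda>: "!!v w. \<Lambda> (%i. v i + w i) = (%i. \<Lambda> v i + \<Lambda> w i)"
  and gen: "!!g u. [|g \<in> B; u \<in>. U|] ==> tcoord (f (g, u)) = \<Lambda> (%i. g * fs (\<sigma> u i))"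
  and x: "x \<in>. fract_tensor B U"
 shows "gen_lift (fract_tensor B' U) f x \<in>. fract_tensor B' U \<and> tcoord (gen_lift (fract_tensor B' U) f x) = \<Lambda> (tcoord x)"
proof -
 note l = tensor_transfer[OF fu[OF B] tensor_abelian[OF fu[OF B']], where \<theta> = tcoord and \<Theta> = tcoord and \<Lambda> = \<Lambda> and f = f]
 have f': "f \<in> carrier (fract_space B) \<times> carrier U \<rightarrow> carrier (fract_tensor B' U)" using f by auto
 have g': "tcoord (f s) = \<Lambda> (tcoord (gen_class (carrier (fract_space B) \<times> carrier U) (tensor_relations univ_ring (fract_space B) U) s))"
  if s': "s \<in> carrier (fract_space B) \<times> carrier U" for s
 proof -
  obtain g u where s: "s = (g, u)" and gu: "g \<in> B" "u \<in>. U" using s' by auto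
  show ?thesis using gen[OF gu] tcoord_pure[OF B gu] by (simp add: s pure_tensor_def)
 qed
 show ?thesis
  by (intro conjI l(1)[OF f' _ tcoord_inj[OF B'] _ \<Lambda> g' x] l(4)[OF f' _ tcoord_inj[OF B'] _ \<Lambda> g' x])
    (simp_all add: tcoord_add[OF B] tcoord_add[OF B'])
qed

lemma tcoord_incl:
 assumes B: "kspace B" and B': "kspace B'" and sub: "B \<subseteq> B'" and x: "x \<in>. fract_tensor B U"
 shows "fract_incl B' U x \<in>. fract_tensor B' U" "tcoord (fract_incl B' U x) = tcoord x"
 using tcoord_transfer[OF B B' _ _ _ x, where \<Lambda> = "%v. v" and f = "%(g, u). fract_pure B' U g u"] sub
 by (auto simp: fract_incl_def fpure_closed[OF B'] tcoord_pure[OF B'] subset_iff)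

lemma chart_module_simps:
 "carrier (chart_module h U) = carrier (fract_tensor (loc h) U)" "add (chart_module h U) = add (fract_tensor (loc h) U)"
 "zero (chart_module h U) = zero (fract_tensor (loc h) U)"
 by (simp_all add: chart_module_def Let_def)

lemma tcoord_chart_smult:
 assumes x: "x \<in>. chart_module h U"
 shows "a .[chart_module h U] x \<in>. chart_module h U" "tcoord (a .[chart_module h U] x) = (%i. incl a * tcoord x i)"
 using tcoord_transfer[OF kspace_loc kspace_loc _ _ _ x[unfolded chart_module_simps], where \<Lambda> = "%v i. incl a * v i" and
   f = "%(g, u). fract_pure (loc h) U (incl a * g) u"]
 by (auto simp: chart_module_def Let_def fpure_closed[OF kspace_loc] tcoord_pure[OF kspace_loc] loc_mult algebra_simps)

text \<open>Passage from the definition of \<open>chart_module\<close> to coordinates. The sum over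
  coordinate derivatives of g is \<eta>(g) by \<open>fder_expand\<close>.\<close>

lemma tcoord_chart_lie:
 assumes x: "x \<in>. chart_module h U" and \<eta>: "\<eta> \<in> derivations"
  and act: "!!p m u. u \<in>. U ==> mact U (mat_unit p m) u \<in>. U"
  and act_A: "!!p m u. u \<in>. U ==> \<sigma> (mact U (mat_unit p m) u) = mv I I (A p m) (\<sigma> u)"
 shows "lie (chart_module h U) \<eta> x \<in>. chart_module h U"
  "tcoord (lie (chart_module h U) \<eta> x) = (%i. dext \<eta> (tcoord x i)
   + (\<Sum>p\<in>UNIV. \<Sum>m\<in>UNIV. jac h \<eta> $ p $ m * mv I I (%i j. fs (A p m i j)) (tcoord x) i))"
proof -
 let ?T = "fract_tensor (loc h) U" and ?p = "fract_pure (loc h) U"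
 interpret FT: abelian_group ?T by (rule tensor_abelian[OF fu[OF kspace_loc]])
 let ?e = "%i. incl (\<eta> (chart_param h i))"
 let ?f = "%(g, u). (\<Oplus>\<^bsub>?T\<^esub>i\<in>UNIV. ?p (?e i * chart_partial h i g) u) +[?T]
      (\<Oplus>\<^bsub>?T\<^esub>q\<in>UNIV. \<Oplus>\<^bsub>?T\<^esub>i\<in>UNIV. ?p (g * chart_partial h q (?e i)) (mact U (mat_unit q i) u))"
 let ?L = "%v i. dext \<eta> (v i) + (\<Sum>p\<in>UNIV. \<Sum>m\<in>UNIV. jac h \<eta> $ p $ m * mv I I (%i j. fs (A p m i j)) v i)"
 have c1: "(%i. ?p (?e i * chart_partial h i g) u) \<in> UNIV \<rightarrow> carrier ?T"
  and c2: "(%i. ?p (g * chart_partial h q (?e i)) (mact U (mat_unit q i) u)) \<in> UNIV \<rightarrow> carrier ?T"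
  if "g \<in> loc h" "u \<in>. U" for g u q
  using that by (auto simp: chart_partial_eq intro!: fpure_closed[OF kspace_loc] loc_mult loc_pd act)
 have c3: "(%q. \<Oplus>\<^bsub>?T\<^esub>i\<in>UNIV. ?p (g * chart_partial h q (?e i)) (mact U (mat_unit q i) u)) \<in> UNIV \<rightarrow> carrier ?T"
  if "g \<in> loc h" "u \<in>. U" for g u
  using FT.finsum_closed[OF c2[OF that]] by auto
 note D = fder_dext[OF \<eta>]
 have gen: "tcoord (?f (g, u)) = ?L (%i. g * fs (\<sigma> u i))" if g: "g \<in> loc h" and u: "u \<in>. U" for g u
 proof
  fix k
  have "tcoord (?f (g, u)) k = (\<Sum>i\<in>UNIV. ?e i * pd h i g * fs (\<sigma> u k))
    + (\<Sum>q\<in>UNIV. \<Sum>i\<in>UNIV. g * jac h \<eta> $ q $ i * fs (mv I I (A q i) (\<sigma> u) k))"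
  proof -
   have "tcoord (?p (?e i * chart_partial h i g) u) k = ?e i * pd h i g * fs (\<sigma> u k)" for i
    using g u by (simp add: tcoord_pure[OF kspace_loc] loc_mult loc_pd chart_partial_eq)
   moreover have "tcoord (?p (g * chart_partial h q (?e i)) (mact U (mat_unit q i) u)) k
     = g * jac h \<eta> $ q $ i * fs (mv I I (A q i) (\<sigma> u) k)" for q i
    using g u by (simp add: tcoord_pure[OF kspace_loc] loc_mult loc_pd chart_partial_eq act act_A jac_def)
   ultimately show ?thesis
    unfolding prod.case tcoord_add[OF kspace_loc FT.finsum_closed[OF c1[OF g u]] FT.finsum_closed[OF c3[OF g u]]]
     tcoord_finsum[OF kspace_loc finite c1[OF g u]] tcoord_finsum[OF kspace_loc finite c3[OF g u]]
     tcoord_finsum[OF kspace_loc finite c2[OF g u]] by (simp only:)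
  qed
  also have "(\<Sum>i\<in>UNIV. ?e i * pd h i g * fs (\<sigma> u k)) = dext \<eta> (g * fs (\<sigma> u k))"
   using fder_expand[OF D, of g h] by (simp add: fder_mult[OF D] fder_scalar[OF D] dext_incl[OF \<eta>] sum_distrib_right)
  also have "(\<Sum>q\<in>UNIV. \<Sum>i\<in>UNIV. g * jac h \<eta> $ q $ i * fs (mv I I (A q i) (\<sigma> u) k))
    = (\<Sum>p\<in>UNIV. \<Sum>m\<in>UNIV. jac h \<eta> $ p $ m * mv I I (%i j. fs (A p m i j)) (%i. g * fs (\<sigma> u i)) k)"
  proof -
   have "fs (mv I I (A q i) (\<sigma> u) k) = mv I I (%a c. fs (A q i a c)) (%i. fs (\<sigma> u i)) k" for q i
    by (simp add: mv_def rhom_sum rhom_mult)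
   thus ?thesis by (simp add: mv_smult mult_ac)
  qed
  finally show "tcoord (?f (g, u)) k = ?L (%i. g * fs (\<sigma> u i)) k" .
 qed
 have add: "?L (%i. v i + w i) = (%i. ?L v i + ?L w i)" for v w
  by (simp add: mv_add fder_add[OF D] sum_2 algebra_simps)
 have cl: "?f (g, u) \<in>. ?T" if "g \<in> loc h" "u \<in>. U" for g u
  using FT.finsum_closed[OF c1[OF that]] FT.finsum_closed[OF c3[OF that]] by simp
 have lie: "lie (chart_module h U) \<eta> = gen_lift ?T ?f" by (simp add: chart_module_def Let_def)
 show "lie (chart_module h U) \<eta> x \<in>. chart_module h U" "tcoord (lie (chart_module h U) \<eta> x) = ?L (tcoord x)"
  using tcoord_transfer[OF kspace_loc kspace_loc cl add gen x[unfolded chart_module_simps]] unfolding lie chart_module_simps by auto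
qed

end

subsection \<open>The unit, \<open>A\<^sup>-\<^sup>2\<close> and \<open>\<Omega>\<close>\<close>

text \<open>With exponent n this is the n-th power of the inverse determinant: the unit object for n
  = 0 and A^-2 for n = 1, as the identity matrix acts by -2 on the inverse determinant.\<close>

definition qunit :: "unit => unit => 'k::one pexp"
 where "qunit i j = PC 1"

lemma polyrep_qunit: "polyrep {()} qunit"
 by (simp add: polyrep_def qunit_def mm_def)

lemma rho_qunit: "rho fs qunit n g i j = 1 / det g ^ n"
 by (simp add: rho_def qunit_def)

lemma drho_qunit: "drho fs qunit n X i j = - (of_nat n * trace X)"
 by (simp add: drho_def qunit_def)

lemma mv_unit: "mv {()} {()} A v = (%i. A () () * v ())"
 by (simp add: mv_def fun_eq_iff)

text \<open>Meant for carriers that are subsets of a larger space C on which \<theta> is injective,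
  such as A^-2 inside A_(z) \<otimes> U: closure is read off from the image instead of being checked
  by hand.\<close>

lemma av_closed_pullback:
 assumes M: "av_closed M" and inj: "inj_on \<theta> C" and C: "carrier X \<subseteq> C" and im: "\<theta> ` carrier X = carrier M"
  and add: "!!x y. [|x \<in>. X; y \<in>. X|] ==> x +[X] y \<in> C \<and> \<theta> (x +[X] y) = \<theta> x +[M] \<theta> y"
  and smult: "!!a x. x \<in>. X ==> a .[X] x \<in> C \<and> \<theta> (a .[X] x) = a .[M] \<theta> x"
  and lie: "!!\<eta> x. [|\<eta> \<in> derivations; x \<in>. X|] ==> lie X \<eta> x \<in> C \<and> \<theta> (lie X \<eta> x) = lie M \<eta> (\<theta> x)"
 shows "av_closed X" "av_iso X M"
proof -
 have in_X: "z \<in>. X" if "z \<in> C" "\<theta> z \<in>. M" for z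
 proof -
  obtain x where "x \<in>. X" "\<theta> x = \<theta> z" using im \<open>\<theta> z \<in> carrier M\<close> by (metis imageE)
  thus ?thesis using inj C \<open>z \<in> C\<close> by (metis inj_onD subsetD)
 qed
 have cl: "\<theta> x \<in>. M" if "x \<in>. X" for x using that im by auto
 show "av_closed X"
  unfolding av_closed_def
  using M cl add smult lie by (auto simp: av_closed_def intro!: in_X)
 have "\<theta> \<in> av_hom X M" by (rule av_homI) (use add smult lie cl in auto)
 moreover have "bij_betw \<theta> (carrier X) (carrier M)" using inj_on_subset[OF inj C] im by (simp add: bij_betw_def)
 ultimately show "av_iso X M" by (auto simp: av_iso_def)
qed

lemma av_unit_iso: "rep_module (av_unit :: ('k::field_char_0 sphere, _) av_struct) {()} qunit 0" "av_closed (av_unit :: ('k sphere, _) av_struct)"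
proof -
 let ?M = "SMod {()} qunit 0 :: ('k sphere, _) av_struct" and ?f = "%(a :: 'k sphere) (i :: unit). incl a"
 have car: "v \<in>. ?M \<longleftrightarrow> (\<forall>h. v () \<in> loc h)" for v
  by (auto simp: Mod_carrier mv_unit rho_qunit fun_eq_iff)
 have im: "?f ` UNIV = carrier ?M"
 proof (intro Set.set_eqI iffI)
  fix v assume "v \<in>. ?M"
  hence "\<exists>a. v () = incl a" using car loc_Inter by blast
  then obtain a where "v () = incl a" by blast
  hence "v = ?f a" by (simp add: fun_eq_iff)
  thus "v \<in> ?f ` UNIV" by blast
 qed (auto simp: car)
 have Lie: "Lie_chart {()} qunit 0 coord_z \<eta> (?f a) = ?f (\<eta> a)" if "\<eta> \<in> derivations" for \<eta> a
  using that by (simp add: Lie_chart_def fun_eq_iff mv_unit drho_qunit dext_incl)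
 have "av_closed ?M" by (rule av_module_closed[OF av_module_Mod[OF polyrep_qunit]])
 from av_closed_pullback[OF this, of ?f UNIV av_unit]
 show "rep_module (av_unit :: ('k sphere, _) av_struct) {()} qunit 0" "av_closed (av_unit :: ('k sphere, _) av_struct)"
  using polyrep_qunit im by (auto simp: rep_module_def av_unit_def inj_on_def fun_eq_iff incl_add incl_mult Lie)
qed

text \<open>The sign for the chart N(y) comes from the order (x, z) of its parameters.\<close>

lemma det_cc_z: "det (cc coord_z h) = ((if h = coord_y then - 1 else 1) * (fcoord coord_z / fcoord h) :: 'k::field_char_0 sphere fract)"
proof (cases h)
 case coord_x
 have "pd coord_x 1 (fparam coord_x 1) = (1 :: 'k sphere fract)" "pd coord_x 2 (fparam coord_x 1) = (0 :: 'k sphere fract)" using pd_param[of coord_x 1 1] pd_param[of coord_x 2 1] by simp_all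
 thus ?thesis by (simp add: coord_x det_2 cc_eq pd_self)
next
 case coord_y
 have "pd coord_y 1 (fparam coord_y 1) = (1 :: 'k sphere fract)" "pd coord_y 2 (fparam coord_y 1) = (0 :: 'k sphere fract)" using pd_param[of coord_y 1 1] pd_param[of coord_y 2 1] by simp_all
 thus ?thesis by (simp add: coord_y det_2 cc_eq pd_self)
next
 case coord_z
 thus ?thesis by simp
qed

lemma weight_coords: "coords (weight_module \<alpha> :: ('k::field_char_0, 'k) mat_struct) {()} (%i. 1) (%u i. u)"
 and weight_module_module: "Module.module univ_ring (weight_module \<alpha> :: ('k, 'k) mat_struct)"
proof -
 let ?U = "weight_module \<alpha> :: ('k, 'k) mat_struct"
 show m: "Module.module univ_ring ?U"
 proof (rule moduleI)
  show "cring (univ_ring :: 'k ring)" by (rule cring_univ_ring)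
  show "abelian_group ?U"
  proof (rule abelian_groupI)
   fix x assume "x \<in>. ?U"
   show "\<exists>y\<in>carrier ?U. y +[?U] x = 0[?U]" by (rule bexI[of _ "- x"]) (simp_all add: weight_module_def)
  qed (simp_all add: weight_module_def algebra_simps)
 qed (simp_all add: weight_module_def algebra_simps)
 interpret Module.module univ_ring ?U by (rule m)
 have c: "carrier ?U = UNIV" by (simp add: weight_module_def)
 have "(\<Oplus>\<^bsub>?U\<^esub>i\<in>{()}. u .[?U] 1) = u" for u
  by (simp add: c Pi_def) (simp add: weight_module_def)
 thus "coords ?U {()} (%i. 1) (%u i. u)"
  using m by (simp add: coords_def c) (simp add: weight_module_def)
qed

lemma A_power_iso:
 "rep_module (A_power (- 2) :: ('k::field_char_0 sphere, _) av_struct) {()} qunit 1" "av_closed (A_power (- 2) :: ('k sphere, _) av_struct)"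
proof -
 let ?U = "weight_module (- 2) :: ('k, 'k) mat_struct" and ?M = "SMod {()} qunit 1 :: ('k sphere, _) av_struct"
 let ?B = "{fcoord coord_z powi (- (- 2 div 2)) * incl a |a. True} :: 'k sphere fract set"
 let ?A = "A_power (- 2) :: ('k sphere, _) av_struct" and ?C = "chart_module coord_z ?U"
 let ?\<theta> = "tcoord (%(u :: 'k) (i :: unit). u)"
 note co = weight_coords[of "- 2 :: int", where 'k = 'k]
 have B_eq: "?B = {fcoord coord_z * incl a |a. True}" by simp
 have B: "kspace ?B" unfolding B_eq kspace_def
 proof (intro conjI ballI allI)
  show "0 \<in> {fcoord coord_z * incl a |a. True}" by (auto intro: exI[of _ 0])
  fix f assume "f \<in> {fcoord coord_z * incl (a :: 'k sphere) |a. True}"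
  then obtain a where f: "f = fcoord coord_z * incl a" by blast
  show "fs c * f \<in> {fcoord coord_z * incl a |a. True}" for c
   by (auto simp: f fract_scalar_def intro!: exI[of _ "scalar c * a"] simp: incl_mult)
  fix g assume "g \<in> {fcoord coord_z * incl (a :: 'k sphere) |a. True}"
  then obtain a' where "g = fcoord coord_z * incl a'" by blast
  thus "f + g \<in> {fcoord coord_z * incl a |a. True}" by (auto simp: f incl_add distrib_left intro!: exI[of _ "a + a'"])
 qed
 have sub: "?B \<subseteq> loc coord_z" unfolding B_eq by (auto intro: loc_mult)
 have carA: "carrier ?A = fract_incl (loc coord_z) ?U ` carrier (fract_tensor ?B ?U)"
  by (simp only: A_power_def Let_def module.select_convs(1) partial_object.simps) simp
 have opsA: "add ?A = add ?C" "smult ?A = smult ?C" "lie ?A = lie ?C" "zero ?A = zero ?C"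
  by (simp_all add: A_power_def Let_def)
 have tin: "fract_incl (loc coord_z) ?U x \<in>. ?C \<and> ?\<theta> (fract_incl (loc coord_z) ?U x) = ?\<theta> x"
  if "x \<in>. fract_tensor ?B ?U" for x
  using tcoord_incl[OF co B kspace_loc sub that] by (simp add: chart_module_simps[OF co])
 \<comment> \<open>Regularity on N(h) means that v / det C, which is v h / z up to sign, lies in
   \<open>loc h\<close>. As h is invertible there, the three conditions together say that v / z lies
   in A.\<close>
 have carM: "v \<in>. ?M \<longleftrightarrow> v () \<in> ?B" for v
 proof -
  have "v \<in>. ?M \<longleftrightarrow> (\<forall>h. v () / det (cc coord_z h) \<in> loc h)"
   by (simp add: Mod_carrier mv_unit rho_qunit fun_eq_iff)
  also have "... \<longleftrightarrow> (\<forall>h. v () * fcoord h / fcoord coord_z \<in> loc h)"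
  proof (rule iff_allI)
   fix h
   show "v () / det (cc coord_z h) \<in> loc h \<longleftrightarrow> v () * fcoord h / fcoord coord_z \<in> loc h"
    using loc_minus[of "v () * fcoord h / fcoord coord_z" h] loc_minus[of "- (v () * fcoord h / fcoord coord_z)" h]
    by (auto simp: det_cc_z)
  qed
  also have "... \<longleftrightarrow> (\<forall>h. v () / fcoord coord_z \<in> loc h)"
  proof (rule iff_allI)
   fix h
   show "v () * fcoord h / fcoord coord_z \<in> loc h \<longleftrightarrow> v () / fcoord coord_z \<in> loc h"
    using loc_divide[of "v () * fcoord h / fcoord coord_z" h] loc_mult[of "v () / fcoord coord_z" h "fcoord h"] by auto
  qed
  also have "... \<longleftrightarrow> v () \<in> ?B"
   unfolding B_eq using loc_Inter[of "v () / fcoord coord_z"] by (auto simp: field_simps)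
  finally show ?thesis .
 qed
 have im: "?\<theta> ` carrier ?A = carrier ?M"
 proof (intro Set.set_eqI iffI)
  fix v assume "v \<in> ?\<theta> ` carrier ?A"
  then obtain x where "x \<in>. fract_tensor ?B ?U" "v = ?\<theta> x" using tin by (auto simp: carA)
  thus "v \<in>. ?M" using tcoord_range(1)[OF co B] carM by blast
 next
  fix v assume "v \<in>. ?M"
  hence vB: "v i \<in> ?B" for i using carM[of v] unfolding unit_eq[of i] by blast
  have "v i = (\<Sum>j\<in>{()}. fs 1 * v j)" for i by simp
  from tcoord_surj[OF co B vB this] obtain x where x: "x \<in>. fract_tensor ?B ?U" "?\<theta> x = v" by (elim bexE)
  show "v \<in> ?\<theta> ` carrier ?A" unfolding carA image_image
   using tin[OF x(1), THEN conjunct2, unfolded x(2)] x(1) by (intro image_eqI[where x = x]) (simp only:)+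
 qed
 have CA: "carrier ?A \<subseteq> carrier ?C" unfolding carA using tin by blast
 have act: "mact ?U (mat_unit p m) u = mv {()} {()} (%i j. - (if p = m then 1 else 0)) (%i. u) ()" for p m u
  using two_cases[of p] two_cases[of m] by (auto simp: weight_module_def mv_unit trace_2 mat_unit_def)
 have lie: "lie ?A \<eta> x \<in>. ?C \<and> ?\<theta> (lie ?A \<eta> x) = lie ?M \<eta> (?\<theta> x)" if \<eta>: "\<eta> \<in> derivations" and x: "x \<in>. ?C" for \<eta> x
  using tcoord_chart_lie[OF co x \<eta>, of "%p m i j. - (if p = m then 1 else 0)"] act
  by (auto simp: opsA weight_module_def[of "- 2"] fun_eq_iff Lie_chart_def mv_unit drho_qunit trace_2 sum_2 rhom_minus[OF rhom_fs] algebra_simps)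
 have add: "x +[?A] y \<in>. ?C \<and> ?\<theta> (x +[?A] y) = ?\<theta> x +[?M] ?\<theta> y" if "x \<in>. ?C" "y \<in>. ?C" for x y
 proof -
  interpret FT: abelian_group "fract_tensor (loc coord_z) ?U" by (rule tensor_abelian[OF fu[OF co kspace_loc]])
  show ?thesis using that tcoord_add[OF co kspace_loc] by (simp add: opsA chart_module_simps[OF co])
 qed
 have sm: "a .[?A] x \<in>. ?C \<and> ?\<theta> (a .[?A] x) = a .[?M] ?\<theta> x" if "x \<in>. ?C" for a x
  using tcoord_chart_smult[OF co that] by (simp add: opsA)
 have inj: "inj_on ?\<theta> (carrier ?C)" using tcoord_inj[OF co kspace_loc] by (simp add: chart_module_simps[OF co])
 have "av_closed ?M" by (rule av_module_closed[OF av_module_Mod[OF polyrep_qunit]])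
 note pb = av_closed_pullback[OF this inj CA im, OF add sm lie]
 have "av_closed ?A \<and> av_iso ?A ?M" using pb CA by blast
 thus "rep_module ?A {()} qunit 1" "av_closed ?A" using polyrep_qunit by (simp_all add: rep_module_def)
qed

section \<open>Kaehler differentials\<close>

lemma vecs_minus: "v -[vecs] w = (%i. v i - w i)"
proof -
 interpret abelian_group vecs by (rule vecs_abelian)
 have "v -[vecs] w +[vecs] w = v" 
  unfolding a_minus_def by (subst a_assoc) (simp_all only: vecs_simps(1) UNIV_I l_neg a_inv_closed r_zero)
 thus ?thesis by (simp add: fun_eq_iff eq_diff_eq)
qed

abbreviation Om :: "(('k::field_char_0 sphere \<times> 'k sphere) \<Rightarrow>\<^sub>0 int) set ring"
 where "Om == gen_rel UNIV kahler_relations"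

definition kd :: "'k::field_char_0 sphere => 'k sphere => (('k sphere \<times> 'k sphere) \<Rightarrow>\<^sub>0 int) set"
 where "kd g f = gen_class UNIV kahler_relations (g, f)"

lemma kahler_keys: "\<forall>r\<in>kahler_relations. keys r \<subseteq> UNIV" by simp

lemmas Om_abelian = gen_rel_abelian[OF kahler_keys]

interpretation Om: abelian_group "Om :: (('k::field_char_0 sphere \<times> 'k sphere) \<Rightarrow>\<^sub>0 int) set ring"
 by (rule Om_abelian)

lemma kd_closed [simp]: "kd g f \<in>. Om"
 unfolding kd_def by (rule gen_class_closed[OF kahler_keys]) simp

lemma kd_relation:
 assumes "frag_of a - c \<in> kahler_relations"
 shows "gen_class UNIV kahler_relations a = gen_coset UNIV kahler_relations c"
proof -
 have cl: "gen_coset UNIV kahler_relations c \<in>. Om" by (auto simp: gen_rel_simps[OF kahler_keys])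
 have "gen_coset UNIV kahler_relations (frag_of a - c) +[Om] gen_coset UNIV kahler_relations c = gen_class UNIV kahler_relations a"
  by (simp add: gen_rel_simps(3)[OF kahler_keys] gen_class_coset)
 thus ?thesis using gen_coset_rel[OF kahler_keys assms] cl by simp
qed

lemma kd_rules:
 shows kd_add: "kd (g + g') f = kd g f +[Om] kd g' f"
  and kd_add': "kd g (f + f') = kd g f +[Om] kd g f'"
  and kd_scalar: "kd (scalar c * g) f = kd g (scalar c * f)"
  and kd_mult: "kd g (f * f') = kd (g * f') f +[Om] kd (g * f) f'"
proof -
 have 2: "gen_coset UNIV kahler_relations (frag_of a + frag_of b) =
   gen_class UNIV kahler_relations a +[Om] gen_class UNIV kahler_relations b" for a b :: "'a sphere \<times> 'a sphere"
  by (simp add: gen_class_coset gen_rel_simps(3)[OF kahler_keys])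
 show "kd (g + g') f = kd g f +[Om] kd g' f"
  unfolding kd_def 2[symmetric] by (rule kd_relation) (simp add: kahler_relations_def diff_diff_eq[symmetric], blast)
 show "kd g (f + f') = kd g f +[Om] kd g f'"
  unfolding kd_def 2[symmetric] by (rule kd_relation) (simp add: kahler_relations_def diff_diff_eq[symmetric], blast)
 show "kd g (f * f') = kd (g * f') f +[Om] kd (g * f) f'"
  unfolding kd_def 2[symmetric] by (rule kd_relation) (simp add: kahler_relations_def diff_diff_eq[symmetric], blast)
 show "kd (scalar c * g) f = kd g (scalar c * f)"
  unfolding kd_def gen_class_coset[of _ _ "(g, scalar c * f)"] by (rule kd_relation) (simp add: kahler_relations_def, blast)
qed

lemma kd_0: "kd 0 f = 0[Om]"
 using kd_add[of 0 0 f] Om.add.l_cancel_one'[OF kd_closed kd_closed, of 0 f 0 f] by simp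

lemma kd_of_scalar: "kd g (scalar c) = 0[Om]"
proof -
 have "kd g (1 * 1) = 0[Om]" for g :: "'a sphere"
  using kd_mult[of g 1 1] Om.add.l_cancel_one'[OF kd_closed kd_closed, of g 1 g 1] by simp
 thus ?thesis using kd_scalar[of c g 1] by simp
qed

definition kdx :: "(coord => 'k::field_char_0 sphere) => (('k sphere \<times> 'k sphere) \<Rightarrow>\<^sub>0 int) set"
 where "kdx g = kd (g coord_x) (coord_fun coord_x) +[Om] (kd (g coord_y) (coord_fun coord_y) +[Om] kd (g coord_z) (coord_fun coord_z))"

lemma kdx_closed [simp]: "kdx g \<in>. Om"
 by (simp add: kdx_def)

lemma kdx_add: "kdx (%a. g a + g' a) = kdx g +[Om] kdx g'"
 by (simp add: kdx_def kd_add Om.a_ac)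

lemma kdx_0: "kdx (%a. 0) = 0[Om]"
 by (simp add: kdx_def kd_0)

lemma kdx_minus: "kdx g -[Om] kdx g' = kdx (%a. g a - g' a)"
proof -
 have "kdx g = kdx (%a. g a - g' a) +[Om] kdx g'" by (simp flip: kdx_add)
 thus ?thesis by (simp only: a_minus_def Om.a_assoc[OF kdx_closed kdx_closed Om.a_inv_closed[OF kdx_closed]] Om.r_neg[OF kdx_closed] Om.r_zero[OF kdx_closed])
qed

text \<open>By additivity and the Leibniz rule the differentials of the three coordinates
  generate.\<close>

lemma kd_eq_kdx: "\<exists>e. kd g f = kdx e"
proof (induction f arbitrary: g rule: sphere_induct)
 case (scalar c)
 show ?case by (rule exI[of _ "%a. 0"]) (simp add: kdx_0 kd_of_scalar)
next
 case (coord a)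
 show ?case by (rule exI[of _ "%b. if b = a then g else 0"]) (cases a; simp add: kdx_def kd_0)
next
 case (add a b)
 obtain e e' where "kd g a = kdx e" "kd g b = kdx e'" using add(1)[of g] add(2)[of g] by (elim exE)
 thus ?case by (intro exI[of _ "%a. e a + e' a"]) (simp only: kd_add' kdx_add)
next
 case (mult a b)
 obtain e e' where "kd (g * b) a = kdx e" "kd (g * a) b = kdx e'" using mult(1)[of "g * b"] mult(2)[of "g * a"] by (elim exE)
 thus ?case by (intro exI[of _ "%a. e a + e' a"]) (simp only: kd_mult kdx_add)
qed

lemma Om_eq_kdx: "x \<in>. Om ==> \<exists>e. x = kdx e"
proof (induction rule: gen_rel_induct[OF kahler_keys, consumes 1, case_names zero diff of])
 case zero
 show ?case by (rule exI[of _ "%a. 0"]) (simp only: kdx_0)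
next
 case (diff x y)
 obtain e e' where "x = kdx e" "y = kdx e'" using diff(3,4) by (elim exE)
 thus ?case by (intro exI[of _ "%a. e a - e' a"]) (simp only: kdx_minus)
next
 case (of s)
 show ?case using kd_eq_kdx[of "fst s" "snd s"] by (simp add: kd_def)
qed

definition omcoord :: "(('k::field_char_0 sphere \<times> 'k sphere) \<Rightarrow>\<^sub>0 int) set => 2 => 'k sphere fract"
 where "omcoord = gen_lift vecs (%(g, f) i. incl g * pd coord_z i (incl f))"

lemma omcoord:
 fixes x y :: "(('k::field_char_0 sphere \<times> 'k sphere) \<Rightarrow>\<^sub>0 int) set" and g f :: "'k sphere"
 shows omcoord_add: "[|x \<in>. Om; y \<in>. Om|] ==> omcoord (x +[Om] y) = (%i. omcoord x i + omcoord y i)"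
  and omcoord_kd: "omcoord (kd g f) = (%i. incl g * pd coord_z i (incl f))"
proof -
 let ?f = "%(g :: 'k sphere, f :: 'k sphere) i. incl g * pd coord_z i (incl f)"
 have f: "?f \<in> UNIV \<rightarrow> carrier vecs" by simp
 note fl = free_lift_diff[OF vecs_abelian f subset_UNIV subset_UNIV] free_lift_of[OF vecs_abelian f UNIV_I]
 have rel: "free_lift vecs ?f r = 0[vecs]" if r: "r \<in> kahler_relations" for r
  using r unfolding kahler_relations_def
  by (elim UnE CollectE exE conjE; hypsubst; unfold fl vecs_minus prod.case vecs_simps;
    simp add: incl_add incl_mult fder_add[OF fder_pd] fder_mult[OF fder_pd] fder_scalar[OF fder_pd] algebra_simps flip: fract_scalar_def)
 note l = gen_lift[OF kahler_keys vecs_abelian _ rel, folded omcoord_def, simplified]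
 show "[|x \<in>. Om; y \<in>. Om|] ==> omcoord (x +[Om] y) = (%i. omcoord x i + omcoord y i)"
  using l(2) by simp
 show "omcoord (kd g f) = (%i. incl g * pd coord_z i (incl f))" using l(3)[of "(g, f)"] by (simp add: kd_def)
qed

lemma omcoord_kdx: "omcoord (kdx e) = (%i. incl (e coord_x) * pd coord_z i (fcoord coord_x)
  + incl (e coord_y) * pd coord_z i (fcoord coord_y) + incl (e coord_z) * pd coord_z i (fcoord coord_z))"
 by (simp add: kdx_def omcoord_add omcoord_kd add.assoc)

text \<open>The relation \<open>x dx + y dy + z dz = d(1) / 2 = 0\<close>.\<close>

lemma kdx_radial: "kdx (%a. coord_fun a * c) = 0[Om]"
proof -
 have "kdx (%a. coord_fun a * c) +[Om] kdx (%a. coord_fun a * c) = 0[Om]" for c :: "'a sphere"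
 proof -
  have "kd c (coord_fun coord_x * coord_fun coord_x + coord_fun coord_y * coord_fun coord_y + coord_fun coord_z * coord_fun coord_z) = 0[Om]"
   unfolding sphere_eq using kd_of_scalar[of c 1] by simp
  thus ?thesis unfolding kdx_def kd_add' kd_mult by (simp add: Om.a_ac mult.commute)
 qed
 \<comment> \<open>Differentiating the equation of the sphere gives twice the radial form, so c is
   halved.\<close>
 from this[of "scalar (1 / 2) * c"]
 have "kdx (%a. coord_fun a * (scalar (1 / 2) * c) + coord_fun a * (scalar (1 / 2) * c)) = 0[Om]"
  by (simp only: kdx_add)
 moreover have "coord_fun a * (scalar (1 / 2) * c) + coord_fun a * (scalar (1 / 2) * c) = coord_fun a * c" for a
 proof -
  have "scalar (1 / 2) + scalar (1 / 2) = (1 :: 'a sphere)" by (simp flip: scalar_add)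
  hence "coord_fun a * c * (scalar (1 / 2) + scalar (1 / 2)) = coord_fun a * c" by simp
  thus ?thesis by (simp add: algebra_simps)
 qed
 ultimately show ?thesis by simp
qed

text \<open>If both components in the chart N(z) vanish, the coefficients (g_x, g_y, g_z) are a
  multiple of (x, y, z), and such a form is zero by \<open>kdx_radial\<close>.\<close>

lemma omcoord_inj: "inj_on omcoord (carrier (Om :: (('k::field_char_0 sphere \<times> 'k sphere) \<Rightarrow>\<^sub>0 int) set ring))"
proof (rule inj_onI)
 fix x y :: "(('k sphere \<times> 'k sphere) \<Rightarrow>\<^sub>0 int) set"
 assume x: "x \<in>. Om" and y: "y \<in>. Om" and eq: "omcoord x = omcoord y"
 obtain e e' where e: "x = kdx e" "y = kdx e'" using Om_eq_kdx[OF x] Om_eq_kdx[OF y] by (elim exE)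
 define g where "g a = e a - e' a" for a
 have "omcoord (kdx g) = (%i. 0)"
  using eq unfolding e omcoord_kdx g_def by (simp add: fun_eq_iff incl_diff algebra_simps)
 hence z: "incl (g coord_x) * pd coord_z i (fparam coord_z 1) + incl (g coord_y) * pd coord_z i (fparam coord_z 2)
   + incl (g coord_z) * pd coord_z i (fcoord coord_z) = 0" for i
  by (simp add: omcoord_kdx fun_eq_iff)
 have "incl (coord_fun coord_z * g coord_x) = incl (coord_fun coord_x * g coord_z)"
  "incl (coord_fun coord_z * g coord_y) = incl (coord_fun coord_y * g coord_z)"
  using z[of 1] z[of 2] unfolding pd_param pd_self by (simp_all add: incl_mult field_simps)
 hence gz: "coord_fun coord_z * g coord_x = coord_fun coord_x * g coord_z"
  "coord_fun coord_z * g coord_y = coord_fun coord_y * g coord_z" by simp_all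
 \<comment> \<open>If g = c (x, y, z), pairing with (x, y, z) recovers c by the equation of the
   sphere.\<close>
 define c where "c = coord_fun coord_x * g coord_x + coord_fun coord_y * g coord_y + coord_fun coord_z * g coord_z"
 have "coord_fun coord_z * c = coord_fun coord_x * (coord_fun coord_z * g coord_x)
   + coord_fun coord_y * (coord_fun coord_z * g coord_y) + coord_fun coord_z * (coord_fun coord_z * g coord_z)"
  by (simp add: c_def algebra_simps)
 also have "... = (coord_fun coord_x * coord_fun coord_x + coord_fun coord_y * coord_fun coord_y
   + coord_fun coord_z * coord_fun coord_z) * g coord_z"
  unfolding gz by (simp add: algebra_simps)
 finally have cz: "coord_fun coord_z * c = g coord_z" unfolding sphere_eq by simp
 have "coord_fun coord_z * (coord_fun a * c) = coord_fun coord_z * g a" if "a = coord_x \<or> a = coord_y" for a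
  using that gz by (auto simp: mult.left_commute[of "coord_fun coord_z"] cz)
 hence "g a = coord_fun a * c" for a using cz by (cases a) auto
 hence "g = (%a. coord_fun a * c)" by (rule ext)
 hence "kdx g = 0[Om]" by (simp only: kdx_radial)
 moreover have "kdx g +[Om] kdx e' = kdx e" by (simp add: g_def flip: kdx_add)
 ultimately show "x = y" using e by simp
qed

lemma polyrep_PV: "polyrep (UNIV :: 2 set) PV"
 by (simp add: polyrep_def mm_def matrix_matrix_mult_def)

lemma pd_chain: "(\<Sum>j\<in>UNIV. cc h h' $ i $ j * pd h j f) = pd h' i f"
 using fder_expand[OF fder_pd, of h' i f h] by (simp add: cc_eq)

text \<open>In each chart the components of g df are g times the partial derivatives of f. By
  \<open>pd_chain\<close> they transform with the Jacobian matrix itself, that is by the natural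
  representation with entries \<open>PV\<close>.\<close>

lemma Omega_iso:
 "rep_module (Omega :: ('k::field_char_0 sphere, _) av_struct) UNIV PV 0" "av_closed (Omega :: ('k sphere, _) av_struct)"
proof -
 let ?M = "SMod (UNIV :: 2 set) PV 0 :: ('k sphere, _) av_struct"
 let ?O = "Omega :: ('k sphere, _) av_struct" and ?T = "Om :: (('k sphere \<times> 'k sphere) \<Rightarrow>\<^sub>0 int) set ring"
 have car: "v \<in>. ?M \<longleftrightarrow> (\<forall>h i. (\<Sum>j\<in>UNIV. cc coord_z h $ i $ j * v j) \<in> loc h)" for v
  by (auto simp: Mod_carrier rho_def mv_def fun_eq_iff mat_def if_distrib[of "%x. x * _"] cong: if_cong)
 have kdM: "omcoord (kd g f) \<in>. ?M" for g f :: "'k sphere"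
 proof -
  have "(\<Sum>j\<in>UNIV. cc coord_z h $ i $ j * omcoord (kd g f) j) = incl g * pd h i (incl f)" for h i
   unfolding omcoord_kd by (simp add: sum_distrib_left mult_ac flip: pd_chain[where h = coord_z and h' = h])
  thus ?thesis by (simp add: car loc_mult loc_pd)
 qed
 interpret M: Module.module univ_ring ?M by (rule Mod_module[OF polyrep_PV])
 have TM: "omcoord x \<in>. ?M" if x: "x \<in>. ?T" for x
 proof -
  obtain e where e: "x = kdx e" using Om_eq_kdx[OF x] by (elim exE)
  have "omcoord x = omcoord (kd (e coord_x) (coord_fun coord_x)) +[?M] (omcoord (kd (e coord_y) (coord_fun coord_y)) +[?M] omcoord (kd (e coord_z) (coord_fun coord_z)))"
   by (simp add: e kdx_def omcoord_add)
  also have "... \<in>. ?M" by (intro M.a_closed kdM)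
  finally show ?thesis .
 qed
 have carO: "carrier ?O = carrier ?T" "add ?O = add ?T" by (simp_all add: Omega_def Let_def)
 have smO: "smult ?O a = gen_lift ?T (%(g, f). kd (a * g) f)" for a by (simp add: Omega_def Let_def kd_def)
 have lieO: "lie ?O \<eta> = gen_lift ?T (%(g, f). kd (\<eta> g) f +[?T] kd g (\<eta> f))" for \<eta> by (simp add: Omega_def Let_def kd_def)
 have sm: "smult ?O a x \<in>. ?T" "omcoord (smult ?O a x) = (%i. incl a * omcoord x i)" if "x \<in>. ?T" for a x
  unfolding smO
  by (rule gen_transfer_closed[OF kahler_keys Om_abelian, where \<theta> = omcoord and \<Theta> = omcoord and \<Lambda> = "%v i. incl a * v i"]
     gen_transfer[OF kahler_keys Om_abelian, where \<theta> = omcoord and \<Theta> = omcoord and \<Lambda> = "%v i. incl a * v i"];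
    use that in \<open>auto simp: omcoord_inj omcoord_add omcoord_kd incl_mult algebra_simps simp flip: kd_def\<close>)+
 have Lie: "Lie_chart UNIV PV 0 coord_z \<eta> v i = dext \<eta> (v i) + (\<Sum>j\<in>UNIV. jac coord_z \<eta> $ i $ j * v j)"
  for \<eta> and v :: "2 => 'k sphere fract" and i
  by (simp add: Lie_chart_def mv_def drho_def)
 have Lie_add: "Lie_chart UNIV PV 0 coord_z \<eta> (%i. v i + w i)
   = (%i. Lie_chart UNIV PV 0 coord_z \<eta> v i + Lie_chart UNIV PV 0 coord_z \<eta> w i)"
  if "\<eta> \<in> derivations" for \<eta> and v w :: "2 => 'k sphere fract"
  using fder_add[OF fder_dext[OF that]] by (simp add: fun_eq_iff Lie distrib_left sum.distrib)
 have Lie_kd: "omcoord (kd (\<eta> g) f +[?T] kd g (\<eta> f)) = Lie_chart UNIV PV 0 coord_z \<eta> (omcoord (kd g f))"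
  if \<eta>: "\<eta> \<in> derivations" for \<eta> g f
 proof
  fix i
  note D = fder_dext[OF \<eta>]
  have "omcoord (kd (\<eta> g) f +[?T] kd g (\<eta> f)) i = dext \<eta> (incl g) * pd coord_z i (incl f) + incl g * pd coord_z i (dext \<eta> (incl f))"
   by (simp add: omcoord_add omcoord_kd dext_incl \<eta>)
  thus "omcoord (kd (\<eta> g) f +[?T] kd g (\<eta> f)) i = Lie_chart UNIV PV 0 coord_z \<eta> (omcoord (kd g f)) i"
   unfolding pd_commutator[OF \<eta>] Lie omcoord_kd fder_mult[OF D] distrib_left sum_distrib_left
   by (simp only: mult.left_commute add.assoc)
 qed
 have lie: "lie ?O \<eta> x \<in>. ?T \<and> omcoord (lie ?O \<eta> x) = Lie_chart UNIV PV 0 coord_z \<eta> (omcoord x)"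
  if "\<eta> \<in> derivations" "x \<in>. ?T" for \<eta> x
  unfolding lieO
  by (intro conjI gen_transfer_closed[OF kahler_keys Om_abelian, where \<theta> = omcoord and \<Theta> = omcoord and \<Lambda> = "Lie_chart UNIV PV 0 coord_z \<eta>"]
     gen_transfer[OF kahler_keys Om_abelian, where \<theta> = omcoord and \<Theta> = omcoord and \<Lambda> = "Lie_chart UNIV PV 0 coord_z \<eta>"];
    use that Lie_kd[OF that(1)] Lie_add[OF that(1)] omcoord_inj in \<open>auto simp: omcoord_add simp flip: kd_def\<close>)
 have "v \<in> omcoord ` carrier ?T" if v: "v \<in>. ?M" for v
 proof (rule partition_principle[OF Mod_module[OF polyrep_PV] v])
  fix h
  define w where "w i = (\<Sum>j\<in>UNIV. cc coord_z h $ i $ j * v j)" for i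
  obtain N1 N2 where N: "!!M. M \<ge> N1 ==> \<exists>a. fcoord h ^ M * w 1 = incl a" "!!M. M \<ge> N2 ==> \<exists>a. fcoord h ^ M * w 2 = incl a"
   using loc_clear[of "w 1" h] loc_clear[of "w 2" h] v[unfolded car] unfolding w_def by blast
  obtain a b where ab: "fcoord h ^ (max N1 N2) * w 1 = incl a" "fcoord h ^ (max N1 N2) * w 2 = incl b"
   using N(1)[of "max N1 N2"] N(2)[of "max N1 N2"] by auto
  \<comment> \<open>The form a dt_1 + b dt_2, whose components in the chart h are those of v cleared
    of denominators.\<close>
  let ?y = "kd a (chart_param h 1) +[?T] kd b (chart_param h 2)"
  have "omcoord ?y j = fcoord h ^ (max N1 N2) * v j" for j
  proof -
   have "omcoord ?y j = fcoord h ^ (max N1 N2) * (\<Sum>i\<in>UNIV. cc h coord_z $ j $ i * w i)"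
    by (simp add: omcoord_add omcoord_kd flip: ab) (simp add: sum_2 cc_eq algebra_simps)
   also have "(\<Sum>i\<in>UNIV. cc h coord_z $ j $ i * w i) = (\<Sum>l\<in>UNIV. (cc h coord_z ** cc coord_z h) $ j $ l * v l)"
    by (simp add: w_def matrix_matrix_mult_def sum_2 algebra_simps)
   also have "... = v j" by (simp add: cc_comp mat_def if_distrib[of "%x. x * _"] cong: if_cong)
   finally show ?thesis .
  qed
  hence "coord_fun h ^ max N1 N2 .[?M] v = omcoord ?y" by (simp add: fun_eq_iff incl_power)
  thus "\<exists>K. coord_fun h ^ K .[?M] v \<in> omcoord ` carrier ?T" by (intro exI[of _ "max N1 N2"]) auto
 next
  fix x y assume "x \<in> omcoord ` carrier ?T" "y \<in> omcoord ` carrier ?T"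
  then obtain s t where st: "s \<in>. ?T" "t \<in>. ?T" "x = omcoord s" "y = omcoord t" by blast
  thus "x +[?M] y \<in> omcoord ` carrier ?T" by (intro image_eqI[of _ _ "s +[?T] t"]) (simp_all add: omcoord_add)
 next
  fix a x assume "x \<in> omcoord ` carrier ?T"
  then obtain s where st: "s \<in>. ?T" "x = omcoord s" by blast
  thus "a .[?M] x \<in> omcoord ` carrier ?T" by (intro image_eqI[of _ _ "smult ?O a s"]) (simp_all add: sm)
 qed (use TM in blast)
 hence im: "omcoord ` carrier ?O = carrier ?M" using TM by (auto simp: carO)
 have "av_closed ?M" by (rule av_module_closed[OF av_module_Mod[OF polyrep_PV]])
 note pb = av_closed_pullback[OF this omcoord_inj _ im]
 have "av_closed ?O \<and> av_iso ?O ?M"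
  by (intro conjI pb) (use sm lie in \<open>simp_all add: carO omcoord_add\<close>)
 thus "rep_module ?O UNIV PV 0" "av_closed ?O" using polyrep_PV by (simp_all add: rep_module_def)
qed

subsection \<open>Linear combinations and bases\<close>

definition lincomb :: "('r, 'm, 'x) module_scheme => 'i set => ('i => 'm) => ('i => 'r) => 'm"
 where "lincomb M I b c = (\<Oplus>\<^bsub>M\<^esub>i\<in>I. c i .[M] b i)"

context
 fixes M :: "('r::comm_ring_1, 'm, 'x) module_scheme" and I :: "'i set" and b
 assumes M: "Module.module univ_ring M" and I: "finite I" and b: "b \<in> I \<rightarrow> carrier M"
begin

interpretation M: Module.module univ_ring M by (rule M)

lemma smult_in: "m \<in>. M ==> a .[M] m \<in>. M"
 using M.smult_closed[of a m] by simp

lemma lincomb_terms: "(%i. c i .[M] b i) \<in> I \<rightarrow> carrier M"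
 using b smult_in by auto

lemma lincomb_closed: "lincomb M I b c \<in>. M"
 unfolding lincomb_def by (rule M.finsum_closed[OF lincomb_terms])

lemma lincomb_add: "lincomb M I b (%i. c i + d i) = lincomb M I b c +[M] lincomb M I b d"
proof -
 have "lincomb M I b (%i. c i + d i) = (\<Oplus>\<^bsub>M\<^esub>i\<in>I. c i .[M] b i +[M] d i .[M] b i)"
  unfolding lincomb_def
 proof (rule M.finsum_cong')
  fix i assume "i \<in> I"
  hence "b i \<in>. M" using b by auto
  thus "(c i + d i) .[M] b i = c i .[M] b i +[M] d i .[M] b i"
   using M.smult_l_distr[of "c i" "d i" "b i"] by simp
 qed (use lincomb_terms[of c] lincomb_terms[of d] in \<open>auto intro!: M.a_closed\<close>)
 thus ?thesis unfolding lincomb_def by (simp add: M.finsum_addf[OF lincomb_terms lincomb_terms])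
qed

lemma lincomb_smult: "lincomb M I b (%i. a * c i) = a .[M] lincomb M I b c"
proof -
 have "lincomb M I b (%i. a * c i) = (\<Oplus>\<^bsub>M\<^esub>i\<in>I. a .[M] (c i .[M] b i))"
  unfolding lincomb_def
 proof (rule M.finsum_cong')
  fix i assume "i \<in> I"
  hence "b i \<in>. M" using b by auto
  thus "(a * c i) .[M] b i = a .[M] (c i .[M] b i)" using M.smult_assoc1[of a "c i" "b i"] by simp
 qed (use lincomb_terms[of c] smult_in in auto)
 thus ?thesis unfolding lincomb_def using M.finsum_smult_ldistr[OF I _ lincomb_terms[of c], of a] by simp
qed

lemma lincomb_cong: "(!!i. i \<in> I ==> c i = d i) ==> lincomb M I b c = lincomb M I b d"
 unfolding lincomb_def by (rule M.finsum_cong'[OF refl lincomb_terms]) simp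

lemma smult_0: "m \<in>. M ==> 0 .[M] m = 0[M]" and smult_1: "m \<in>. M ==> 1 .[M] m = m"
 using M.smult_l_null[of m] M.smult_one[of m] by simp_all

lemma lincomb_single:
 assumes i: "i \<in> I"
 shows "lincomb M I b (%j. if i = j then c else 0) = c .[M] b i"
proof -
 have "lincomb M I b (%j. if i = j then c else 0) = (\<Oplus>\<^bsub>M\<^esub>j\<in>I. if i = j then c .[M] b j else 0[M])"
  unfolding lincomb_def by (rule M.finsum_cong') (use b in \<open>auto simp: smult_0 smult_in Pi_iff\<close>)
 also have "... = c .[M] b i" by (rule M.finsum_singleton[OF i I]) (use lincomb_terms[of "%_. c"] in simp)
 finally show ?thesis .
qed

end

text \<open>\<open>fin_gen\<close> and \<open>gl2_coeffs_of\<close> sum over sets of vectors, so the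
  coefficients of equal members of a family have to be added up.\<close>

lemma lincomb_regroup:
 fixes M :: "('r::comm_ring_1, 'm, 'x) module_scheme"
 assumes M: "Module.module univ_ring M" and I: "finite I" and S: "finite S" "b ` I \<subseteq> S" "S \<subseteq> carrier M"
 shows "lincomb M S (%x. x) (%x. \<Sum>i\<in>{i \<in> I. b i = x}. c i) = lincomb M I b c"
 using I S(2)
proof (induction I rule: finite_induct)
 case empty
 interpret M: Module.module univ_ring M by (rule M)
 have S': "(%x. x) \<in> S \<rightarrow> carrier M" using S by auto
 have "lincomb M S (%x. x) (%x. 0 * 0) = 0[M]"
  unfolding lincomb_smult[OF M S(1) S'] by (rule smult_0[OF M S(1) S' lincomb_closed[OF M S(1) S']])
 thus ?case by (simp add: lincomb_def[of _ "{}"])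
next
 case (insert i I)
 interpret M: Module.module univ_ring M by (rule M)
 have S': "(%x. x) \<in> S \<rightarrow> carrier M" using S by auto
 have bI: "b \<in> insert i I \<rightarrow> carrier M" using insert.prems S by auto
 have "(\<Sum>j\<in>{j \<in> insert i I. b j = x}. c j) = (if b i = x then c i else 0) + (\<Sum>j\<in>{j \<in> I. b j = x}. c j)" for x
 proof -
  have "{j \<in> insert i I. b j = x} = (if b i = x then insert i {j \<in> I. b j = x} else {j \<in> I. b j = x})" by auto
  thus ?thesis using insert.hyps by simp
 qed
 hence "lincomb M S (%x. x) (%x. \<Sum>j\<in>{j \<in> insert i I. b j = x}. c j) = c i .[M] b i +[M] lincomb M I b c"
  using insert.IH insert.prems by (simp add: lincomb_add[OF M S(1) S'] lincomb_single[OF M S(1) S'])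
 also have "... = lincomb M (insert i I) b c"
  unfolding lincomb_def using insert.hyps bI by (subst M.finsum_insert) (auto intro!: smult_in[OF M])
 finally show ?case .
qed

lemma fin_gen_lincomb:
 assumes M: "Module.module univ_ring M" and I: "finite I" and b: "b \<in> I \<rightarrow> carrier M"
  and ex: "!!m. m \<in>. M ==> \<exists>c. m = lincomb M I b c"
 shows "fin_gen univ_ring M"
 unfolding fin_gen_def
proof (intro exI[of _ "b ` I"] conjI ballI)
 fix m assume m: "m \<in>. M"
 obtain c where "m = lincomb M I b c" using ex[OF m] by (elim exE)
 hence "m = lincomb M (b ` I) (%x. x) (%x. \<Sum>i\<in>{i \<in> I. b i = x}. c i)"
  using lincomb_regroup[OF M I, of "b ` I" b c] I b by (simp add: image_subset_iff Pi_def)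
 thus "\<exists>c\<in>b ` I \<rightarrow> carrier univ_ring. m = (\<Oplus>\<^bsub>M\<^esub>b\<in>b ` I. c b .[M] b)"
  unfolding lincomb_def by (intro bexI[of _ "%x. \<Sum>i\<in>{i \<in> I. b i = x}. c i"]) simp_all
qed (use I b in auto)

text \<open>A spanning set of least cardinality has unique coefficients: a nontrivial relation would
  allow one of its members to be dropped.\<close>

lemma basis_exists:
 fixes U :: "('k::field_char_0, 'u) mat_struct"
 assumes U: "Module.module univ_ring U" and fg: "fin_gen univ_ring U"
 shows "\<exists>B \<sigma>. coords U B (%x. x) \<sigma> \<and> (\<forall>b\<in>B. \<forall>i. \<sigma> b i = (if i = b then 1 else 0))"
proof -
 interpret U: Module.module univ_ring U by (rule U)
 define P where "P B \<longleftrightarrow> finite B \<and> B \<subseteq> carrier U \<and> (\<forall>u\<in>carrier U. \<exists>c. u = lincomb U B (%x. x) c)" for B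
 obtain B\<^sub>0 where B\<^sub>0: "finite B\<^sub>0" "B\<^sub>0 \<subseteq> carrier U" "\<forall>u\<in>carrier U. \<exists>c\<in>B\<^sub>0 \<rightarrow> carrier univ_ring. u = lincomb U B\<^sub>0 (%x. x) c"
  using fg unfolding fin_gen_def lincomb_def by (elim exE conjE)
 have "P B\<^sub>0" unfolding P_def using B\<^sub>0 by (intro conjI ballI) (assumption+, drule (1) bspec, erule bexE, erule exI)
 hence "\<exists>B. P B" by (rule exI)
 then obtain B where PB: "P B" and min: "!!B'. P B' ==> card B \<le> card B'"
  using ex_has_least_nat[of P _ card] by blast
 have B: "finite B" "(%x. x) \<in> B \<rightarrow> carrier U" using PB by (auto simp: P_def)
 let ?L = "lincomb U B (%x. x)"
 note L = lincomb_closed[OF U B] lincomb_add[OF U B] lincomb_smult[OF U B] lincomb_single[OF U B]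
 have uniq: "c x = c' x" if eq: "?L c = ?L c'" and x: "x \<in> B" for c c' x
 proof (rule ccontr)
  assume ne: "c x \<noteq> c' x"
  define a where "a = c x - c' x"
  define d where "d y = (c y - c' y) / a" for y
  have a: "a \<noteq> 0" "d x = 1" using ne by (simp_all add: a_def d_def)
  have "?L c = ?L c' +[U] ?L (%y. c y - c' y)" by (simp flip: L(2))
  hence "?L (%y. c y - c' y) = 0[U]"
   using U.add.l_cancel_one'[OF L(1) L(1), of c' "%y. c y - c' y"] eq by simp
  hence "(1 / a) .[U] ?L (%y. c y - c' y) = 0[U]" using U.smult_r_null[of "1 / a"] by simp
  hence Ld: "?L d = 0[U]" by (simp add: d_def[abs_def] flip: L(3))
  have "\<exists>f. u = lincomb U (B - {x}) (%x. x) f" if u: "u \<in>. U" for u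
  proof -
   obtain e where e: "u = ?L e" using PB[unfolded P_def, THEN conjunct2, THEN conjunct2, rule_format, OF u] by (elim exE)
   \<comment> \<open>Subtracting a multiple of the relation d, normalized by d x = 1, removes x from
     the expansion.\<close>
   define f where "f y = e y - e x * d y" for y
   have "?L e = ?L f +[U] e x .[U] ?L d" by (simp add: f_def flip: L(2,3))
   hence 1: "u = ?L f" using e Ld U.smult_r_null[of "e x"] L(1)[of f] by simp
   have fx: "f x = 0" by (simp add: f_def a)
   have B': "B = insert x (B - {x})" using x by blast
   have t: "(%y. f y .[U] y) \<in> B \<rightarrow> carrier U" by (rule lincomb_terms[OF U B])
   have "?L f = f x .[U] x +[U] lincomb U (B - {x}) (%x. x) f"
    unfolding lincomb_def by (subst B', subst U.finsum_insert) (use B t x in auto)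
   also have "... = lincomb U (B - {x}) (%x. x) f"
    using lincomb_closed[OF U, of "B - {x}" "%x. x" f] smult_0[OF U B, of x] B x fx by (simp add: Pi_def)
   finally show ?thesis using 1 by (intro exI[of _ f]) (rule trans)
  qed
  hence "P (B - {x})" using B unfolding P_def by (intro conjI ballI) auto
  from min[OF this] show False using card_Diff1_less[OF B(1) x] by simp
 qed
 define \<sigma> where "\<sigma> u i = (if i \<in> B then (SOME c. u = ?L c) i else 0)" for u i
 have \<sigma>_L: "?L (\<sigma> u) = u" if "u \<in>. U" for u
 proof -
  have "u = ?L (SOME c. u = ?L c)"
   by (rule someI_ex[OF PB[unfolded P_def, THEN conjunct2, THEN conjunct2, rule_format, OF that]])
  moreover have "?L (\<sigma> u) = ?L (SOME c. u = ?L c)"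
   by (rule lincomb_cong[OF U B]) (simp add: \<sigma>_def)
  ultimately show ?thesis by simp
 qed
 have \<sigma>_eq: "\<sigma> (?L c) = (%i. if i \<in> B then c i else 0)" for c
 proof
  fix i show "\<sigma> (?L c) i = (if i \<in> B then c i else 0)"
   using uniq[OF \<sigma>_L[OF L(1)], of i c] by (auto simp: \<sigma>_def)
 qed
 have "coords U B (%x. x) \<sigma>"
  unfolding coords_def
 proof (intro conjI ballI allI impI)
  show "u = (\<Oplus>\<^bsub>U\<^esub>i\<in>B. \<sigma> u i .[U] i)" if "u \<in>. U" for u using \<sigma>_L[OF that] by (simp add: lincomb_def)
  show "\<sigma> (u +[U] v) = (%i. \<sigma> u i + \<sigma> v i)" if uv: "u \<in>. U" "v \<in>. U" for u v
  proof -
   have "u +[U] v = ?L (%i. \<sigma> u i + \<sigma> v i)" by (simp add: L(2) \<sigma>_L uv)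
   hence "\<sigma> (u +[U] v) = (%i. if i \<in> B then \<sigma> u i + \<sigma> v i else 0)" by (simp only: \<sigma>_eq)
   thus ?thesis by (auto simp: \<sigma>_def)
  qed
  show "\<sigma> (a .[U] u) = (%i. a * \<sigma> u i)" if u: "u \<in>. U" for a u
  proof -
   have "a .[U] u = ?L (%i. a * \<sigma> u i)" by (simp add: L(3) \<sigma>_L u)
   hence "\<sigma> (a .[U] u) = (%i. if i \<in> B then a * \<sigma> u i else 0)" by (simp only: \<sigma>_eq)
   thus ?thesis by (auto simp: \<sigma>_def)
  qed
 qed (use U B in \<open>auto simp: \<sigma>_def\<close>)
 moreover have "\<sigma> x i = (if i = x then 1 else 0)" if x: "x \<in> B" for x i
 proof -
  have "?L (%j. if x = j then 1 else 0) = x" using L(4)[OF x, of 1] smult_1[OF U B, of x] x B by auto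
  from arg_cong[OF this, of \<sigma>] show ?thesis using x by (auto simp: \<sigma>_eq fun_eq_iff split: if_splits)
 qed
 ultimately show ?thesis by blast
qed

subsection \<open>Regular functions\<close>

definition pprod :: "('i => 'k::one pexp) => 'i set => 'k pexp"
 where "pprod f A = foldr (%i. PM (f i)) (SOME xs. set xs = A \<and> distinct xs) (PC 1)"

lemma pprod:
 assumes "finite A" "rhom \<iota>"
 shows "pev \<iota> (pprod f A) g = (\<Prod>i\<in>A. pev \<iota> (f i) g)"
proof -
 define xs where "xs = (SOME xs. set xs = A \<and> distinct xs)"
 have xs: "set xs = A \<and> distinct xs"
  unfolding xs_def by (rule someI_ex) (use finite_distinct_list[OF assms(1)] in blast)
 have "distinct xs ==> pev \<iota> (foldr (%i. PM (f i)) xs (PC 1)) g = (\<Prod>i\<in>set xs. pev \<iota> (f i) g)"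
  by (induction xs) (simp_all add: rhom_1[OF assms(2)])
 thus ?thesis using xs by (simp add: pprod_def flip: xs_def)
qed

definition mono :: "(2 \<times> 2 \<Rightarrow>\<^sub>0 nat) => 'k::{zero,one} pexp"
 where "mono \<mu> = pprod (%e. ppow (PV (fst e) (snd e)) (lookup \<mu> e)) (keys \<mu>)"

definition gpoly :: "((2 \<times> 2 \<Rightarrow>\<^sub>0 nat) \<Rightarrow>\<^sub>0 'k::{zero,one}) => 'k pexp"
 where "gpoly Q = psum (%\<mu>. PM (PC (lookup Q \<mu>)) (mono \<mu>)) (keys Q)"

lemma gl2_eval_gpoly: "rhom \<iota> ==> gl2_eval \<iota> \<phi> g = pev \<iota> (gpoly (fst \<phi>)) g * inverse (det g) ^ snd \<phi>"
 by (cases \<phi>) (simp add: gl2_eval_def gpoly_def mono_def psum pprod pev_ppow)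

lemma pev_mono_add:
 fixes \<iota> :: "'k::field => 'r::comm_ring_1"
 assumes \<iota>: "rhom \<iota>"
 shows "pev \<iota> (mono (\<mu> + \<nu>)) g = pev \<iota> (mono \<mu>) g * pev \<iota> (mono \<nu>) g"
proof -
 let ?K = "keys \<mu> \<union> keys \<nu>"
 have m: "pev \<iota> (mono \<xi>) g = (\<Prod>e\<in>?K. (g $ fst e $ snd e) ^ lookup \<xi> e)"
  if "keys \<xi> \<subseteq> ?K" for \<xi>
  unfolding mono_def pprod[OF finite_keys \<iota>] pev_ppow[OF \<iota>] pev.simps
  by (rule prod.mono_neutral_left) (use that in \<open>auto simp: in_keys_iff\<close>)
 show ?thesis using keys_add[of \<mu> \<nu>] by (simp add: m lookup_add power_add prod.distrib)
qed

lemma pev_gpoly_single: "rhom \<iota> ==> pev \<iota> (gpoly (single \<mu> c)) g = \<iota> c * pev \<iota> (mono \<mu>) g"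
 by (simp add: gpoly_def psum rhom_0)

lemma pev_gpoly_add:
 fixes \<iota> :: "'k::field => 'r::comm_ring_1"
 assumes \<iota>: "rhom \<iota>"
 shows "pev \<iota> (gpoly (P + Q)) g = pev \<iota> (gpoly P) g + pev \<iota> (gpoly Q) g"
proof -
 let ?K = "keys P \<union> keys Q"
 have m: "pev \<iota> (gpoly R) g = (\<Sum>\<mu>\<in>?K. \<iota> (lookup R \<mu>) * pev \<iota> (mono \<mu>) g)" if "keys R \<subseteq> ?K" for R
  unfolding gpoly_def psum(1)[OF finite_keys \<iota>] pev.simps
  by (rule sum.mono_neutral_left) (use that in \<open>auto simp: in_keys_iff rhom_0[OF \<iota>]\<close>)
 show ?thesis using keys_add[of P Q] by (simp add: m lookup_add rhom_add[OF \<iota>] distrib_right sum.distrib)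
qed

text \<open>Return from expressions to the encoding of polynomials that \<open>gl2_coeffs_of\<close>
  demands.\<close>

lemma gpoly_surj:
 fixes e :: "'k::field pexp"
 shows "\<exists>Q. \<forall>g. pev0 e g = pev0 (gpoly Q) g"
proof (induction e)
 case (PC c)
 show ?case by (rule exI[of _ "single 0 c"]) (simp add: pev_gpoly_single mono_def pprod)
next
 case (PV i j)
 show ?case by (rule exI[of _ "single (single (i, j) 1) 1"])
  (simp add: pev_gpoly_single mono_def pprod)
next
 case (PA a b)
 then obtain P Q where "\<forall>g. pev0 a g = pev0 (gpoly P) g" "\<forall>g. pev0 b g = pev0 (gpoly Q) g" by blast
 thus ?case by (intro exI[of _ "P + Q"]) (simp add: pev_gpoly_add)
next
 case (PM a b)
 then obtain P Q where PQ: "\<forall>g. pev0 a g = pev0 (gpoly P) g" "\<forall>g. pev0 b g = pev0 (gpoly Q) g" by blast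
 let ?R = "\<Sum>\<mu>\<in>keys P. \<Sum>\<nu>\<in>keys Q.
  single (\<mu> + \<nu>) (lookup P \<mu> * lookup Q \<nu>)"
 have sum: "pev0 (gpoly (\<Sum>a\<in>A. F a)) g = (\<Sum>a\<in>A. pev0 (gpoly (F a)) g)" for A g
   and F :: "_ => (2 \<times> 2 \<Rightarrow>\<^sub>0 nat) \<Rightarrow>\<^sub>0 'k"
  by (induction A rule: infinite_finite_induct) (simp_all add: pev_gpoly_add, simp_all add: gpoly_def psum)
 have "pev0 (gpoly ?R) g = pev0 (gpoly P) g * pev0 (gpoly Q) g" for g
  by (simp add: sum pev_gpoly_single pev_mono_add) (simp add: gpoly_def psum sum_product mult_ac)
 thus ?case using PQ by (intro exI[of _ ?R]) simp
qed

subsection \<open>Rational representations in coordinates\<close>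

text \<open>Difference between the coaction and the matrix description of one coordinate, multiplied
  by det^(n+N). For N at least all exponents in \<phi> nothing but a polynomial function is left,
  and density applies.\<close>

definition coaction_gap :: "('k::zero_neq_one => 'r::comm_ring_1) => 'u set => ('u => ((2 \<times> 2 \<Rightarrow>\<^sub>0 nat) \<Rightarrow>\<^sub>0 'k) \<times> nat) =>
  ('u => 'k) => nat => 'i set => ('i => 'k pexp) => ('i => 'k) => nat => 'r^2^2 => 'r"
 where "coaction_gap \<iota> B \<phi> s N I p t n G =
  det G ^ n * (\<Sum>b\<in>B. pev \<iota> (gpoly (fst (\<phi> b))) G * det G ^ (N - snd (\<phi> b)) * \<iota> (s b))
   - det G ^ N * (\<Sum>j\<in>I. pev \<iota> (p j) G * \<iota> (t j))"

lemma coaction_gap: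
 fixes \<iota> :: "'k::field_char_0 => 'r::{idom,inverse}"
 assumes \<iota>: "rhom \<iota>" and G: "det G * inverse (det G) = 1" and N: "!!b. b \<in> B ==> snd (\<phi> b) \<le> N"
 shows "coaction_gap \<iota> B \<phi> s N I p t n G =
  det G ^ N * (det G ^ n * (\<Sum>b\<in>B. gl2_eval \<iota> (\<phi> b) G * \<iota> (s b)) - (\<Sum>j\<in>I. pev \<iota> (p j) G * \<iota> (t j)))"
proof -
 have eval: "det G ^ N * gl2_eval \<iota> (\<phi> b) G = pev \<iota> (gpoly (fst (\<phi> b))) G * det G ^ (N - snd (\<phi> b))" if "b \<in> B" for b
 proof -
  have "det G ^ N = det G ^ (N - snd (\<phi> b)) * det G ^ snd (\<phi> b)" using N[OF that] by (simp flip: power_add)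
  moreover have "det G ^ snd (\<phi> b) * inverse (det G) ^ snd (\<phi> b) = 1" using G by (simp flip: power_mult_distrib)
  ultimately show ?thesis by (simp add: gl2_eval_gpoly \<iota> mult_ac)
 qed
 have "det G ^ N * (\<Sum>b\<in>B. gl2_eval \<iota> (\<phi> b) G * \<iota> (s b))
   = (\<Sum>b\<in>B. pev \<iota> (gpoly (fst (\<phi> b))) G * det G ^ (N - snd (\<phi> b)) * \<iota> (s b))"
  unfolding sum_distrib_left using eval by (intro sum.cong refl) (simp flip: mult.assoc)
 thus ?thesis unfolding coaction_gap_def right_diff_distrib by (simp only: mult.left_commute[of "det G ^ N" "det G ^ n"])
qed

text \<open>The coaction used by \<open>differentiate\<close> and \<open>gl2_extend\<close> is
  picked by \<open>SOME\<close>. Its value at every matrix over a domain with invertible determinant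
  is nevertheless the one given by q / det^n; this is applied over k[[t]] and over the fraction
  field.\<close>

lemma coaction_eval:
 fixes \<iota> :: "'k::field_char_0 => 'r::{idom,inverse}" and U :: "('k, 'u) mat_struct"
 assumes co: "coords U I b \<sigma>"
  and act: "!!g. invertible g ==> \<sigma> (mact U g u) = mv I I (rho0 q n g) (\<sigma> u)"
  and B: "gl2_coeffs_of U u B \<phi>" and \<iota>: "rhom \<iota>" and G: "det G * inverse (det G) = 1"
 shows "det G ^ n * (\<Sum>b\<in>B. gl2_eval \<iota> (\<phi> b) G * \<iota> (\<sigma> b i)) = mv I I (%i j. pev \<iota> (q i j) G) (%j. \<iota> (\<sigma> u j)) i"
proof (cases "i \<in> I")
 case False
 hence "\<sigma> b i = 0" if "b \<in> B" for b using coordsD(7)[OF co, of b i] B that by (auto simp: gl2_coeffs_of_def)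
 thus ?thesis using False by (simp add: mv_out rhom_0[OF \<iota>])
next
 case i: True
 have fB: "finite B" and sB: "B \<subseteq> carrier U"
  and m: "!!g. invertible g ==> mact U g u = (\<Oplus>\<^bsub>U\<^esub>b\<in>B. gl2_eval (%c. c) (\<phi> b) g .[U] b)"
  using B by (auto simp: gl2_coeffs_of_def)
 define N where "N = (\<Sum>b\<in>B. snd (\<phi> b))"
 have N: "snd (\<phi> b) \<le> N" if "b \<in> B" for b unfolding N_def by (rule member_le_sum) (use that fB in auto)
 let ?f = "%\<iota>. coaction_gap \<iota> B \<phi> (%b. \<sigma> b i) N I (q i) (\<sigma> u) n"
 have k: "coaction_gap (%c. c) B \<phi> (%b. \<sigma> b i) N I (q i) (\<sigma> u) n g = 0" if g: "invertible g" for g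
 proof -
  interpret U: Module.module univ_ring U by (rule coordsD(1)[OF co])
  have d: "det g * inverse (det g) = 1" using g by (simp add: invertible_det_nz)
  have cl: "(%b. gl2_eval (%c. c) (\<phi> b) g .[U] b) \<in> B \<rightarrow> carrier U" using sB U_smult_closed[OF co] by auto
  have "\<sigma> (mact U g u) i = (\<Sum>b\<in>B. gl2_eval (%c. c) (\<phi> b) g * \<sigma> b i)"
   unfolding m[OF g] \<sigma>_finsum[OF co fB cl] by (intro sum.cong refl) (use sB in \<open>simp add: coordsD(6)[OF co] subset_iff\<close>)
  moreover have "\<sigma> (mact U g u) i = (\<Sum>j\<in>I. pev0 (q i j) g * \<sigma> u j) / det g ^ n"
   using i by (simp add: act[OF g] mv_def rho_def sum_divide_distrib)
  ultimately have "det g ^ n * (\<Sum>b\<in>B. gl2_eval (%c. c) (\<phi> b) g * \<sigma> b i) = (\<Sum>j\<in>I. pev0 (q i j) g * \<sigma> u j)"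
   using g by (simp add: invertible_det_nz field_simps)
  thus ?thesis by (simp add: coaction_gap[OF rhom_id d N])
 qed
 have "?f \<iota> G = 0"
 proof (rule polyfun_eq_0[OF _ \<iota>])
  show "polyfun (?f \<iota>)" unfolding coaction_gap_def
   by (intro pf_diff pf_mult pf_power pf_det pf_sum pf_const pf_pev pf_entry)
  fix g :: "'k^2^2" assume "invertible g"
  hence "\<iota> (coaction_gap (%c. c) B \<phi> (%b. \<sigma> b i) N I (q i) (\<sigma> u) n g) = 0" by (simp add: k rhom_0[OF \<iota>])
  thus "?f \<iota> (mmap \<iota> g) = 0"
   by (simp add: coaction_gap_def rhom_diff[OF \<iota>] rhom_mult[OF \<iota>] rhom_power[OF \<iota>] rhom_sum[OF \<iota>] pev_map[OF \<iota>] mmap_det[OF \<iota>])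
 qed
 moreover have "det G ^ N \<noteq> 0" using G by auto
 ultimately show ?thesis using i by (auto simp: coaction_gap[OF \<iota> G N] mv_def)
qed

definition rep_coords :: "('k::field_char_0, 'u) mat_struct => 'i set => ('i => 'u) => ('u => 'i => 'k) => ('i, 'k) qmat => nat => bool"
 where "rep_coords U I b \<sigma> q n \<longleftrightarrow> coords U I b \<sigma> \<and> polyrep I q \<and>
  (\<forall>g. invertible g --> (\<forall>u\<in>carrier U. mact U g u \<in>. U \<and> \<sigma> (mact U g u) = mv I I (rho0 q n g) (\<sigma> u))) \<and>
  (\<forall>j\<in>I. \<forall>i. \<sigma> (b j) i = (if i \<in> I then rho0 q n (mat 1) i j else 0))"

text \<open>In a basis, the coordinates of the coaction on the basis vectors are the matrix
  coefficients; they are brought to the common denominator det^N, where N is the sum of all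
  exponents that occur.\<close>

lemma rational_coords:
 fixes U :: "('k::field_char_0, 'u) mat_struct"
 assumes U: "rational_gl2_module U"
 shows "\<exists>I \<sigma> q n. rep_coords U I (%x. x) \<sigma> q n"
proof -
 have mU: "Module.module univ_ring U" and fU: "fin_gen univ_ring U"
  and cl: "!!g u. invertible g ==> u \<in>. U ==> mact U g u \<in>. U"
  and add: "!!g u v. invertible g ==> u \<in>. U ==> v \<in>. U ==> mact U g (u +[U] v) = mact U g u +[U] mact U g v"
  and sm: "!!g c u. invertible g ==> u \<in>. U ==> mact U g (c .[U] u) = c .[U] mact U g u"
  and one: "!!u. u \<in>. U ==> mact U (mat 1) u = u"
  and mult: "!!g h u. invertible g ==> invertible h ==> u \<in>. U ==> mact U (g ** h) u = mact U g (mact U h u)"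
  and ex: "!!u. u \<in>. U ==> \<exists>B \<phi>. gl2_coeffs_of U u B \<phi>"
  using U by (simp_all add: rational_gl2_module_def)
 interpret U: Module.module univ_ring U by (rule mU)
 obtain I \<sigma> where co: "coords U I (%x. x) \<sigma>" and \<delta>: "!!b i. b \<in> I ==> \<sigma> b i = (if i = b then 1 else 0)"
  using basis_exists[OF mU fU] by blast
 note coD = coordsD[OF co]
 have "\<forall>j. \<exists>B \<phi>. j \<in> I --> gl2_coeffs_of U j B \<phi>" using ex coD(3) by blast
 then obtain B \<phi> where B: "!!j. j \<in> I ==> gl2_coeffs_of U j (B j) (\<phi> j)" by metis
 have fB: "finite (B j)" "B j \<subseteq> carrier U" if "j \<in> I" for j using B[OF that] by (auto simp: gl2_coeffs_of_def)
 define N where "N = (\<Sum>j\<in>I. \<Sum>b\<in>B j. snd (\<phi> j b))"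
 have N: "snd (\<phi> j b) \<le> N" if "j \<in> I" "b \<in> B j" for j b
 proof -
  have "snd (\<phi> j b) \<le> (\<Sum>b\<in>B j. snd (\<phi> j b))" by (rule member_le_sum) (use that fB in auto)
  also have "... \<le> N" unfolding N_def by (rule member_le_sum) (use that coD(2) in auto)
  finally show ?thesis .
 qed
 define q where "q i j = psum (%b. PM (PM (gpoly (fst (\<phi> j b))) (ppow pdet (N - snd (\<phi> j b)))) (PC (\<sigma> b i))) (B j)" for i j
 have rho: "rho0 q N g i j = \<sigma> (mact U g j) i" if j: "j \<in> I" and g: "invertible g" for g i j
 proof -
  have d: "det g \<noteq> 0" using g by (simp add: invertible_det_nz)
  have clB: "(%b. gl2_eval (%c. c) (\<phi> j b) g .[U] b) \<in> B j \<rightarrow> carrier U" using fB(2)[OF j] U_smult_closed[OF co] by auto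
  have "mact U g j = (\<Oplus>\<^bsub>U\<^esub>b\<in>B j. gl2_eval (%c. c) (\<phi> j b) g .[U] b)" using B[OF j] g by (simp add: gl2_coeffs_of_def)
  hence "\<sigma> (mact U g j) i = (\<Sum>b\<in>B j. gl2_eval (%c. c) (\<phi> j b) g * \<sigma> b i)"
   using \<sigma>_finsum[OF co fB(1)[OF j] clB] fB(2)[OF j] by (simp add: coD(6) subset_iff)
  also have "... = (\<Sum>b\<in>B j. pev0 (gpoly (fst (\<phi> j b))) g * det g ^ (N - snd (\<phi> j b)) * \<sigma> b i / det g ^ N)"
  proof (rule sum.cong[OF refl])
   fix b assume "b \<in> B j"
   hence "det g ^ N = det g ^ (N - snd (\<phi> j b)) * det g ^ snd (\<phi> j b)" using N[OF j] by (simp flip: power_add)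
   thus "gl2_eval (%c. c) (\<phi> j b) g * \<sigma> b i = pev0 (gpoly (fst (\<phi> j b))) g * det g ^ (N - snd (\<phi> j b)) * \<sigma> b i / det g ^ N"
    using d by (simp add: gl2_eval_gpoly power_inverse field_simps)
  qed
  also have "... = rho0 q N g i j"
   by (simp add: rho_def q_def psum fB(1)[OF j] pev_ppow pdet sum_divide_distrib)
  finally show ?thesis by simp
 qed
 have act: "\<sigma> (mact U g u) = mv I I (rho0 q N g) (\<sigma> u)" if g: "invertible g" and u: "u \<in>. U" for g u
 proof
  fix i
  have t: "(%j. \<sigma> u j .[U] j) \<in> I \<rightarrow> carrier U" using coD(3) U_smult_closed[OF co] by auto
  have "mact U g u = mact U g (\<Oplus>\<^bsub>U\<^esub>j\<in>I. \<sigma> u j .[U] j)" using coD(4)[OF u] by simp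
  also have "... = (\<Oplus>\<^bsub>U\<^esub>j\<in>I. mact U g (\<sigma> u j .[U] j))"
   by (rule additive_finsum[OF U.abelian_group_axioms U.abelian_group_axioms _ _ t coD(2)]) (use cl add g in auto)
  finally have "\<sigma> (mact U g u) = (%i. \<Sum>j\<in>I. \<sigma> (mact U g (\<sigma> u j .[U] j)) i)"
   using \<sigma>_finsum[OF co coD(2), of "%j. mact U g (\<sigma> u j .[U] j)"] t cl[OF g] by (simp add: Pi_iff)
  moreover have "\<sigma> (mact U g (\<sigma> u j .[U] j)) i = rho0 q N g i j * \<sigma> u j" if "j \<in> I" for j
   using that by (simp add: sm g coD(3,6) cl rho mult.commute)
  ultimately have "\<sigma> (mact U g u) i = (\<Sum>j\<in>I. rho0 q N g i j * \<sigma> u j)" by simp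
  thus "\<sigma> (mact U g u) i = mv I I (rho0 q N g) (\<sigma> u) i" using coD(7)[OF cl[OF g u], of i] by (simp add: mv_def)
 qed
 have "polyrep I q"
  unfolding polyrep_def
 proof (intro conjI allI impI ballI coD(2))
  fix g h :: "'k^2^2" and i j assume gh: "invertible g" "invertible h" and ij: "i \<in> I" "j \<in> I"
  have d: "det g \<noteq> 0" "det h \<noteq> 0" using gh by (simp_all add: invertible_det_nz)
  have "mm I (rho0 q N g) (rho0 q N h) i j = mv I I (rho0 q N g) (\<sigma> (mact U h j)) i"
   using ij by (simp add: mm_def mv_def rho gh)
  also have "... = \<sigma> (mact U (g ** h) j) i" using ij gh coD(3) cl by (simp add: act mult)
  also have "... = rho0 q N (g ** h) i j" using ij gh by (simp add: rho invertible_mult)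
  finally show "mm I (%i j. pev0 (q i j) g) (%i j. pev0 (q i j) h) i j = pev0 (q i j) (g ** h)"
   using d by (simp add: mm_def rho_def det_mul power_mult_distrib flip: sum_divide_distrib)
 qed
 moreover have "\<sigma> j i = (if i \<in> I then rho0 q N (mat 1) i j else 0)" if "j \<in> I" for i j
  using rho[OF that, of "mat 1" i] one[of j] that coD(3) coD(7)[of j i] by (auto simp: invertible_det_nz)
 ultimately show ?thesis using co cl act unfolding rep_coords_def by blast
qed

text \<open>The image of the idempotent \<rho>(1), copied to the universe type by \<kappa>. It
  provides the representation U that \<open>tensor_module\<close> asks for, and essential
  surjectivity of the functor.\<close>

definition rep_space :: "(('i => 'k) => 'u) => 'i set => ('i, 'k::field_char_0) qmat => nat => ('k, 'u) mat_struct"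
 where "rep_space \<kappa> I q n = (let X = {c. mv I I (rho0 q n (mat 1)) c = c}; \<pi> = the_inv_into X \<kappa> in
  \<lparr>carrier = \<kappa> ` X, mult = undefined, one = undefined, zero = \<kappa> (%i. 0), add = (%u v. \<kappa> (%i. \<pi> u i + \<pi> v i)),
   smult = (%c u. \<kappa> (%i. c * \<pi> u i)), mact = (%g u. \<kappa> (mv I I (rho0 q n g) (\<pi> u)))\<rparr>)"

lemma rep_space:
 fixes I :: "'i set" and q :: "('i, 'k::field_char_0) qmat" and n and \<kappa> :: "('i => 'k) => 'u"
 defines "X == {c. mv I I (rho0 q n (mat 1)) c = c}"
 assumes q: "polyrep I q" and \<kappa>: "inj_on \<kappa> X"
 shows "rational_gl2_module (rep_space \<kappa> I q n)"
  "rep_coords (rep_space \<kappa> I q n) I (%j. \<kappa> (%i. if i \<in> I then rho0 q n (mat 1) i j else 0)) (the_inv_into X \<kappa>) q n"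
proof -
 let ?U = "rep_space \<kappa> I q n" and ?\<pi> = "the_inv_into X \<kappa>"
 let ?b = "%j. \<kappa> (%i. if i \<in> I then rho0 q n (mat 1) i j else 0)"
 note fI = finite_polyrep[OF q]
 have ops: "carrier ?U = \<kappa> ` X" "zero ?U = \<kappa> (%i. 0)" "add ?U = (%u v. \<kappa> (%i. ?\<pi> u i + ?\<pi> v i))"
  "smult ?U = (%c u. \<kappa> (%i. c * ?\<pi> u i))" "mact ?U = (%g u. \<kappa> (mv I I (rho0 q n g) (?\<pi> u)))"
  by (simp_all add: rep_space_def X_def Let_def)
 have \<pi>: "?\<pi> (\<kappa> c) = c" if "c \<in> X" for c using \<kappa> that by (rule the_inv_into_f_f)
 have \<pi>X: "?\<pi> u \<in> X" and \<kappa>\<pi>: "\<kappa> (?\<pi> u) = u" if "u \<in>. ?U" for u using that \<pi> by (auto simp: ops)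
 have X: "(%i. 0) \<in> X" "!!c d. c \<in> X ==> d \<in> X ==> (%i. c i + d i) \<in> X" "!!a c. c \<in> X ==> (%i. a * c i) \<in> X"
  "!!g c. mv I I (rho0 q n g) c \<in> X" "!!c i. c \<in> X ==> i \<notin> I ==> c i = 0"
 proof -
  show "mv I I (rho0 q n g) c \<in> X" for g c
   unfolding X_def mem_Collect_eq mv_mv by (rule mv_cong) (simp_all add: rho_mult[OF q])
  show "c i = 0" if "c \<in> X" "i \<notin> I" for c i using that mv_out[of i I] by (metis (mono_tags, lifting) X_def mem_Collect_eq)
 qed (simp_all add: X_def mv_0 mv_add mv_smult)
 have inX: "c \<in> X ==> \<kappa> c \<in>. ?U" for c by (simp add: ops)
 have mU: "Module.module univ_ring ?U"
 proof (rule moduleI)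
  show "cring (univ_ring :: 'k ring)" by (rule cring_univ_ring)
  show "abelian_group ?U"
  proof (rule abelian_groupI)
   fix u assume u: "u \<in>. ?U"
   let ?v = "\<kappa> (%i. - 1 * ?\<pi> u i)"
   have 1: "(%i. - 1 * ?\<pi> u i) \<in> X" by (rule X(3)[OF \<pi>X[OF u]])
   have "?v \<in>. ?U" using inX[OF 1] .
   moreover have "?v +[?U] u = 0[?U]" unfolding ops \<pi>[OF 1] by simp
   ultimately show "\<exists>v\<in>carrier ?U. v +[?U] u = 0[?U]" by blast
  qed (auto simp: ops \<pi> X algebra_simps)
 qed (auto simp: ops \<pi> X algebra_simps)
 interpret U: Module.module univ_ring ?U by (rule mU)
 have eX: "(%i. if i \<in> I then rho0 q n (mat 1) i j else 0) \<in> X" if j: "j \<in> I" for j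
 proof -
  have "mv I I (rho0 q n (mat 1)) (%i. if i = j then 1 else 0) \<in> X" by (rule X(4))
  moreover have "mv I I (rho0 q n (mat 1)) (%i. if i = j then 1 else 0) = (%i. if i \<in> I then rho0 q n (mat 1) i j else 0)"
   using fI j by (simp add: mv_def fun_eq_iff if_distrib[of "%x. _ * x"] cong: if_cong)
  ultimately show ?thesis by simp
 qed
 have b: "?b \<in> I \<rightarrow> carrier ?U" using eX inX by auto
 have L: "lincomb ?U I ?b c = \<kappa> (mv I I (rho0 q n (mat 1)) c)" for c
 proof -
  have t: "(%i. c i .[?U] ?b i) \<in> I \<rightarrow> carrier ?U" by (rule lincomb_terms[OF mU fI b])
  have cl: "lincomb ?U I ?b c \<in>. ?U" by (rule lincomb_closed[OF mU fI b])
  have "?\<pi> (lincomb ?U I ?b c) = (%i. \<Sum>j\<in>I. ?\<pi> (c j .[?U] ?b j) i)"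
   using additive_finsum[OF U.abelian_group_axioms vecs_abelian, of ?\<pi> "%i. c i .[?U] ?b i" I] t fI
   by (simp add: lincomb_def finsum_vecs) (simp add: ops \<pi> X \<pi>X)
  also have "... = mv I I (rho0 q n (mat 1)) c"
   using eX by (simp add: ops \<pi> X mv_def fun_eq_iff mult.commute)
  finally show ?thesis using \<kappa>\<pi>[OF cl] by simp
 qed
 have exp: "lincomb ?U I ?b (?\<pi> u) = u" if "u \<in>. ?U" for u
  using \<pi>X[OF that] \<kappa>\<pi>[OF that] unfolding L by (simp add: X_def)
 have co: "coords ?U I ?b ?\<pi>"
  unfolding coords_def
 proof (intro conjI ballI allI impI)
  show "u = (\<Oplus>\<^bsub>?U\<^esub>i\<in>I. ?\<pi> u i .[?U] ?b i)" if "u \<in>. ?U" for u using exp[OF that] by (simp add: lincomb_def)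
  show "?\<pi> (u +[?U] v) = (%i. ?\<pi> u i + ?\<pi> v i)" if "u \<in>. ?U" "v \<in>. ?U" for u v
   using X(2)[OF \<pi>X \<pi>X] that by (simp add: ops \<pi>)
  show "?\<pi> (c .[?U] u) = (%i. c * ?\<pi> u i)" if "u \<in>. ?U" for c u
   using X(3)[OF \<pi>X] that by (simp add: ops \<pi>)
  show "?\<pi> u i = 0" if "u \<in>. ?U" "i \<notin> I" for u i using X(5)[OF \<pi>X] that by blast
 qed (use mU fI b in auto)
 thus rc: "rep_coords ?U I ?b ?\<pi> q n"
  using q X(4) eX by (simp add: rep_coords_def \<pi>) (simp add: ops \<pi>)
 show "rational_gl2_module ?U"
  unfolding rational_gl2_module_def
 proof (intro conjI allI impI ballI)
  show "fin_gen univ_ring ?U"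
   by (rule fin_gen_lincomb[OF mU fI b]) (rule exI, rule exp[symmetric])
  fix u assume u: "u \<in>. ?U"
  show "mact ?U (mat 1) u = u" using \<pi>X[OF u] \<kappa>\<pi>[OF u] by (simp add: ops X_def)
  show "\<exists>B \<phi>. gl2_coeffs_of ?U u B \<phi>"
  proof -
   \<comment> \<open>Different indices may give the same vector, so the coefficient of a vector x
     collects all indices i with b i = x.\<close>
   have "\<exists>Q. \<forall>g. pev0 (psum (%i. psum (%j. PM (q i j) (PC (?\<pi> u j))) I) {i \<in> I. ?b i = x}) g = pev0 (gpoly Q) g" for x
    by (rule gpoly_surj)
   then obtain Q where Q: "!!x g. pev0 (psum (%i. psum (%j. PM (q i j) (PC (?\<pi> u j))) I) {i \<in> I. ?b i = x}) g = pev0 (gpoly (Q x)) g"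
    by metis
   have "mact ?U g u = (\<Oplus>\<^bsub>?U\<^esub>x\<in>?b ` I. gl2_eval (%c. c) (Q x, n) g .[?U] x)" for g
   proof -
    have "gl2_eval (%c. c) (Q x, n) g = (\<Sum>i\<in>{i \<in> I. ?b i = x}. mv I I (rho0 q n g) (?\<pi> u) i)" for x
     by (simp add: gl2_eval_gpoly psum fI mv_def rho_def divide_inverse power_inverse sum_distrib_left mult_ac flip: Q)
    hence "(\<Oplus>\<^bsub>?U\<^esub>x\<in>?b ` I. gl2_eval (%c. c) (Q x, n) g .[?U] x) = lincomb ?U I ?b (mv I I (rho0 q n g) (?\<pi> u))"
     using lincomb_regroup[OF mU fI, of "?b ` I" ?b "mv I I (rho0 q n g) (?\<pi> u)"] fI b
     by (simp add: lincomb_def image_subset_iff Pi_iff)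
    also have "... = mact ?U g u" using X(4)[of g "?\<pi> u"] unfolding L ops by (simp add: X_def)
    finally show ?thesis by simp
   qed
   thus ?thesis using fI b unfolding gl2_coeffs_of_def
    by (intro exI[of _ "?b ` I"] exI[of _ "%x. (Q x, n)"]) auto
  qed
 next
  fix g h :: "'k^2^2" and u assume "u \<in>. ?U"
  have "mv I I (rho0 q n (g ** h)) c = mv I I (rho0 q n g) (mv I I (rho0 q n h) c)" for c
   unfolding mv_mv by (rule mv_cong) (simp_all add: rho_mult[OF q])
  thus "mact ?U (g ** h) u = mact ?U g (mact ?U h u)" by (simp add: ops \<pi> X)
 next
  fix g :: "'k^2^2" and u v assume uv: "u \<in>. ?U" "v \<in>. ?U"
  show "mact ?U g (u +[?U] v) = mact ?U g u +[?U] mact ?U g v"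
   using X(2)[OF \<pi>X \<pi>X] uv by (simp add: ops \<pi> X(4) mv_add)
 next
  fix g :: "'k^2^2" and u c assume u: "u \<in>. ?U"
  show "mact ?U g (c .[?U] u) = c .[?U] mact ?U g u"
   using X(3)[OF \<pi>X] u by (simp add: ops \<pi> X(4) mv_smult)
  show "mact ?U g u \<in>. ?U" by (simp add: ops X)
 qed (use mU in auto)
qed

subsection \<open>Tensor modules\<close>

lemma gl2_coaction_coeffs:
 assumes "rational_gl2_module U" "u \<in>. U"
 shows "\<exists>B \<phi>. gl2_coaction U u = (B, \<phi>) \<and> gl2_coeffs_of U u B \<phi>"
proof -
 have "\<exists>p. case p of (B, \<phi>) => gl2_coeffs_of U u B \<phi>" using assms by (simp add: rational_gl2_module_def)
 hence "case gl2_coaction U u of (B, \<phi>) => gl2_coeffs_of U u B \<phi>" unfolding gl2_coaction_def by (rule someI_ex)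
 thus ?thesis by (auto split: prod.splits)
qed

lemma differentiate_simps [simp]:
 "carrier (differentiate U) = carrier U" "zero (differentiate U) = zero U" "add (differentiate U) = add U" "smult (differentiate U) = smult U"
 by (simp_all add: differentiate_def)

lemma finsum_differentiate [simp]: "finsum (differentiate U) = finsum U"
 by (simp add: finsum_def finprod_def fun_eq_iff)

lemma tensor_differentiate [simp]: "tensor R S (differentiate U) = tensor R S U"
 "pure_tensor R S (differentiate U) = pure_tensor R S U"
 by (simp_all add: tensor_def pure_tensor_def tensor_relations_def fun_eq_iff)

lemma module_differentiate:
 assumes "Module.module R U" shows "Module.module R (differentiate U)"
proof -
 interpret Module.module R U by (rule assms)
 show ?thesis
 proof (rule moduleI)
  show "cring R" by (rule R.is_cring)
  show "abelian_group (differentiate U)"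
  proof (rule abelian_groupI)
   fix x assume "x \<in>. differentiate U"
   thus "\<exists>y\<in>carrier (differentiate U). y +[differentiate U] x = 0[differentiate U]"
    by (intro bexI[of _ "\<ominus>\<^bsub>U\<^esub> x"]) (simp_all add: l_neg)
  qed (auto simp: a_ac)
 qed (simp_all add: smult_l_distr smult_r_distr smult_assoc1)
qed

context
 fixes U :: "('k::field_char_0, 'u) mat_struct" and I :: "'i set" and b \<sigma> q n
 assumes U: "rational_gl2_module U" and rc: "rep_coords U I b \<sigma> q n"
begin

lemma rep_coordsD:
 shows co: "coords U I b \<sigma>" and q: "polyrep I q"
  and act_closed: "!!g u. invertible g ==> u \<in>. U ==> mact U g u \<in>. U"
  and act: "!!g u. invertible g ==> u \<in>. U ==> \<sigma> (mact U g u) = mv I I (rho0 q n g) (\<sigma> u)"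
  and \<sigma>b: "!!i j. j \<in> I ==> \<sigma> (b j) i = (if i \<in> I then rho0 q n (mat 1) i j else 0)"
 using rc by (simp_all add: rep_coords_def)

interpretation U: Module.module univ_ring U by (rule coordsD(1)[OF co])

lemma differentiate_co: "coords (differentiate U) I b \<sigma>"
 using co module_differentiate[OF U.module_axioms] by (simp add: coords_def)

text \<open>Evaluate the coaction at 1 + t X by \<open>coaction_eval\<close>. The sum S satisfies
  det^n S = q(1 + t X) u, and comparing coefficients of t yields that of S, with the trace term
  coming from det^n.\<close>

lemma differentiate_act:
 assumes u: "u \<in>. U"
 shows "mact (differentiate U) X u \<in>. U" "\<sigma> (mact (differentiate U) X u) = mv I I (drho0 q n X) (\<sigma> u)"
proof -
 obtain B \<phi> where B: "gl2_coaction U u = (B, \<phi>)" "gl2_coeffs_of U u B \<phi>" using gl2_coaction_coeffs[OF U u] by blast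
 have fB: "finite B" "B \<subseteq> carrier U" using B(2) by (auto simp: gl2_coeffs_of_def)
 let ?G = "\<chi> i j. fps_const (mat 1 $ i $ j) + fps_X * fps_const (X $ i $ j)"
 have act_eq: "mact (differentiate U) X u = (\<Oplus>\<^bsub>U\<^esub>b\<in>B. fps_nth (gl2_eval fps_const (\<phi> b) ?G) 1 .[U] b)"
  by (simp add: differentiate_def B(1))
 have cl: "(%b. fps_nth (gl2_eval fps_const (\<phi> b) ?G) 1 .[U] b) \<in> B \<rightarrow> carrier U"
  using fB U_smult_closed[OF co] by auto
 show "mact (differentiate U) X u \<in>. U" unfolding act_eq by (rule U.finsum_closed[OF cl])
 have G0: "mmap (%f. fps_nth f 0) ?G = mat 1" and G1: "mmap (%f. fps_nth f (Suc 0)) ?G = X"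
  by (simp_all add: vec_eq_iff)
 have d0: "fps_nth (det ?G) 0 = 1" using mmap_det[OF rhom_fps_nth_0, of ?G] G0 by simp
 have d1: "fps_nth (det ?G) (Suc 0) = trace X"
  using pev_fps_nth_1[of "%c. c" pdet ?G] G0 G1 by (simp add: pdet)
 have dd: "det ?G * inverse (det ?G) = 1" by (rule inverse_mult_eq_1') (simp add: d0)
 define S where "S i = (\<Sum>b\<in>B. gl2_eval fps_const (\<phi> b) ?G * fps_const (\<sigma> b i))" for i
 have S: "det ?G ^ n * S i = mv I I (%i j. pev fps_const (q i j) ?G) (%j. fps_const (\<sigma> u j)) i" for i
  unfolding S_def by (rule coaction_eval[OF co act[OF _ u] B(2) rhom_fps_const dd])
 have S0: "fps_nth (S i) 0 = mv I I (%i j. pev0 (q i j) (mat 1)) (\<sigma> u) i" for i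
  using arg_cong[OF S, of "%f. fps_nth f 0" i] fps_power_nth(1)[OF d0, of n]
  by (simp add: mv_def fps_sum_nth pev_fps_nth_0 G0 split: if_splits)
 have S1: "fps_nth (S i) (Suc 0) = mv I I (drho0 q n X) (\<sigma> u) i" for i
 proof -
  have "fps_nth (S i) (Suc 0) + of_nat n * trace X * fps_nth (S i) 0 = mv I I (%i j. pdv (%c. c) (q i j) (mat 1) X) (\<sigma> u) i"
   using arg_cong[OF S, of "%f. fps_nth f (Suc 0)" i] fps_power_nth[OF d0, of n] d1
   by (simp add: mv_def fps_sum_nth pev_fps_nth_1 fps_mult_nth_1[simplified] G0 G1 split: if_splits)
  hence "fps_nth (S i) (Suc 0) = mv I I (%i j. pdv (%c. c) (q i j) (mat 1) X) (\<sigma> u) i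
    - of_nat n * trace X * mv I I (%i j. pev0 (q i j) (mat 1)) (\<sigma> u) i"
   unfolding S0 by (simp only: eq_diff_eq)
  thus ?thesis by (simp add: mv_def drho_def sum_distrib_left sum_subtractf left_diff_distrib right_diff_distrib mult_ac)
 qed
 have "\<sigma> (mact (differentiate U) X u) i = fps_nth (S i) (Suc 0)" for i
 proof -
  have "\<sigma> (mact (differentiate U) X u) i = (\<Sum>b\<in>B. \<sigma> (fps_nth (gl2_eval fps_const (\<phi> b) ?G) 1 .[U] b) i)"
   unfolding act_eq \<sigma>_finsum[OF co fB(1) cl] ..
  also have "... = fps_nth (S i) (Suc 0)"
   unfolding S_def fps_sum_nth by (rule sum.cong[OF refl]) (use fB in \<open>simp add: coordsD(6)[OF co] subset_iff\<close>)
  finally show ?thesis .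
 qed
 thus "\<sigma> (mact (differentiate U) X u) = mv I I (drho0 q n X) (\<sigma> u)" by (intro ext) (simp only: S1)
qed

text \<open>\<open>coaction_eval\<close> over the fraction field at the Jacobian matrix C, whose
  inverse determinant is regular on the overlap.\<close>

lemma tcoord_extend:
 assumes x: "x \<in>. fract_tensor (loc2 h h') U"
 shows "gl2_extend (loc2 h h') U (cc h h') x \<in>. fract_tensor (loc2 h h') U"
  "tcoord \<sigma> (gl2_extend (loc2 h h') U (cc h h') x) = mv I I (rho fs q n (cc h h')) (tcoord \<sigma> x)"
proof -
 let ?B = "loc2 h h' :: 'k sphere fract set" and ?T = "fract_tensor (loc2 h h') U" and ?C = "cc h h' :: 'k sphere fract^2^2"
 note kB = kspace_loc2[of h h', where 'k = 'k]
 interpret T: abelian_group ?T by (rule tensor_abelian[OF fu[OF co kB]])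
 let ?f = "%(g, u). case gl2_coaction U u of (S, \<phi>) => (\<Oplus>\<^bsub>?T\<^esub>b\<in>S. fract_pure ?B U (g * gl2_eval fs (\<phi> b) ?C) b)"
 have eval_B: "gl2_eval fs \<phi> ?C \<in> ?B" for \<phi>
 proof -
  have "pev fs (gpoly (fst \<phi>)) ?C \<in> loc h'" by (rule pev_closed) (auto intro: loc_add loc_mult)
  moreover have "det (cc h' h) ^ snd \<phi> \<in> loc h" by (intro loc_power loc_det) auto
  ultimately have "pev fs (gpoly (fst \<phi>)) ?C * det (cc h' h) ^ snd \<phi> \<in> ?B"
   using loc_subset_loc2 by (blast intro: loc2_mult)
  thus ?thesis by (simp add: gl2_eval_gpoly inverse_det_cc)
 qed
 have key: "?f (g, u) \<in>. ?T \<and> tcoord \<sigma> (?f (g, u)) = mv I I (rho fs q n ?C) (%i. g * fs (\<sigma> u i))"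
  if g: "g \<in> ?B" and u: "u \<in>. U" for g u
 proof -
  obtain B \<phi> where B: "gl2_coaction U u = (B, \<phi>)" "gl2_coeffs_of U u B \<phi>" using gl2_coaction_coeffs[OF U u] by blast
  have fB: "finite B" "B \<subseteq> carrier U" using B(2) by (auto simp: gl2_coeffs_of_def)
  have cl: "(%b. fract_pure ?B U (g * gl2_eval fs (\<phi> b) ?C) b) \<in> B \<rightarrow> carrier ?T"
   using fB by (auto intro!: fpure_closed[OF co kB] loc2_mult g eval_B)
  have "tcoord \<sigma> (?f (g, u)) i = mv I I (rho fs q n ?C) (%i. g * fs (\<sigma> u i)) i" for i
  proof -
   have "tcoord \<sigma> (?f (g, u)) i = (\<Sum>b\<in>B. g * gl2_eval fs (\<phi> b) ?C * fs (\<sigma> b i))"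
    unfolding prod.case B(1) tcoord_finsum[OF co kB fB(1) cl]
    by (rule sum.cong[OF refl]) (use fB in \<open>simp add: tcoord_pure[OF co kB] loc2_mult g eval_B subset_iff\<close>)
   also have "... = g * (\<Sum>b\<in>B. gl2_eval fs (\<phi> b) ?C * fs (\<sigma> b i))" by (simp add: sum_distrib_left mult.assoc)
   also have "(\<Sum>b\<in>B. gl2_eval fs (\<phi> b) ?C * fs (\<sigma> b i)) = mv I I (rho fs q n ?C) (%i. fs (\<sigma> u i)) i"
   proof -
    have "det ?C ^ n * (\<Sum>b\<in>B. gl2_eval fs (\<phi> b) ?C * fs (\<sigma> b i)) = mv I I (%i j. pev fs (q i j) ?C) (%j. fs (\<sigma> u j)) i"
     by (rule coaction_eval[OF co act[OF _ u] B(2) rhom_fs]) (assumption, rule right_inverse, rule det_cc_nz)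
    thus ?thesis by (simp add: mv_def rho_def field_simps sum_divide_distrib[symmetric] split: if_splits)
   qed
   finally show ?thesis by (simp add: mv_smult)
  qed
  moreover have "?f (g, u) \<in>. ?T" using T.finsum_closed[OF cl] by (simp add: B(1))
  ultimately show ?thesis by blast
 qed
 have "gl2_extend ?B U ?C = gen_lift ?T ?f" by (simp add: gl2_extend_def Let_def)
 thus "gl2_extend ?B U ?C x \<in>. ?T" "tcoord \<sigma> (gl2_extend ?B U ?C x) = mv I I (rho fs q n ?C) (tcoord \<sigma> x)"
  using tcoord_transfer[OF co kB kB _ _ _ x, where \<Lambda> = "mv I I (rho fs q n ?C)" and f = ?f] key by (auto simp: mv_add)
qed

end

text \<open>In coordinates the embedding \<phi>_h is \<rho>(C) for the change from N(z) to N(h).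
  Compatibility with vector fields is \<open>Lie_chart_cc\<close>, and the condition on overlaps is
  the cocycle rule \<open>cc_comp\<close>.\<close>

lemma rep_tensor_module:
 fixes M :: "('k::field_char_0 sphere, 'u) av_struct" and q :: "('i, 'k) qmat" and \<kappa> :: "('i => 'k) => 'u"
 assumes M: "av_module M" and rep: "rep_module M I q n"
  and \<kappa>: "inj_on \<kappa> {c. mv I I (rho0 q n (mat 1)) c = c}"
 shows "tensor_module M"
proof -
 have q: "polyrep I q" using rep by (simp add: rep_module_def)
 define U where "U = rep_space \<kappa> I q n"
 obtain b \<sigma> where U: "rational_gl2_module U" and rc: "rep_coords U I b \<sigma> q n"
  using rep_space[OF q \<kappa>] unfolding U_def by blast
 define D where "D = differentiate U"
 note co = rep_coordsD(1)[OF U rc] and \<sigma>b = rep_coordsD(5)[OF U rc]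
 have coD: "coords D I b \<sigma>" unfolding D_def by (rule differentiate_co[OF U rc])
 let ?C = "%h. chart_module h D"
 obtain \<alpha> where \<alpha>: "\<alpha> \<in> av_hom M (SMod I q n)" "bij_betw \<alpha> (carrier M) (carrier (SMod I q n))"
  using rep by (auto simp: rep_module_def av_iso_def)
 note ah = av_homD[OF \<alpha>(1)] and cl = av_moduleD(2)[OF M]
 have clM: "av_closed M" by (rule av_module_closed[OF M])
 let ?R = "%h. mv I I (rho fs q n (cc coord_z h))"
 have ex: "\<exists>x\<in>carrier (?C h). tcoord \<sigma> x = ?R h v" if v: "v \<in>. SMod I q n" for h v
 proof -
  have "?R h v i = (\<Sum>j\<in>I. fs (\<sigma> (b j) i) * ?R h v j)" for i
  proof -
   have "?R h v = mv I I (rho fs q n (mat 1)) (?R h v)" by (simp add: mv_rho_mult[OF q])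
   hence "?R h v i = mv I I (rho fs q n (mat 1)) (?R h v) i" by (rule fun_cong)
   also have "... = (\<Sum>j\<in>I. fs (\<sigma> (b j) i) * ?R h v j)"
   proof -
    have "fs (rho0 q n (mat 1) i j) = rho fs q n (mat 1) i j" for i j
     by (simp add: rho_map mmap_1)
    thus ?thesis unfolding mv_def[of I I "rho fs q n (mat 1)"] by (simp add: \<sigma>b)
   qed
   finally show ?thesis .
  qed
  moreover have "?R h v i \<in> loc h" for i using v by (simp add: Mod_carrier)
  ultimately have "\<exists>x\<in>carrier (fract_tensor (loc h) D). tcoord \<sigma> x = ?R h v"
   by (intro tcoord_surj[OF coD kspace_loc])
  thus ?thesis by (simp add: chart_module_simps[OF coD])
 qed
 have "\<forall>h m. \<exists>x. m \<in>. M --> x \<in>. ?C h \<and> tcoord \<sigma> x = ?R h (\<alpha> m)"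
  using ex ah(1) by blast
 then obtain \<phi> where \<phi>: "!!h m. m \<in>. M ==> \<phi> h m \<in>. ?C h"
  "!!h m. m \<in>. M ==> tcoord \<sigma> (\<phi> h m) = ?R h (\<alpha> m)" by metis
 have inj: "x = y" if "x \<in>. ?C h" "y \<in>. ?C h" "tcoord \<sigma> x = tcoord \<sigma> y" for h x y
  using that unfolding chart_module_simps[OF coD] by (intro inj_onD[OF tcoord_inj[OF coD kspace_loc[of h]]])
 have hom: "\<phi> h \<in> av_hom M (?C h)" for h
 proof (rule av_homI)
  interpret FT: abelian_group "fract_tensor (loc h) D" by (rule tensor_abelian[OF fu[OF coD kspace_loc]])
  fix m assume m: "m \<in>. M"
  show "\<phi> h m \<in>. ?C h" by (rule \<phi>(1)[OF m])
  fix m' assume m': "m' \<in>. M"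
  have mm': "m +[M] m' \<in>. M" using clM m m' by (simp add: av_closed_def)
  show "\<phi> h (m +[M] m') = \<phi> h m +[?C h] \<phi> h m'"
   using \<phi>(1)[OF m] \<phi>(1)[OF m']
   by (intro inj[OF \<phi>(1)[OF mm']])
    (simp_all add: chart_module_simps[OF coD] tcoord_add[OF coD kspace_loc] \<phi>(2) m m' mm' ah(2) mv_add)
 next
  fix a m assume m: "m \<in>. M"
  have am: "a .[M] m \<in>. M" using clM m by (simp add: av_closed_def)
  show "\<phi> h (a .[M] m) = a .[?C h] \<phi> h m"
   by (rule inj[OF \<phi>(1)[OF am] tcoord_chart_smult(1)[OF coD \<phi>(1)[OF m]]])
    (simp add: tcoord_chart_smult(2)[OF coD \<phi>(1)[OF m]] \<phi>(2) m am ah(3) mv_smult)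
 next
  fix \<eta> :: "'k sphere => 'k sphere" and m assume \<eta>: "\<eta> \<in> derivations" and m: "m \<in>. M"
  have lm: "lie M \<eta> m \<in>. M" using clM m \<eta> by (simp add: av_closed_def)
  have act1: "mact D (mat_unit p m) u \<in>. D" and act2: "\<sigma> (mact D (mat_unit p m) u) = mv I I (drho0 q n (munit p m)) (\<sigma> u)"
   if "u \<in>. D" for p m u
   using differentiate_act[OF U rc, of u] that by (simp_all add: D_def mat_unit_eq)
  note tl = tcoord_chart_lie[OF coD \<phi>(1)[OF m] \<eta>, where A = "%p m. drho0 q n (munit p m)", OF act1 act2]
  have fsd: "fs (drho0 q n (munit p l) i j) = drho fs q n (munit p l) i j" for p l i j
   by (simp add: drho_map mmap_munit)
  have "(\<Sum>p\<in>UNIV. \<Sum>l\<in>UNIV. jac h \<eta> $ p $ l * mv I I (drho fs q n (munit p l)) w i) = mv I I (drho fs q n (jac h \<eta>)) w i" for w i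
   unfolding mv_def drho_expand[where X = "jac h \<eta>"]
   by (simp add: sum_2 sum_distrib_left distrib_right sum.distrib mult.assoc)
  hence "tcoord \<sigma> (lie (?C h) \<eta> (\<phi> h m)) = (%i. dext \<eta> (?R h (\<alpha> m) i) + mv I I (drho fs q n (jac h \<eta>)) (?R h (\<alpha> m)) i)"
   using tl(2) by (simp add: fsd \<phi>(2) m)
  also have "... = Lie_chart I q n h \<eta> (?R h (\<alpha> m))"
   by (simp add: Lie_chart_def fun_eq_iff mv_out fder_0[OF fder_dext[OF \<eta>]])
  also have "... = ?R h (Lie_chart I q n coord_z \<eta> (\<alpha> m))" by (rule Lie_chart_cc[OF q \<eta>, symmetric])
  also have "... = ?R h (\<alpha> (lie M \<eta> m))" by (simp add: ah(4) \<eta> m)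
  finally have "tcoord \<sigma> (\<phi> h (lie M \<eta> m)) = tcoord \<sigma> (lie (?C h) \<eta> (\<phi> h m))" by (simp add: \<phi>(2) lm)
  thus "\<phi> h (lie M \<eta> m) = lie (?C h) \<eta> (\<phi> h m)" by (intro inj[OF \<phi>(1)[OF lm]] tl(1))
 qed
 have inj_\<phi>: "inj_on (\<phi> h) (carrier M)" for h
 proof (rule inj_onI)
  fix m m' assume m: "m \<in>. M" and m': "m' \<in>. M" and "\<phi> h m = \<phi> h m'"
  hence "?R h (\<alpha> m) = ?R h (\<alpha> m')" using \<phi>(2) by metis
  hence "mv I I (rho fs q n (cc h coord_z)) (?R h (\<alpha> m)) = mv I I (rho fs q n (cc h coord_z)) (?R h (\<alpha> m'))" by simp
  moreover have "mv I I (rho fs q n (mat 1)) (\<alpha> m) = \<alpha> m" "mv I I (rho fs q n (mat 1)) (\<alpha> m') = \<alpha> m'"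
   using ah(1)[OF m] ah(1)[OF m'] by (simp_all add: Mod_carrier)
  ultimately have "\<alpha> m = \<alpha> m'" by (simp add: mv_rho_mult[OF q] cc_comp)
  thus "m = m'" using \<alpha>(2) m m' by (simp add: bij_betw_def inj_on_def)
 qed
 have comp: "gl2_extend (loc2 h h') U (cc h h') (fract_incl (loc2 h h') U (\<phi> h m)) = fract_incl (loc2 h h') U (\<phi> h' m)"
  if m: "m \<in>. M" for h h' m
 proof -
  have c: "\<phi> h m \<in>. fract_tensor (loc h) U" for h
   using \<phi>(1)[OF m, of h] by (simp add: chart_module_simps[OF coD]) (simp add: D_def)
  note i1 = tcoord_incl[OF co kspace_loc kspace_loc2[of h h'] loc_subset_loc2(1) c[of h]]
   and i2 = tcoord_incl[OF co kspace_loc kspace_loc2[of h h'] loc_subset_loc2(2) c[of h']]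
  note e = tcoord_extend[OF U rc i1(1)]
  have "tcoord \<sigma> (gl2_extend (loc2 h h') U (cc h h') (fract_incl (loc2 h h') U (\<phi> h m))) = tcoord \<sigma> (fract_incl (loc2 h h') U (\<phi> h' m))"
   unfolding e(2) i1(2) i2(2) \<phi>(2)[OF m] mv_rho_mult[OF q] cc_comp ..
  thus ?thesis by (rule inj_onD[OF tcoord_inj[OF co kspace_loc2] _ e(1) i2(1)])
 qed
 have "fin_gen univ_ring M"
 proof -
  obtain w :: "coord \<times> 'i => _" where w: "!!s. s \<in> UNIV \<times> I ==> w s \<in>. SMod I q n"
   and ex: "!!v. v \<in>. SMod I q n ==> \<exists>a. v = (%i. \<Sum>s\<in>UNIV \<times> I. incl (a s) * w s i)"
   using fin_gen_Mod[OF q, of n] by (elim exE conjE) (rule that, erule (1) bspec, erule (1) bspec)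
  have fin: "finite (UNIV \<times> I :: (coord \<times> 'i) set)" using finite_polyrep[OF q] by (simp add: UNIV_coord)
  define b' where "b' s = the_inv_into (carrier M) \<alpha> (w s)" for s
  have b': "b' s \<in>. M" "\<alpha> (b' s) = w s" if "s \<in> UNIV \<times> I" for s
   using \<alpha>(2) w[OF that] unfolding b'_def bij_betw_def
   by (auto intro: the_inv_into_into f_the_inv_into_f)
  have b'M: "b' \<in> (UNIV \<times> I) \<rightarrow> carrier M" using b' by blast
  interpret MM: Module.module univ_ring M by (rule av_moduleD(1)[OF M])
  have "\<exists>a. m = lincomb M (UNIV \<times> I) b' a" if m: "m \<in>. M" for m
  proof -
   obtain a where a: "\<alpha> m = (%i. \<Sum>s\<in>UNIV \<times> I. incl (a s) * w s i)" using ex[OF ah(1)[OF m]] by (elim exE)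
   have t: "(%s. a s .[M] b' s) \<in> UNIV \<times> I \<rightarrow> carrier M" by (rule lincomb_terms[OF MM.module_axioms fin b'M])
   have "\<alpha> (lincomb M (UNIV \<times> I) b' a) = (\<Oplus>\<^bsub>SMod I q n\<^esub>s\<in>UNIV \<times> I. \<alpha> (a s .[M] b' s))"
    unfolding lincomb_def
    by (rule additive_finsum[OF MM.abelian_group_axioms Mod_abelian[OF q] _ _ t fin]) (use ah(1,2) in auto)
   also have "... = (%i. \<Sum>s\<in>UNIV \<times> I. \<alpha> (a s .[M] b' s) i)"
    by (rule finsum_Mod[OF q _ fin]) (use t ah(1) in blast)
   also have "... = (%i. \<Sum>s\<in>UNIV \<times> I. incl (a s) * w s i)"
    by (intro ext sum.cong refl) (simp add: ah(3) b')
   finally have "\<alpha> (lincomb M (UNIV \<times> I) b' a) = \<alpha> m" by (simp add: a)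
   hence "m = lincomb M (UNIV \<times> I) b' a"
    using \<alpha>(2) m lincomb_closed[OF MM.module_axioms fin b'M] by (metis bij_betw_def inj_onD)
   thus ?thesis by (rule exI[of _ a])
  qed
  thus ?thesis by (rule fin_gen_lincomb[OF MM.module_axioms fin b'M])
 qed
 thus ?thesis unfolding tensor_module_def using M U hom inj_\<phi> comp unfolding D_def by blast
qed

subsection \<open>Cardinalities\<close>

text \<open>Lists are folded by an injective pairing on the infinite type. The length is stored as
  well, since the folding is injective only among lists of equal length.\<close>

lemma inj_list:
 fixes \<iota> :: "'a => 'u"
 assumes \<iota>: "inj \<iota>" and inf: "infinite (UNIV :: 'u set)"
 shows "\<exists>f :: 'a list => 'u. inj f"
proof -
 have "|UNIV :: ('u \<times> 'u) set| \<le>o |UNIV :: 'u set|"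
  using card_of_Times_same_infinite[OF inf] by (simp add: ordIso_imp_ordLeq)
 then obtain p :: "'u \<times> 'u => 'u" where p: "inj p" by (auto simp flip: card_of_ordLeq)
 obtain c :: "nat => 'u" where c: "inj c" using infinite_countable_subset[OF inf] by blast
 define e where "e = foldr (%a x. p (\<iota> a, x))"
 have e: "length xs = length ys ==> e xs x = e ys x ==> xs = ys" for xs ys :: "'a list" and x
  by (induction xs ys rule: list_induct2) (auto simp: e_def dest!: injD[OF p] injD[OF \<iota>])
 have "inj (%xs. p (c (length xs), e xs (c 0)))"
  by (rule injI) (auto dest!: injD[OF p] injD[OF c] intro: e)
 thus ?thesis by blast
qed

text \<open>Polynomials embed as coefficient lists, residue classes by representatives and fractions
  as pairs, so the fraction field is no larger than a type into which k embeds.\<close>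

lemma inj_fract:
 fixes \<iota> :: "'k::field_char_0 => 'u"
 assumes \<iota>: "inj \<iota>"
 shows "\<exists>f :: 'k sphere fract => 'u. inj f"
proof -
 have inf: "infinite (UNIV :: 'u set)" using infinite_UNIV_char_0[where 'a = 'k] \<iota> by (metis finite_imageD finite_subset subset_UNIV)
 have poly: "\<exists>f :: 'b poly => 'u. inj f" if \<iota>: "inj \<iota>" for \<iota> :: "'b::zero => 'u"
 proof -
  obtain f :: "'b list => 'u" where "inj f" using inj_list[OF \<iota> inf] by blast
  hence "inj (f \<circ> coeffs)" by (auto simp: inj_def coeffs_eq_iff)
  thus ?thesis by blast
 qed
 obtain f1 :: "'k poly => 'u" where "inj f1" using poly[OF \<iota>] by blast
 then obtain f2 :: "'k poly poly => 'u" where "inj f2" using poly by blast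
 then obtain f3 :: "'k poly poly poly => 'u" where f3: "inj f3" using poly by blast
 have "inj (rep_sphere :: 'k sphere => _)" by (metis Quotient_abs_rep[OF Quotient_sphere] injI)
 hence f4: "inj (f3 \<circ> (rep_sphere :: 'k sphere => _))" using f3 by (rule inj_compose[rotated])
 obtain f5 :: "'k sphere list => 'u" where f5: "inj f5" using inj_list[OF f4 inf] by blast
 have "\<forall>x :: 'k sphere fract. \<exists>ab. x = incl (fst ab) / incl (snd ab)" using fract_exhaust by (metis fst_conv snd_conv)
 then obtain r where r: "!!x :: 'k sphere fract. x = incl (fst (r x)) / incl (snd (r x))" by metis
 have "inj (%x. f5 [fst (r x), snd (r x)])"
 proof (rule injI)
  fix x y assume "f5 [fst (r x), snd (r x)] = f5 [fst (r y), snd (r y)]"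
  hence "[fst (r x), snd (r x)] = [fst (r y), snd (r y)]" by (rule injD[OF f5])
  thus "x = y" using r[of x] r[of y] by simp
 qed
 thus ?thesis by blast
qed

lemma inj_on_vectors:
 fixes \<iota> :: "'f::zero => 'u" and I :: "'i set"
 assumes \<iota>: "inj \<iota>" and inf: "infinite (UNIV :: 'u set)" and I: "finite I"
 shows "\<exists>\<kappa> :: ('i => 'f) => 'u. inj_on \<kappa> {v. \<forall>i. i \<notin> I --> v i = 0}"
proof -
 obtain f :: "'f list => 'u" where f: "inj f" using inj_list[OF \<iota> inf] by blast
 obtain xs where xs: "set xs = I" using finite_list[OF I] by blast
 have "inj_on (%v. f (map v xs)) {v. \<forall>i. i \<notin> I --> v i = 0}"
 proof (rule inj_onI)
  fix v w assume vw: "v \<in> {v. \<forall>i. i \<notin> I --> v i = 0}" "w \<in> {v. \<forall>i. i \<notin> I --> v i = 0}" "f (map v xs) = f (map w xs)"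
  hence "map v xs = map w xs" by (intro injD[OF f])
  hence "v i = w i" for i using vw(1,2) xs by (cases "i \<in> I") auto
  thus "v = w" by (rule ext)
 qed
 thus ?thesis by blast
qed

subsection \<open>Equivalences of categories\<close>

definition is_category :: "('o, 'a) category => bool"
 where "is_category \<C> \<longleftrightarrow>
  (\<forall>x\<in>cat_obj \<C>. cat_id \<C> x \<in> cat_hom \<C> x x) \<and>
  (\<forall>x\<in>cat_obj \<C>. \<forall>y\<in>cat_obj \<C>. \<forall>f\<in>cat_hom \<C> x y.
   cat_comp \<C> x x y f (cat_id \<C> x) = f \<and> cat_comp \<C> x y y (cat_id \<C> y) f = f) \<and>
  (\<forall>x\<in>cat_obj \<C>. \<forall>y\<in>cat_obj \<C>. \<forall>z\<in>cat_obj \<C>. \<forall>f\<in>cat_hom \<C> x y. \<forall>g\<in>cat_hom \<C> y z.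
   cat_comp \<C> x y z g f \<in> cat_hom \<C> x z) \<and>
  (\<forall>w\<in>cat_obj \<C>. \<forall>x\<in>cat_obj \<C>. \<forall>y\<in>cat_obj \<C>. \<forall>z\<in>cat_obj \<C>.
   \<forall>f\<in>cat_hom \<C> w x. \<forall>g\<in>cat_hom \<C> x y. \<forall>h\<in>cat_hom \<C> y z.
   cat_comp \<C> w x z (cat_comp \<C> x y z h g) f = cat_comp \<C> w y z h (cat_comp \<C> w x y g f))"

lemma is_categoryD:
 assumes "is_category \<C>"
 shows cat_id: "x \<in> cat_obj \<C> ==> cat_id \<C> x \<in> cat_hom \<C> x x"
  and cat_id_right: "[|x \<in> cat_obj \<C>; y \<in> cat_obj \<C>; f \<in> cat_hom \<C> x y|] ==> cat_comp \<C> x x y f (cat_id \<C> x) = f"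
  and cat_id_left: "[|x \<in> cat_obj \<C>; y \<in> cat_obj \<C>; f \<in> cat_hom \<C> x y|] ==> cat_comp \<C> x y y (cat_id \<C> y) f = f"
  and cat_comp: "[|x \<in> cat_obj \<C>; y \<in> cat_obj \<C>; z \<in> cat_obj \<C>; f \<in> cat_hom \<C> x y; g \<in> cat_hom \<C> y z|] ==>
   cat_comp \<C> x y z g f \<in> cat_hom \<C> x z"
  and cat_assoc: "[|w \<in> cat_obj \<C>; x \<in> cat_obj \<C>; y \<in> cat_obj \<C>; z \<in> cat_obj \<C>;
   f \<in> cat_hom \<C> w x; g \<in> cat_hom \<C> x y; h \<in> cat_hom \<C> y z|] ==>
   cat_comp \<C> w x z (cat_comp \<C> x y z h g) f = cat_comp \<C> w y z h (cat_comp \<C> w x y g f)"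
 using assms by (simp_all add: is_category_def)

text \<open>A fully faithful and essentially surjective functor has a quasi-inverse: preimages G y
  with isomorphisms \<epsilon> y are chosen for the objects, and full faithfulness defines it on
  morphisms.\<close>

lemma equivalent_categoriesI:
 assumes C: "is_category \<C>" and D: "is_category \<D>" and F: "is_functor \<C> \<D> F F'"
  and ff: "!!x y. [|x \<in> cat_obj \<C>; y \<in> cat_obj \<C>|] ==> bij_betw (F' x y) (cat_hom \<C> x y) (cat_hom \<D> (F x) (F y))"
  and es: "!!y. y \<in> cat_obj \<D> ==> \<exists>x\<in>cat_obj \<C>. \<exists>f g. inverse_arrows \<D> (F x) y f g"
 shows "equivalent_categories \<C> \<D>"
proof -
 let ?c = "cat_comp \<C>" and ?d = "cat_comp \<D>" and ?O = "cat_obj \<C>" and ?P = "cat_obj \<D>"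
 have Fo: "F x \<in> ?P" if "x \<in> ?O" for x using F that by (simp add: is_functor_def)
 have Fh: "F' x y f \<in> cat_hom \<D> (F x) (F y)" if "x \<in> ?O" "y \<in> ?O" "f \<in> cat_hom \<C> x y" for x y f
  using F that by (simp add: is_functor_def)
 have Fi: "F' x x (cat_id \<C> x) = cat_id \<D> (F x)" if "x \<in> ?O" for x using F that by (simp add: is_functor_def)
 have Fc: "F' x z (?c x y z g f) = ?d (F x) (F y) (F z) (F' y z g) (F' x y f)"
  if "x \<in> ?O" "y \<in> ?O" "z \<in> ?O" "f \<in> cat_hom \<C> x y" "g \<in> cat_hom \<C> y z" for x y z f g
  using F that by (simp add: is_functor_def)
 have "\<forall>y. \<exists>x f g. y \<in> ?P --> x \<in> ?O \<and> inverse_arrows \<D> (F x) y f g" using es by blast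
 then obtain G \<epsilon> \<epsilon>' where G': "!!y. y \<in> ?P ==> G y \<in> ?O \<and> inverse_arrows \<D> (F (G y)) y (\<epsilon> y) (\<epsilon>' y)" by metis
 have Go: "G y \<in> ?O" and e: "\<epsilon> y \<in> cat_hom \<D> (F (G y)) y" and e': "\<epsilon>' y \<in> cat_hom \<D> y (F (G y))"
  and e'e: "?d (F (G y)) y (F (G y)) (\<epsilon>' y) (\<epsilon> y) = cat_id \<D> (F (G y))"
  and ee': "?d y (F (G y)) y (\<epsilon> y) (\<epsilon>' y) = cat_id \<D> y" if "y \<in> ?P" for y
  using G'[OF that] by (simp_all add: inverse_arrows_def)
 note obj = Fo Go
 define L where "L x y h = the_inv_into (cat_hom \<C> x y) (F' x y) h" for x y h
 have L: "L x y h \<in> cat_hom \<C> x y" "F' x y (L x y h) = h" if "x \<in> ?O" "y \<in> ?O" "h \<in> cat_hom \<D> (F x) (F y)" for x y h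
  using ff[OF that(1,2)] that(3) unfolding L_def bij_betw_def
  by (auto intro: the_inv_into_into f_the_inv_into_f)
 have Finj: "f = g" if "x \<in> ?O" "y \<in> ?O" "f \<in> cat_hom \<C> x y" "g \<in> cat_hom \<C> x y" "F' x y f = F' x y g" for x y f g
  using ff[OF that(1,2)] that(3-) unfolding bij_betw_def by (auto dest: inj_onD)
 \<comment> \<open>The morphism h conjugated by the chosen isomorphisms; its unique preimage under
   F' is the value of the quasi-inverse at h.\<close>
 let ?\<phi> = "%y z h. ?d (F (G y)) z (F (G z)) (\<epsilon>' z) (?d (F (G y)) y z h (\<epsilon> y))"
 define G'' where "G'' y z h = L (G y) (G z) (?\<phi> y z h)" for y z h
 have h\<epsilon>: "?d (F (G y)) y z h (\<epsilon> y) \<in> cat_hom \<D> (F (G y)) z" if "y \<in> ?P" "z \<in> ?P" "h \<in> cat_hom \<D> y z" for y z h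
  using that by (intro cat_comp[OF D] obj e)
 have \<phi>h: "?\<phi> y z h \<in> cat_hom \<D> (F (G y)) (F (G z))" if "y \<in> ?P" "z \<in> ?P" "h \<in> cat_hom \<D> y z" for y z h
  using that by (intro cat_comp[OF D] obj e e' h\<epsilon>)
 have G'': "G'' y z h \<in> cat_hom \<C> (G y) (G z)" "F' (G y) (G z) (G'' y z h) = ?\<phi> y z h"
  if "y \<in> ?P" "z \<in> ?P" "h \<in> cat_hom \<D> y z" for y z h
  using L[OF Go Go \<phi>h[OF that], OF that(1,2)] by (simp_all add: G''_def)
 have fG: "is_functor \<D> \<C> G G''"
  unfolding is_functor_def
 proof (intro conjI ballI)
  fix y assume y: "y \<in> ?P"
  show "G y \<in> ?O" by (rule Go[OF y])
  note i = cat_id[OF D y]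
  show "G'' y y (cat_id \<D> y) = cat_id \<C> (G y)"
   by (rule Finj[OF Go[OF y] Go[OF y] G''(1)[OF y y i] cat_id[OF C Go[OF y]]])
    (simp add: G''(2)[OF y y i] Fi Go y cat_id_left[OF D Fo[OF Go[OF y]] y e[OF y]] e'e)
 next
  fix y z h assume "y \<in> ?P" "z \<in> ?P" "h \<in> cat_hom \<D> y z"
  thus "G'' y z h \<in> cat_hom \<C> (G y) (G z)" by (rule G''(1))
 next
  fix x y z f g assume o: "x \<in> ?P" "y \<in> ?P" "z \<in> ?P" and f: "f \<in> cat_hom \<D> x y" and g: "g \<in> cat_hom \<D> y z"
  note gf = cat_comp[OF D o f g]
  have "?d (F (G x)) (F (G y)) (F (G z)) (?\<phi> y z g) (?\<phi> x y f)
    = ?d (F (G x)) z (F (G z)) (\<epsilon>' z) (?d (F (G x)) (F (G y)) z (?d (F (G y)) y z g (\<epsilon> y)) (?\<phi> x y f))"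
   by (intro cat_assoc[OF D] obj o \<phi>h f g h\<epsilon> e')
  also have "?d (F (G x)) (F (G y)) z (?d (F (G y)) y z g (\<epsilon> y)) (?\<phi> x y f)
    = ?d (F (G x)) y z g (?d (F (G x)) (F (G y)) y (\<epsilon> y) (?\<phi> x y f))"
   by (intro cat_assoc[OF D] obj o \<phi>h f g e)
  also have "?d (F (G x)) (F (G y)) y (\<epsilon> y) (?\<phi> x y f) = ?d (F (G x)) y y (?d y (F (G y)) y (\<epsilon> y) (\<epsilon>' y)) (?d (F (G x)) x y f (\<epsilon> x))"
   by (intro cat_assoc[OF D, symmetric] obj o f h\<epsilon> e e')
  also have "... = ?d (F (G x)) x y f (\<epsilon> x)"
   unfolding ee'[OF o(2)] by (intro cat_id_left[OF D] obj o f h\<epsilon>)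
  also have "?d (F (G x)) y z g (?d (F (G x)) x y f (\<epsilon> x)) = ?d (F (G x)) x z (?d x y z g f) (\<epsilon> x)"
   by (intro cat_assoc[OF D, symmetric] obj o f g e)
  finally show "G'' x z (?d x y z g f) = ?c (G x) (G y) (G z) (G'' y z g) (G'' x y f)"
   by (intro Finj[OF Go[OF o(1)] Go[OF o(3)] G''(1)[OF o(1,3) gf] cat_comp[OF C]])
    (simp_all add: G'' o f g gf Go Fc)
 qed
 have \<tau>: "natural_iso \<D> \<D> (%x. F (G x)) (%x y f. F' (G x) (G y) (G'' x y f)) (%x. x) (%x y f. f) \<epsilon>"
  unfolding natural_iso_def
 proof (intro conjI ballI)
  fix y assume "y \<in> ?P" thus "\<exists>\<sigma>. inverse_arrows \<D> (F (G y)) y (\<epsilon> y) \<sigma>" using G' by blast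
 next
  fix x y f assume o: "x \<in> ?P" "y \<in> ?P" and f: "f \<in> cat_hom \<D> x y"
  have "?d (F (G x)) (F (G y)) y (\<epsilon> y) (?\<phi> x y f) = ?d (F (G x)) y y (?d y (F (G y)) y (\<epsilon> y) (\<epsilon>' y)) (?d (F (G x)) x y f (\<epsilon> x))"
   by (intro cat_assoc[OF D, symmetric] obj o f h\<epsilon> e e')
  also have "... = ?d (F (G x)) x y f (\<epsilon> x)"
   unfolding ee'[OF o(2)] by (intro cat_id_left[OF D] obj o f h\<epsilon>)
  finally show "?d (F (G x)) (F (G y)) y (\<epsilon> y) (F' (G x) (G y) (G'' x y f)) = ?d (F (G x)) x y f (\<epsilon> x)"
   by (simp add: G'' o f)
 qed
 \<comment> \<open>The unit of the equivalence is the preimage of the inverse isomorphism at F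
   x.\<close>
 define s where "s x = L x (G (F x)) (\<epsilon>' (F x))" for x
 have s: "s x \<in> cat_hom \<C> x (G (F x))" "F' x (G (F x)) (s x) = \<epsilon>' (F x)" if "x \<in> ?O" for x
  using L[of x "G (F x)" "\<epsilon>' (F x)"] that by (simp_all add: s_def obj e')
 have \<sigma>: "natural_iso \<C> \<C> (%x. x) (%x y f. f) (%x. G (F x)) (%x y f. G'' (F x) (F y) (F' x y f)) s"
  unfolding natural_iso_def
 proof (intro conjI ballI)
  fix x assume x: "x \<in> ?O"
  let ?y = "G (F x)" and ?t = "L (G (F x)) x (\<epsilon> (F x))"
  have y: "?y \<in> ?O" using x by (intro obj)
  have t: "?t \<in> cat_hom \<C> ?y x" "F' ?y x ?t = \<epsilon> (F x)" using L[OF y x, of "\<epsilon> (F x)"] x by (simp_all add: e obj)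
  have "?c x ?y x ?t (s x) = cat_id \<C> x"
   by (rule Finj[OF x x cat_comp[OF C x y x s(1)[OF x] t(1)] cat_id[OF C x]])
    (simp add: Fc x y t s Fi ee' Fo)
  moreover have "?c ?y x ?y (s x) ?t = cat_id \<C> ?y"
   by (rule Finj[OF y y cat_comp[OF C y x y t(1) s(1)[OF x]] cat_id[OF C y]])
    (simp add: Fc x y t s Fi e'e Fo)
  ultimately show "\<exists>\<sigma>. inverse_arrows \<C> x ?y (s x) \<sigma>" using s(1)[OF x] t(1) by (auto simp: inverse_arrows_def)
 next
  fix x y f assume x: "x \<in> ?O" and y: "y \<in> ?O" and f: "f \<in> cat_hom \<C> x y"
  let ?u = "F x" and ?v = "F y" and ?f = "F' x y f"
  note o = Fo[OF x] Fo[OF y] and Ff = Fh[OF x y f]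
  note gf = G''(1)[OF o Ff]
  have "?d ?u (F (G ?u)) (F (G ?v)) (?\<phi> ?u ?v ?f) (\<epsilon>' ?u)
    = ?d ?u ?v (F (G ?v)) (\<epsilon>' ?v) (?d ?u (F (G ?u)) ?v (?d (F (G ?u)) ?u ?v ?f (\<epsilon> ?u)) (\<epsilon>' ?u))"
   by (intro cat_assoc[OF D] obj x y Ff h\<epsilon> e')
  also have "?d ?u (F (G ?u)) ?v (?d (F (G ?u)) ?u ?v ?f (\<epsilon> ?u)) (\<epsilon>' ?u) = ?d ?u ?u ?v ?f (?d ?u (F (G ?u)) ?u (\<epsilon> ?u) (\<epsilon>' ?u))"
   by (intro cat_assoc[OF D] obj x y Ff e e')
  also have "... = ?f" unfolding ee'[OF o(1)] by (rule cat_id_right[OF D o Ff])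
  finally show "?c x y (G ?v) (s y) f = ?c x (G ?u) (G ?v) (G'' ?u ?v ?f) (s x)"
   using Go[OF o(1)] Go[OF o(2)]
   by (intro Finj[OF x Go[OF o(2)]] cat_comp[OF C] x y f s gf) (simp_all add: Fc x y f s gf G''(2)[OF o Ff])
 qed
 show ?thesis unfolding equivalent_categories_def using F fG \<sigma> \<tau> by blast
qed

subsection \<open>The functor from rational representations to tensor modules\<close>

lemma is_category_av:
 assumes "!!M. M \<in> cat_obj \<D> ==> av_module M"
  and "cat_hom \<D> = cat_hom av_category" "cat_id \<D> = cat_id av_category" "cat_comp \<D> = cat_comp av_category"
 shows "is_category (\<D> :: (('k::field_char_0 sphere, 'u) av_struct, 'u => 'u) category)"
proof -
 have cl: "av_closed M" if "M \<in> cat_obj \<D>" for M using assms(1)[OF that] by (rule av_module_closed)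
 have id: "(\<lambda>m\<in>carrier M. m) \<in> av_hom M M" if "M \<in> cat_obj \<D>" for M
  using cl[OF that] by (intro av_homI) (auto simp: av_closed_def)
 have comp: "compose (carrier L) g f \<in> av_hom L N" if "L \<in> cat_obj \<D>" "f \<in> av_hom L M" "g \<in> av_hom M N" for L M N f g
  using cl[OF that(1)] av_homD[OF that(2)] av_homD[OF that(3)]
  by (intro av_homI) (auto simp: av_closed_def compose_def)
 have units: "compose (carrier M) (\<lambda>m\<in>carrier N. m) f = f" "compose (carrier M) f (\<lambda>m\<in>carrier M. m) = f"
  if "f \<in> av_hom M N" "f \<in> extensional (carrier M)" for f and M N :: "('k sphere, 'u) av_struct"
  using that by (auto simp: fun_eq_iff compose_def av_hom_closed extensional_def)
 have assoc: "compose (carrier L) (compose (carrier M) h g) f = compose (carrier L) h (compose (carrier L) g f)"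
  if "f \<in> av_hom L M" for f g h and L M :: "('k sphere, 'u) av_struct"
  using that by (auto simp: fun_eq_iff compose_def av_hom_closed)
 show ?thesis
  unfolding is_category_def assms(2-4) av_category_def category.simps
  by (intro conjI ballI) (auto simp: id comp units assoc simp del: restrict_apply)
qed

lemma gl2_homD:
 assumes "f \<in> gl2_hom U W"
 shows gl2_hom_closed: "u \<in>. U ==> f u \<in>. W"
  and gl2_hom_add: "[|u \<in>. U; v \<in>. U|] ==> f (u +[U] v) = f u +[W] f v"
  and gl2_hom_smult: "u \<in>. U ==> f (c .[U] u) = c .[W] f u"
  and gl2_hom_act: "[|invertible g; u \<in>. U|] ==> f (mact U g u) = mact W g (f u)"
 using assms by (auto simp: gl2_hom_def)

lemma gl2_homI:
 assumes "!!u. u \<in>. U ==> f u \<in>. W"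
  "!!u v. [|u \<in>. U; v \<in>. U|] ==> f (u +[U] v) = f u +[W] f v"
  "!!c u. u \<in>. U ==> f (c .[U] u) = c .[W] f u"
  "!!g u. [|invertible g; u \<in>. U|] ==> f (mact U g u) = mact W g (f u)"
 shows "f \<in> gl2_hom U W"
 using assms by (auto simp: gl2_hom_def)

lemma gl2_closed:
 assumes "rational_gl2_module U"
 shows "[|u \<in>. U; v \<in>. U|] ==> u +[U] v \<in>. U"
  "u \<in>. U ==> c .[U] u \<in>. U" "[|invertible g; u \<in>. U|] ==> mact U g u \<in>. U"
proof -
 interpret Module.module univ_ring U using assms by (simp add: rational_gl2_module_def)
 show "[|u \<in>. U; v \<in>. U|] ==> u +[U] v \<in>. U" by simp
 show "u \<in>. U ==> c .[U] u \<in>. U" using smult_closed[of c u] by simp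
 show "[|invertible g; u \<in>. U|] ==> mact U g u \<in>. U" using assms by (simp add: rational_gl2_module_def)
qed

lemma is_category_gl2: "is_category (gl2_category :: (('k::field_char_0, 'u) mat_struct, 'u => 'u) category)"
proof -
 have id: "(\<lambda>u\<in>carrier U. u) \<in> gl2_hom U U" if "rational_gl2_module U" for U :: "('k, 'u) mat_struct"
  by (rule gl2_homI) (auto simp: gl2_closed[OF that])
 have comp: "compose (carrier U) g f \<in> gl2_hom U X" if "rational_gl2_module U" "f \<in> gl2_hom U W" "g \<in> gl2_hom W X"
  for U W X :: "('k, 'u) mat_struct" and f g
  by (rule gl2_homI) (auto simp: compose_def gl2_closed[OF that(1)] gl2_homD[OF that(2)] gl2_homD[OF that(3)])
 have units: "compose (carrier M) (\<lambda>m\<in>carrier N. m) f = f" "compose (carrier M) f (\<lambda>m\<in>carrier M. m) = f"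
  if "f \<in> gl2_hom M N" "f \<in> extensional (carrier M)" for f and M N :: "('k, 'u) mat_struct"
  using that by (auto simp: fun_eq_iff compose_def gl2_hom_closed extensional_def)
 have assoc: "compose (carrier L) (compose (carrier M) h g) f = compose (carrier L) h (compose (carrier L) g f)"
  if "f \<in> gl2_hom L M" for f g h and L M :: "('k, 'u) mat_struct"
  using that by (auto simp: fun_eq_iff compose_def gl2_hom_closed)
 show ?thesis
  unfolding is_category_def gl2_category_def category.simps
  by (intro conjI ballI) (auto simp: id comp units assoc simp del: restrict_apply)
qed

text \<open>Columns are the coordinates of the images of the spanning family. The matrix obtained is
  normalized, T \<rho>(1) = T, as uniqueness requires.\<close>

definition hmat :: "('u => 'w) => ('i => 'u) => ('w => 'j => 'k) => 'j => 'i => 'k"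
 where "hmat f b \<sigma>' j i = \<sigma>' (f (b i)) j"

context
 fixes U :: "('k::field_char_0, 'u) mat_struct" and W :: "('k, 'w) mat_struct" and I :: "'i set" and J :: "'j set"
  and b \<sigma> q n b' \<sigma>' q' n'
 assumes U: "rational_gl2_module U" and rU: "rep_coords U I b \<sigma> q n"
  and W: "rational_gl2_module W" and rW: "rep_coords W J b' \<sigma>' q' n'"
begin

interpretation U: Module.module univ_ring U by (rule coordsD(1)[OF rep_coordsD(1)[OF U rU]])
interpretation W: Module.module univ_ring W by (rule coordsD(1)[OF rep_coordsD(1)[OF W rW]])

lemma hmat_coords:
 assumes f: "f \<in> gl2_hom U W" and u: "u \<in>. U"
 shows "\<sigma>' (f u) = mv J I (hmat f b \<sigma>') (\<sigma> u)"
proof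
 fix j
 note coU = rep_coordsD(1)[OF U rU] and coW = rep_coordsD(1)[OF W rW]
 note h = gl2_homD[OF f]
 have t: "(%i. \<sigma> u i .[U] b i) \<in> I \<rightarrow> carrier U" using coordsD(3)[OF coU] U_smult_closed[OF coU] by auto
 have "f u = f (\<Oplus>\<^bsub>U\<^esub>i\<in>I. \<sigma> u i .[U] b i)" using coordsD(4)[OF coU u] by simp
 also have "... = (\<Oplus>\<^bsub>W\<^esub>i\<in>I. f (\<sigma> u i .[U] b i))"
  by (rule additive_finsum[OF U.abelian_group_axioms W.abelian_group_axioms _ _ t coordsD(2)[OF coU]]) (use h(1,2) in auto)
 finally have "\<sigma>' (f u) = (%j. \<Sum>i\<in>I. \<sigma>' (f (\<sigma> u i .[U] b i)) j)"
  using \<sigma>_finsum[OF coW coordsD(2)[OF coU], of "%i. f (\<sigma> u i .[U] b i)"] t h(1) by (simp add: Pi_iff)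
 also have "... = (%j. \<Sum>i\<in>I. hmat f b \<sigma>' j i * \<sigma> u i)"
  using coordsD(3)[OF coU] by (simp add: h(1,3) coordsD(6)[OF coW] hmat_def mult.commute)
 finally show "\<sigma>' (f u) j = mv J I (hmat f b \<sigma>') (\<sigma> u) j"
  using coordsD(7)[OF coW h(1)[OF u], of j] by (simp add: mv_def)
qed

lemma hmat_props:
 assumes f: "f \<in> gl2_hom U W"
 shows "!!j i. [|j \<in> J; i \<in> I|] ==> mm I (hmat f b \<sigma>') (rho0 q n (mat 1)) j i = hmat f b \<sigma>' j i"
  "equivariant I q n J q' n' (hmat f b \<sigma>')"
proof -
 note coU = rep_coordsD(1)[OF U rU] and coW = rep_coordsD(1)[OF W rW]
 note h = gl2_homD[OF f] and aU = rep_coordsD(3,4)[OF U rU] and aW = rep_coordsD(3,4)[OF W rW]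
 have \<sigma>b: "\<sigma> (b i) l = rho0 q n (mat 1) l i" if "i \<in> I" "l \<in> I" for i l
  using rep_coordsD(5)[OF U rU] that by simp
 show *: "mm I (hmat f b \<sigma>') (rho0 q n (mat 1)) j i = hmat f b \<sigma>' j i" if "j \<in> J" "i \<in> I" for j i
 proof -
  have "hmat f b \<sigma>' j i = mv J I (hmat f b \<sigma>') (\<sigma> (b i)) j"
   using hmat_coords[OF f coordsD(3)[OF coU that(2)]] by (simp add: hmat_def[of f b])
  also have "... = mm I (hmat f b \<sigma>') (rho0 q n (mat 1)) j i" using that by (simp add: mv_def mm_def \<sigma>b)
  finally show ?thesis by simp
 qed
 show "equivariant I q n J q' n' (hmat f b \<sigma>')"
  unfolding equivariant_def
 proof (intro allI impI ballI)
  fix g :: "'k^2^2" and j i assume g: "invertible g" and ji: "j \<in> J" "i \<in> I"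
  have bi: "b i \<in>. U" by (rule coordsD(3)[OF coU ji(2)])
  have "\<sigma> (mact U g (b i)) l = rho0 q n g l i" if "l \<in> I" for l
  proof -
   have "\<sigma> (mact U g (b i)) l = mm I (rho0 q n g) (rho0 q n (mat 1)) l i"
    using that ji by (simp add: aU(2)[OF g bi] mv_def mm_def \<sigma>b)
   thus ?thesis using rho_mult[OF rep_coordsD(2)[OF U rU] rhom_id that ji(2), of n g "mat 1"] by simp
  qed
  hence "mm I (hmat f b \<sigma>') (rho0 q n g) j i = mv J I (hmat f b \<sigma>') (\<sigma> (mact U g (b i))) j"
   using ji by (simp add: mm_def mv_def)
  also have "... = \<sigma>' (f (mact U g (b i))) j" using hmat_coords[OF f aU(1)[OF g bi]] by simp
  also have "... = mv J J (rho0 q' n' g) (\<sigma>' (f (b i))) j" by (simp add: h(4)[OF g bi] aW(2)[OF g h(1)[OF bi]])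
  also have "... = mm J (rho0 q' n' g) (hmat f b \<sigma>') j i" using ji by (simp add: mm_def mv_def hmat_def)
  finally show "mm I (hmat f b \<sigma>') (rho0 q n g) j i = mm J (rho0 q' n' g) (hmat f b \<sigma>') j i" .
 qed
qed

text \<open>Equivariance at g = 1 shows that T \<sigma>(u) is fixed by \<rho>'(1), so it is the
  coordinate vector of an element of W although b' only spans.\<close>

lemma hmat_surj:
 assumes T: "equivariant I q n J q' n' T"
 shows "\<exists>f\<in>gl2_hom U W. \<forall>u\<in>carrier U. \<sigma>' (f u) = mv J I T (\<sigma> u)"
proof -
 note coU = rep_coordsD(1)[OF U rU] and coW = rep_coordsD(1)[OF W rW]
 note aU = rep_coordsD(3,4)[OF U rU] and aW = rep_coordsD(3,4)[OF W rW]
 have intertwine: "mv J J (rho0 q' n' g) (mv J I T (\<sigma> u)) = mv J I T (\<sigma> (mact U g u))"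
  if g: "invertible g" and u: "u \<in>. U" for g u
  unfolding aU(2)[OF g u] mv_mv by (rule mv_cong) (use T g in \<open>simp_all add: equivariant_def\<close>)
 have one: "mact U (mat 1) u = u" if "u \<in>. U" for u using U that by (simp add: rational_gl2_module_def)
 have inv1: "invertible (mat 1 :: 'k^2^2)" by (simp add: invertible_det_nz)
 have ex: "\<exists>w\<in>carrier W. \<sigma>' w = mv J I T (\<sigma> u)" if u: "u \<in>. U" for u
 proof
  let ?v = "mv J I T (\<sigma> u)" and ?w = "lincomb W J b' (mv J I T (\<sigma> u))"
  have b': "b' \<in> J \<rightarrow> carrier W" using coordsD(3)[OF coW] by auto
  show "?w \<in>. W" by (rule lincomb_closed[OF W.module_axioms coordsD(2)[OF coW] b'])
  have t: "(%j. ?v j .[W] b' j) \<in> J \<rightarrow> carrier W"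
   by (rule lincomb_terms[OF W.module_axioms coordsD(2)[OF coW] b'])
  have "\<sigma>' ?w = (%i. \<Sum>j\<in>J. \<sigma>' (?v j .[W] b' j) i)"
   unfolding lincomb_def by (rule \<sigma>_finsum[OF coW coordsD(2)[OF coW] t])
  also have "... = mv J J (rho0 q' n' (mat 1)) ?v"
   using coordsD(3)[OF coW] rep_coordsD(5)[OF W rW] by (simp add: coordsD(6)[OF coW] mv_def[of J J] fun_eq_iff mult.commute)
  also have "... = ?v" using intertwine[OF inv1 u] one[OF u] by simp
  finally show "\<sigma>' ?w = ?v" .
 qed
 have "\<forall>u. \<exists>w. u \<in>. U --> w \<in>. W \<and> \<sigma>' w = mv J I T (\<sigma> u)" using ex by blast
 then obtain f where f: "!!u. u \<in>. U ==> f u \<in>. W" "!!u. u \<in>. U ==> \<sigma>' (f u) = mv J I T (\<sigma> u)" by metis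
 note clU = gl2_closed[OF U] and clW = gl2_closed[OF W]
 have inj: "w = w'" if "w \<in>. W" "w' \<in>. W" "\<sigma>' w = \<sigma>' w'" for w w'
  using \<sigma>_inj[OF coW] that by (auto dest: inj_onD)
 have "f \<in> gl2_hom U W"
 proof (rule gl2_homI)
  show "f (u +[U] v) = f u +[W] f v" if "u \<in>. U" "v \<in>. U" for u v
   using that by (intro inj f(1) clU clW) (simp_all add: f clU coordsD(5)[OF coU] coordsD(5)[OF coW] mv_add)
  show "f (c .[U] u) = c .[W] f u" if "u \<in>. U" for u c
   using that by (intro inj f(1) clU clW) (simp_all add: f clU coordsD(6)[OF coU] coordsD(6)[OF coW] mv_smult)
  show "f (mact U g u) = mact W g (f u)" if "invertible g" "u \<in>. U" for g u
   using that by (intro inj f(1) clU clW) (simp_all add: f clU aW(2) intertwine)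
 qed (rule f(1))
 thus ?thesis using f(2) by blast
qed

end

lemma av_hom_restrict:
 assumes "f \<in> av_hom M N" "av_closed M"
 shows "(\<lambda>m\<in>carrier M. f m) \<in> av_hom M N"
 using assms by (auto simp: av_hom_def av_closed_def)

lemma hmat_hmat:
 assumes U: "rational_gl2_module U" "rep_coords U I b \<sigma> q n" and W: "rational_gl2_module W" "rep_coords W J b' \<sigma>' q' n'"
  and X: "rational_gl2_module X" "rep_coords X K b'' \<sigma>'' q'' n''"
  and f: "f \<in> gl2_hom U W" and g: "g \<in> gl2_hom W X" and ki: "k \<in> K" "i \<in> I"
 shows "mm J (hmat g b' \<sigma>'') (hmat f b \<sigma>') k i = hmat (%u. g (f u)) b \<sigma>'' k i"
proof -
 have "b i \<in>. U" by (rule coordsD(3)[OF rep_coordsD(1)[OF U] ki(2)])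
 from hmat_coords[OF W X g gl2_hom_closed[OF f this]] ki show ?thesis
  by (simp add: hmat_def[of "%u. g (f u)"] mm_def mv_def hmat_def[of f])
qed

lemma hmat_id:
 assumes "rational_gl2_module U" "rep_coords U I b \<sigma> q n" "j \<in> I" "i \<in> I" "!!u. u \<in>. U ==> f u = u"
 shows "hmat f b \<sigma> j i = rho0 q n (mat 1) j i"
 using assms rep_coordsD(5)[OF assms(1,2), of i j] coordsD(3)[OF rep_coordsD(1)[OF assms(1,2)]] by (simp add: hmat_def)

lemma gl2_hom_id: "(%u. u) \<in> gl2_hom U U"
 by (rule gl2_homI) auto

lemma mv_fs_cong: "(!!j i. j \<in> J ==> i \<in> I ==> A j i = B j i) ==> mv J I (%j i. fs (A j i)) v = mv J I (%j i. fs (B j i)) v"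
 by (rule mv_cong) simp_all

lemma mv_fs_mm: "mv K J (%j i. fs (A j i)) (mv J I (%j i. fs (B j i)) v) = mv K I (%j i. fs (mm J A B j i)) v"
 unfolding mv_mv by (rule mv_cong) (simp_all add: mm_map[OF rhom_fs])

lemma mv_fs_rho_1: "mv I I (%j i. fs (rho0 q n (mat 1) j i)) = mv I I (rho fs q n (mat 1))"
 by (rule ext, rule mv_cong) (simp_all add: rho_map mmap_1)

text \<open>The matrices of the identity map between the two coordinate systems are inverse to each
  other modulo the idempotents, so the module depends on U alone up to isomorphism.\<close>

lemma SMod_rep_coords_iso:
 assumes U: "rational_gl2_module U" and r: "rep_coords U I b \<sigma> q n" and r': "rep_coords U J b' \<sigma>' q' n'"
 shows "av_iso (SMod I q n) (SMod J q' n')"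
 by (rule Mod_iso(2)[OF rep_coordsD(2)[OF U r] rep_coordsD(2)[OF U r'], where T = "hmat (%u. u) b \<sigma>'" and S = "hmat (%u. u) b' \<sigma>"])
  (simp_all add: hmat_props(2)[OF U r U r' gl2_hom_id] hmat_props(2)[OF U r' U r gl2_hom_id]
   hmat_hmat[OF U r U r' U r gl2_hom_id gl2_hom_id] hmat_hmat[OF U r' U r U r' gl2_hom_id gl2_hom_id] hmat_id[OF U r] hmat_id[OF U r'])

text \<open>Index sets are sets of natural numbers, since types cannot be quantified;
  \<open>rep_objects_has_copies\<close> renumbers any other finite index set.\<close>

definition rep_objects :: "('k::field_char_0 sphere, 'u) av_struct set"
 where "rep_objects = {M. av_module M \<and> (\<exists>(I :: nat set) q n. rep_module M I q n)}"

lemma rep_module_iso: "rep_module M I q n ==> av_iso N M ==> rep_module N I q n"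
 unfolding rep_module_def using av_iso_trans by blast

lemma rep_objects_has_copies:
 assumes "rep_module M I q n"
 shows "has_copies rep_objects M"
 unfolding has_copies_def
proof (intro allI impI)
 fix T assume T: "av_module T" "av_iso T M"
 have q: "polyrep I q" using assms by (simp add: rep_module_def)
 obtain e where e: "bij_betw e {..<card I} I" using finite_polyrep[OF q] by (metis ex_bij_betw_nat_finite lessThan_atLeast0)
 note r = SMod_reindex[OF q e]
 have "rep_module T I q n" using rep_module_iso[OF assms T(2)] .
 hence "av_iso T (SMod I q n)" by (simp add: rep_module_def)
 moreover have "av_iso (SMod I q n) (SMod {..<card I} (%i j. q (e i) (e j)) n)"
  by (rule av_iso_sym[OF r(2) av_module_closed[OF av_module_Mod[OF r(1)]]])
 ultimately have "rep_module T {..<card I} (%i j. q (e i) (e j)) n"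
  using r(1) av_iso_trans by (auto simp: rep_module_def)
 thus "T \<in> rep_objects" using T(1) by (auto simp: rep_objects_def)
qed

context
 fixes \<iota> :: "'k::field_char_0 => 'u"
 assumes \<iota>: "inj \<iota>"
begin

lemma infinite_universe: "infinite (UNIV :: 'u set)"
 using infinite_UNIV_char_0[where 'a = 'k] \<iota> by (metis finite_imageD finite_subset subset_UNIV)

lemma rep_copy_ex:
 assumes q: "polyrep I (q :: ('i, 'k) qmat)"
 shows "\<exists>(M :: ('k sphere, 'u) av_struct) \<alpha>. av_module M \<and> \<alpha> \<in> av_hom M (SMod I q n) \<and> bij_betw \<alpha> (carrier M) (carrier (SMod I q n))"
proof -
 obtain f :: "'k sphere fract => 'u" where f: "inj f" using inj_fract[OF \<iota>] by blast
 obtain \<kappa> :: "('i => 'k sphere fract) => 'u" where "inj_on \<kappa> {v. \<forall>i. i \<notin> I --> v i = 0}"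
  using inj_on_vectors[OF f infinite_universe finite_polyrep[OF q]] by blast
 hence "inj_on \<kappa> (carrier (SMod I q n))" by (rule inj_on_subset) (auto simp: Mod_out[OF q])
 from av_copy[OF av_module_Mod[OF q] this] show ?thesis by blast
qed

lemma inj_on_fixed_vectors:
 assumes q: "polyrep I (q :: ('i, 'k) qmat)"
 shows "\<exists>\<kappa> :: ('i => 'k) => 'u. inj_on \<kappa> {c. mv I I (rho0 q n (mat 1)) c = c}"
proof -
 obtain \<kappa> :: "('i => 'k) => 'u" where "inj_on \<kappa> {v. \<forall>i. i \<notin> I --> v i = 0}"
  using inj_on_vectors[OF \<iota> infinite_universe finite_polyrep[OF q]] by blast
 moreover have "{c. mv I I (rho0 q n (mat 1)) c = c} \<subseteq> {v. \<forall>i. i \<notin> I --> v i = 0}"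
 proof (intro subsetI CollectI allI impI)
  fix c :: "'i => 'k" and i assume c: "c \<in> {c. mv I I (rho0 q n (mat 1)) c = c}" "i \<notin> I"
  hence "c i = mv I I (rho0 q n (mat 1)) c i" by simp
  thus "c i = 0" by (rule trans) (rule mv_out[OF c(2)])
 qed
 ultimately show ?thesis using inj_on_subset by blast
qed

lemma rep_objects_tensor: "rep_objects \<subseteq> cat_obj (tensor_category :: (('k sphere, 'u) av_struct, _) category)"
proof
 fix M :: "('k sphere, 'u) av_struct" assume "M \<in> rep_objects"
 then obtain I :: "nat set" and q n where M: "av_module M" "rep_module M I q n" by (auto simp: rep_objects_def)
 hence "polyrep I q" by (simp add: rep_module_def)
 then obtain \<kappa> :: "(nat => 'k) => 'u" where "inj_on \<kappa> {c. mv I I (rho0 q n (mat 1)) c = c}"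
  using inj_on_fixed_vectors by blast
 hence "tensor_module M" using rep_tensor_module[OF M] by blast
 thus "M \<in> cat_obj tensor_category" using M(1) by (simp add: tensor_category_def full_subcategory_def av_category_def)
qed

text \<open>Coordinates and a copy of the resulting module on the universe type are chosen for every
  representation. Full faithfulness is \<open>Mod_hom_matrix\<close> with its uniqueness
  counterpart, essential surjectivity comes from \<open>rep_space\<close>.\<close>

lemma rep_equivalence:
 "equivalent_categories (gl2_category :: (('k, 'u) mat_struct, 'u => 'u) category)
  (full_subcategory tensor_category (rep_objects :: ('k sphere, 'u) av_struct set))"
proof -
 let ?C = "gl2_category :: (('k, 'u) mat_struct, 'u => 'u) category"
 let ?D = "full_subcategory tensor_category rep_objects :: (('k sphere, 'u) av_struct, 'u => 'u) category"
 let ?R = "rational_gl2_module :: ('k, 'u) mat_struct => bool"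
 have objD: "cat_obj ?D = rep_objects"
  using rep_objects_tensor by (auto simp: full_subcategory_def)
 have D: "cat_hom ?D = cat_hom av_category" "cat_id ?D = cat_id av_category" "cat_comp ?D = cat_comp av_category"
  by (simp_all add: full_subcategory_def tensor_category_def)
 note cD = D[unfolded av_category_def, simplified]
 have objC: "cat_obj ?C = {U. ?R U}" by (simp add: gl2_category_def)
 have "\<exists>I \<sigma> q n (M :: ('k sphere, 'u) av_struct) \<alpha>. rep_coords U I (%u. u) \<sigma> q n \<and> av_module M \<and> \<alpha> \<in> av_hom M (SMod I q n) \<and> bij_betw \<alpha> (carrier M) (carrier (SMod I q n))"
  if U: "?R U" for U
 proof -
  obtain I \<sigma> q n where r: "rep_coords U I (%u. u) \<sigma> q n" using rational_coords[OF U] by blast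
  from rep_copy_ex[OF rep_coordsD(2)[OF U r], of n] r show ?thesis by blast
 qed
 then obtain I \<sigma> q n and M :: "_ => ('k sphere, 'u) av_struct" and \<alpha> where
  rc: "!!U. ?R U ==> rep_coords U (I U) (%u. u) (\<sigma> U) (q U) (n U)" and M: "!!U. ?R U ==> av_module (M U)"
  and \<alpha>: "!!U. ?R U ==> \<alpha> U \<in> av_hom (M U) (SMod (I U) (q U) (n U))"
  "!!U. ?R U ==> bij_betw (\<alpha> U) (carrier (M U)) (carrier (SMod (I U) (q U) (n U)))" by metis
 note pr = rep_coordsD(2)[OF _ rc] and co = rep_coordsD(1)[OF _ rc] and clM = av_module_closed[OF M]
 define \<beta> where "\<beta> U = the_inv_into (carrier (M U)) (\<alpha> U)" for U
 have \<beta>: "\<beta> U \<in> av_hom (SMod (I U) (q U) (n U)) (M U)" if "?R U" for U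
  unfolding \<beta>_def by (rule av_hom_inverse[OF \<alpha>[OF that] clM[OF that]])
 have \<alpha>\<beta>: "\<alpha> U (\<beta> U v) = v" if "?R U" "v \<in>. SMod (I U) (q U) (n U)" for U v
  using \<alpha>(2)[OF that(1)] that(2) unfolding \<beta>_def by (metis bij_betw_def f_the_inv_into_f)
 have \<alpha>_inj: "m = m'" if "?R U" "m \<in>. M U" "m' \<in>. M U" "\<alpha> U m = \<alpha> U m'" for U m m'
  using \<alpha>(2)[OF that(1)] that(2-) by (auto simp: bij_betw_def dest: inj_onD)
 define H where "H U W f = (%j i. fs (hmat f (%u :: 'u. u) (\<sigma> W) j i))" for U W :: "('k, 'u) mat_struct" and f :: "'u => 'u"
 define \<Phi> where "\<Phi> U W f = (\<lambda>m\<in>carrier (M U). \<beta> W (mv (I W) (I U) (H U W f) (\<alpha> U m)))" for U W f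
 have Hh: "mv (I W) (I U) (H U W f) \<in> av_hom (SMod (I U) (q U) (n U)) (SMod (I W) (q W) (n W))"
  if "?R U" "?R W" "f \<in> gl2_hom U W" for U W f
  unfolding H_def by (rule Mod_map_hom[OF pr pr hmat_props(2)[OF that(1) rc that(2) rc that(3)]]) (use that in simp_all)
 have \<Phi>: "\<Phi> U W f \<in> av_hom (M U) (M W)" if "?R U" "?R W" "f \<in> gl2_hom U W" for U W f
  unfolding \<Phi>_def
  by (rule av_hom_restrict[OF av_hom_comp[OF av_hom_comp[OF \<alpha>(1) Hh] \<beta>] clM]) (use that in simp_all)
 have \<alpha>\<Phi>: "\<alpha> W (\<Phi> U W f m) = mv (I W) (I U) (H U W f) (\<alpha> U m)" if "?R U" "?R W" "f \<in> gl2_hom U W" "m \<in>. M U" for U W f m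
  using that(4) by (simp add: \<Phi>_def \<alpha>\<beta>[OF that(2)] av_hom_closed[OF Hh[OF that(1-3)]] av_hom_closed[OF \<alpha>(1)[OF that(1)]])
 \<comment> \<open>As \<alpha> W is injective, equality of homomorphisms and hence the functor laws
   become identities of matrices acting on coordinates.\<close>
 have \<Phi>I: "g = \<Phi> U W f" if "?R U" "?R W" "f \<in> gl2_hom U W" "g \<in> av_hom (M U) (M W)" "g \<in> extensional (carrier (M U))"
  "!!m. m \<in>. M U ==> \<alpha> W (g m) = mv (I W) (I U) (H U W f) (\<alpha> U m)" for U W f g
 proof
  fix m show "g m = \<Phi> U W f m"
  proof (cases "m \<in>. M U")
   case True
   thus ?thesis using av_hom_closed[OF that(4)] av_hom_closed[OF \<Phi>[OF that(1-3)]] that(6) \<alpha>\<Phi>[OF that(1-3)]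
    by (intro \<alpha>_inj[OF that(2)]) simp_all
  qed (use that(5) in \<open>simp add: \<Phi>_def extensional_def\<close>)
 qed
 show ?thesis
 proof (rule equivalent_categoriesI[where F = M and F' = \<Phi>])
  show "is_category ?C" by (rule is_category_gl2)
  show "is_category ?D" by (rule is_category_av[OF _ D]) (simp only: objD, simp add: rep_objects_def)
  show "is_functor ?C ?D M \<Phi>"
   unfolding is_functor_def objC objD cD mem_Collect_eq
  proof (intro conjI ballI; (unfold mem_Collect_eq)?)
   fix U assume U: "?R U"
   have "rep_module (M U) (I U) (q U) (n U)" using \<alpha>[OF U] pr[OF U U] by (auto simp: rep_module_def av_iso_def)
   thus "M U \<in> rep_objects" using has_copiesD[OF rep_objects_has_copies M[OF U] av_iso_refl] by blast
   have "(\<lambda>m\<in>carrier (M U). m) = \<Phi> U U (\<lambda>u\<in>carrier U. u)"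
   proof (rule \<Phi>I[OF U U])
    show "(\<lambda>u\<in>carrier U. u) \<in> gl2_hom U U" by (rule gl2_homI) (auto simp: gl2_closed[OF U])
    show "(\<lambda>m\<in>carrier (M U). m) \<in> av_hom (M U) (M U)" by (rule av_hom_restrict[OF _ clM[OF U]]) (simp add: av_hom_def)
    fix m assume m: "m \<in>. M U"
    have "mv (I U) (I U) (H U U (\<lambda>u\<in>carrier U. u)) (\<alpha> U m) = mv (I U) (I U) (rho fs (q U) (n U) (mat 1)) (\<alpha> U m)"
     unfolding H_def mv_fs_rho_1[symmetric] by (rule mv_fs_cong) (simp add: hmat_id[OF U rc[OF U]])
    thus "\<alpha> U ((\<lambda>m\<in>carrier (M U). m) m) = mv (I U) (I U) (H U U (\<lambda>u\<in>carrier U. u)) (\<alpha> U m)"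
     using m av_hom_closed[OF \<alpha>(1)[OF U] m] by (simp add: Mod_carrier)
   qed simp
   thus "\<Phi> U U (cat_id ?C U) = (\<lambda>m\<in>carrier (M U). m)" by (simp add: gl2_category_def)
  next
   fix U W f assume "?R U" "?R W" "f \<in> cat_hom ?C U W"
   thus "\<Phi> U W f \<in> av_hom (M U) (M W) \<inter> extensional (carrier (M U))"
    using \<Phi>[of U W f] by (simp add: gl2_category_def) (simp add: \<Phi>_def)
  next
   fix U W X f g assume U: "?R U" and W: "?R W" and X: "?R X" and "f \<in> cat_hom ?C U W" "g \<in> cat_hom ?C W X"
   hence f: "f \<in> gl2_hom U W" and g: "g \<in> gl2_hom W X" by (simp_all add: gl2_category_def)
   have gf: "compose (carrier U) g f \<in> gl2_hom U X"
    by (rule gl2_homI) (auto simp: compose_def gl2_closed[OF U] gl2_homD[OF f] gl2_homD[OF g])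
   have "compose (carrier (M U)) (\<Phi> W X g) (\<Phi> U W f) = \<Phi> U X (compose (carrier U) g f)"
   proof (rule \<Phi>I[OF U X gf])
    show "compose (carrier (M U)) (\<Phi> W X g) (\<Phi> U W f) \<in> av_hom (M U) (M X)"
     unfolding compose_def by (rule av_hom_restrict[OF av_hom_comp[OF \<Phi>[OF U W f] \<Phi>[OF W X g]] clM[OF U]])
    show "compose (carrier (M U)) (\<Phi> W X g) (\<Phi> U W f) \<in> extensional (carrier (M U))" by (simp add: compose_def)
    fix m assume m: "m \<in>. M U"
    have "mv (I X) (I W) (H W X g) (mv (I W) (I U) (H U W f) (\<alpha> U m)) = mv (I X) (I U) (H U X (compose (carrier U) g f)) (\<alpha> U m)"
     unfolding H_def mv_fs_mm
    proof (rule mv_fs_cong)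
     fix k i assume ki: "k \<in> I X" "i \<in> I U"
     have "i \<in>. U" by (rule coordsD(3)[OF co[OF U U] ki(2)])
     thus "mm (I W) (hmat g (%u. u) (\<sigma> X)) (hmat f (%u. u) (\<sigma> W)) k i = hmat (compose (carrier U) g f) (%u. u) (\<sigma> X) k i"
      unfolding hmat_hmat[OF U rc[OF U] W rc[OF W] X rc[OF X] f g ki] by (simp add: hmat_def compose_def)
    qed
    thus "\<alpha> X (compose (carrier (M U)) (\<Phi> W X g) (\<Phi> U W f) m) = mv (I X) (I U) (H U X (compose (carrier U) g f)) (\<alpha> U m)"
     using m av_hom_closed[OF \<Phi>[OF U W f] m] by (simp add: compose_def \<alpha>\<Phi>[OF U W f] \<alpha>\<Phi>[OF W X g])
   qed
   thus "\<Phi> U X (cat_comp ?C U W X g f) = compose (carrier (M U)) (\<Phi> W X g) (\<Phi> U W f)" by (simp add: gl2_category_def)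
  qed
 next
  fix U W assume "U \<in> cat_obj ?C" "W \<in> cat_obj ?C"
  hence U: "?R U" and W: "?R W" by (simp_all add: objC)
  let ?A = "gl2_hom U W \<inter> extensional (carrier U)" and ?B = "av_hom (M U) (M W) \<inter> extensional (carrier (M U))"
  have h: "cat_hom ?C U W = ?A" by (simp add: gl2_category_def)
  note props = hmat_props[OF U rc[OF U] W rc[OF W]] and hc = hmat_coords[OF U rc[OF U] W rc[OF W]]
  show "bij_betw (\<Phi> U W) (cat_hom ?C U W) (cat_hom ?D (M U) (M W))"
   unfolding bij_betw_def h cD
  proof
   show "inj_on (\<Phi> U W) ?A"
   proof (rule inj_onI)
    fix f g assume f: "f \<in> ?A" and g: "g \<in> ?A"
     and eq: "\<Phi> U W f = \<Phi> U W g"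
    have "mv (I W) (I U) (H U W f) v = mv (I W) (I U) (H U W g) v" if v: "v \<in>. SMod (I U) (q U) (n U)" for v
     using \<alpha>\<Phi>[OF U W, of f "\<beta> U v"] \<alpha>\<Phi>[OF U W, of g "\<beta> U v"] f g eq av_hom_closed[OF \<beta>[OF U] v] by (simp add: \<alpha>\<beta>[OF U v])
    hence T: "hmat f (%u. u) (\<sigma> W) j i = hmat g (%u. u) (\<sigma> W) j i" if "j \<in> I W" "i \<in> I U" for j i
     using f g that unfolding H_def by (intro Mod_hom_matrix_unique[OF pr[OF U U] props(1) props(1)]) auto
    have *: "f u = g u" if u: "u \<in>. U" for u
    proof -
     have "\<sigma> W (f u) = \<sigma> W (g u)" using hc[of f u] hc[of g u] f g u mv_cong[of "I W" "I U" "hmat f (%u. u) (\<sigma> W)"] T by auto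
     thus ?thesis using f g u by (auto intro: inj_onD[OF \<sigma>_inj[OF co[OF W W]]] dest: gl2_hom_closed)
    qed
    show "f = g" by (rule extensionalityI[of f "carrier U" g]) (use f g * in auto)
   qed
   show "\<Phi> U W ` ?A = ?B"
   proof
    show "\<Phi> U W ` ?A \<subseteq> ?B"
     using \<Phi>[OF U W] by (auto simp: \<Phi>_def)
    show "?B \<subseteq> \<Phi> U W ` ?A"
    proof
     fix g assume g: "g \<in> ?B"
     then obtain T where T: "equivariant (I U) (q U) (n U) (I W) (q W) (n W) T"
      "!!m. m \<in>. M U ==> \<alpha> W (g m) = mv (I W) (I U) (fsm T) (\<alpha> U m)"
      using rep_hom_matrix[OF M[OF U] pr[OF U U] pr[OF W W] \<alpha>[OF U] \<alpha>(1)[OF W]] by blast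
     obtain f where f: "f \<in> gl2_hom U W" "!!u. u \<in>. U ==> \<sigma> W (f u) = mv (I W) (I U) T (\<sigma> U u)"
      using hmat_surj[OF U rc[OF U] W rc[OF W] T(1)] by blast
     let ?f = "\<lambda>u\<in>carrier U. f u"
     have f': "?f \<in> ?A"
      by (auto intro!: gl2_homI simp: gl2_homD[OF f(1)] gl2_closed[OF U])
     have "g = \<Phi> U W ?f"
     proof (rule \<Phi>I[OF U W])
      fix m assume m: "m \<in>. M U"
      have "hmat ?f (%u. u) (\<sigma> W) j i = mm (I U) T (rho0 (q U) (n U) (mat 1)) j i" if "j \<in> I W" "i \<in> I U" for j i
      proof -
       have "i \<in>. U" by (rule coordsD(3)[OF co[OF U U] that(2)])
       thus ?thesis using that f(2) by (simp add: hmat_def mv_def mm_def rep_coordsD(5)[OF U rc[OF U]])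
      qed
      hence "mv (I W) (I U) (H U W ?f) (\<alpha> U m) = mv (I W) (I U) (fsm T) (mv (I U) (I U) (%j i. fs (rho0 (q U) (n U) (mat 1) j i)) (\<alpha> U m))"
       unfolding mv_fs_mm H_def by (rule mv_fs_cong)
      also have "... = \<alpha> W (g m)" using av_hom_closed[OF \<alpha>(1)[OF U] m] by (simp add: mv_fs_rho_1 T(2)[OF m] Mod_carrier)
      finally show "\<alpha> W (g m) = mv (I W) (I U) (H U W ?f) (\<alpha> U m)" ..
     qed (use f' g in auto)
     thus "g \<in> \<Phi> U W ` ?A" using f' by blast
    qed
   qed
  qed
 next
  fix N assume "N \<in> cat_obj ?D"
  then obtain J :: "nat set" and p m where N: "av_module N" "rep_module N J p m"
   unfolding objD by (auto simp: rep_objects_def)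
  hence p: "polyrep J p" by (simp add: rep_module_def)
  obtain \<kappa> :: "(nat => 'k) => 'u" where "inj_on \<kappa> {c. mv J J (rho0 p m (mat 1)) c = c}"
   using inj_on_fixed_vectors[OF p] by blast
  note U = rep_space[OF p this]
  let ?U = "rep_space \<kappa> J p m"
  have "av_iso (M ?U) (SMod (I ?U) (q ?U) (n ?U))" using \<alpha>[OF U(1)] by (auto simp: av_iso_def)
  moreover have "av_iso (SMod (I ?U) (q ?U) (n ?U)) (SMod J p m)" by (rule SMod_rep_coords_iso[OF U(1) rc[OF U(1)] U(2)])
  moreover have "av_iso (SMod J p m) N" using av_iso_sym[of N "SMod J p m"] av_module_closed[OF N(1)] N(2) by (simp add: rep_module_def)
  ultimately have "av_iso (M ?U) N" by (rule av_iso_trans[OF av_iso_trans])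
  then obtain f where f: "f \<in> av_hom (M ?U) N" "bij_betw f (carrier (M ?U)) (carrier N)" by (auto simp: av_iso_def)
  let ?f = "\<lambda>m\<in>carrier (M ?U). f m" and ?g = "\<lambda>x\<in>carrier N. the_inv_into (carrier (M ?U)) f x"
  have g: "the_inv_into (carrier (M ?U)) f \<in> av_hom N (M ?U)" by (rule av_hom_inverse[OF f clM[OF U(1)]])
  have "inverse_arrows ?D (M ?U) N ?f ?g"
   unfolding inverse_arrows_def cD
   using av_hom_restrict[OF f(1) clM[OF U(1)]] av_hom_restrict[OF g av_module_closed[OF N(1)]] f(2) av_hom_closed[OF f(1)] av_hom_closed[OF g]
   by (auto simp: compose_def fun_eq_iff bij_betw_def the_inv_into_f_f f_the_inv_into_f)
  thus "\<exists>U\<in>cat_obj ?C. \<exists>f g. inverse_arrows ?D (M U) N f g" using U(1) objC by blast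
 qed
qed

end

subsection \<open>Closure of the subcategory\<close>

text \<open>Each summand is twisted by the exponent of the other, so that both have the denominator
  det^(n+n').\<close>

lemma rep_module_sum:
 assumes M: "rep_module M I q n" and N: "rep_module N J q' n'"
 shows "rep_module (av_sum M N) (I <+> J) (qsum (ptwist n' q) (ptwist n q')) (n + n')"
 using av_sum_iso[OF rep_module_ptwist[OF M, of n']] rep_module_ptwist[OF N, of n] by (simp add: add.commute)

lemma rep_module_tensor:
 assumes M: "av_module M" "rep_module M I q n" and N: "av_module N" "rep_module N J q' n'"
 shows "rep_module (av_tensor M N) (I \<times> J) (qtensor q q') (n + n')" "av_closed (av_tensor M N)"
proof -
 obtain \<alpha> \<beta> where \<alpha>: "\<alpha> \<in> av_hom M (SMod I q n)" "bij_betw \<alpha> (carrier M) (carrier (SMod I q n))"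
  and \<beta>: "\<beta> \<in> av_hom N (SMod J q' n')" "bij_betw \<beta> (carrier N) (carrier (SMod J q' n'))"
  and q: "polyrep I q" and q': "polyrep J q'" using M N by (auto simp: rep_module_def av_iso_def)
 note t = av_tensor_iso[OF q q' M(1) N(1) \<alpha> \<beta>]
 show "rep_module (av_tensor M N) (I \<times> J) (qtensor q q') (n + n')"
  using t(1) polyrep_qtensor[OF q q'] by (simp add: rep_module_def)
 show "av_closed (av_tensor M N)" by (rule t(2))
qed

lemma polyrep_empty: "polyrep {} q"
 by (simp add: polyrep_def)

lemma SMod_empty: "carrier (SMod {} q n) = {%i. 0}"
 by (auto simp: Mod_carrier mv_def fun_eq_iff)

lemma rep_module_zero:
 assumes T: "av_module T" "carrier T = {0[T]}"
 shows "rep_module T {} q n"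
proof -
 have "(%m i. 0) \<in> av_hom T (SMod {} q n)"
  by (rule av_homI) (simp_all add: SMod_empty, simp add: Lie_chart_def fun_eq_iff mv_def)
 moreover have "bij_betw (%m i. 0) (carrier T) (carrier (SMod {} q n))"
  by (simp add: T(2) SMod_empty bij_betw_def)
 ultimately show ?thesis by (auto simp: rep_module_def av_iso_def polyrep_empty)
qed

lemma rep_objects_closed: "monoidal_abelian_closed (rep_objects :: ('k::field_char_0 sphere, 'u) av_struct set)"
 unfolding monoidal_abelian_closed_def
proof (intro conjI ballI allI impI)
 show "has_copies rep_objects (av_unit :: ('k sphere, _) av_struct)" by (rule rep_objects_has_copies[OF av_unit_iso(1)])
 fix T :: "('k sphere, 'u) av_struct" assume T: "av_module T" "carrier T = {0[T]}"
 thus "T \<in> rep_objects" using has_copiesD[OF rep_objects_has_copies T(1) av_iso_refl] rep_module_zero by blast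
next
 fix M :: "('k sphere, 'u) av_struct" assume "M \<in> rep_objects"
 then obtain I :: "nat set" and q n where M: "av_module M" "rep_module M I q n" by (auto simp: rep_objects_def)
 show "av_module M" by (rule M(1))
 show "has_copies rep_objects M" by (rule rep_objects_has_copies[OF M(2)])
 fix N :: "('k sphere, 'u) av_struct" assume "N \<in> rep_objects"
 then obtain J :: "nat set" and q' n' where N: "av_module N" "rep_module N J q' n'" by (auto simp: rep_objects_def)
 show "has_copies rep_objects (av_sum M N)" by (rule rep_objects_has_copies[OF rep_module_sum[OF M(2) N(2)]])
 show "has_copies rep_objects (av_tensor M N)" by (rule rep_objects_has_copies[OF rep_module_tensor(1)[OF M N]])
 fix f assume f: "f \<in> av_hom M N"
 show "has_copies rep_objects (M\<lparr>carrier := {m \<in> carrier M. f m = 0[N]}\<rparr>)"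
  using av_kernel_iso[OF M N f] rep_objects_has_copies by blast
 show "has_copies rep_objects (av_quotient N (f ` carrier M))"
  using av_cokernel_iso[OF M N f] rep_objects_has_copies by blast
qed

subsection \<open>Representations built from the natural one\<close>

text \<open>The partial derivative as an expression again, so that it can be iterated;
  \<open>pdv\<close> only returns values.\<close>

primrec pdx :: "2 => 2 => 'k::{zero,one} pexp => 'k pexp" where
 "pdx a b (PC c) = PC 0"
| "pdx a b (PV i j) = PC (if i = a \<and> j = b then 1 else 0)"
| "pdx a b (PA e f) = PA (pdx a b e) (pdx a b f)"
| "pdx a b (PM e f) = PA (PM (pdx a b e) f) (PM e (pdx a b f))"

lemma pev_pdx: "rhom \<iota> ==> pev \<iota> (pdx a b e) g = pdv \<iota> e g (munit a b)"
 by (induction e) (simp_all add: rhomD munit_def)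

primrec psub :: "'k^2^2 => 'k pexp => 'k pexp" where
 "psub h (PC c) = PC c"
| "psub h (PV i j) = PA (PM (PV i 1) (PC (h $ 1 $ j))) (PM (PV i 2) (PC (h $ 2 $ j)))"
| "psub h (PA e f) = PA (psub h e) (psub h f)"
| "psub h (PM e f) = PM (psub h e) (psub h f)"

lemma pev_psub: "pev0 (psub h e) g = pev0 e (g ** h)"
 by (induction e) (simp_all add: matrix_matrix_mult_def sum_2)

lemma pdv_psub: "pdv (%c. c) (psub h e) g X = pdv (%c. c) e (g ** h) (X ** h)"
 by (induction e) (simp_all add: pev_psub, simp add: matrix_matrix_mult_def sum_2)

lemma pdv_munit_mult:
 "pdv \<iota> e g (munit a b ** h) = (\<Sum>c\<in>UNIV. h $ b $ c * pdv \<iota> e g (munit a c))"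
proof -
 have "munit a b ** h = (\<chi> i j. h $ b $ 1 * munit a 1 $ i $ j) + (\<chi> i j. h $ b $ 2 * munit a 2 $ i $ j)"
  using two_cases by (auto simp: vec_eq_iff munit_def matrix_matrix_mult_def sum_2 forall_2)
 thus ?thesis by (simp add: pdv_add pdv_smult sum_2)
qed

text \<open>Equal values over k imply equal values over k[[t]] by density, and the derivative is a
  coefficient there. This permits working with expressions up to equality of values.\<close>

lemma pdv_eqI:
 fixes e e' :: "'k::field_char_0 pexp"
 assumes "!!g. pev0 e g = pev0 e' g"
 shows "pdv (%c. c) e g X = pdv (%c. c) e' g X"
proof -
 have "pev fps_const e G - pev fps_const e' G = 0" for G :: "'k fps^2^2"
 proof (rule polyfun_eq_0[OF _ rhom_fps_const, where f = "%G. pev fps_const e G - pev fps_const e' G"])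
  fix g :: "'k^2^2"
  show "pev fps_const e (mmap fps_const g) - pev fps_const e' (mmap fps_const g) = 0"
   using assms[of g] pev_map[OF rhom_fps_const, of "%c. c"] by (metis eq_iff_diff_eq_0)
 qed (intro pf_diff pf_pev pf_entry)
 hence "pev fps_const e (jet g X) = pev fps_const e' (jet g X)" by simp
 moreover have "mmap (%f. fps_nth f 1) (jet g X) = X" by (simp add: vec_eq_iff jet_def)
 ultimately show ?thesis using pev_fps_nth_1[of "%c. c" e "jet g X"] pev_fps_nth_1[of "%c. c" e' "jet g X"] by simp
qed

text \<open>Iterated partial derivative in the entries (a_1, b_1), (a_2, b_2), and so on. Words of
  equal length are meant; a surplus is ignored.\<close>

fun Dw :: "2 list => 2 list => 'k::{zero,one} pexp => 'k pexp" where
 "Dw (a # as) (b # bs) e = pdx a b (Dw as bs e)"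
| "Dw _ _ e = e"

text \<open>Matrix entry of the tensor power of the natural representation whose basis vectors are
  the words of a fixed length.\<close>

fun ptens :: "2 list => 2 list => 'k::one pexp" where
 "ptens (b # bs) (c # cs) = PM (PV b c) (ptens bs cs)"
| "ptens _ _ = PC 1"

lemma finite_lists_length: "finite {xs :: 2 list. length xs = d}"
 using finite_lists_length_eq[of "UNIV :: 2 set" d] by simp

lemma sum_lists_Suc: "(\<Sum>xs | length xs = Suc d. f xs) = (\<Sum>a\<in>UNIV. \<Sum>xs | length xs = d. f ((a :: 2) # xs))"
proof -
 have "bij_betw (%(a, xs). a # xs) (UNIV \<times> {xs :: 2 list. length xs = d}) {xs. length xs = Suc d}"
  by (auto simp: bij_betw_def inj_on_def length_Suc_conv image_iff)
 from sum.reindex_bij_betw[OF this, of f] show ?thesis by (simp add: sum.cartesian_product split_def)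
qed

lemma Dw_cong:
 assumes "!!g. pev0 e g = pev0 (e' :: 'k::field_char_0 pexp) g"
 shows "pev0 (Dw as bs e) g = pev0 (Dw as bs e') g"
 using assms
proof (induction as bs e arbitrary: g rule: Dw.induct)
 case (1 a as b bs e)
 have "pev0 (Dw as bs e) g = pev0 (Dw as bs e') g" for g by (rule "1.IH") (rule "1.prems")
 thus ?case unfolding Dw.simps pev_pdx[OF rhom_id] by (rule pdv_eqI)
qed simp_all

lemma Dw_sum:
 fixes f :: "'l => 'k::field_char_0 pexp"
 assumes L: "finite L"
 shows "pev0 (Dw as bs (psum (%l. PM (f l) (PC (c l))) L)) g = (\<Sum>l\<in>L. pev0 (Dw as bs (f l)) g * c l)"
proof (induction as bs "psum (%l. PM (f l) (PC (c l))) L" arbitrary: g rule: Dw.induct)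
 case (1 a as b bs)
 have "pdv (%c. c) (Dw as bs (psum (%l. PM (f l) (PC (c l))) L)) g X = pdv (%c. c) (psum (%l. PM (Dw as bs (f l)) (PC (c l))) L) g X" for X
  by (rule pdv_eqI) (simp add: 1 psum L)
 thus ?case by (simp add: pev_pdx psum L)
qed (simp_all add: psum L)

text \<open>
 By the chain rule, the derivatives of order \<open>d\<close> at the origin of a function on the space of matrices
 transform under right translations as the \<open>d\<close>-th tensor power of the natural representation.
\<close>

lemma Dw_translate:
 fixes e :: "'k::field_char_0 pexp"
 assumes "length as = length bs"
 shows "pev0 (Dw as bs (psub h e)) g
  = (\<Sum>cs | length cs = length bs. pev0 (ptens bs cs) h * pev0 (Dw as cs e) (g ** h))"
 using assms
proof (induction as bs arbitrary: g rule: list_induct2)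
 case Nil
 show ?case by (simp add: pev_psub)
next
 case (Cons a as b bs)
 let ?L = "{cs. length cs = length bs}"
 have "pdv (%c. c) (Dw as bs (psub h e)) g (munit a b)
   = pdv (%c. c) (psum (%cs. PM (PC (pev0 (ptens bs cs) h)) (psub h (Dw as cs e))) ?L) g (munit a b)"
  by (rule pdv_eqI) (simp add: Cons.IH psum finite_lists_length pev_psub)
 also have "... = (\<Sum>cs\<in>?L. pev0 (ptens bs cs) h * (\<Sum>c\<in>UNIV. h $ b $ c * pev0 (pdx a c (Dw as cs e)) (g ** h)))"
  by (simp add: psum finite_lists_length pdv_psub pdv_munit_mult pev_pdx)
 also have "... = (\<Sum>c\<in>UNIV. \<Sum>cs\<in>?L. h $ b $ c * pev0 (ptens bs cs) h * pev0 (pdx a c (Dw as cs e)) (g ** h))"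
  by (subst sum.swap) (simp add: sum_distrib_left mult_ac)
 finally show ?case by (simp add: pev_pdx[of _ a b] sum_lists_Suc)
qed

text \<open>Taylor's formula at 0 along the scalar matrices s 1. There d/ds is the sum of the
  derivatives in the diagonal entries, so only pairs of equal words occur; the series is finite, and
  s = 1 gives the value at the identity.\<close>

lemma Dw_taylor:
 fixes e :: "'k::field_char_0 pexp"
 shows "\<exists>D. \<forall>m\<ge>D. (\<Sum>as | length as \<le> m. pev0 (Dw as as e) 0 / fact (length as)) = pev0 e (mat 1)"
proof -
 define Z where "Z = (\<chi> i j. if i = j then [:0, 1:] else 0 :: 'k poly^2^2)"
 define E where "E e = pev (%c. [:c:]) e Z" for e
 have c: "rhom (%c :: 'k. [:c:])" and p: "rhom (%p :: 'k poly. poly p x)" for x by (simp_all add: rhom_def one_pCons)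
 have "mmap (%p. poly p 1) Z = mat 1" "mmap (%p. poly p 0) Z = 0" by (auto simp: vec_eq_iff Z_def mat_def)
 hence E: "poly (E e) 1 = pev0 e (mat 1)" "poly (E e) 0 = pev0 e 0" for e
  by (simp_all add: E_def pev_map[OF p])
 have "mmap pderiv Z = munit 1 1 + munit 2 2"
  using two_cases by (auto simp: vec_eq_iff Z_def munit_def pderiv_pCons forall_2 one_pCons)
 hence d1: "pderiv (E e) = (\<Sum>a\<in>UNIV. E (pdx a a e))" for e
  unfolding E_def by (subst pdv_chain) (simp_all add: pderiv_add pderiv_mult pderiv_pCons algebra_simps pdv_add sum_2 pev_pdx[OF c])
 have ps: "pderiv (sum f A) = (\<Sum>a\<in>A. pderiv (f a))" for f :: "2 list => 'k poly" and A
  by (induction A rule: infinite_finite_induct) (simp_all add: pderiv_add)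
 have dn: "(pderiv ^^ d) (E e) = (\<Sum>as | length as = d. E (Dw as as e))" for d
 proof (induction d)
  case (Suc d)
  have "(pderiv ^^ Suc d) (E e) = (\<Sum>as | length as = d. \<Sum>a\<in>UNIV. E (pdx a a (Dw as as e)))"
   by (simp add: Suc ps d1)
  thus ?case by (subst (asm) sum.swap) (simp add: sum_lists_Suc)
 qed simp
 have co: "coeff (E e) d = (\<Sum>as | length as = d. pev0 (Dw as as e) 0 / fact (length as))" for d
 proof -
  have "fact d * coeff (E e) d = poly ((pderiv ^^ d) (E e)) 0"
   by (simp add: poly_0_coeff_0 coeff_higher_pderiv pochhammer_fact)
  hence "coeff (E e) d = (\<Sum>as | length as = d. pev0 (Dw as as e) 0) / fact d"
   by (simp add: dn poly_sum E field_simps)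
  thus ?thesis by (simp add: sum_divide_distrib)
 qed
 have "(\<Sum>as | length as \<le> m. pev0 (Dw as as e) 0 / fact (length as)) = pev0 e (mat 1)" if m: "degree (E e) \<le> m" for m
 proof -
  have fin: "finite {as :: 2 list. length as \<le> m}" using finite_lists_length_le[of "UNIV :: 2 set" m] by simp
  have "(\<Sum>as | length as \<le> m. pev0 (Dw as as e) 0 / fact (length as))
    = (\<Sum>d\<le>m. \<Sum>as | length as \<le> m \<and> length as = d. pev0 (Dw as as e) 0 / fact (length as))"
by (intro sum.group[OF fin finite_atMost, where g = length, unfolded mem_Collect_eq, symmetric]) auto
  also have "... = (\<Sum>d\<le>m. coeff (E e) d)" unfolding co by (intro sum.cong) auto
  also have "... = (\<Sum>d\<le>degree (E e). coeff (E e) d)"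
   by (rule sum.mono_neutral_right) (use m in \<open>auto simp: coeff_eq_0\<close>)
  also have "... = poly (E e) 1" by (simp add: poly_altdef)
  finally show ?thesis by (simp add: E)
 qed
 thus ?thesis by blast
qed

definition qfam :: "('l => ('i, 'k::zero) qmat) => 'l \<times> 'i => 'l \<times> 'i => 'k pexp"
 where "qfam q x y = (if fst x = fst y then q (fst x) (snd x) (snd y) else PC 0)"

text \<open>
 A representation embeds into a sum of twisted tensor powers of the natural one by taking the
 derivatives at the origin of the matrix coefficients; Taylor's formula gives a left inverse.
\<close>

lemma tensor_embedding:
 fixes q :: "('i, 'k::field_char_0) qmat"
 assumes q: "polyrep I q"
 defines "J == %k :: 'i \<times> 2 list. {bs :: 2 list. length bs = length (snd k)}"
 shows "\<exists>K T L. finite K \<and> equivariant I q n (Sigma K J) (qfam (%k. ptens)) n T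
  \<and> (\<forall>i\<in>I. \<forall>j\<in>I. mm (Sigma K J) L T i j = rho0 q n (mat 1) i j)"
proof -
 note fI = finite_polyrep[OF q]
 have "\<exists>D. \<forall>x m. D x \<le> m --> (\<Sum>as | length as \<le> m. pev0 (Dw as as (q (fst x) (snd x))) 0 / fact (length as)) = pev0 (q (fst x) (snd x)) (mat 1)"
  by (rule choice, rule allI, rule Dw_taylor)
 then obtain D where D: "!!i j m. D (i, j) \<le> m ==> (\<Sum>as | length as \<le> m. pev0 (Dw as as (q i j)) 0 / fact (length as)) = pev0 (q i j) (mat 1)"
  by auto
 define m where "m = (\<Sum>x\<in>I \<times> I. D x)"
 have m: "D (i, j) \<le> m" if "i \<in> I" "j \<in> I" for i j unfolding m_def by (rule member_le_sum) (use that fI in auto)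
 define K where "K = I \<times> {as :: 2 list. length as \<le> m}"
 \<comment> \<open>Row ((i, as), bs) holds the derivatives at the origin of the entries in row i of
   q along the words as, bs. The label (i, as) selects a copy of a tensor power and bs its basis
   vector.\<close>
 define T where "T x j = pev0 (Dw (snd (fst x)) (snd x) (q (fst (fst x)) j)) 0" for x j
 \<comment> \<open>For row i it picks the diagonal words bs = as with the weights of Taylor's
   formula, so that L T = q(1).\<close>
 define L where "L i x = (if fst (fst x) = i \<and> snd (fst x) = snd x then 1 / fact (length (snd x)) else 0 :: 'k)" for i :: 'i and x :: "('i \<times> 2 list) \<times> 2 list"
 have fm: "finite {as :: 2 list. length as \<le> m}" using finite_lists_length_le[of "UNIV :: 2 set" m] by simp
 have fK: "finite K" using fI fm by (simp add: K_def)
 have fJ: "finite (J k)" for k by (simp add: J_def finite_lists_length)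
 have "mm I T (rho0 q n h) ((i, as), bs) j = mm (Sigma K J) (rho0 (qfam (%k. ptens)) n h) T ((i, as), bs) j"
  if x: "((i, as), bs) \<in> Sigma K J" and j: "j \<in> I" for i as bs j h
 proof -
  have i: "i \<in> I" and l: "length as = length bs" using x by (auto simp: K_def J_def)
  \<comment> \<open>Differentiate \<Sum> q_{il}(g) q_{lj}(h) = q_{ij}(g h) with respect to g at g =
    0, which is legitimate because \<open>polyrep_mult\<close> holds for all matrices.\<close>
  have "(\<Sum>l\<in>I. pev0 (Dw as bs (q i l)) 0 * pev0 (q l j) h)
    = pev0 (Dw as bs (psub h (q i j))) 0"
   unfolding Dw_sum[OF fI, symmetric]
   by (rule Dw_cong) (use polyrep_mult[OF q rhom_id i j] in \<open>simp add: psum fI pev_psub mm_def\<close>)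
  also have "... = (\<Sum>cs\<in>J (i, as). pev0 (ptens bs cs) h * T ((i, as), cs) j)"
   using l by (simp add: Dw_translate T_def J_def)
  also have "... = (\<Sum>k\<in>K. if k = (i, as) then \<Sum>cs\<in>J k. pev0 (ptens bs cs) h * T (k, cs) j else 0)"
   using x fK by (simp add: K_def)
  also have "... = (\<Sum>k\<in>K. \<Sum>cs\<in>J k. pev0 (qfam (%k. ptens) ((i, as), bs) (k, cs)) h * T (k, cs) j)"
   by (intro sum.cong refl) (simp add: qfam_def)
  also have "... = (\<Sum>y\<in>Sigma K J. pev0 (qfam (%k. ptens) ((i, as), bs) y) h * T y j)"
   using fK fJ by (simp add: sum.Sigma split_def)
  finally show ?thesis by (simp add: mm_def rho_def T_def flip: sum_divide_distrib)
 qed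
 hence "equivariant I q n (Sigma K J) (qfam (%k. ptens)) n T"
  unfolding equivariant_def by (metis surj_pair)
 moreover have "mm (Sigma K J) L T i j = rho0 q n (mat 1) i j" if ij: "i \<in> I" "j \<in> I" for i j
 proof -
  have "mm (Sigma K J) L T i j = (\<Sum>k\<in>K. \<Sum>bs\<in>J k. L i (k, bs) * T (k, bs) j)"
   using fK fJ by (simp add: mm_def sum.Sigma split_def)
  also have "... = (\<Sum>k\<in>K. if fst k = i then T (k, snd k) j / fact (length (snd k)) else 0)"
  proof (rule sum.cong[OF refl])
   fix k
   have "(\<Sum>bs\<in>J k. L i (k, bs) * T (k, bs) j) = (\<Sum>bs\<in>J k. if bs = snd k then (if fst k = i then T (k, snd k) j / fact (length (snd k)) else 0) else 0)"
    by (rule sum.cong) (auto simp: L_def)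
   thus "(\<Sum>bs\<in>J k. L i (k, bs) * T (k, bs) j) = (if fst k = i then T (k, snd k) j / fact (length (snd k)) else 0)"
    by (simp add: fJ) (simp add: J_def)
  qed
  also have "... = (\<Sum>i'\<in>I. \<Sum>as | length as \<le> m. if i' = i then T ((i', as), as) j / fact (length as) else 0)"
   unfolding K_def sum.cartesian_product by (rule sum.cong) auto
  also have "... = (\<Sum>i'\<in>I. if i' = i then \<Sum>as | length as \<le> m. T ((i, as), as) j / fact (length as) else 0)"
   by (intro sum.cong refl) simp
  also have "... = pev0 (q i j) (mat 1)" using ij fI D[OF m[OF ij]] by (simp add: T_def)
  finally show ?thesis by (simp add: rho_1)
 qed
 ultimately show ?thesis using fK by blast
qed

subsection \<open>Generation by \<open>A\<^sup>-\<^sup>2\<close> and \<open>\<Omega>\<close>\<close>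

definition rep_in :: "('k::field_char_0 sphere, 'u) av_struct set => 'i set => ('i, 'k) qmat => nat => bool"
 where "rep_in S I q n \<longleftrightarrow> polyrep I q \<and> has_copies S (SMod I q n)"

lemma rep_in_of_module:
 assumes X: "rep_module X I q n" "av_closed X" and S: "has_copies S X"
 shows "rep_in S I q n"
 using X S av_iso_sym has_copies_iso unfolding rep_in_def rep_module_def by blast

lemma rep_in_reindex:
 assumes "rep_in S I q n" "bij_betw e J I"
 shows "rep_in S J (%i j. q (e i) (e j)) n"
 using assms SMod_reindex[of I q e J] has_copies_iso unfolding rep_in_def by blast

lemma rep_in_cong:
 assumes "rep_in S I q n" "!!i j. i \<in> I ==> j \<in> I ==> q i j = q' i j"
 shows "rep_in S I q' n"
proof -
 have "SMod I q' n = SMod I q n" by (rule SMod_cong) (simp_all add: rho_def drho_def assms(2))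
 thus ?thesis using assms by (simp add: rep_in_def polyrep_def mm_def)
qed

lemma inj_on_mv_fs:
 assumes q: "polyrep I q" and L: "!!i j. i \<in> I ==> j \<in> I ==> mm J L T i j = rho0 q n (mat 1) i j"
 shows "inj_on (mv J I (fsm T)) (carrier (SMod I q n))"
proof (rule inj_on_inverseI[where g = "mv I J (%i j. fs (L i j))"])
 fix v assume v: "v \<in>. SMod I q n"
 have "mv I J (%i j. fs (L i j)) (mv J I (fsm T) v) = mv I I (%i j. fs (rho0 q n (mat 1) i j)) v"
  unfolding mv_fs_mm by (rule mv_fs_cong) (rule L)
 thus "mv I J (%i j. fs (L i j)) (mv J I (fsm T) v) = v" using v by (simp add: mv_fs_rho_1 Mod_carrier)
qed

context
 fixes \<iota> :: "'k::field_char_0 => 'u" and S :: "('k sphere, 'u) av_struct set"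
 assumes \<iota>: "inj \<iota>" and S: "monoidal_abelian_closed S" "has_copies S (A_power (- 2) :: ('k sphere, _) av_struct)"
  "has_copies S (Omega :: ('k sphere, _) av_struct)"
begin

lemma rep_in_copy:
 assumes "rep_in S I q n"
 shows "\<exists>M\<in>S. \<exists>\<alpha>. av_module M \<and> \<alpha> \<in> av_hom M (SMod I q n) \<and> bij_betw \<alpha> (carrier M) (carrier (SMod I q n))"
proof -
 have q: "polyrep I q" and S: "has_copies S (SMod I q n)" using assms by (simp_all add: rep_in_def)
 obtain M :: "('k sphere, 'u) av_struct" and \<alpha> where M: "av_module M" "\<alpha> \<in> av_hom M (SMod I q n)"
  "bij_betw \<alpha> (carrier M) (carrier (SMod I q n))" using rep_copy_ex[OF \<iota> q] by blast
 thus ?thesis using has_copiesD[OF S M(1)] by (auto simp: av_iso_def)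
qed

lemma rep_in_module:
 assumes "rep_in S I q n"
 shows "\<exists>M\<in>S. av_module M \<and> rep_module M I q n"
 using rep_in_copy[OF assms] assms by (auto simp: rep_in_def rep_module_def av_iso_def)

lemma rep_in_tensor:
 assumes "rep_in S I q n" "rep_in S J q' n'"
 shows "rep_in S (I \<times> J) (qtensor q q') (n + n')"
proof -
 obtain M N where M: "M \<in> S" "av_module M" "rep_module M I q n" and N: "N \<in> S" "av_module N" "rep_module N J q' n'"
  using rep_in_module assms by metis
 have "has_copies S (av_tensor M N)" using S(1) M(1) N(1) by (simp add: monoidal_abelian_closed_def)
 thus ?thesis by (rule rep_in_of_module[OF rep_module_tensor[OF M(2,3) N(2,3)]])
qed

lemma rep_in_sum:
 assumes "rep_in S I q n" "rep_in S J q' n"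
 shows "rep_in S (I <+> J) (qsum q q') n"
proof -
 obtain M N where M: "M \<in> S" "av_module M" "rep_module M I q n" and N: "N \<in> S" "av_module N" "rep_module N J q' n"
  using rep_in_module assms by metis
 have "has_copies S (av_sum M N)" using S(1) M(1) N(1) by (simp add: monoidal_abelian_closed_def)
 moreover have "av_closed (av_sum M N)"
  using av_module_closed[OF M(2)] av_module_closed[OF N(2)] by (auto simp: av_closed_def av_sum_def)
 ultimately show ?thesis by (intro rep_in_of_module[OF av_sum_iso[OF M(3) N(3)]])
qed

lemma rep_in_empty: "rep_in S {} q n"
proof -
 have "T \<in> S" if T: "av_module T" "av_iso T (SMod {} q n)" for T
 proof -
  obtain f where "bij_betw f (carrier T) (carrier (SMod {} q n))" using T(2) by (auto simp: av_iso_def)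
  hence f: "inj_on f (carrier T)" "x \<in>. T ==> f x = (%i. 0)" for x by (auto simp: bij_betw_def SMod_empty)
  have z: "0[T] \<in>. T" by (rule av_zero_closed[OF T(1)])
  have "x = 0[T]" if "x \<in>. T" for x by (rule inj_onD[OF f(1) _ that z]) (simp add: f(2) that z)
  hence "carrier T = {0[T]}" using z by blast
  thus ?thesis using S(1) T(1) by (simp add: monoidal_abelian_closed_def)
 qed
 thus ?thesis by (simp add: rep_in_def polyrep_empty has_copies_def)
qed

lemma rep_in_family:
 assumes "finite K" "!!k. k \<in> K ==> rep_in S (J k) (q k) n"
 shows "rep_in S (Sigma K J) (qfam q) n"
 using assms
proof (induction K rule: finite_induct)
 case empty
 show ?case using rep_in_empty by simp
next
 case (insert k K)
 let ?e = "%(l, j). if l = k then Inl j else Inr (l, j)"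
 have "bij_betw ?e (Sigma (insert k K) J) (J k <+> Sigma K J)"
  using insert.hyps by (fastforce simp: bij_betw_def inj_on_def image_iff split: if_splits)
 from rep_in_reindex[OF rep_in_sum[OF insert.prems insert.IH] this]
 have "rep_in S (Sigma (insert k K) J) (%i j. qsum (q k) (qfam q) (?e i) (?e j)) n" using insert.prems by simp
 moreover have "(%i j. qsum (q k) (qfam q) (?e i) (?e j)) = qfam q"
  by (auto simp: fun_eq_iff qfam_def)
 ultimately show ?case by simp
qed

text \<open>Each tensor product with A^-2, the inverse determinant, raises the exponent n by
  one.\<close>

lemma rep_in_det: "rep_in S I q 0 ==> rep_in S I q n"
proof (induction n)
 case (Suc n)
 have det: "rep_in S {()} qunit 1" by (rule rep_in_of_module[OF A_power_iso S(2)])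
 have "bij_betw (%i. (i, ())) I (I \<times> {()})" by (auto simp: bij_betw_def inj_on_def)
 from rep_in_reindex[OF rep_in_tensor[OF Suc.IH[OF Suc.prems] det] this]
 have "rep_in S I (%i j. PM (q i j) (PC 1)) (Suc n)" by (simp add: qtensor_def qunit_def)
 moreover have "SMod I (%i j. PM (q i j) (PC 1)) (Suc n) = SMod I q (Suc n)"
  by (rule SMod_cong) (simp_all add: rho_def drho_def)
 ultimately show ?case using Suc.prems by (simp add: rep_in_def)
qed

text \<open>The zeroth power is the unit object; each further factor is a tensor product with
  \<Omega>, split off as the head of the word.\<close>

lemma rep_in_ptens: "rep_in S {bs. length bs = d} ptens 0"
proof (induction d)
 case 0
 have "rep_in S {()} qunit 0"
  by (rule rep_in_of_module[OF av_unit_iso]) (use S(1) in \<open>simp add: monoidal_abelian_closed_def\<close>)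
 moreover have "bij_betw (%bs. ()) {bs :: 2 list. length bs = 0} {()}" by (simp add: bij_betw_def)
 ultimately have "rep_in S {bs :: 2 list. length bs = 0} (%i j. qunit () ()) 0" by (rule rep_in_reindex)
 thus ?case by (rule rep_in_cong) (simp add: qunit_def)
next
 case (Suc d)
 have nat: "rep_in S UNIV PV 0" by (rule rep_in_of_module[OF Omega_iso S(3)])
 have "bij_betw (%bs. (hd bs, tl bs)) {bs :: 2 list. length bs = Suc d} (UNIV \<times> {bs. length bs = d})"
  by (rule bij_betw_byWitness[where f' = "%(b, bs). b # bs"]) (auto simp: length_Suc_conv)
 from rep_in_reindex[OF rep_in_tensor[OF nat Suc] this]
 have "rep_in S {bs :: 2 list. length bs = Suc d} (%i j. PM (PV (hd i) (hd j)) (ptens (tl i) (tl j))) 0" by (simp add: qtensor_def)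
 thus ?case by (rule rep_in_cong) (auto simp: length_Suc_conv)
qed

text \<open>The embedding lands in a sum of tensor powers of \<Omega> twisted n times by A^-2, which
  belongs to S. Its matrix has the left inverse L modulo \<rho>(1), hence is injective on the
  modules.\<close>

lemma rep_embedding:
 assumes q: "polyrep I (q :: ('i, 'k) qmat)"
 shows "\<exists>(J :: (('i \<times> 2 list) \<times> 2 list) set) q' T. rep_in S J q' n \<and> equivariant I q n J q' n T
  \<and> inj_on (mv J I (fsm T)) (carrier (SMod I q n))"
proof -
 let ?J = "%k :: 'i \<times> 2 list. {bs :: 2 list. length bs = length (snd k)}"
 obtain K and T :: "('i \<times> 2 list) \<times> 2 list => 'i => 'k" and L where K: "finite K" and T: "equivariant I q n (Sigma K ?J) (qfam (%k. ptens)) n T"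
  and L: "!!i j. i \<in> I ==> j \<in> I ==> mm (Sigma K ?J) L T i j = rho0 q n (mat 1) i j"
  using tensor_embedding[OF q, of n] by blast
 have "rep_in S (Sigma K ?J) (qfam (%k. ptens)) n"
  by (rule rep_in_family[OF K]) (rule rep_in_det[OF rep_in_ptens])
 thus ?thesis using T inj_on_mv_fs[OF q L] by blast
qed

text \<open>Every representation is the kernel of a homomorphism between two such sums.\<close>

lemma rep_objects_minimal: "rep_objects \<subseteq> S"
proof
 fix M :: "('k sphere, 'u) av_struct" assume "M \<in> rep_objects"
 then obtain I :: "nat set" and q n \<alpha> where M: "av_module M" and q: "polyrep I q"
  and \<alpha>: "\<alpha> \<in> av_hom M (SMod I q n)" "bij_betw \<alpha> (carrier M) (carrier (SMod I q n))"
  by (auto simp: rep_objects_def rep_module_def av_iso_def)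
 obtain J :: "((nat \<times> 2 list) \<times> 2 list) set" and p T where p: "rep_in S J p n" and T: "equivariant I q n J p n T"
  and inj: "inj_on (mv J I (fsm T)) (carrier (SMod I q n))" using rep_embedding[OF q, of n] by blast
 have pJ: "polyrep J p" using p by (simp add: rep_in_def)
 obtain T' where T': "\<forall>j\<in>J. \<forall>i\<in>I. mm J (mm I T T') T j i = T j i"
  using generalized_inverse[OF finite_polyrep[OF q] finite_polyrep[OF pJ]] by blast
 note ctx = q pJ T T'
 let ?c = "qcoker I J p T T'" and ?T = "mv J I (fsm T)" and ?P = "mv J J (%i j. fs (idm i j - mm I T T' i j))"
 note c = polyrep_qcoker[OF ctx]
 \<comment> \<open>The cokernel of the embedding is not yet known to lie in S. It is embedded once
   more into a sum that does, which makes the image of the first embedding the kernel of a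
   homomorphism inside S.\<close>
 obtain J2 :: "((((nat \<times> 2 list) \<times> 2 list) \<times> 2 list) \<times> 2 list) set" and p2 T2 where p2: "rep_in S J2 p2 n" and T2: "equivariant J ?c n J2 p2 n T2"
  and inj2: "inj_on (mv J2 J (fsm T2)) (carrier (SMod J ?c n))" using rep_embedding[OF c, of n] by blast
 have pJ2: "polyrep J2 p2" using p2 by (simp add: rep_in_def)
 let ?T2 = "mv J2 J (fsm T2)"
 obtain N \<beta> where N: "N \<in> S" "av_module N" "\<beta> \<in> av_hom N (SMod J p n)" "bij_betw \<beta> (carrier N) (carrier (SMod J p n))"
  using rep_in_copy[OF p] by blast
 obtain N2 \<gamma> where N2: "N2 \<in> S" "av_module N2" "\<gamma> \<in> av_hom N2 (SMod J2 p2 n)" "bij_betw \<gamma> (carrier N2) (carrier (SMod J2 p2 n))"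
  using rep_in_copy[OF p2] by blast
 note hT = Mod_map_hom[OF q pJ T] and hP = Mod_map_hom[OF pJ c equivariant_qcoker[OF ctx]] and hT2 = Mod_map_hom[OF c pJ2 T2]
 let ?\<gamma>' = "the_inv_into (carrier N2) \<gamma>" and ?\<beta>' = "the_inv_into (carrier N) \<beta>"
 define h where "h x = ?\<gamma>' (?T2 (?P (\<beta> x)))" for x
 define f where "f m = ?\<beta>' (?T (\<alpha> m))" for m
 have h: "h \<in> av_hom N N2"
  unfolding h_def by (intro av_hom_comp[OF _ av_hom_inverse[OF N2(3,4) av_module_closed[OF N2(2)]]] av_hom_comp[OF _ hT2] av_hom_comp[OF N(3) hP])
 have f: "f \<in> av_hom M N"
  unfolding f_def by (rule av_hom_comp[OF av_hom_comp[OF \<alpha>(1) hT] av_hom_inverse[OF N(3,4) av_module_closed[OF N(2)]]])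
 have \<beta>f: "\<beta> (f m) = ?T (\<alpha> m)" if "m \<in>. M" for m
  unfolding f_def by (rule f_the_inv_into_f_bij_betw[OF N(4)], rule av_hom_closed[OF hT av_hom_closed[OF \<alpha>(1) that]])
 have \<gamma>h: "\<gamma> (h x) = ?T2 (?P (\<beta> x))" if "x \<in>. N" for x
  unfolding h_def by (rule f_the_inv_into_f_bij_betw[OF N2(4)], rule av_hom_closed[OF hT2 av_hom_closed[OF hP av_hom_closed[OF N(3) that]]])
 \<comment> \<open>The second embedding is injective, so the kernel of h is that of the projection
   to the cokernel, which is the image of T by \<open>ker_vP\<close>.\<close>
 have iff: "h x = 0[N2] \<longleftrightarrow> \<beta> x \<in> ?T ` carrier (SMod I q n)" if x: "x \<in>. N" for x
 proof -
  have "h x = 0[N2] \<longleftrightarrow> ?T2 (?P (\<beta> x)) = (%j. 0)"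
   using Mod_zero_iff[OF N2(2) pJ2 N2(3,4) av_hom_closed[OF h x]] by (simp add: \<gamma>h[OF x])
  also have "... \<longleftrightarrow> ?P (\<beta> x) = (%j. 0)"
  proof
   have 0: "(%j. 0) \<in>. SMod J ?c n" using av_zero_closed[OF av_module_Mod[OF c, of n]] by simp
   assume "?T2 (?P (\<beta> x)) = (%j. 0)"
   thus "?P (\<beta> x) = (%j. 0)" using inj_onD[OF inj2 _ av_hom_closed[OF hP av_hom_closed[OF N(3) x]] 0] by (simp add: mv_0)
  qed (simp add: mv_0)
  also have "... \<longleftrightarrow> \<beta> x \<in> ?T ` carrier (SMod I q n)"
   using ker_vP[OF ctx av_hom_closed[OF N(3) x]] vP_vT[OF ctx] by auto
  finally show ?thesis .
 qed
 let ?K = "N\<lparr>carrier := {x \<in> carrier N. h x = 0[N2]}\<rparr>"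
 have "f \<in> av_hom M ?K"
  using f iff[OF av_hom_closed[OF f]] \<beta>f av_hom_closed[OF \<alpha>(1)] by (auto simp: av_hom_def)
 moreover have "bij_betw f (carrier M) (carrier ?K)"
  unfolding bij_betw_def
 proof
  show "inj_on f (carrier M)"
  proof (rule inj_onI)
   fix m m' assume m: "m \<in>. M" "m' \<in>. M" "f m = f m'"
   hence "?T (\<alpha> m) = ?T (\<alpha> m')" using \<beta>f by metis
   hence "\<alpha> m = \<alpha> m'" by (rule inj_onD[OF inj]) (use m av_hom_closed[OF \<alpha>(1)] in auto)
   thus "m = m'" using \<alpha>(2) m by (auto simp: bij_betw_def dest: inj_onD)
  qed
  show "f ` carrier M = carrier ?K"
  proof
   show "f ` carrier M \<subseteq> carrier ?K"
    using iff[OF av_hom_closed[OF f]] \<beta>f av_hom_closed[OF \<alpha>(1)] av_hom_closed[OF f] by auto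
   show "carrier ?K \<subseteq> f ` carrier M"
   proof
    fix x assume "x \<in>. ?K"
    hence x: "x \<in>. N" "\<beta> x \<in> ?T ` carrier (SMod I q n)" using iff by auto
    hence "\<beta> x \<in> ?T ` \<alpha> ` carrier M" using \<alpha>(2) by (simp add: bij_betw_def)
    then obtain m where m: "m \<in>. M" "\<beta> x = \<beta> (f m)" using \<beta>f by auto
    hence "x = f m" using N(4) x(1) av_hom_closed[OF f m(1)] by (auto simp: bij_betw_def dest: inj_onD)
    thus "x \<in> f ` carrier M" using m(1) by blast
   qed
  qed
 qed
 ultimately have "av_iso M ?K" by (auto simp: av_iso_def)
 moreover have "has_copies S ?K" using S(1) N(1) N2(1) h by (auto simp: monoidal_abelian_closed_def)
 ultimately show "M \<in> S" using has_copiesD M by blast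
qed

end

text \<open>The witness is \<open>rep_objects\<close>. It is closed under isomorphism, is itself one
  of the closed classes containing both generators, and lies in each of them by
  \<open>rep_objects_minimal\<close>.\<close>

theorem corollary16:
  assumes "\<exists>\<iota> :: 'k::{alg_closed_field,field_char_0} \<Rightarrow> 'u. inj \<iota>"
  shows "\<exists>S :: ('k sphere, 'u) av_struct set.
    S \<subseteq> cat_obj tensor_category \<and>
    equivalent_categories (gl2_category :: (('k, 'u) mat_struct, 'u \<Rightarrow> 'u) category)
      (full_subcategory tensor_category S) \<and>
    iso_closure S = generated_by_two (A_power (- 2)) Omega"
proof -
 obtain \<iota> :: "'k => 'u" where \<iota>: "inj \<iota>" using assms by blast
 let ?S = "rep_objects :: ('k sphere, 'u) av_struct set"
 have closed: "monoidal_abelian_closed ?S" by (rule rep_objects_closed)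
 have "iso_closure ?S = ?S"
 proof
  show "iso_closure ?S \<subseteq> ?S"
  proof
   fix T assume "T \<in> iso_closure ?S"
   then obtain M where T: "av_module T" "M \<in> ?S" "av_iso T M" by (auto simp: iso_closure_def)
   have "has_copies ?S M" using closed T(2) by (simp add: monoidal_abelian_closed_def)
   thus "T \<in> ?S" by (rule has_copiesD) (rule T)+
  qed
  show "?S \<subseteq> iso_closure ?S"
  proof
   fix M assume M: "M \<in> ?S"
   hence "av_module M" by (simp add: rep_objects_def)
   thus "M \<in> iso_closure ?S" using M av_iso_refl[of M] unfolding iso_closure_def by blast
  qed
 qed
 moreover have "?S = generated_by_two (A_power (- 2)) Omega"
  unfolding generated_by_two_def
 proof (intro equalityI Inter_greatest Inter_lower)
  show "?S \<in> {S. monoidal_abelian_closed S \<and> has_copies S (A_power (- 2) :: ('k sphere, _) av_struct) \<and> has_copies S (Omega :: ('k sphere, _) av_struct)}"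
   using closed rep_objects_has_copies[OF A_power_iso(1)] rep_objects_has_copies[OF Omega_iso(1)] by blast
 qed (auto intro: subsetD[OF rep_objects_minimal[OF \<iota>]])
 ultimately have "iso_closure ?S = generated_by_two (A_power (- 2)) Omega" by simp
 thus ?thesis using rep_objects_tensor[OF \<iota>] rep_equivalence[OF \<iota>] by blast
qed

end
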